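(* Let $X'$ be the core of the inverse limit of a tent map $T_s$, $s\in(\sqrt2,2]$, with kneading sequence $\nu$, embedded in the plane by $\varphi_{\mathcal C}=\varphi_L$ with $L=0^\infty1$. If $\nu=\mathrm{rhe}(q)$ for some $q=\frac mn\in(0,\frac12)$, where $m$ and $n$ are relatively prime, then in $\varphi_{\mathcal C}(X')$ there exist $n$ partially accessible lines, which are symbolically described by a tail which is a shift of $\overleftarrow\nu$, and no other point of $\varphi_{\mathcal C}(X')$ is accessible. Specifically, there exist no infinite canals in $\varphi_{\mathcal C}(X')$.
   Context: Tent inverse limits. For $s\in(\sqrt2,2]$ let $T=T_s\colon[0,1]\to[0,1]$, $T_s(t)=\min\{st,s(1-t)\}$, $c=\frac12$, and $X=\{x=(\pi_i(x))_{i\le0}\in[0,1]^{-\mathbb N_0}: T(\pi_i(x))=\pi_{i+1}(x)\ \forall i<0\}$ with the product topology. The core is $X'=\varprojlim([T^2(c),T(c)],T)\subset X$, an indecomposable continuum; $X=X'\cup\mathcal C$, where $\mathcal C$ is a ray containing the fixed point $(\ldots,0,0)$. Symbolics. $\#_1(w)$ is the number of ones of a word $w$. The kneading sequence is $\nu=c_1c_2\ldots$, $c_i=0$ if $T^i(c)\in[0,c]$, $c_i=1$ if $T^i(c)\in[c,1]$; if $T^n(c)=c$, $\nu$ is the smaller of $(c_1\ldots c_{n-1}0)^\infty,(c_1\ldots c_{n-1}1)^\infty$ in the parity-lexicographical order: for sequences (or words of equal length) first differing at index $k$, $s\prec t$ iff $s_k<t_k$ and $\#_1(s_1\ldots s_{k-1})$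 is even, or $s_k>t_k$ and it is odd. A word $a_1\ldots a_n$ is admissible if $c_2\ldots c_{2+n-i}\preceq a_i\ldots a_n\preceq c_1\ldots c_{1+n-i}$ for all $i$. An infinite sequence is admissible if all its finite subwords are; additionally, sequences $0^\infty s_ks_{k+1}\ldots$ with $s_k=1$ and the part from $s_k$ on admissible (and the constant zero sequence) are called admissible; these correspond to points of $\mathcal C$. $X$ is identified with $\Sigma_{adm}/\!\sim$, where $\Sigma_{adm}$ is the set of admissible two-sided sequences $\ldots s_{-1}.s_0s_1\ldots$ and $s\sim t$ iff $s=t$ or they differ at exactly one index $k$ and $s_{k+1}s_{k+2}\ldots=t_{k+1}t_{k+2}\ldots=\nu$; the point $x$ corresponds to the class of $(x_i)$ with $x_i=0$ (resp. $1$) if $\pi_i(x)$ (for $i\le0$) or $T^i(\pi_0(x))$ (for $i>0$) lies in $[0,c]$ (resp. $[c,1]$). Using only sequences all of whose finite subwords are admissible gives $X'$. Left-infinite sequences are written $\overleftarrow s=\ldots s_2s_1$ ($s_j$ being the entry at index $-j$), and the basic arc $A(\overleftarrow s)$ is the set of points of $X$ having a representative with left part $\overleftarrow s$; it is an arc or a point. $\overleftarrow\nu=\ldots c_3c_2c_1$ is the reverse of $\nu$. An arc-component (union of all arcs through a point) is symbolically described by a tail which is a shift of $\overleftarrow\nu$ if there is $i\in\mathbb Z$ such that it consists of the basic arcs $A(\overleftarrow s)$ with $s_{k+i}=c_k$ for all sufficiently large $k$. Embeddings. For an admissible left-infinite $L=\ldots l_2l_1$ put $\psi_L(\overleftarrow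 s)=\sum_{i\ge1}(-1)^{\#_1(l_i\ldots l_1)-\#_1(s_i\ldots s_1)}3^{-i}+\frac12$. The embedding $\varphi_L\colon X\to\mathbb R^2$ draws each basic arc $A(\overleftarrow s)$ as the horizontal segment $\pi_0(A(\overleftarrow s))\times\{\psi_L(\overleftarrow s)\}$; whenever two $\sim$-identified two-sided sequences differ only at an index $k<0$, the corresponding endpoints of the two basic arcs are joined by a semicircle, on the left if $\#_1$ of the word at indices $k+1,\ldots,-1$ is odd and on the right if it is even. $X'$ is embedded by restricting $\varphi_L$. The sequence rhe. For $q\in(0,\frac12)$ let $\kappa_1(q)=\lfloor\frac1q\rfloor-1$ and $\kappa_i(q)=\lfloor\frac iq\rfloor-\lfloor\frac{i-1}q\rfloor-2$ for $i\ge2$. For $q=\frac mn$ in lowest terms let $w_q=10^{\kappa_1(q)}110^{\kappa_2(q)}11\ldots110^{\kappa_m(q)-1}$, let $\hat w_q$ be the reverse of the word $w_q$, and $\mathrm{rhe}(q)=10(\hat w_q1)^\infty$. Accessibility and prime ends. For a non-separating continuum $K\subset\mathbb R^2$, $a\in K$ is accessible if some arc $A\subset\mathbb R^2$ has $A\cap K=\{a\}$; an arc-component is partially accessible if some but not all of its points are accessible. A line is a continuous injective image of $\mathbb R$. A crosscut is an arc $Q\subset\mathbb R^2$ meeting $K$ exactly in its endpoints; $B_Q$ is the bounded component of $\mathbb R^2\setminus(K\cup Q)$. A chain is a sequence of pairwise disjoint crosscuts $Q_i$ with $\operatorname{diam}Q_i\to0$ and $B_{Q_{i+1}}\subset B_{Q_i}$;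 two chains are equivalent if each $B$-set of one contains a $B$-set of the other and conversely; equivalence classes are prime ends. For a prime end $P$, $\Pi(P)=\{\lim Q_i:\{Q_i\}\in P\text{ convergent}\}$. An infinite canal is a prime end $P$ with $\Pi(P)$ non-degenerate and different from $K$. Here $K=\varphi_{\mathcal C}(X')$. *)

theory Defs
  imports "HOL-Analysis.Analysis"
begin

section \<open>Tent inverse limits\<close>

definition tent :: "real \<Rightarrow> real \<Rightarrow> real" where
  "tent s t = min (s * t) (s * (1 - t))"

definition crit :: real where
  "crit = 1/2"

(* A point x of an inverse limit is a function on nat: x i is the coordinate pi_(-i)(x). *)
definition inverse_limit :: "real set \<Rightarrow> (real \<Rightarrow> real) \<Rightarrow> (nat \<Rightarrow> real) set" where
  "inverse_limit I T = {x. (\<forall>i. x i \<in> I) \<and> (\<forall>i. T (x (Suc i)) = x i)}"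

definition tent_limit :: "real \<Rightarrow> (nat \<Rightarrow> real) set" where
  "tent_limit s = inverse_limit {0..1} (tent s)"

definition tent_core :: "real \<Rightarrow> (nat \<Rightarrow> real) set" where
  "tent_core s = inverse_limit {tent s (tent s crit)..tent s crit} (tent s)"

(* Coordinates at all integer indices: pi_i(x) for i <= 0 and T^i(pi_0(x)) for i > 0. *)
definition coord :: "real \<Rightarrow> (nat \<Rightarrow> real) \<Rightarrow> int \<Rightarrow> real" where
  "coord s x i = (if i \<le> 0 then x (nat (- i)) else (tent s ^^ nat i) (x 0))"

section \<open>Symbolic description\<close>

(* The symbols 0 and 1 are False and True. One-sided sequences are functions on nat counted
   from 0: for a right-infinite sequence s_1 s_2 ... the value at k is s_(k+1); for a
   left-infinite sequence ... s_2 s_1 the value at k is s_(k+1), the entry at index -(k+1). *)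

definition ones :: "bool list \<Rightarrow> nat" where
  "ones w = count_list w True"

definition initial :: "(nat \<Rightarrow> bool) \<Rightarrow> nat \<Rightarrow> bool list" where
  "initial a n = map a [0..<n]"

definition periodic_seq :: "bool list \<Rightarrow> nat \<Rightarrow> bool" where
  "periodic_seq w k = w ! (k mod length w)"

text \<open>Parity-lexicographical order on words of equal length and on infinite sequences.\<close>

definition plex_less :: "bool list \<Rightarrow> bool list \<Rightarrow> bool" where
  "plex_less u v \<longleftrightarrow> length u = length v \<and>
     (\<exists>k < length u. take k u = take k v \<and>
        (u ! k < v ! k \<and> even (ones (take k u)) \<or>
         v ! k < u ! k \<and> odd (ones (take k u))))"

definition plex_le :: "bool list \<Rightarrow> bool list \<Rightarrow> bool" where
  "plex_le u v \<longleftrightarrow> u = v \<or> plex_less u v"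

definition seq_less :: "(nat \<Rightarrow> bool) \<Rightarrow> (nat \<Rightarrow> bool) \<Rightarrow> bool" where
  "seq_less a b \<longleftrightarrow> (\<exists>n. plex_less (initial a n) (initial b n))"

(* In the periodic case n is the least period, so that the symbols c_1, ..., c_(n-1) are
   unambiguous. *)
definition kneading :: "real \<Rightarrow> nat \<Rightarrow> bool" where
  "kneading s =
    (let itin = (\<lambda>k. crit \<le> (tent s ^^ Suc k) crit) in
     if \<exists>n>0. (tent s ^^ n) crit = crit
     then (let n = (LEAST n. n > 0 \<and> (tent s ^^ n) crit = crit);
               a = periodic_seq (initial itin (n - 1) @ [False]);
               b = periodic_seq (initial itin (n - 1) @ [True])
           in if seq_less a b then a else b)
     else itin)"

definition admissible_word :: "real \<Rightarrow> bool list \<Rightarrow> bool" where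
  "admissible_word s w \<longleftrightarrow>
     (\<forall>i < length w.
        plex_le (initial (\<lambda>k. kneading s (Suc k)) (length w - i)) (drop i w) \<and>
        plex_le (drop i w) (initial (kneading s) (length w - i)))"

definition subword :: "(int \<Rightarrow> bool) \<Rightarrow> int \<Rightarrow> nat \<Rightarrow> bool list" where
  "subword \<sigma> i n = map (\<lambda>j. \<sigma> (i + int j)) [0..<n]"

definition Sigma_adm :: "real \<Rightarrow> (int \<Rightarrow> bool) set" where
  "Sigma_adm s =
     {\<sigma>. \<forall>i n. admissible_word s (subword \<sigma> i n)} \<union>
     {\<sigma>. \<exists>k. \<sigma> k \<and> (\<forall>i<k. \<not> \<sigma> i) \<and> (\<forall>i\<ge>k. \<forall>n. admissible_word s (subword \<sigma> i n))} \<union>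
     {\<lambda>i. False}"

definition identified_at :: "real \<Rightarrow> int \<Rightarrow> (int \<Rightarrow> bool) \<Rightarrow> (int \<Rightarrow> bool) \<Rightarrow> bool" where
  "identified_at s k \<sigma> \<tau> \<longleftrightarrow>
     \<sigma> k \<noteq> \<tau> k \<and> (\<forall>i. i \<noteq> k \<longrightarrow> \<sigma> i = \<tau> i) \<and>
     (\<forall>j. \<sigma> (k + 1 + int j) = kneading s j) \<and> (\<forall>j. \<tau> (k + 1 + int j) = kneading s j)"

(* Where a coordinate equals the critical point either symbol is allowed; admissibility then
   leaves exactly one class modulo the identifications above. *)
definition represents :: "real \<Rightarrow> (int \<Rightarrow> bool) \<Rightarrow> (nat \<Rightarrow> real) \<Rightarrow> bool" where
  "represents s \<sigma> x \<longleftrightarrow> \<sigma> \<in> Sigma_adm s \<and>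
     (\<forall>i. coord s x i \<in> (if \<sigma> i then {crit..1} else {0..crit}))"

definition left_part :: "(int \<Rightarrow> bool) \<Rightarrow> nat \<Rightarrow> bool" where
  "left_part \<sigma> j = \<sigma> (- int (Suc j))"

definition basic_arc :: "real \<Rightarrow> (nat \<Rightarrow> bool) \<Rightarrow> (nat \<Rightarrow> real) set" where
  "basic_arc s l = {x \<in> tent_limit s. \<exists>\<sigma>. represents s \<sigma> x \<and> left_part \<sigma> = l}"

section \<open>The planar embeddings\<close>

definition psi :: "(nat \<Rightarrow> bool) \<Rightarrow> (nat \<Rightarrow> bool) \<Rightarrow> real" where
  "psi L l =
     (\<Sum>i. (-1) powi (int (ones (initial L (Suc i))) - int (ones (initial l (Suc i)))) / 3 ^ Suc i)
     + 1/2"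

(* The semicircle with end points (p, y1) and (p, y2), to the left or to the right of the
   vertical line through them. *)
definition semicircle :: "bool \<Rightarrow> real \<Rightarrow> real \<Rightarrow> real \<Rightarrow> (real \<times> real) set" where
  "semicircle on_left p y1 y2 =
     {(u, v). (u - p)\<^sup>2 + (v - (y1 + y2) / 2)\<^sup>2 = ((y1 - y2) / 2)\<^sup>2 \<and>
              (if on_left then u \<le> p else p \<le> u)}"

(* The part of the drawing of X that belongs to the point x: its position on each horizontal
   segment pi_0(A(l)) x {psi_L(l)} with x in A(l), and, if x is a common end point of two basic
   arcs, the semicircle that joins these positions. *)
definition draw_point :: "real \<Rightarrow> (nat \<Rightarrow> bool) \<Rightarrow> (nat \<Rightarrow> real) \<Rightarrow> (real \<times> real) set" where
  "draw_point s L x =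
     {(x 0, psi L l) | l. x \<in> basic_arc s l} \<union>
     \<Union>{semicircle (odd (ones (subword \<sigma> (k + 1) (nat (- k - 1))))) (x 0)
           (psi L (left_part \<sigma>)) (psi L (left_part \<tau>)) | \<sigma> \<tau> k.
         k < 0 \<and> represents s \<sigma> x \<and> represents s \<tau> x \<and> identified_at s k \<sigma> \<tau>}"

(* The planar copy phi_L(Y) of a subset Y of X that contains with a point also the adjacent
   basic arcs; it is used for Y = X' and for arc-components of X'. *)
definition phi :: "real \<Rightarrow> (nat \<Rightarrow> bool) \<Rightarrow> (nat \<Rightarrow> real) set \<Rightarrow> (real \<times> real) set" where
  "phi s L Y = (\<Union>x\<in>Y. draw_point s L x)"

(* The left-infinite sequence 0^infinity 1. *)
definition L_ray :: "nat \<Rightarrow> bool" where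
  "L_ray j \<longleftrightarrow> j = 0"

section \<open>The sequence rhe\<close>

definition kappa :: "rat \<Rightarrow> nat \<Rightarrow> int" where
  "kappa q i = (if i = 1 then \<lfloor>1 / q\<rfloor> - 1
                else \<lfloor>of_nat i / q\<rfloor> - \<lfloor>(of_nat i - 1) / q\<rfloor> - 2)"

(* The last block of zeros (i = m) is shortened by one; for m = 1 the word is 1 0^(kappa_1 - 1). *)
definition w_word :: "rat \<Rightarrow> bool list" where
  "w_word q =
    (let m = nat (fst (quotient_of q));
         zeros = (\<lambda>i. replicate (nat (kappa q i - (if i = m then 1 else 0))) False)
     in [True] @ zeros 1 @ concat (map (\<lambda>i. [True, True] @ zeros i) [2..<Suc m]))"

definition rhe :: "rat \<Rightarrow> nat \<Rightarrow> bool" where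
  "rhe q k = (if k < 2 then k = 0 else periodic_seq (rev (w_word q) @ [True]) (k - 2))"

section \<open>Arc-components, accessibility and prime ends\<close>

definition arc_component :: "(real \<times> real) set \<Rightarrow> real \<times> real \<Rightarrow> (real \<times> real) set" where
  "arc_component K a = insert a (\<Union>{path_image g | g. arc g \<and> path_image g \<subseteq> K \<and> a \<in> path_image g})"

definition arc_components :: "(real \<times> real) set \<Rightarrow> (real \<times> real) set set" where
  "arc_components K = arc_component K ` K"

definition line :: "(real \<times> real) set \<Rightarrow> bool" where
  "line U \<longleftrightarrow> (\<exists>f :: real \<Rightarrow> real \<times> real. continuous_on UNIV f \<and> inj f \<and> range f = U)"

definition accessible :: "(real \<times> real) set \<Rightarrow> real \<times> real \<Rightarrow> bool" where
  "accessible K a \<longleftrightarrow> a \<in> K \<and> (\<exists>g. arc g \<and> path_image g \<inter> K = {a})"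

definition partially_accessible :: "(real \<times> real) set \<Rightarrow> (real \<times> real) set \<Rightarrow> bool" where
  "partially_accessible K U \<longleftrightarrow> (\<exists>a\<in>U. accessible K a) \<and> (\<exists>a\<in>U. \<not> accessible K a)"

text \<open>The arc-component \<open>U\<close> of \<open>phi s L (tent_core s)\<close> is symbolically described by a tail
  which is a shift of the reversed kneading sequence.\<close>

definition tail_shift_of_kneading ::
    "real \<Rightarrow> (nat \<Rightarrow> bool) \<Rightarrow> (real \<times> real) set \<Rightarrow> bool" where
  "tail_shift_of_kneading s L U \<longleftrightarrow>
     (\<exists>i::int. U = phi s L (tent_core s \<inter>
        \<Union>{basic_arc s l | l. \<forall>\<^sub>F k in sequentially. l (nat (int k + i)) = kneading s k}))"

definition crosscut :: "(real \<times> real) set \<Rightarrow> (real \<times> real) set \<Rightarrow> bool" where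
  "crosscut K Q \<longleftrightarrow>
     (\<exists>g. arc g \<and> Q = path_image g \<and> Q \<inter> K = {pathstart g, pathfinish g})"

definition B_set :: "(real \<times> real) set \<Rightarrow> (real \<times> real) set \<Rightarrow> (real \<times> real) set" where
  "B_set K Q = (THE B. B \<in> components (- (K \<union> Q)) \<and> bounded B)"

definition chains :: "(real \<times> real) set \<Rightarrow> (nat \<Rightarrow> (real \<times> real) set) set" where
  "chains K = {Q. (\<forall>i. crosscut K (Q i)) \<and> (\<forall>i j. i \<noteq> j \<longrightarrow> Q i \<inter> Q j = {}) \<and>
                  (\<lambda>i. diameter (Q i)) \<longlonglongrightarrow> 0 \<and>
                  (\<forall>i. B_set K (Q (Suc i)) \<subseteq> B_set K (Q i))}"

definition chain_equiv ::
    "(real \<times> real) set \<Rightarrow> ((nat \<Rightarrow> (real \<times> real) set) \<times> (nat \<Rightarrow> (real \<times> real) set)) set" where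
  "chain_equiv K = {(Q, R). Q \<in> chains K \<and> R \<in> chains K \<and>
     (\<forall>i. \<exists>j. B_set K (R j) \<subseteq> B_set K (Q i)) \<and> (\<forall>i. \<exists>j. B_set K (Q j) \<subseteq> B_set K (R i))}"

definition prime_ends :: "(real \<times> real) set \<Rightarrow> (nat \<Rightarrow> (real \<times> real) set) set set" where
  "prime_ends K = chains K // chain_equiv K"

(* As the diameters of the crosscuts tend to 0, a limit of a chain is a single point. *)
definition principal_set :: "(nat \<Rightarrow> (real \<times> real) set) set \<Rightarrow> (real \<times> real) set" where
  "principal_set P = {a. \<exists>Q\<in>P. \<forall>e>0. \<forall>\<^sub>F i in sequentially. Q i \<subseteq> ball a e}"

definition infinite_canal ::
    "(real \<times> real) set \<Rightarrow> (nat \<Rightarrow> (real \<times> real) set) set \<Rightarrow> bool" where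
  "infinite_canal K P \<longleftrightarrow> P \<in> prime_ends K \<and>
     (\<exists>a\<in>principal_set P. \<exists>b\<in>principal_set P. a \<noteq> b) \<and> principal_set P \<noteq> K"

end

theory Submission
 imports Defs
begin

text \<open>The condition \<open>\<nu> = rhe q\<close> says that the critical orbit is coded by the rotation by \<open>m/n\<close>: the third
image of the critical point is periodic, and its itinerary is the rotation sequence. A point of the
plane continuum is described by the height of its strand, that is by a left-infinite code, so locally the continuum
is a Cantor set of strands, and a point can be accessible only if its strand is not approached by others from one
side. Followed backwards, such a strand remains topmost or bottommost above its point; its position along the outer boundary
then evolves by the inverse of a contracted rotation, which forces the code to end in a shift of the rotation
sequence. This leaves \<open>n\<close> tails, each of which gives a dense line.

If a prime end had two principal points, a circle separating them would contain infinitely many gaps that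
accumulate at a point of the continuum. A short gap joins two neighbouring strands of one line, so together with
an arc of that line it bounds a disc that misses the continuum, and no chain with two different limits can enter such a disc.\<close>

section \<open>The sequence rhe as a rotation coding\<close>

text \<open>Strands are followed through the inverse branches of the tent map, which contract by
  \<open>s\<close>; hence the periodic orbit \<open>Z\<close> is indexed against the dynamics. The
  top and the bottom copy of the core interval form a circle of length \<open>ell\<close>, and one
  step back acts on it as \<open>x / s + kap\<close> modulo \<open>ell\<close>. The point where the
  circle is cut is itself an orbit position, so a position and the orbit position just below it are
  never torn apart; this gives the rotation tail. The same map misses an arc of the circle, and two
  neighbouring strands both enter that arc right after they part; this is why a short gap joins
  strands of a single line. The obstacle is local. The semicircles of the drawing shrink to the
  finitely many points \<open>Fold i\<close>, and charts are built only elsewhere; finiteness lets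
  the separating circle avoid these points. It must also be decided that the loop formed by a gap
  and an arc of a line has no point of the continuum inside. Any other line is dense, so otherwise
  the whole continuum would lie in the closed disc, with its leftmost and rightmost points on the
  arc; but these two points do not lie on a common line.\<close>

definition rhe_block :: "nat => nat => nat => bool list" where
 "rhe_block m n i = [True, True] @ replicate ((i * n) div m - ((i - 1) * n) div m - 2) False"

definition rhe_prefix :: "nat => nat => nat => bool list" where
 "rhe_prefix m n j =
   [True] @ replicate (n div m - 1) False @ concat (map (rhe_block m n) [2..<Suc j])"

lemma rhe_prefix_Suc:
 "1 \<le> j ==> rhe_prefix m n (Suc j) = rhe_prefix m n j @ rhe_block m n (Suc j)"
 by (cases j) (auto simp: rhe_prefix_def)

lemma div_block_ge:
 fixes m n i :: nat
 assumes "0 < m" "2 * m < n"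
 shows "(i * n) div m + 2 \<le> (Suc i * n) div m"
proof -
 have "(i * n) div m + 2 = (i * n + 2 * m) div m" using assms by simp
 also have "\<dots> \<le> (Suc i * n) div m" using assms by (intro div_le_mono) simp
 finally show ?thesis .
qed

text \<open>A block consists of the indices at which the multiples of \<open>m\<close> run between
  two consecutive multiples of \<open>n\<close>. Just after passing a multiple of \<open>n\<close>
  the residue takes one value below \<open>m\<close> and then one between \<open>m\<close> and
  \<open>2 * m\<close>; these are the two ones that open a block. Only the first block starts with
  residue \<open>m\<close>, whence its single one. Index \<open>n\<close> is excluded because its
  letter is dropped later.\<close>

lemma rhe_prefix_props:
 assumes m: "0 < m" and mn: "2 * m < n" and co: "coprime m n" and j: "1 \<le> j" "j \<le> m"
 shows "length (rhe_prefix m n j) = (j * n) div m \<and>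
  (\<forall>p. p < (j * n) div m --> p + 1 < n -->
   rhe_prefix m n j ! p = (((p + 1) * m) mod n < 2 * m))"
 using j
proof (induction j rule: dec_induct)
 case base
 have "1 \<le> n div m" using m mn by (simp add: Suc_leI div_greater_zero_iff)
 hence len: "length (rhe_prefix m n 1) = n div m" by (simp add: rhe_prefix_def)
 have "rhe_prefix m n 1 ! p = (((p + 1) * m) mod n < 2 * m)" if p: "p < n div m" "p + 1 < n" for p
 proof (cases p)
  case 0
  thus ?thesis using m mn by (simp add: rhe_prefix_def)
 next
  case (Suc p')
  have le: "(p + 1) * m \<le> n"
   by (metis p(1) Suc_eq_plus1 Suc_leI div_times_less_eq_dividend le_trans mult_le_mono1)
  have "(p + 1) * m ~= n"
  proof
   assume eq: "(p + 1) * m = n"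
   hence "m dvd n" by (metis dvd_triv_right)
   hence "m = 1" using co by (simp add: coprime_absorb_left)
   thus False using eq p by simp
  qed
  hence "((p + 1) * m) mod n = (p + 1) * m" using le by simp
  thus ?thesis using Suc p by (simp add: rhe_prefix_def)
 qed
 thus ?case using len by simp
next
 case (step j)
 let ?L = "(j * n) div m" and ?L' = "(Suc j * n) div m"
 define r where "r = (j * n) mod m"
 have jm: "j < m" "1 \<le> j" using step by auto
 have r: "?L * m + r = j * n" "r < m" using m by (auto simp: r_def)
 have r0: "0 < r"
 proof (rule ccontr)
  assume "\<not> 0 < r"
  hence "m dvd j * n" by (simp add: r_def mod_eq_0_iff_dvd)
  hence "m dvd j" using co by (simp add: coprime_dvd_mult_left_iff)
  thus False using jm by (auto dest: dvd_imp_le)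
 qed
 have L2: "?L + 2 \<le> ?L'" using div_block_ge[OF m mn] .
 have IH: "length (rhe_prefix m n j) = ?L"
  "\<And>p. p < ?L ==> p + 1 < n ==> rhe_prefix m n j ! p = (((p + 1) * m) mod n < 2 * m)"
  using step by auto
 have eq: "rhe_prefix m n (Suc j) =
   rhe_prefix m n j @ [True, True] @ replicate (?L' - ?L - 2) False"
  using rhe_prefix_Suc[OF jm(2)] by (simp add: rhe_block_def)
 have len: "length (rhe_prefix m n (Suc j)) = ?L'" using eq IH(1) L2 by simp
 have "rhe_prefix m n (Suc j) ! p = (((p + 1) * m) mod n < 2 * m)"
  if p: "p < ?L'" "p + 1 < n" for p
 proof -
  consider "p < ?L" | "p = ?L" | "p = ?L + 1" | t where "p = ?L + 2 + t"
  proof (cases "p < ?L + 2")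
   case False
   hence "p = ?L + 2 + (p - (?L + 2))" by simp
   thus ?thesis using that by blast
  next
   case True
   hence "p < ?L \<or> p = ?L \<or> p = ?L + 1" by linarith
   thus ?thesis using that by blast
  qed
  thus ?thesis
  proof cases
   case 1
   thus ?thesis using eq IH p by (simp add: nth_append)
  next
   case 2
   have "(p + 1) * m = j * n + (m - r)" using r 2 by (simp add: algebra_simps)
   hence "((p + 1) * m) mod n = m - r" using mn by simp
   thus ?thesis using eq IH 2 m by (simp add: nth_append)
  next
   case 3
   have "(p + 1) * m = j * n + (2 * m - r)" using r 3 by (simp add: algebra_simps)
   hence "((p + 1) * m) mod n = 2 * m - r" using mn r0 by simp
   thus ?thesis using eq IH 3 m r0 by (simp add: nth_append)
  next
   case 4
   have e: "(p + 1) * m = j * n + ((3 + t) * m - r)" using r 4 by (simp add: algebra_simps)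
   have lt: "(p + 1) * m < Suc j * n"
   proof (cases "Suc j = m")
    case True
    thus ?thesis using p m by (metis mult.commute mult_less_cancel2)
   next
    case False
    have "(p + 1) * m \<le> ?L' * m" using p by (intro mult_le_mono1) simp
    also have "\<dots> \<le> Suc j * n" by (metis div_times_less_eq_dividend)
    finally have le: "(p + 1) * m \<le> Suc j * n" .
    have "(p + 1) * m ~= Suc j * n"
    proof
     assume "(p + 1) * m = Suc j * n"
     hence "m dvd Suc j * n" by (metis dvd_triv_right)
     hence "m dvd Suc j" using co coprime_dvd_mult_left_iff by blast
     thus False using False jm by (auto dest: dvd_imp_le)
    qed
    thus ?thesis using le by simp
   qed
   have "(3 + t) * m - r < n" using e lt by simp
   hence "((p + 1) * m) mod n = (3 + t) * m - r" using e by simp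
   moreover have "\<not> (3 + t) * m - r < 2 * m" using r by (simp add: algebra_simps)
   moreover have "rhe_prefix m n (Suc j) ! p = False"
    using eq IH 4 p by (simp add: nth_append)
   ultimately show ?thesis by simp
  qed
 qed
 thus ?case using len by simp
qed

section \<open>From floors of rationals to natural division\<close>

lemma floor_of_nat_div_rat:
 fixes q :: rat
 assumes "q = of_nat m / of_nat n"
 shows "\<lfloor>of_nat i / q\<rfloor> = int ((i * n) div m)"
proof -
 have "of_nat i / q = of_nat (i * n) / (of_nat m :: rat)" using assms by simp
 thus ?thesis by (simp only: floor_divide_of_nat_eq)
qed

lemma kappa_nat:
 assumes q: "q = of_nat m / of_nat n" and m: "0 < m" and mn: "2 * m < n"
 shows "kappa q 1 = int (n div m - 1)"
  and "2 \<le> i ==> kappa q i = int ((i * n) div m - ((i - 1) * n) div m - 2)"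
proof -
 have "1 \<le> n div m" using m mn by (simp add: Suc_leI div_greater_zero_iff)
 thus "kappa q 1 = int (n div m - 1)"
  using floor_of_nat_div_rat[OF q, of 1] by (simp add: kappa_def of_nat_diff)
 assume i: "2 \<le> i"
 have "(of_nat i - 1 :: rat) = of_nat (i - 1)" using i by (simp add: of_nat_diff)
 hence "kappa q i = int ((i * n) div m) - int (((i - 1) * n) div m) - 2"
  using i floor_of_nat_div_rat[OF q, of i] floor_of_nat_div_rat[OF q, of "i - 1"]
  by (simp add: kappa_def)
 moreover have "((i - 1) * n) div m + 2 \<le> (i * n) div m"
  using div_block_ge[OF m mn, of "i - 1"] i by simp
 ultimately show "kappa q i = int ((i * n) div m - ((i - 1) * n) div m - 2)" by simp
qed

lemma quotient_of_nat_div: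
 assumes q: "q = of_nat m / of_nat n" and m: "0 < n" and co: "coprime m n"
 shows "quotient_of q = (int m, int n)"
proof -
 have "q = Fract (int m) (int n)" using q by (simp add: Fract_of_int_quotient)
 thus ?thesis using co m by (simp add: quotient_of_Fract normalize_def)
qed

lemma butlast_replicate_eq: "butlast (replicate k x) = replicate (k - 1) x"
 by (cases k) (simp_all add: replicate_append_same[symmetric])

text \<open>Shortening the last block of zeros by one amounts to dropping the last letter as soon as
  that block contains a zero, which \<open>2 * m < n\<close> guarantees.\<close>

lemma w_word_eq_butlast:
 assumes q: "q = of_nat m / of_nat n" and m: "0 < m" and mn: "2 * m < n" and co: "coprime m n"
 shows "w_word q = butlast (rhe_prefix m n m)"
proof -
 have mq: "nat (fst (quotient_of q)) = m" using quotient_of_nat_div[OF q _ co] mn by simp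
 show ?thesis
 proof (cases "m = 1")
  case True
  have "w_word q = [True] @ replicate (nat (kappa q 1 - 1)) False"
   unfolding w_word_def Let_def mq using True by simp
  moreover have "nat (kappa q 1 - 1) = n - 1 - 1" using kappa_nat(1)[OF q m mn] True by simp
  ultimately show ?thesis using True mn by (simp add: rhe_prefix_def butlast_replicate_eq butlast_append)
 next
  case False
  then obtain j where j: "m = Suc j" "1 \<le> j" using m by (cases m) auto
  have 1: "map (%i. [True, True] @ replicate (nat (kappa q i - (if i = m then 1 else 0))) False) [2..<m]
    = map (rhe_block m n) [2..<m]"
   using kappa_nat(2)[OF q m mn] by (intro map_cong) (auto simp: rhe_block_def)
  have km: "nat (kappa q m - 1) = (m * n) div m - ((m - 1) * n) div m - 2 - 1"
   using kappa_nat(2)[OF q m mn, of m] False m by simp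
  have gt: "0 < (m * n) div m - ((m - 1) * n) div m - 2"
  proof -
   have "((m - 1) * n) div m < n - 2"
   proof (rule div_less_iff_less_mult[THEN iffD2])
    show "0 < m" by fact
    have "(m - 1) * n = m * n - n" "(n - 2) * m = m * n - 2 * m"
     by (simp_all add: diff_mult_distrib diff_mult_distrib2 mult.commute)
    moreover have "n \<le> m * n" using m by simp
    ultimately show "(m - 1) * n < (n - 2) * m" using mn by linarith
   qed
   thus ?thesis using m by simp
  qed
  have up: "[2..<Suc m] = [2..<m] @ [m]" using j by simp
  have "w_word q = [True] @ replicate (nat (kappa q 1)) False @
    concat (map (rhe_block m n) [2..<m]) @ ([True, True] @ replicate (nat (kappa q m - 1)) False)"
   unfolding w_word_def Let_def mq up map_append concat_append 1 using False by simp
  also have "\<dots> = butlast (rhe_prefix m n m)"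
   using gt kappa_nat(1)[OF q m mn] j unfolding j(1) rhe_prefix_Suc[OF j(2)] km[unfolded j(1)]
   by (simp add: rhe_prefix_def rhe_block_def butlast_append butlast_replicate_eq)
  finally show ?thesis .
 qed
qed

lemma w_word_nth:
 assumes q: "q = of_nat m / of_nat n" and m: "0 < m" and mn: "2 * m < n" and co: "coprime m n"
 shows "length (w_word q) = n - 1"
  and "p < n - 1 ==> w_word q ! p = (((p + 1) * m) mod n < 2 * m)"
proof -
 have "length (rhe_prefix m n m) = n"
  "\<And>p. p < n ==> p + 1 < n ==> rhe_prefix m n m ! p = (((p + 1) * m) mod n < 2 * m)"
  using rhe_prefix_props[OF m mn co, of m] m by auto
 thus "length (w_word q) = n - 1"
  "p < n - 1 ==> w_word q ! p = (((p + 1) * m) mod n < 2 * m)"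
  using w_word_eq_butlast[OF assms] by (auto simp: nth_butlast)
qed

text \<open>Reversing the word turns the index into its negative modulo \<open>n\<close>, and the
  appended 1 stands at residue 0, the one residue that \<open>w_word\<close> leaves out.\<close>

lemma rhe_rotation:
 assumes q: "q = of_nat m / of_nat n" and m: "0 < m" and mn: "2 * m < n" and co: "coprime m n"
 shows "rhe q (k + 2) \<longleftrightarrow> (- (int k + 1) * int m) mod int n < 2 * int m"
proof -
 define r where "r = k mod n"
 have r: "r < n" using mn by (simp add: r_def)
 have len: "length (rev (w_word q) @ [True]) = n" using w_word_nth(1)[OF q m mn co] mn by simp
 have "rhe q (k + 2) = (rev (w_word q) @ [True]) ! r"
  by (simp add: rhe_def periodic_seq_def len[simplified] r_def)
 also have "\<dots> \<longleftrightarrow> ((n - 1 - r) * m) mod n < 2 * m"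
 proof (cases "r = n - 1")
  case True
  thus ?thesis using w_word_nth(1)[OF q m mn co] m by (simp add: nth_append)
 next
  case False
  hence "r < n - 1" using r by simp
  moreover from this have "n - 1 - Suc r + 1 = n - 1 - r" by simp
  ultimately show ?thesis
   using w_word_nth(1)[OF q m mn co] w_word_nth(2)[OF q m mn co, of "n - 1 - Suc r"] by (simp add: nth_append rev_nth)
 qed
 also have "\<dots> \<longleftrightarrow> (- (int k + 1) * int m) mod int n < 2 * int m"
 proof -
  have "int (((n - 1 - r) * m) mod n) = ((int n - 1 - int r) * int m) mod int n"
   using r by (simp add: zmod_int of_nat_diff diff_diff_eq)
  also have "\<dots> = ((- (int k + 1)) * int m) mod int n"
  proof (rule mod_mult_cong[OF _ refl])
   have "(int n - 1 - int r) mod int n = (- 1 - int r) mod int n"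
    by (metis add.commute add_diff_eq diff_conv_add_uminus mod_add_self2)
   also have "\<dots> = (- 1 - int k) mod int n" unfolding r_def zmod_int by (simp add: mod_diff_right_eq)
   finally show "(int n - 1 - int r) mod int n = (- (int k + 1)) mod int n"
    by (simp add: algebra_simps)
  qed
  finally show ?thesis by (metis of_nat_less_iff of_nat_mult of_nat_numeral)
 qed
 finally show ?thesis .
qed

section \<open>The critical orbit\<close>

text \<open>\<open>itin\<close> is the equation for the kneading sequence from its third symbol on;
  the first two symbols are 1 and 0 for all slopes in this range.\<close>

locale tent_rot =
 fixes s :: real and m n :: nat
 assumes s_gt: "sqrt 2 < s" and s_lt: "s < 2"
  and m_pos: "0 < m" and mn: "2 * m < n" and co: "coprime m n"
  and nonper: "0 < k ==> (tent s ^^ k) (1/2) ~= 1/2"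
  and itin: "1/2 \<le> (tent s ^^ (k + 3)) (1/2) \<longleftrightarrow> (- (int k + 1) * int m) mod int n < 2 * int m"
begin

abbreviation T :: "real => real" where "T \<equiv> tent s"

definition a :: real where "a = s * (1 - s / 2)"
definition b :: real where "b = s / 2"
definition lam :: "int => bool" where "lam i \<longleftrightarrow> (i * int m) mod int n < 2 * int m"
text \<open>The periodic orbit of the third image of the critical point, traversed backwards:
  \<open>T (Z (i + 1)) = Z i\<close>, with \<open>Z 0\<close> the third image itself. Increasing
  \<open>i\<close> then agrees with going deeper into a left-infinite code.\<close>

definition Z :: "int => real" where "Z i = (T ^^ (nat ((- i) mod int n) + 3)) (1/2)"
definition br :: "bool => real => real" where "br e y = (if e then 1 - y / s else y / s)"

lemma s_gt1: "1 < s"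
proof -
 have "1 < sqrt 2" by simp
 thus ?thesis using s_gt by (rule less_trans)
qed

lemma s_pos: "0 < s" using s_gt1 by simp

lemma s_sq: "2 < s * s"
proof -
 have "sqrt 2 * sqrt 2 < s * s" using s_gt by (intro mult_strict_mono) (auto intro: s_pos)
 thus ?thesis by simp
qed

lemma n_pos: "0 < n" and n_ge3: "3 \<le> n" using m_pos mn by auto

lemma T_left: "y \<le> 1/2 ==> T y = s * y"
 and T_right: "1/2 \<le> y ==> T y = s * (1 - y)"
 using s_pos by (auto simp: tent_def min_def mult_le_cancel_left)

lemma T_crit: "T (1/2) = b" by (simp add: T_left b_def)

lemma b_gt: "1/2 < b" using s_gt1 by (simp add: b_def)

lemma a_lt: "a < 1/2"
proof -
 have "0 < (s - 1) * (s - 1)" using s_gt1 by simp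
 thus ?thesis by (simp add: a_def algebra_simps)
qed

lemma a_pos: "0 < a" using s_pos s_lt by (simp add: a_def)

lemma b_lt1: "b < 1" using s_lt by (simp add: b_def)

lemma T_b: "T b = a" using b_gt by (simp add: T_right a_def b_def)

lemma T_a: "T a = s * a" using a_lt by (simp add: T_left)

lemma ab: "a < b" using a_lt b_gt by simp

lemma sa_le_b: "s * a < b" using a_lt s_pos by (simp add: b_def)

lemma a_lt_sa: "a < s * a" using s_gt1 a_pos by simp

lemma T_range: assumes "a \<le> y" "y \<le> b" shows "a \<le> T y" "T y \<le> b"
proof -
 have "T y = s * y \<or> T y = s * (1 - y)" "T y \<le> s * y" "T y \<le> s * (1 - y)"
  by (auto simp: tent_def min_def)
 moreover have "s * a \<le> s * y" "s * (1 - b) \<le> s * (1 - y)" using assms s_pos by auto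
 moreover have "s * (1 - b) = a" by (simp add: a_def b_def)
 ultimately show "a \<le> T y" using a_lt_sa by linarith
 have "y \<le> 1/2 \<or> 1 - y \<le> 1/2" by linarith
 hence "T y \<le> s * (1/2)"
  using \<open>T y \<le> s * y\<close> \<open>T y \<le> s * (1 - y)\<close> s_pos
  by (metis mult_left_mono order.trans less_imp_le)
 thus "T y \<le> b" by (simp add: b_def)
qed

lemma T_eq_b_iff: "T y = b \<longleftrightarrow> y = 1/2"
proof
 assume "T y = b"
 hence "s / 2 = s * y \<and> y \<le> 1/2 \<or> s / 2 = s * (1 - y) \<and> 1/2 \<le> y"
  using T_left T_right by (metis b_def linear)
 thus "y = 1/2" using s_pos by auto
next
 assume "y = 1/2"
 thus "T y = b" by (simp only: T_crit)
qed

lemma T_br: "y \<le> b ==> T (br e y) = y"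
 using s_pos by (cases e) (auto simp: br_def b_def T_left T_right field_simps)

lemma br_T: "y ~= 1/2 \<or> e = (1/2 < y) ==> e = (1/2 < y) ==> br e (T y) = y"
 using s_pos by (cases e) (auto simp: br_def T_left T_right field_simps)

lemma br_True_range: assumes "a \<le> y" "y \<le> b" shows "1/2 \<le> br True y" "br True y \<le> b"
proof -
 show "1/2 \<le> br True y" using assms s_pos by (simp add: br_def b_def field_simps)
 have "a / s \<le> y / s" using assms s_pos by (simp add: divide_right_mono)
 moreover have "a / s = 1 - b" using s_pos by (simp add: a_def b_def)
 ultimately show "br True y \<le> b" by (simp add: br_def)
qed

lemma br_False_range: assumes "s * a \<le> y" "y \<le> b" shows "a \<le> br False y" "br False y \<le> 1/2"
 using assms s_pos by (auto simp: br_def b_def field_simps)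

lemma br_b: "br e b = 1/2" using s_pos by (simp add: br_def b_def)

lemma br_a: "br True a = b" using s_pos by (simp add: br_def b_def a_def)

lemma br_sa: "br False (s * a) = a" using s_pos by (simp add: br_def)

lemma br_diff: "br e x - br e y = (if e then - 1 else 1) * (x - y) / s"
 by (simp add: br_def diff_divide_distrib)

lemma funpow_range: assumes "a \<le> y" "y \<le> b" shows "a \<le> (T ^^ k) y \<and> (T ^^ k) y \<le> b"
 by (induction k) (use assms T_range in auto)

lemma crit_orbit_range: "a \<le> (T ^^ Suc k) (1/2)" "(T ^^ Suc k) (1/2) \<le> b"
 using funpow_range[of b k] ab by (simp_all add: funpow_swap1 T_crit)

section \<open>Orientation and itineraries\<close>

primrec sg :: "nat => real => real" where
 "sg 0 y = 1"
| sg_Suc: "sg (Suc N) y = (if y \<le> 1/2 then 1 else - 1) * sg N (T y)"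

declare sg_Suc [simp del]

lemma funpow_T_add: "(T ^^ i) ((T ^^ j) y) = (T ^^ (i + j)) y"
 by (simp add: funpow_add)

lemma sg_add: "sg (M + N) y = sg M y * sg N ((T ^^ M) y)"
 by (induction M arbitrary: y) (simp_all add: sg_Suc funpow_swap1)

lemma sg_cases: "sg N y = 1 \<or> sg N y = - 1"
 by (induction N arbitrary: y) (auto simp: sg_Suc)

lemma sg_sq [simp]: "sg N y * sg N y = 1" using sg_cases[of N y] by auto

lemma abs_sg [simp]: "\<bar>sg N y\<bar> = 1" using sg_cases[of N y] by auto

definition sameit :: "nat => real => real => bool" where
 "sameit N x y \<longleftrightarrow> (\<forall>i<N. (1/2 < (T ^^ i) x) = (1/2 < (T ^^ i) y))"

lemma sameit_0 [simp]: "sameit 0 x y" by (simp add: sameit_def)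

lemma sameit_Suc: "sameit (Suc N) x y \<longleftrightarrow> (1/2 < x) = (1/2 < y) \<and> sameit N (T x) (T y)"
 by (auto simp: sameit_def less_Suc_eq_0_disj funpow_swap1)

lemma sg_cong: "sameit N x y ==> sg N x = sg N y"
 by (induction N arbitrary: x y) (auto simp: sg_Suc sameit_Suc)

lemma T_diff: "sameit N x y ==> (T ^^ N) x - (T ^^ N) y = sg N y * s ^ N * (x - y)"
proof (induction N arbitrary: x y)
 case (Suc N)
 have 1: "(T ^^ N) (T x) - (T ^^ N) (T y) = sg N (T y) * s ^ N * (T x - T y)"
  using Suc by (simp add: sameit_Suc)
 have "T x - T y = (if y \<le> 1/2 then 1 else - 1) * s * (x - y)"
  using Suc.prems by (cases "y \<le> 1/2") (auto simp: sameit_Suc T_left T_right algebra_simps)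
 thus ?case using 1 by (simp add: sg_Suc funpow_swap1)
qed simp

lemma sameit_all_imp_eq:
 assumes "a \<le> x" "x \<le> b" "a \<le> y" "y \<le> b" and "\<And>N. sameit N x y"
 shows "x = y"
proof (rule ccontr)
 assume "x ~= y"
 then obtain N where N: "1 / \<bar>x - y\<bar> < s ^ N" using real_arch_pow[OF s_gt1] by blast
 have "\<bar>(T ^^ N) x - (T ^^ N) y\<bar> = s ^ N * \<bar>x - y\<bar>"
  using T_diff[OF assms(5)] s_pos by (simp add: abs_mult)
 also have "\<dots> > 1" using N \<open>x ~= y\<close> by (simp add: field_simps)
 finally show False
  using funpow_range[OF assms(1,2), of N] funpow_range[OF assms(3,4), of N] a_pos b_lt1 by linarith
qed

lemma lam_period: "lam (i + int n * j) = lam i"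
proof -
 have "(i + int n * j) * int m = i * int m + int n * (j * int m)" by (simp add: algebra_simps)
 thus ?thesis by (simp add: lam_def)
qed

text \<open>A tail determines \<open>lam\<close> only on a half-line of indices; periodicity extends
  the equality to all of them. As \<open>m\<close> is invertible modulo \<open>n\<close>, every
  residue occurs, so the residues below \<open>2 * m\<close> are invariant under translation by
  \<open>i * m\<close>; a nonempty proper arc of a cycle is invariant only under the trivial
  translation.\<close>

lemma lam_shift_imp_dvd:
 assumes "\<And>k. k \<le> K ==> lam (i + k) = lam k"
 shows "int n dvd i"
proof -
 have all: "lam (i + k) = lam k" for k
 proof -
  define j where "j = (\<bar>k\<bar> + \<bar>K\<bar>)"
  have "k - int n * j \<le> K"
  proof -
   have "1 * j \<le> int n * j" using n_pos by (intro mult_right_mono) (auto simp: j_def)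
   thus ?thesis by (simp add: j_def)
  qed
  hence "lam (i + (k + int n * (- j))) = lam (k + int n * (- j))" using assms by simp
  thus ?thesis using lam_period[of k "- j"] lam_period[of "i + k" "- j"] by (simp add: algebra_simps)
 qed
 define d where "d = (i * int m) mod int n"
 have d: "0 \<le> d" "d < int n" using n_pos by (auto simp: d_def)
 have ex: "\<exists>k. (k * int m) mod int n = x" if "0 \<le> x" "x < int n" for x
 proof -
  obtain u v where "u * int m + v * int n = 1"
   using bezout_int[of "int m" "int n"] co by (auto simp: coprime_iff_gcd_eq_1)
  hence "x * (u * int m + v * int n) = x" by simp
  hence "(x * u) * int m = x + int n * (- (x * v))" by (simp add: algebra_simps)
  hence "((x * u) * int m) mod int n = x" using that by (metis mod_mult_self2 mod_pos_pos_trivial)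
  thus ?thesis by blast
 qed
 have eq: "(x < 2 * int m) = ((x + d) mod int n < 2 * int m)" if x: "0 \<le> x" "x < int n" for x
 proof -
  obtain k where k: "(k * int m) mod int n = x" using ex[OF x] by blast
  have "(i + k) * int m = k * int m + i * int m" by (simp add: algebra_simps)
  hence "((i + k) * int m) mod int n = (x + d) mod int n"
   using k by (metis d_def mod_add_eq)
  thus ?thesis using all[of k] k by (simp add: lam_def)
 qed
 have "d = 0"
 proof (rule ccontr)
  assume "d ~= 0"
  show False
  proof (cases "d < 2 * int m")
   case True
   thus False using eq[of "2 * int m - d"] \<open>d ~= 0\<close> d mn by simp
  next
   case False
   thus False using eq[of 0] d m_pos by simp
  qed
 qed
 hence "int n dvd i * int m" by (simp add: d_def dvd_eq_mod_eq_0)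
 thus ?thesis using co by (simp add: coprime_commute coprime_dvd_mult_left_iff)
qed

section \<open>The periodic orbit of the third image\<close>

lemma itin_lam: "1/2 \<le> (T ^^ (k + 3)) (1/2) \<longleftrightarrow> lam (- (int k + 1))"
 unfolding lam_def by (rule itin)

lemma itin_lam': "1/2 < (T ^^ (k + 3)) (1/2) \<longleftrightarrow> lam (- (int k + 1))"
 using itin_lam[of k] nonper[of "k + 3"] by (metis add_gr_0 less_eq_real_def zero_less_numeral)

text \<open>From the third image on the itinerary has period \<open>n\<close>, and by expansion an
  itinerary determines its point.\<close>

lemma crit_period: "(T ^^ (k + n + 3)) (1/2) = (T ^^ (k + 3)) (1/2)"
proof (rule sameit_all_imp_eq)
 show "sameit N ((T ^^ (k + n + 3)) (1/2)) ((T ^^ (k + 3)) (1/2))" for N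
  unfolding sameit_def
 proof (intro allI impI)
  fix i
  have 1: "(T ^^ i) ((T ^^ (k + n + 3)) (1/2)) = (T ^^ ((i + k + n) + 3)) (1/2)"
   "(T ^^ i) ((T ^^ (k + 3)) (1/2)) = (T ^^ ((i + k) + 3)) (1/2)"
   by (simp_all only: funpow_T_add add.assoc)
  show "(1/2 < (T ^^ i) ((T ^^ (k + n + 3)) (1/2))) = (1/2 < (T ^^ i) ((T ^^ (k + 3)) (1/2)))"
   unfolding 1 itin_lam' using lam_period[of "- (int (i + k) + 1)" "- 1"] by (simp add: algebra_simps)
 qed
qed (use crit_orbit_range[of "k + n + 2"] crit_orbit_range[of "k + 2"] in \<open>simp_all add: numeral_3_eq_3\<close>)

lemma crit_period_mult: "(T ^^ (k + n * j + 3)) (1/2) = (T ^^ (k + 3)) (1/2)"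
proof (induction j)
 case (Suc j)
 thus ?case using crit_period[of "k + n * j"] by (simp add: algebra_simps)
qed simp

lemma crit_eq_Z: "(T ^^ (k + 3)) (1/2) = Z (- int k)"
proof -
 have "nat ((- (- int k)) mod int n) = k mod n" by (simp add: zmod_int[symmetric])
 moreover have "k mod n + n * (k div n) = k" by simp
 ultimately show ?thesis using crit_period_mult[of "k mod n" "k div n"] by (simp add: Z_def)
qed

lemma Z_period: "Z (i + int n * j) = Z i"
proof -
 have "(- (i + int n * j)) mod int n = (- i) mod int n"
  by (metis add_uminus_conv_diff minus_add_distrib mod_mult_self2 mult_minus_right)
 thus ?thesis unfolding Z_def by (rule arg_cong)
qed

lemma Z_eq_crit: "\<exists>k. Z i = (T ^^ (k + 3)) (1/2) \<and> K \<le> k \<and> int n dvd (i + int k)"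
proof -
 define j where "j = nat ((- i) mod int n)"
 have "int n dvd (i + int j)"
  using n_pos by (simp add: j_def) (metis add.right_neutral add.right_inverse dvd_eq_mod_eq_0 mod_0 mod_add_right_eq)
 hence "int n dvd (i + int (j + n * K))" by (simp add: add.assoc[symmetric])
 moreover have "Z i = (T ^^ (j + n * K + 3)) (1/2)"
  using crit_period_mult[of j K] by (simp add: Z_def j_def)
 moreover have "K \<le> j + n * K" using n_pos by (simp add: trans_le_add2)
 ultimately show ?thesis by blast
qed

lemma T_Z: "T (Z (i + 1)) = Z i"
proof -
 obtain k where k: "Z (i + 1) = (T ^^ (k + 3)) (1/2)" "int n dvd (i + 1 + int k)"
  using Z_eq_crit by blast
 have "T (Z (i + 1)) = (T ^^ (Suc k + 3)) (1/2)" unfolding k(1) by (simp only: add_Suc funpow.simps o_apply)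
 also have "\<dots> = Z (- int (Suc k))" by (rule crit_eq_Z)
 also have "\<dots> = Z i"
 proof -
  obtain j where "i + 1 + int k = int n * j" using k(2) by (elim dvdE)
  hence "i = - int (Suc k) + int n * j" by simp
  thus ?thesis using Z_period by metis
 qed
 finally show ?thesis .
qed

lemma Z_sym: "1/2 < Z (i + 1) \<longleftrightarrow> lam i"
proof -
 obtain k where k: "Z (i + 1) = (T ^^ (k + 3)) (1/2)" "int n dvd (i + 1 + int k)"
  using Z_eq_crit by blast
 obtain j where "i + 1 + int k = int n * j" using k(2) by (elim dvdE)
 hence "i = - (int k + 1) + int n * j" by simp
 thus ?thesis using k(1) itin_lam' lam_period by metis
qed

lemma Z_neq_crit: "Z i ~= 1/2"
 using Z_eq_crit[of i 0] nonper by (metis add_gr_0 zero_less_numeral)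

lemma Z_br: "br (lam i) (Z i) = Z (i + 1)"
 using br_T[of "Z (i + 1)" "lam i"] Z_sym[of i] T_Z[of i] by simp

lemma Z_neq_b: "Z i ~= b"
 using T_Z[of i] T_eq_b_iff Z_neq_crit by metis

text \<open>If \<open>a\<close> were on the cycle, its successor \<open>s * a\<close> would be both
  \<open>Z (i - 1)\<close> and \<open>Z 0\<close>. Another \<open>n - 1\<close> steps forward give
  \<open>Z i = Z 1\<close>, so \<open>Z 1 = a\<close>; but the symbol \<open>lam 0\<close> is 1,
  which puts \<open>Z 1\<close> to the right of 1/2.\<close>

lemma Z_neq_a: "Z i ~= a"
proof
 assume eq: "Z i = a"
 have "Z (i - 1) = s * a" using T_Z[of "i - 1"] eq T_a by simp
 moreover have "s * a = (T ^^ (0 + 3)) (1/2)" using T_a by (simp add: numeral_3_eq_3 T_crit T_b)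
 ultimately have 1: "Z (i - 1) = Z 0" using crit_eq_Z[of 0] by simp
 have "Z (i - 1 - int k) = Z (- int k)" for k
 proof (induction k)
  case (Suc k)
  show ?case using T_Z[of "i - 1 - int (Suc k)"] T_Z[of "- int (Suc k)"] Suc
   by (simp add: algebra_simps)
 qed (use 1 in simp)
 from this[of "n - 1"] have "Z (i - 1 - int (n - 1)) = Z (- int (n - 1))" .
 moreover have "i - 1 - int (n - 1) = i + int n * (- 1)" "- int (n - 1) = 1 + int n * (- 1)"
  using n_pos by auto
 ultimately have "Z 1 = a" using Z_period eq by metis
 moreover have "lam 0" using m_pos by (simp add: lam_def)
 ultimately show False using Z_sym[of 0] a_lt by simp
qed

lemma Z_range: "a < Z i" "Z i < b"
proof -
 obtain k where "Z i = (T ^^ Suc (k + 2)) (1/2)" using Z_eq_crit[of i 0] by (auto simp: numeral_3_eq_3)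
 hence "a \<le> Z i" "Z i \<le> b" using crit_orbit_range by metis+
 thus "a < Z i" "Z i < b" using Z_neq_a Z_neq_b by (metis less_eq_real_def)+
qed

lemma Z_0: "Z 0 = s * a" using crit_eq_Z[of 0] T_a by (simp add: numeral_3_eq_3 T_crit T_b)

lemma Z_gt_if_not_lam: "\<not> lam i ==> Z 0 < Z i"
 using Z_br[of i] Z_range(1)[of "i + 1"] s_pos by (simp add: br_def Z_0 field_simps)

lemma finite_range_Z: "finite (range Z)"
proof -
 have "range Z \<subseteq> (%j. (T ^^ (j + 3)) (1/2)) ` {..<n}"
 proof
  fix x assume "x \<in> range Z"
  then obtain i where "x = Z i" by auto
  moreover have "nat ((- i) mod int n) < n" using n_pos by (simp add: nat_less_iff)
  ultimately show "x \<in> (%j. (T ^^ (j + 3)) (1/2)) ` {..<n}" by (auto simp: Z_def)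
 qed
 thus ?thesis by (rule finite_subset) simp
qed

lemma crit_orbit_cases:
 "(T ^^ Suc j) (1/2) = (if j = 0 then b else if j = 1 then a else Z (- int (j - 2)))"
proof (cases j)
 case (Suc j')
 thus ?thesis using crit_eq_Z[of "j' - 1"] by (cases j') (auto simp: T_crit T_b numeral_3_eq_3)
qed (simp add: T_crit)

end

section \<open>A contracted rotation\<close>

context tent_rot
begin

definition rho :: "int => int" where "rho i = (i * int m) mod int n"
text \<open>The ones of \<open>lam\<close> come in adjacent pairs, first a residue below
  \<open>m\<close>, then one between \<open>m\<close> and \<open>2 * m\<close>; this marks the
  second of each pair. By \<open>top_step\<close> it flips exactly at the ones, so it is the
  orientation with which a strand of the cycle is traversed.\<close>

definition top :: "int => bool" where "top i \<longleftrightarrow> int m \<le> rho i \<and> rho i < 2 * int m"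

lemma rho_range: "0 \<le> rho i" "rho i < int n" using n_pos by (auto simp: rho_def)

lemma lam_rho: "lam i \<longleftrightarrow> rho i < 2 * int m" by (simp add: lam_def rho_def)

lemma rho_Suc: "rho (i + 1) = (if rho i + int m < int n then rho i + int m else rho i + int m - int n)"
proof -
 have "(i + 1) * int m = i * int m + int m" by (simp add: algebra_simps)
 hence 1: "rho (i + 1) = (rho i + int m) mod int n" by (simp add: rho_def mod_add_left_eq)
 show ?thesis
 proof (cases "rho i + int m < int n")
  case True
  thus ?thesis using 1 rho_range(1)[of i] by simp
 next
  case False
  have "(rho i + int m) mod int n = (rho i + int m - int n) mod int n" by simp
  also have "\<dots> = rho i + int m - int n"
   using False rho_range(2)[of i] mn by (intro mod_pos_pos_trivial) auto
  finally show ?thesis using False 1 by simp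
 qed
qed

lemma top_Suc: "top (i + 1) \<longleftrightarrow> rho i < int m"
 using rho_Suc[of i] rho_range[of i] mn m_pos by (auto simp: top_def split: if_splits)

lemma top_lam: "top i ==> lam i" by (simp add: top_def lam_rho)

lemma top_step: "top (i + 1) \<longleftrightarrow> (top i ~= lam i)"
 using rho_range(1)[of i] m_pos by (auto simp: top_Suc) (auto simp: top_def lam_rho)

lemma rho_0_iff: "rho i = 0 \<longleftrightarrow> int n dvd i"
proof -
 have "rho i = 0 \<longleftrightarrow> int n dvd i * int m" by (simp add: rho_def dvd_eq_mod_eq_0)
 also have "\<dots> \<longleftrightarrow> int n dvd i" using co by (simp add: coprime_commute coprime_dvd_mult_left_iff)
 finally show ?thesis .
qed

definition sgn_top :: "int => real" where "sgn_top i = (if top i then - 1 else 1)"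

lemma funpow_T_Z: "(T ^^ k) (Z i) = Z (i - int k)"
proof (induction k)
 case (Suc k)
 thus ?case using T_Z[of "i - int k - 1"] by (simp add: algebra_simps)
qed simp

text \<open>Since \<open>top\<close> flips exactly at the ones, the sign of the slope along the
  cycle is a quotient of two values of \<open>sgn_top\<close>.\<close>

lemma sg_Z: "sg N (Z i) = sgn_top i * sgn_top (i - int N)"
proof (induction N arbitrary: i)
 case 0
 show ?case by (simp add: sgn_top_def)
next
 case (Suc N)
 have s1: "(1/2 < Z i) = lam (i - 1)" using Z_sym[of "i - 1"] by simp
 have s2: "top i = (top (i - 1) ~= lam (i - 1))" using top_step[of "i - 1"] by simp
 have "T (Z i) = Z (i - 1)" using T_Z[of "i - 1"] by simp
 hence "sg (Suc N) (Z i) = (if Z i \<le> 1/2 then 1 else - 1) * (sgn_top (i - 1) * sgn_top (i - 1 - int N))"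
  using Suc[of "i - 1"] by (simp add: sg_Suc)
 also have "\<dots> = sgn_top i * sgn_top (i - int (Suc N))"
  using s1 s2 by (auto simp: sgn_top_def algebra_simps)
 finally show ?case .
qed

lemma of_bool_mod_less:
 "(of_bool (x mod int n < 2 * int m) :: int) = x div int n - (x - 2 * int m) div int n"
proof -
 define r where "r = x mod int n"
 have x: "x - 2 * int m = (r - 2 * int m) + int n * (x div int n)" by (simp add: r_def)
 have r: "0 \<le> r" "r < int n" using n_pos by (auto simp: r_def)
 have 1: "(x - 2 * int m) div int n = (r - 2 * int m) div int n + x div int n"
  unfolding x using n_pos by simp
 have "(r - 2 * int m) div int n = (if r < 2 * int m then - 1 else 0)"
 proof (cases "r < 2 * int m")
  case True
  have "(r - 2 * int m) div int n = ((r - 2 * int m + int n) + int n * (- 1)) div int n" by simp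
  also have "\<dots> = (r - 2 * int m + int n) div int n - 1" using n_pos by simp
  also have "(r - 2 * int m + int n) div int n = 0" using True r mn by (intro div_pos_pos_trivial) auto
  finally show ?thesis using True by simp
 next
  case False
  thus ?thesis using r mn by simp
 qed
 thus ?thesis using 1 by (auto simp: r_def)
qed

text \<open>The indicator of an arc of length \<open>2 * m\<close> is a difference of two floors;
  along steps of length \<open>m\<close> these cancel with lag two, so two terms survive at each
  end.\<close>

lemma sum_symbols:
 "(\<Sum>k<N. of_bool ((e - (int k + 1) * int m) mod int n < 2 * int m)) =
  (e - int m) div int n + (e - 2 * int m) div int n
  - (e - (int N + 1) * int m) div int n - (e - (int N + 2) * int m) div int n"
proof (induction N)
 case (Suc N)
 have eq: "e - (int N + 1) * int m - 2 * int m = e - (int (Suc N) + 2) * int m" by (simp add: algebra_simps)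
 have "(of_bool ((e - (int N + 1) * int m) mod int n < 2 * int m) :: int)
   = (e - (int N + 1) * int m) div int n - (e - (int (Suc N) + 2) * int m) div int n"
  unfolding of_bool_mod_less by (simp only: eq)
 moreover have "(e - (int N + 2) * int m) div int n = (e - (int (Suc N) + 1) * int m) div int n"
  by (simp add: algebra_simps)
 ultimately show ?case using Suc by simp
qed simp

text \<open>Compare the forward itineraries at their first difference. The floor formula shows that
  up to there the orbit of \<open>Z i\<close> has met no more ones than that of \<open>Z 0\<close>,
  so \<open>Z i\<close> is the one with symbol 0. Neither \<open>i\<close> nor the index reached is
  \<open>top\<close>, so the orientation is positive and the order pulls back.\<close>

lemma Z_less:
 assumes "0 < rho i" "rho i < int m"
 shows "Z i < Z 0"
proof -
 define r where "r = rho i"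
 have lam0: "lam (- int k - 1) = ((0 - (int k + 1) * int m) mod int n < 2 * int m)" for k
 proof -
  have "(- int k - 1) * int m = 0 - (int k + 1) * int m" by (simp add: algebra_simps)
  thus ?thesis by (simp only: lam_def)
 qed
 have lami: "lam (i - int k - 1) = ((r - (int k + 1) * int m) mod int n < 2 * int m)" for k
 proof -
  have "(i - int k - 1) * int m = i * int m - (int k + 1) * int m" by (simp add: algebra_simps)
  thus ?thesis by (simp add: lam_def r_def rho_def mod_diff_left_eq)
 qed
 have "\<exists>k. lam (i - int k - 1) ~= lam (- int k - 1)"
 proof (rule ccontr)
  assume "\<not> ?thesis"
  hence eq: "lam (i - int k - 1) = lam (- int k - 1)" for k by simp
  have "lam (i + k) = lam k" if "k \<le> - 1" for k
   using eq[of "nat (- 1 - k)"] that by simp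
  hence "int n dvd i" by (rule lam_shift_imp_dvd)
  hence "rho i = 0" using rho_0_iff by blast
  thus False using assms by simp
 qed
 then obtain k where k: "lam (i - int k - 1) ~= lam (- int k - 1)"
  "\<And>j. j < k ==> lam (i - int j - 1) = lam (- int j - 1)"
  using exists_least_iff[of "%k. lam (i - int k - 1) ~= lam (- int k - 1)"] by auto
 have same: "sameit k (Z i) (Z 0)"
  unfolding sameit_def funpow_T_Z
 proof (intro allI impI)
  fix j assume "j < k"
  thus "(1/2 < Z (i - int j)) = (1/2 < Z (0 - int j))"
   using k(2)[of j] Z_sym[of "i - int j - 1"] Z_sym[of "- int j - 1"] by simp
 qed
 have not_lam: "\<not> lam (i - int k - 1)"
 proof
  assume li: "lam (i - int k - 1)"
  \<comment> \<open>The number of ones among the first \<open>N\<close> symbols of the rotation that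
    starts at residue \<open>e\<close>.\<close>
  define S where "S e N = (\<Sum>k<N. of_bool ((e - (int k + 1) * int m) mod int n < 2 * int m) :: int)" for e N
  have "S r k = S 0 k" unfolding S_def using k(2) lam0 lami by (intro sum.cong) auto
  hence lt: "S 0 (Suc k) < S r (Suc k)" using li k(1) lam0 lami by (simp add: S_def)
  have neg: "x div int n = - 1" if "- int n \<le> x" "x < 0" for x
  proof -
   have "x div int n = (x + int n) div int n - 1" using n_pos by simp
   also have "(x + int n) div int n = 0" using that by (intro div_pos_pos_trivial) auto
   finally show ?thesis by simp
  qed
  have "(0 - int m) div int n = - 1" "(0 - 2 * int m) div int n = - 1"
   "(r - int m) div int n = - 1" "(r - 2 * int m) div int n = - 1"
   using assms mn m_pos by (auto intro!: neg simp: r_def)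
  moreover have "(0 - (int (Suc k) + 1) * int m) div int n \<le> (r - (int (Suc k) + 1) * int m) div int n"
   "(0 - (int (Suc k) + 2) * int m) div int n \<le> (r - (int (Suc k) + 2) * int m) div int n"
   using assms n_pos by (auto intro!: zdiv_mono1 simp: r_def)
  ultimately have "S r (Suc k) \<le> S 0 (Suc k)" unfolding S_def sum_symbols by linarith
  thus False using lt by simp
 qed
 have "\<not> top (i - int k)" using top_Suc[of "i - int k - 1"] not_lam m_pos by (simp add: lam_rho)
 moreover have "\<not> top i" using assms by (simp add: top_def)
 ultimately have "sg k (Z 0) = 1" using sg_Z[of k i] sg_cong[OF same] by (simp add: sgn_top_def)
 hence "Z (i - int k) - Z (- int k) = s ^ k * (Z i - Z 0)"
  using T_diff[OF same] by (simp add: funpow_T_Z)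
 moreover have "Z (i - int k) - Z (- int k) < 0"
  using k(1) not_lam Z_sym[of "i - int k - 1"] Z_sym[of "- int k - 1"] by simp
 ultimately show ?thesis using s_pos by (simp add: mult_less_0_iff)
qed

lemma Z_le: "rho i < int m ==> Z i \<le> Z 0"
proof (cases "rho i = 0")
 case True
 then obtain j where "i = int n * j" using rho_0_iff by (auto elim: dvdE)
 thus ?thesis using Z_period[of 0 j] by simp
next
 case False
 thus "rho i < int m ==> ?thesis" using Z_less[of i] rho_range(1)[of i] by simp
qed

section \<open>Positions on the outer boundary\<close>

definition ell :: real where "ell = 2 * (b - a)"
definition kap :: real where "kap = s * a + 1 - 3 * a"

lemma a_div_s: "a / s = 1 - b" using s_pos by (simp add: a_def b_def)

lemma ell_div_s: "ell / s = 2 * b - 1"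
proof -
 have "ell / s = 2 * (b / s) - 2 * (a / s)" by (simp add: ell_def diff_divide_distrib)
 moreover have "b / s = 1/2" using s_pos by (simp add: b_def)
 ultimately show ?thesis using a_div_s by simp
qed

text \<open>Positions of the orbit points. Deciding by \<open>lam\<close> instead of comparing with
  \<open>s * a\<close> gives the orbit point over \<open>s * a\<close> the value 0, whereas
  \<open>th\<close> gives the bottom point there the value \<open>ell\<close>; hence every value of
  \<open>th\<close> has an orbit position strictly below it.\<close>

definition thP :: "int => real" where
 "thP i = (if top i then s * a - 2 * a + Z i
      else if lam i then s * a - Z i else s * a + ell - Z i)"

text \<open>The boundary circle is cut at the bottom over \<open>s * a\<close>. It then runs along
  the bottom left to \<open>a\<close>, along the top from \<open>a\<close> to \<open>b\<close>, and
  along the bottom from \<open>b\<close> back to \<open>s * a\<close>. Symbol 1 is used on the first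
  two pieces and symbol 0 on the third.\<close>

definition th :: "bool => real => real" where
 "th st y = (if st then s * a - 2 * a + y
       else if y < s * a then s * a - y else s * a + ell - y)"

lemma lam_not_top: "lam i ==> \<not> top i ==> Z i \<le> s * a"
 using Z_le[of i] by (auto simp: top_def lam_rho Z_0)

lemma not_lam_gt: "\<not> lam i ==> s * a < Z i"
 using Z_gt_if_not_lam[of i] by (simp add: Z_0)

lemma thP_range: "0 \<le> thP i" "thP i < ell"
 using Z_range[of i] lam_not_top[of i] not_lam_gt[of i] a_lt_sa sa_le_b
 by (auto simp: thP_def ell_def)

text \<open>Each of the three boundary pieces is contracted affinely by an inverse branch; the
  coordinates are chosen so that these three maps become one contraction, up to the full turn made
  on landing in the first piece.\<close>

lemma thP_Suc: "thP (i + 1) = thP i / s + kap - (if rho (i + 1) < int m then ell else 0)"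
proof -
 have e1: "(s * a - 2 * a + Z i) / s = a - 2 * (1 - b) + Z i / s"
  "(s * a - Z i) / s = a - Z i / s" "(s * a + ell - Z i) / s = a + (2 * b - 1) - Z i / s"
  using s_pos a_div_s ell_div_s by (simp_all add: add_divide_distrib diff_divide_distrib)
 have lt: "rho (i + 1) < int m \<longleftrightarrow> lam (i + 1) \<and> \<not> top (i + 1)"
  using m_pos by (auto simp: lam_rho top_def)
 have br: "Z (i + 1) = (if lam i then 1 - Z i / s else Z i / s)" using Z_br[of i] by (simp add: br_def)
 consider "top i" "lam i" "\<not> top (i + 1)" | "\<not> top i" "lam i" "top (i + 1)"
  | "\<not> top i" "\<not> lam i" "\<not> top (i + 1)"
  using top_step[of i] top_lam[of i] by blast
 thus ?thesis
  by cases (use br lt e1 in \<open>auto simp: thP_def kap_def ell_def algebra_simps\<close>)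
qed

lemma thP_0: "thP 0 = 0"
 using m_pos by (simp add: thP_def top_def rho_def lam_def Z_0)

lemma thP_period: "thP (i + int n * j) = thP i"
proof -
 have "(i + int n * j) * int m = i * int m + int n * (j * int m)" by (simp add: algebra_simps)
 hence "rho (i + int n * j) = rho i" by (simp add: rho_def)
 thus ?thesis by (simp add: thP_def top_def lam_period Z_period)
qed

lemma finite_range_thP: "finite (range thP)"
proof -
 have "range thP \<subseteq> thP ` {0..<int n}"
 proof
  fix x assume "x \<in> range thP"
  then obtain i where i: "x = thP i" by auto
  have "thP i = thP (i mod int n + int n * (i div int n))" by simp
  hence "x = thP (i mod int n)" unfolding thP_period using i by simp
  moreover have "i mod int n \<in> {0..<int n}" using n_pos by simp
  ultimately show "x \<in> thP ` {0..<int n}" by blast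
 qed
 thus ?thesis by (rule finite_subset) simp
qed

lemma thP_lam: "lam i ==> thP i < s * a - 2 * a + b" "\<not> lam i ==> s * a - 2 * a + b < thP i"
 using Z_range[of i] top_lam[of i] ab by (auto simp: thP_def ell_def)

text \<open>The contracted circle has length \<open>ell / s\<close>, so its image under the rotation
  leaves out an arc of length \<open>1 - 2 * a\<close>. That arc is the top over the points from
  \<open>a\<close> to \<open>1 - a\<close>.\<close>

lemma thP_gap: "thP i < s * a - a \<or> kap \<le> thP i"
proof -
 have "thP i = thP (i - 1) / s + kap - (if rho i < int m then ell else 0)"
  using thP_Suc[of "i - 1"] by simp
 moreover have "0 \<le> thP (i - 1) / s" "thP (i - 1) / s < ell / s"
  using thP_range[of "i - 1"] s_pos by (auto intro: divide_strict_right_mono)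
 ultimately show ?thesis using ell_div_s by (auto simp: kap_def ell_def)
qed

text \<open>The state \<open>True\<close> means that the strand is followed as the topmost one above its point,
 \<open>False\<close> that it is the bottommost one; the position \<open>th\<close> parametrizes the outer boundary.\<close>

definition run :: "(nat => real) => (nat => bool) => (nat => bool) => bool" where
 "run y l st \<longleftrightarrow> (\<forall>k. a \<le> y k \<and> y k \<le> b \<and> y (Suc k) = br (l k) (y k) \<and> st (Suc k) = (st k ~= l k)
   \<and> l k = (st k \<or> y k < s * a))"

lemma th_range: assumes "a \<le> y" "y \<le> b" shows "0 < th st y" "th st y \<le> ell"
 using assms a_lt_sa sa_le_b by (auto simp: th_def ell_def)

lemma run_range: assumes "run y l st" shows "a \<le> y k" "y k \<le> b"
 using assms by (auto simp: run_def)

lemma th_step: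
 assumes "run y l st"
 shows "th (st (Suc k)) (y (Suc k)) = th (st k) (y k) / s + kap
  - (if \<not> st (Suc k) \<and> y (Suc k) < s * a then ell else 0)"
proof -
 have e1: "(s * a - 2 * a + y k) / s = a - 2 * (1 - b) + y k / s"
  "(s * a - y k) / s = a - y k / s" "(s * a + ell - y k) / s = a + (2 * b - 1) - y k / s"
  using s_pos a_div_s ell_div_s by (simp_all add: add_divide_distrib diff_divide_distrib)
 have r: "y (Suc k) = (if l k then 1 - y k / s else y k / s)" "st (Suc k) = (st k ~= l k)"
  "l k = (st k \<or> y k < s * a)"
  using assms by (auto simp: run_def br_def)
 show ?thesis
  using r e1 by (auto simp: th_def kap_def ell_def algebra_simps)
qed

text \<open>The companion of a position is the orbit position directly below it. If only one of the
  two made a full turn, the position that maps to the cut would lie between them; but it is the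
  orbit position \<open>thP (- 1)\<close>, because \<open>thP 0 = 0\<close>. So both turn together,
  and their distance is divided by \<open>s\<close>.\<close>

lemma companion_step:
 assumes r: "run y l st" and lt: "thP i < th (st k) (y k)"
  and no: "\<And>j. \<not> (thP i < thP j \<and> thP j < th (st k) (y k))"
 shows "th (st (Suc k)) (y (Suc k)) - thP (i + 1) = (th (st k) (y k) - thP i) / s"
  and "\<not> (thP (i + 1) < thP j \<and> thP j < th (st (Suc k)) (y (Suc k)))"
proof -
 define x x' where "x = th (st k) (y k)" and "x' = th (st (Suc k)) (y (Suc k))"
 define w v where "w = (if \<not> st (Suc k) \<and> y (Suc k) < s * a then ell else 0)"
  and "v = (%i. if rho (i + 1) < int m then ell else 0)"
 have x: "0 < x" "x \<le> ell" "0 < x'" "x' \<le> ell"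
  using th_range[OF run_range[OF r]] by (simp_all add: x_def x'_def)
 have x': "x' = x / s + kap - w" using th_step[OF r, of k] by (simp add: x_def x'_def w_def)
 have p: "thP (j + 1) = thP j / s + kap - v j" for j using thP_Suc[of j] by (simp add: v_def)
 have vw: "v j = 0 \<or> v j = ell" "w = 0 \<or> w = ell" for j by (auto simp: v_def w_def)
 have el: "0 < ell" using ab by (simp add: ell_def)
 have mono: "u < u' ==> u / s < u' / s" for u u' using s_pos by (rule divide_strict_right_mono[rotated])
 have kle: "ell / s + kap - ell < kap" "ell / s + kap - ell = s * a - a"
  using ell_div_s a_lt by (auto simp: kap_def ell_def)
 have wv: "w = v i"
 proof (rule ccontr)
  assume "w ~= v i"
  then consider "w = 0" "v i = ell" | "w = ell" "v i = 0" using vw by metis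
  thus False
  proof cases
   case 1
   hence "ell \<le> thP i / s + kap" using p[of i] thP_range(1)[of "i + 1"] by simp
   moreover have "thP i / s < x / s" using lt by (intro mono) (simp add: x_def)
   ultimately show False using x' x 1 by simp
  next
   case 2
   have "v (- 1) = ell" using m_pos by (simp add: v_def rho_def)
   hence q: "thP (- 1) / s + kap = ell" using p[of "- 1"] thP_0 by simp
   have "ell < x / s + kap" "thP i / s + kap < ell"
    using 2 x' x p[of i] thP_range(2)[of "i + 1"] by auto
   hence "thP (- 1) / s < x / s" "thP i / s < thP (- 1) / s" using q by auto
   hence "thP i < thP (- 1) \<and> thP (- 1) < x" using s_pos by (simp add: divide_less_cancel)
   thus False using no by (simp add: x_def)
  qed
 qed
 show "th (st (Suc k)) (y (Suc k)) - thP (i + 1) = (th (st k) (y k) - thP i) / s"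
  using x' p[of i] wv by (simp add: x_def x'_def diff_divide_distrib)
 show "\<not> (thP (i + 1) < thP j \<and> thP j < th (st (Suc k)) (y (Suc k)))"
 proof
  assume j: "thP (i + 1) < thP j \<and> thP j < th (st (Suc k)) (y (Suc k))"
  have pj: "thP j = thP (j - 1) / s + kap - v (j - 1)" using p[of "j - 1"] by simp
  have pos: "0 \<le> thP i / s" "0 \<le> thP (j - 1) / s" "thP (j - 1) / s < ell / s" "x / s \<le> ell / s"
   using thP_range x s_pos by (auto intro: divide_strict_right_mono divide_right_mono)
  consider "v (j - 1) = v i" | "v (j - 1) = ell" "v i = 0" | "v (j - 1) = 0" "v i = ell"
   using vw by metis
  thus False
  proof cases
   case 1
   hence "thP i / s < thP (j - 1) / s" "thP (j - 1) / s < x / s"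
    using j pj p[of i] x' wv by (auto simp: x'_def)
   hence "thP i < thP (j - 1) \<and> thP (j - 1) < x" using s_pos by (simp add: divide_less_cancel)
   thus False using no by (simp add: x_def)
  next
   case 2
   thus False using j pj p[of i] pos kle by linarith
  next
   case 3
   thus False using j pj x' wv pos kle by (simp add: x'_def)
  qed
 qed
qed

text \<open>The symbol depends only on the side of one threshold. The finitely many orbit positions
  keep a positive distance from it, so once the position is closer than that to its companion, both
  read the same symbols.\<close>

lemma companion_tail:
 assumes r: "run y l st" and lt: "thP i < th (st 0) (y 0)"
  and no: "\<And>j. \<not> (thP i < thP j \<and> thP j < th (st 0) (y 0))"
 shows "\<exists>k0. \<forall>k\<ge>k0. l k = lam (i + int k)"
proof -
 define d where "d = th (st 0) (y 0) - thP i"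
 have d: "0 < d" using lt by (simp add: d_def)
 have main: "th (st k) (y k) - thP (i + int k) = d / s ^ k \<and>
   (\<forall>j. \<not> (thP (i + int k) < thP j \<and> thP j < th (st k) (y k)))" for k
 proof (induction k)
  case (Suc k)
  have "0 < d / s ^ k" using d s_pos by simp
  hence l: "thP (i + int k) < th (st k) (y k)" using Suc by linarith
  note c = companion_step[OF r l]
  have "i + int k + 1 = i + int (Suc k)" by simp
  thus ?case using c Suc by (simp add: field_simps)
 qed (use no in \<open>simp add: d_def\<close>)
 \<comment> \<open>The position of the right end \<open>b\<close>, where the symbol changes from 1
   to 0.\<close>
 define tc where "tc = s * a - 2 * a + b"
 obtain e where e: "0 < e" "\<And>j. e \<le> \<bar>thP j - tc\<bar>"
 proof -
  have fin: "finite ((%x. \<bar>x - tc\<bar>) ` range thP)" using finite_range_thP by simp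
  have "0 < Min ((%x. \<bar>x - tc\<bar>) ` range thP)"
  proof (subst Min_gr_iff[OF fin])
   show "\<forall>x\<in>(%x. \<bar>x - tc\<bar>) ` range thP. 0 < x"
   proof
    fix x assume "x \<in> (%x. \<bar>x - tc\<bar>) ` range thP"
    then obtain j where "x = \<bar>thP j - tc\<bar>" by auto
    thus "0 < x" using thP_lam[of j] by (cases "lam j") (auto simp: tc_def)
   qed
  qed simp
  moreover have "Min ((%x. \<bar>x - tc\<bar>) ` range thP) \<le> \<bar>thP j - tc\<bar>" for j
   using fin by (intro Min_le) auto
  ultimately show ?thesis using that by blast
 qed
 obtain k0 where k0: "d / e < s ^ k0" using real_arch_pow[OF s_gt1] by blast
 have "l k = lam (i + int k)" if "k0 \<le> k" for k
 proof -
  have "s ^ k0 \<le> s ^ k" using that s_gt1 by (intro power_increasing) auto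
  hence "d / s ^ k < e" using k0 e s_pos by (simp add: field_simps) (metis mult.commute mult_le_cancel_left_pos order_less_le_trans)
  hence lt: "0 < th (st k) (y k) - thP (i + int k)" "th (st k) (y k) - thP (i + int k) < e"
   using main[of k] d s_pos by auto
  have yk: "l k = (st k \<or> y k < s * a)" "y k \<le> b" "a \<le> y k" using r by (auto simp: run_def)
  have "l k ==> th (st k) (y k) \<le> tc" "\<not> l k ==> tc \<le> th (st k) (y k)"
   using yk ab by (auto simp: th_def tc_def ell_def)
  moreover have "lam (i + int k) ==> thP (i + int k) \<le> tc - e"
   "\<not> lam (i + int k) ==> tc + e \<le> thP (i + int k)"
   using thP_lam[of "i + int k"] e(2)[of "i + int k"] by (auto simp: tc_def)
  ultimately show ?thesis using lt by linarith
 qed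
 thus ?thesis by blast
qed

lemma companion_exists:
 assumes "0 < x"
 shows "\<exists>i. thP i < x \<and> (\<forall>j. \<not> (thP i < thP j \<and> thP j < x))"
proof -
 define A where "A = {t \<in> range thP. t < x}"
 have "finite A" "A ~= {}" using finite_range_thP thP_0 assms by (auto simp: A_def) (metis rangeI)
 hence "Max A \<in> A" "\<And>t. t \<in> A ==> t \<le> Max A" by auto
 then obtain i where "Max A = thP i" "thP i < x" by (auto simp: A_def)
 thus ?thesis using \<open>\<And>t. t \<in> A ==> t \<le> Max A\<close> by (intro exI[of _ i]) (force simp: A_def)
qed

lemma run_tail:
 assumes "run y l st"
 shows "\<exists>i k0. \<forall>k\<ge>k0. l k = lam (i + int k)"
proof -
 have "0 < th (st 0) (y 0)" using assms th_range by (auto simp: run_def)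
 thus ?thesis using companion_exists companion_tail[OF assms] by meson
qed

text \<open>Both positions start in the arc that contains no orbit positions, so they share their
  companion.\<close>

lemma run_tail_eq:
 assumes "run y l st" "run y' l' st'" "st 0" "st' 0" "y 0 \<le> 1 - a" "y' 0 \<le> 1 - a"
 shows "\<exists>k0. \<forall>k\<ge>k0. l k = l' k"
proof -
 have r: "s * a - a \<le> th (st 0) (y 0)" "th (st 0) (y 0) \<le> kap"
  "s * a - a \<le> th (st' 0) (y' 0)" "th (st' 0) (y' 0) \<le> kap"
  using assms by (auto simp: run_def th_def kap_def)
 have "0 < th (st 0) (y 0)" using r a_lt_sa by linarith
 then obtain i where i: "thP i < th (st 0) (y 0)" "\<And>j. \<not> (thP i < thP j \<and> thP j < th (st 0) (y 0))"
  using companion_exists by meson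
 have "thP i < th (st' 0) (y' 0)" using i(1) thP_gap[of i] r by linarith
 moreover have "\<not> (thP i < thP j \<and> thP j < th (st' 0) (y' 0))" for j
  using i(2)[of j] thP_gap[of j] r by linarith
 ultimately obtain k1 where "\<forall>k\<ge>k1. l' k = lam (i + int k)" using companion_tail[OF assms(2)] by meson
 moreover obtain k0 where "\<forall>k\<ge>k0. l k = lam (i + int k)" using companion_tail[OF assms(1)] i by meson
 ultimately show ?thesis by (intro exI[of _ "max k0 k1"]) auto
qed

end

section \<open>Heights\<close>

text \<open>The two branches of the middle-third Cantor set, the upper one reversed because the tent
  map folds. By \<open>psi0_rec\<close> the height of a code is its address under these
  branches.\<close>

definition H :: "bool => real => real" where
 "H e y = (if e then 1 - y / 3 else y / 3)"

lemma H_range: assumes "0 \<le> y" "y \<le> 1" shows "0 \<le> H e y" "H e y \<le> 1"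
 using assms by (auto simp: H_def)

lemma H_diff: "H e x - H e y = (if e then - 1 else 1) * (x - y) / 3"
 by (simp add: H_def field_simps)

lemma H_eq_iff:
 assumes "0 \<le> x" "x \<le> 1" "0 \<le> y" "y \<le> 1"
 shows "H e x = H e' y \<longleftrightarrow> e = e' \<and> x = y"
 using assms by (auto simp: H_def split: if_splits)

abbreviation (input) shift :: "nat => (nat => bool) => nat => bool" where
 "shift N l \<equiv> (%k. l (k + N))"

abbreviation psi0 :: "(nat => bool) => real" where "psi0 \<equiv> psi L_ray"

definition parity_sign :: "(nat => bool) => nat => real" where
 "parity_sign l k = (\<Prod>j<k. if l j then - 1 else 1)"

lemma abs_parity_sign [simp]: "\<bar>parity_sign l k\<bar> = 1"
 by (simp add: parity_sign_def abs_prod if_distrib[of abs] cong: if_cong)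

lemma parity_sign_ones: "parity_sign l k = (- 1) ^ ones (initial l k)"
 by (induction k) (auto simp: parity_sign_def ones_def initial_def)

lemma ones_initial_L_ray: "ones (initial L_ray (Suc i)) = 1"
 by (induction i) (auto simp: ones_def initial_def L_ray_def)

lemma summable_parity: "summable (%i. parity_sign l (Suc i) / 3 ^ Suc i)"
proof (rule summable_comparison_test)
 show "\<exists>N. \<forall>i\<ge>N. norm (parity_sign l (Suc i) / 3 ^ Suc i) \<le> (1 / 3) ^ i"
  by (auto simp: field_simps)
 show "summable (%i. (1 / 3 :: real) ^ i)" by (rule summable_geometric) simp
qed

text \<open>Every nonempty initial word of \<open>L_ray\<close> contains exactly one 1, so the
  reference code contributes only a global sign.\<close>

lemma psi0_eq: "psi0 l = 1/2 - (\<Sum>i. parity_sign l (Suc i) / 3 ^ Suc i)"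
proof -
 have "(- 1 :: real) powi (int (ones (initial L_ray (Suc i))) - int (ones (initial l (Suc i)))) / 3 ^ Suc i
   = - (parity_sign l (Suc i) / 3 ^ Suc i)" for i
 proof -
  have "(- 1 :: real) powi (1 - int k) = - ((- 1) ^ k)" for k
   by (cases "even k") (simp_all add: power_int_diff)
  thus ?thesis unfolding ones_initial_L_ray parity_sign_ones by simp
 qed
 thus ?thesis
  unfolding psi_def by (simp only: suminf_minus[OF summable_parity])
qed

lemma psi0_rec: "psi0 l = H (l 0) (psi0 (shift 1 l))"
proof -
 define e :: real where "e = (if l 0 then - 1 else 1)"
 have 1: "parity_sign l (Suc k) = e * parity_sign (shift 1 l) k" for k
  by (simp add: parity_sign_def prod.lessThan_Suc_shift e_def del: prod.lessThan_Suc)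
 have "(\<Sum>i. parity_sign l (Suc i) / 3 ^ Suc i)
   = parity_sign l 1 / 3 + (\<Sum>i. parity_sign l (Suc (Suc i)) / 3 ^ Suc (Suc i))"
  using suminf_split_head[OF summable_parity[of l]] by simp
 also have "(\<Sum>i. parity_sign l (Suc (Suc i)) / 3 ^ Suc (Suc i))
   = (\<Sum>i. (e / 3) * (parity_sign (shift 1 l) (Suc i) / 3 ^ Suc i))"
  using 1 by (intro suminf_cong) simp
 also have "\<dots> = (e / 3) * (\<Sum>i. parity_sign (shift 1 l) (Suc i) / 3 ^ Suc i)"
  by (rule suminf_mult[OF summable_parity])
 also have "(\<Sum>i. parity_sign (shift 1 l) (Suc i) / 3 ^ Suc i) = 1/2 - psi0 (shift 1 l)"
  by (simp add: psi0_eq)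
 also have "parity_sign l 1 = e" by (simp add: parity_sign_def e_def)
 finally have "psi0 l = 1/2 - (e / 3 + e / 3 * (1/2 - psi0 (shift 1 l)))" by (simp add: psi0_eq)
 thus ?thesis by (cases "l 0") (simp_all add: H_def e_def field_simps)
qed

lemma psi0_range: "0 \<le> psi0 l" "psi0 l \<le> 1"
proof -
 have s: "(%i. (1 / 3 :: real) ^ i) sums (3 / 2)" using geometric_sums[of "1 / 3 :: real"] by simp
 have "(%i. 1 / 3 * (1 / 3 :: real) ^ i) sums (1 / 3 * (3 / 2))" by (rule sums_mult[OF s])
 hence s: "(%i. 1 / 3 ^ Suc i :: real) sums (1 / 2)" by (simp add: power_one_over field_simps)
 have eq: "norm (parity_sign l (Suc i) / 3 ^ Suc i) = 1 / 3 ^ Suc i" for i by (simp add: abs_mult)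
 have "summable (%i. norm (parity_sign l (Suc i) / 3 ^ Suc i))"
  unfolding eq using s sums_summable by blast
 hence "norm (\<Sum>i. parity_sign l (Suc i) / 3 ^ Suc i) \<le> (\<Sum>i. norm (parity_sign l (Suc i) / 3 ^ Suc i))"
  by (rule summable_norm)
 also have "\<dots> = 1 / 2" unfolding eq using s sums_unique by metis
 finally show "0 \<le> psi0 l" "psi0 l \<le> 1" by (auto simp: psi0_eq abs_le_iff)
qed

primrec hg :: "(nat => bool) => nat => real => real" where
 "hg l 0 y = y"
| "hg l (Suc N) y = hg l N (H (l N) y)"

lemma psi0_hg: "psi0 l = hg l N (psi0 (shift N l))"
proof (induction N)
 case (Suc N)
 thus ?case using psi0_rec[of "shift N l"] by simp
qed simp

lemma hg_diff: "hg l N x - hg l N y = parity_sign l N * (x - y) / 3 ^ N"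
proof (induction N arbitrary: x y)
 case (Suc N)
 thus ?case by (simp add: H_diff parity_sign_def)
qed (simp add: parity_sign_def)

lemma hg_cong: "(\<And>k. k < N ==> l k = l' k) ==> hg l N y = hg l' N y"
 by (induction N arbitrary: y) auto

lemma psi0_close:
 assumes "\<And>k. k < N ==> l k = l' k"
 shows "\<bar>psi0 l - psi0 l'\<bar> \<le> 1 / 3 ^ N"
proof -
 have "psi0 l - psi0 l' = hg l N (psi0 (shift N l)) - hg l N (psi0 (shift N l'))"
  using psi0_hg[of l N] psi0_hg[of l' N] hg_cong[of N l l'] assms by simp
 also have "\<bar>\<dots>\<bar> = \<bar>psi0 (shift N l) - psi0 (shift N l')\<bar> / 3 ^ N"
  by (simp add: hg_diff abs_mult)
 also have "\<dots> \<le> 1 / 3 ^ N"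
  using psi0_range[of "shift N l"] psi0_range[of "shift N l'"] by (intro divide_right_mono) auto
 finally show ?thesis .
qed

lemma hg_eq_imp:
 assumes "hg l N x = hg l' N y" "0 \<le> x" "x \<le> 1" "0 \<le> y" "y \<le> 1"
 shows "(\<forall>k<N. l k = l' k) \<and> x = y"
 using assms
proof (induction N arbitrary: x y)
 case (Suc N)
 have eq: "hg l N (H (l N) x) = hg l' N (H (l' N) y)" using Suc.prems(1) by (simp only: hg.simps)
 have 1: "\<forall>k<N. l k = l' k" "H (l N) x = H (l' N) y"
  using Suc.IH[OF eq H_range H_range] Suc.prems(2-) by blast+
 have 2: "l N = l' N \<and> x = y" by (rule iffD1[OF H_eq_iff[OF Suc.prems(2-)] 1(2)])
 show ?case
 proof (intro conjI allI impI)
  fix k assume "k < Suc N"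
  thus "l k = l' k" using 1(1) 2 by (cases "k = N") simp_all
 qed (use 2 in simp)
qed simp

lemma psi0_inj: "psi0 l = psi0 l' \<longleftrightarrow> l = l'"
proof
 assume eq: "psi0 l = psi0 l'"
 show "l = l'"
 proof
  fix k
  have "hg l (Suc k) (psi0 (shift (Suc k) l)) = hg l' (Suc k) (psi0 (shift (Suc k) l'))"
   using eq psi0_hg[of l "Suc k"] psi0_hg[of l' "Suc k"] by simp
  from hg_eq_imp[OF this psi0_range psi0_range] show "l k = l' k" by simp
 qed
qed simp

section \<open>Drawing the strands of a level\<close>

context tent_rot
begin

primrec bk :: "real => (nat => bool) => nat => real" where
 "bk y l 0 = y"
| "bk y l (Suc k) = br (l k) (bk y l k)"

text \<open>Only zeros impose a condition: the branch for 1 maps all of the core interval into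
  itself, while the branch for 0 leaves it when applied below \<open>s * a\<close>.\<close>

definition Adm :: "real => (nat => bool) => bool" where
 "Adm y l \<longleftrightarrow> a \<le> y \<and> y \<le> b \<and> (\<forall>k. \<not> l k --> s * a \<le> bk y l k)"

lemma bk_shift: "bk y l (k + N) = bk (bk y l N) (shift N l) k"
 by (induction k) auto

lemma Adm_range: assumes "Adm y l" shows "a \<le> bk y l k" "bk y l k \<le> b"
proof -
 have "a \<le> bk y l k \<and> bk y l k \<le> b"
 proof (induction k)
  case (Suc k)
  show ?case
  proof (cases "l k")
   case True
   thus ?thesis using Suc br_True_range[of "bk y l k"] a_lt by auto
  next
   case False
   hence "s * a \<le> bk y l k" using assms by (simp add: Adm_def)
   thus ?thesis using False Suc br_False_range[of "bk y l k"] b_gt by auto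
  qed
 qed (use assms in \<open>simp add: Adm_def\<close>)
 thus "a \<le> bk y l k" "bk y l k \<le> b" by auto
qed

lemma Adm_bk: "Adm y l ==> Adm (bk y l N) (shift N l)"
 using Adm_range[of y l N] by (auto simp: Adm_def bk_shift[symmetric])

lemma T_bk: "Adm y l ==> T (bk y l (Suc k)) = bk y l k"
 using Adm_range(2)[of y l k] by (simp add: T_br)

lemma funpow_T_bk: "Adm y l ==> (T ^^ k) (bk y l (k + j)) = bk y l j"
proof (induction k)
 case (Suc k)
 thus ?case using T_bk[OF Suc.prems, of "k + j"] by (simp add: funpow_swap1 del: bk.simps)
qed simp

lemma bk_sym: assumes "Adm y l" "bk y l (Suc k) ~= 1/2" shows "1/2 < bk y l (Suc k) \<longleftrightarrow> l k"
proof -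
 have "bk y l k \<le> b" "a \<le> bk y l k" using Adm_range[OF assms(1)] by auto
 moreover have "\<not> l k ==> s * a \<le> bk y l k" using assms(1) by (simp add: Adm_def)
 ultimately show ?thesis
  using assms(2) br_True_range[of "bk y l k"] br_False_range[of "bk y l k"] by (cases "l k") auto
qed

lemma Adm_cons: assumes "Adm y' l" "y' ~= 1/2" "e = (1/2 < y')"
 shows "Adm (T y') (case_nat e l)" and "bk (T y') (case_nat e l) (Suc k) = bk y' l k"
proof -
 have y': "br e (T y') = y'" using br_T[of y' e] assms by simp
 show bk: "bk (T y') (case_nat e l) (Suc k) = bk y' l k" for k
  by (induction k) (use y' in auto)
 have r: "a \<le> y'" "y' \<le> b" using assms by (auto simp: Adm_def)
 have "s * a \<le> T y'" if "\<not> e" using that assms r s_pos by (simp add: T_left)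
 hence "\<not> (case_nat e l) k --> s * a \<le> bk (T y') (case_nat e l) k" for k
  using bk assms(1) by (cases k) (auto simp: Adm_def)
 thus "Adm (T y') (case_nat e l)" using T_range[OF r] by (simp add: Adm_def)
qed

lemma Adm_cons_crit: assumes "Adm (1/2) l"
 shows "Adm b (case_nat e l)" and "bk b (case_nat e l) (Suc k) = bk (1/2) l k"
proof -
 show bk: "bk b (case_nat e l) (Suc k) = bk (1/2) l k" for k
  by (induction k) (auto simp: br_b)
 have "\<not> (case_nat e l) k --> s * a \<le> bk b (case_nat e l) k" for k
  using bk assms(1) sa_le_b by (cases k) (auto simp: Adm_def)
 thus "Adm b (case_nat e l)" using ab by (simp add: Adm_def)
qed

section \<open>Levels, folds and semicircles\<close>

primrec vh :: "nat => real => real => real" where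
 "vh 0 y h = h"
| "vh (Suc N) y h = vh N (T y) (H (1/2 < y) h)"

lemma vh_range: assumes "0 \<le> h" "h \<le> 1" shows "0 \<le> vh N y h" "vh N y h \<le> 1"
proof -
 have "0 \<le> vh N y h \<and> vh N y h \<le> 1" using assms
  by (induction N arbitrary: y h) (simp_all add: H_range)
 thus "0 \<le> vh N y h" "vh N y h \<le> 1" by auto
qed

lemma vh_add: "vh (M + N) y h = vh N ((T ^^ M) y) (vh M y h)"
 by (induction M arbitrary: y h) (simp_all add: funpow_swap1)

lemma vh_Suc_right: "vh (Suc k) y h = H (1/2 < (T ^^ k) y) (vh k y h)"
 using vh_add[of k 1 y h] by simp

lemma vh_diff: "vh N y h - vh N y h' = sg N y * (h - h') / 3 ^ N"
 by (induction N arbitrary: y h h') (auto simp: sg_Suc H_diff)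

lemma vh_cong: "sameit N x y ==> vh N x h = vh N y h"
 by (induction N arbitrary: x y h) (auto simp: sameit_Suc)

lemma vh_eq_imp:
 assumes "vh N x h = vh N y h'" "0 \<le> h" "h \<le> 1" "0 \<le> h'" "h' \<le> 1"
 shows "sameit N x y \<and> h = h'"
 using assms
proof (induction N arbitrary: x y h h')
 case (Suc N)
 have eq: "vh N (T x) (H (1/2 < x) h) = vh N (T y) (H (1/2 < y) h')"
  using Suc.prems(1) by (simp only: vh.simps)
 have 1: "sameit N (T x) (T y)" "H (1/2 < x) h = H (1/2 < y) h'"
  using Suc.IH[OF eq H_range H_range] Suc.prems(2-) by blast+
 have "(1/2 < x) = (1/2 < y) \<and> h = h'"
  by (rule iffD1[OF H_eq_iff[OF Suc.prems(2-)] 1(2)])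
 thus ?case using 1(1) by (simp only: sameit_Suc)
qed simp

definition pc :: "nat => real" where "pc j = (T ^^ j) b"
definition qc :: "nat => real" where "qc j = vh j b (1/2)"
definition ec :: "nat => real" where "ec j = sg j b"

text \<open>The semicircle at the fold over \<open>b\<close>, carried along for \<open>j\<close>
  steps: its centre follows the orbit of \<open>b\<close>, the vertical scale shrinks by
  \<open>3 ^ j\<close>, and \<open>ec j\<close> tells whether it has been turned from the right to
  the left.\<close>

definition cap :: "nat => real => (real \<times> real) set" where
 "cap j r = {(u, v). (u - pc j)\<^sup>2 + (v - qc j)\<^sup>2 = (r / 3 ^ j)\<^sup>2 \<and> 0 \<le> ec j * (u - pc j)}"

text \<open>The trace, at level zero, of a point seen at level \<open>N\<close>. Over 1/2 the two
  symbols give the heights 1/2 plus and minus \<open>1/2 - h / 3\<close>, and the whole semicircle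
  with this radius stands for the one point.\<close>

primrec dr :: "nat => real => real => (real \<times> real) set" where
 "dr 0 y h = {(y, h)}"
| "dr (Suc N) y h = (if y = 1/2 then cap N (1/2 - h / 3) else dr N (T y) (H (1/2 < y) h))"

lemma pc_neq_crit: "(T ^^ j) b ~= 1/2"
 using nonper[of "Suc j"] by (simp add: funpow_swap1 T_crit)

lemma pc_less_b: "0 < j ==> (T ^^ j) b < b"
proof -
 assume "0 < j"
 then obtain i where i: "j = Suc i" by (cases j) auto
 have "(T ^^ j) b \<le> b" using funpow_range[of b j] ab by simp
 moreover have "(T ^^ j) b ~= b"
  using T_eq_b_iff[of "(T ^^ i) b"] pc_neq_crit[of i] i by simp
 ultimately show ?thesis by simp
qed

lemma dr_split: "(\<And>k. k < K ==> (T ^^ k) y ~= 1/2) ==> dr (K + N) y h = dr N ((T ^^ K) y) (vh K y h)"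
proof (induction K arbitrary: y h)
 case (Suc K)
 have "y ~= 1/2" using Suc.prems[of 0] by simp
 moreover have "(T ^^ k) (T y) ~= 1/2" if "k < K" for k
  using Suc.prems[of "Suc k"] that by (simp add: funpow_swap1)
 ultimately show ?case using Suc.IH[of "T y"] by (simp add: funpow_swap1)
qed simp

lemma dr_nocrit: "(\<And>k. k < N ==> (T ^^ k) y ~= 1/2) ==> dr N y h = {((T ^^ N) y, vh N y h)}"
 using dr_split[of N y 0 h] by simp

lemma dr_crit:
 assumes "\<And>j. j < k ==> (T ^^ j) y ~= 1/2" "(T ^^ k) y = 1/2"
 shows "dr (k + Suc i) y h = cap i (1/2 - vh k y h / 3)"
 using dr_split[of k y "Suc i" h] assms by simp

lemma dr_cases:
 obtains "\<And>k. k < N ==> (T ^^ k) y ~= 1/2" "dr N y h = {((T ^^ N) y, vh N y h)}"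
 | k i where "N = k + Suc i" "\<And>j. j < k ==> (T ^^ j) y ~= 1/2" "(T ^^ k) y = 1/2"
   "dr N y h = cap i (1/2 - vh k y h / 3)"
proof (cases "\<exists>k<N. (T ^^ k) y = 1/2")
 case True
 define k where "k = (LEAST k. k < N \<and> (T ^^ k) y = 1/2)"
 have k: "k < N \<and> (T ^^ k) y = 1/2" unfolding k_def using True by (rule LeastI_ex)
 have "(T ^^ j) y ~= 1/2" if "j < k" for j
  using not_less_Least[of j "%k. k < N \<and> (T ^^ k) y = 1/2"] that k by (auto simp: k_def)
 moreover obtain i where "N = k + Suc i" using k less_iff_Suc_add by auto
 ultimately show ?thesis using that(2) k dr_crit[of k y i h] by metis
next
 case False
 thus ?thesis using that(1) dr_nocrit[of N y h] by blast
qed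

lemma dr_b: "dr N b h = {(pc N, vh N b h)}"
 using dr_nocrit[of N b h] pc_neq_crit by (simp add: pc_def)

lemma height_in_range:
 assumes "\<bar>v - qc j\<bar> \<le> r / 3 ^ j" "r \<le> 1/2"
 shows "\<exists>h. 0 \<le> h \<and> h \<le> 1 \<and> v = vh j b h"
proof -
 define h where "h = 1/2 + ec j * 3 ^ j * (v - qc j)"
 have "vh j b h - vh j b (1/2) = ec j * (ec j * 3 ^ j * (v - qc j)) / 3 ^ j"
  unfolding vh_diff by (simp add: h_def ec_def)
 also have "\<dots> = v - qc j" by (simp add: ec_def mult.assoc[symmetric])
 finally have "v = vh j b h" by (simp add: qc_def)
 moreover have "\<bar>ec j * 3 ^ j * (v - qc j)\<bar> \<le> 1/2"
 proof -
  have "\<bar>ec j * 3 ^ j * (v - qc j)\<bar> = 3 ^ j * \<bar>v - qc j\<bar>" by (simp add: abs_mult ec_def)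
  also have "\<dots> \<le> r" using assms(1) by (simp add: field_simps)
  finally show ?thesis using assms(2) by simp
 qed
 hence "0 \<le> h" "h \<le> 1" unfolding h_def by linarith+
 ultimately show ?thesis by blast
qed

lemma cap_height:
 assumes "(u, v) \<in> cap j r" "0 \<le> r" "r \<le> 1/2"
 shows "\<bar>v - qc j\<bar> \<le> r / 3 ^ j" "\<exists>h. 0 \<le> h \<and> h \<le> 1 \<and> v = vh j b h"
proof -
 have "(u - pc j)\<^sup>2 + (v - qc j)\<^sup>2 = (r / 3 ^ j)\<^sup>2" using assms(1) by (simp add: cap_def)
 hence "(v - qc j)\<^sup>2 \<le> (r / 3 ^ j)\<^sup>2" using zero_le_power2[of "u - pc j"] by linarith
 moreover have "0 \<le> r / 3 ^ j" using assms(2) by simp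
 ultimately show 1: "\<bar>v - qc j\<bar> \<le> r / 3 ^ j"
  using abs_le_square_iff[of "v - qc j" "r / 3 ^ j"] by simp
 show "\<exists>h. 0 \<le> h \<and> h \<le> 1 \<and> v = vh j b h"
  by (rule height_in_range[OF 1 assms(3)])
qed

lemma ec_cases: "ec j = 1 \<or> ec j = - 1"
 using sg_cases by (simp add: ec_def)

text \<open>The pairs \<open>(A, B)\<close> and \<open>(P, B + D)\<close> are the coordinates of one
  point relative to two centres. With equal horizontal coordinates the smaller circle would lie
  strictly inside the larger one; a smaller horizontal distance to the larger centre only moves the
  point further inside.\<close>

lemma nested_circles:
 fixes A B D P :: real
 assumes "A\<^sup>2 + B\<^sup>2 = r\<^sup>2" "P\<^sup>2 + (B + D)\<^sup>2 = R\<^sup>2" "0 \<le> r" "\<bar>D\<bar> + r < R" "\<bar>P\<bar> \<le> \<bar>A\<bar>"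
 shows False
proof -
 have "B\<^sup>2 \<le> r\<^sup>2" using assms(1) zero_le_power2[of A] by linarith
 hence "\<bar>B\<bar> \<le> r" using assms(3) abs_le_square_iff[of B r] by simp
 hence "\<bar>B\<bar> * \<bar>D\<bar> \<le> r * \<bar>D\<bar>" by (intro mult_right_mono) auto
 moreover have "B * D \<le> \<bar>B\<bar> * \<bar>D\<bar>" by (metis abs_ge_self abs_mult)
 ultimately have "B * D \<le> r * \<bar>D\<bar>" by linarith
 have "P\<^sup>2 \<le> A\<^sup>2" using assms(5) by (simp add: abs_le_square_iff)
 hence "R\<^sup>2 \<le> A\<^sup>2 + (B + D)\<^sup>2" using assms(2) by simp
 also have "\<dots> = r\<^sup>2 + 2 * (B * D) + D\<^sup>2" using assms(1) by (simp add: power2_sum)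
 also have "\<dots> \<le> r\<^sup>2 + 2 * (r * \<bar>D\<bar>) + \<bar>D\<bar>\<^sup>2" using \<open>B * D \<le> r * \<bar>D\<bar>\<close> by simp
 also have "\<dots> = (\<bar>D\<bar> + r)\<^sup>2" by (simp add: power2_sum)
 also have "\<dots> < R\<^sup>2" using assms(3,4) by (intro power_strict_mono) auto
 finally show False by simp
qed

text \<open>A semicircle of depth \<open>M\<close> misses everything that is drawn at a level \<open>N \<le> M\<close> on the inner
 side of its centre. If two semicircles open to the same side, the endpoints of the shallower one
 cannot lie in the height range of the deeper one, since strands in that cylinder end earlier.\<close>

lemma cap_Int_dr:
 assumes MN: "N \<le> M" and side: "0 < sg (M - N) b * ((T ^^ (M - N)) b - y)"
  and h: "0 \<le> h" "h \<le> 1" and r: "0 \<le> r" "r \<le> 1/2"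
  and z: "z \<in> cap M r" "z \<in> dr N y h"
 shows False
proof -
 define b' where "b' = (T ^^ (M - N)) b"
 obtain u v where uv: "z = (u, v)" by (cases z)
 obtain h1 where h1: "0 \<le> h1" "h1 \<le> 1" "v = vh M b h1" using cap_height(2) z r uv by blast
 have pM: "pc M = (T ^^ N) b'"
  using MN by (simp add: pc_def b'_def funpow_T_add)
 have vM: "vh M b x = vh N b' (vh (M - N) b x)" for x
  using vh_add[of "M - N" N b x] MN by (simp add: b'_def)
 have eM: "ec M = sg (M - N) b * sg N b'"
  using sg_add[of "M - N" N b] MN by (simp add: b'_def ec_def)
 have zM: "(u - pc M)\<^sup>2 + (v - qc M)\<^sup>2 = (r / 3 ^ M)\<^sup>2" "0 \<le> ec M * (u - pc M)"
  using z(1) uv by (auto simp: cap_def)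
 show False
 proof (cases rule: dr_cases[of N y h])
  case 1
  hence uv': "u = (T ^^ N) y" "v = vh N y h" using z uv by auto
  have "vh N y h = vh N b' (vh (M - N) b h1)" using uv'(2) h1(3) vM by simp
  hence "sameit N y b'" using vh_eq_imp[OF _ h vh_range[OF h1(1,2)]] by blast
  hence "u - pc M = sg N b' * s ^ N * (y - b')" using T_diff uv' pM by simp
  hence "ec M * (u - pc M) = (sg N b' * sg N b') * s ^ N * (sg (M - N) b * (y - b'))"
   by (simp only: eM ac_simps)
  also have "\<dots> = - (s ^ N * (sg (M - N) b * (b' - y)))" by (simp add: algebra_simps)
  also have "\<dots> < 0" using side s_pos by (simp add: b'_def)
  finally show False using zM by simp
 next
  case (2 k i)
  define h' r' where "h' = vh k y h" and "r' = 1/2 - h' / 3"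
  have h': "0 \<le> h'" "h' \<le> 1" using vh_range[OF h] by (auto simp: h'_def)
  have r': "0 \<le> r'" "r' \<le> 1/2" using h' by (auto simp: r'_def)
  have zi: "(u, v) \<in> cap i r'" using z 2 uv by (simp add: r'_def h'_def)
  have iM: "i < M" using 2 MN by simp
  define bi where "bi = (T ^^ (M - i)) b"
  have vMi: "vh M b x = vh i bi (vh (M - i) b x)" for x
   using vh_add[of "M - i" i b x] iM by (simp add: bi_def)
  obtain h2 where h2: "0 \<le> h2" "h2 \<le> 1" "v = vh i b h2" using cap_height(2)[OF zi r'] by blast
  have "vh i bi (vh (M - i) b h1) = vh i b h2" using h1 h2 vMi by simp
  hence same_i: "sameit i bi b" using vh_eq_imp[OF _ vh_range[OF h1(1,2)] h2(1,2)] by blast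
  have "pc M - pc i = sg i b * s ^ i * (bi - b)"
   using T_diff[OF same_i] iM by (simp add: pc_def bi_def funpow_T_add)
  hence "ec i * (pc M - pc i) = (sg i b * sg i b) * s ^ i * (bi - b)" by (simp only: ec_def ac_simps)
  also have "\<dots> = s ^ i * (bi - b)" by simp
  also have "\<dots> < 0" using pc_less_b[of "M - i"] iM s_pos by (simp add: bi_def mult_less_0_iff)
  finally have lt: "ec i * (pc M - pc i) < 0" .
  have zi': "(u - pc i)\<^sup>2 + (v - qc i)\<^sup>2 = (r' / 3 ^ i)\<^sup>2" "0 \<le> ec i * (u - pc i)"
   using zi by (auto simp: cap_def)
  have e: "ec M = ec i" using ec_cases[of i] ec_cases[of M] lt zi'(2) zM(2) by auto
  \<comment> \<open>If a foot of the shallower semicircle lay in the height range of the deeper one,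
    its code would follow that of \<open>b'\<close> until \<open>y\<close> reaches 1/2. The side on
    which \<open>b'\<close> then passes 1/2 would make \<open>ec M\<close> and \<open>ec i\<close>
    opposite.\<close>
  have key: "r / 3 ^ M < \<bar>qc i + t * (r' / 3 ^ i) - qc M\<bar>" if t: "t = 1 \<or> t = - 1" for t
  proof (rule ccontr)
   assume "\<not> ?thesis"
   then obtain h3 where h3: "0 \<le> h3" "h3 \<le> 1" "qc i + t * (r' / 3 ^ i) = vh M b h3"
    using height_in_range[of "qc i + t * (r' / 3 ^ i)" M r] r by auto
   define et where "et \<longleftrightarrow> t * ec i = 1"
   have Het: "H et h' = 1/2 + t * ec i * r'"
    using t ec_cases[of i] by (auto simp: et_def H_def r'_def)
   have "vh i b (H et h') - qc i = ec i * (t * ec i * r') / 3 ^ i"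
    unfolding qc_def vh_diff Het by (simp add: ec_def)
   also have "\<dots> = t * (r' / 3 ^ i)" using ec_cases[of i] by auto
   finally have "vh i b (H et h') = vh i bi (vh (M - i) b h3)" using h3(3) vMi by simp
   hence "H et h' = vh (M - i) b h3"
    using vh_eq_imp[of i b "H et h'" bi "vh (M - i) b h3"] H_range[OF h'] vh_range[OF h3(1,2)]
    by blast
   also have "\<dots> = vh (Suc k) b' (vh (M - N) b h3)"
   proof -
    have "M - i = (M - N) + Suc k" using 2(1) MN by simp
    thus ?thesis unfolding b'_def by (simp only: vh_add)
   qed
   also have "\<dots> = H (1/2 < (T ^^ k) b') (vh k b' (vh (M - N) b h3))" by (rule vh_Suc_right)
   finally have "h' = vh k b' (vh (M - N) b h3)"
    by (rule conjunct2[OF iffD1[OF H_eq_iff[OF h' vh_range[OF vh_range[OF h3(1,2)]]]]])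
   hence "vh k y h = vh k b' (vh (M - N) b h3)" by (simp add: h'_def)
   hence same_k: "sameit k y b'"
    using vh_eq_imp[OF _ h vh_range[OF h3(1,2)]] by blast
   define x where "x = (T ^^ k) b' - 1/2"
   have "1/2 - (T ^^ k) b' = sg k b' * s ^ k * (y - b')" using T_diff[OF same_k] 2(3) by simp
   hence x: "x = sg k b' * s ^ k * (b' - y)" by (simp add: x_def algebra_simps)
   have "sg (M - N) b * sg k b' * x = s ^ k * (sg (M - N) b * (b' - y)) * (sg k b' * sg k b')"
    unfolding x by (simp only: ac_simps)
   also have "\<dots> > 0" using side s_pos by (simp add: b'_def)
   finally have xs: "0 < sg (M - N) b * sg k b' * x" .
   have "sg N b' = sg k b' * ((if (T ^^ k) b' \<le> 1/2 then 1 else - 1) * sg i (T ((T ^^ k) b')))"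
    using sg_add[of k "Suc i" b'] 2(1) by (simp add: sg_Suc)
   moreover have "T ((T ^^ k) b') = bi"
   proof -
    have "T ((T ^^ k) b') = (T ^^ Suc k) b'" by simp
    also have "\<dots> = (T ^^ (Suc k + (M - N))) b" unfolding b'_def by (rule funpow_T_add)
    also have "Suc k + (M - N) = M - i" using 2(1) MN by simp
    finally show ?thesis by (simp only: bi_def)
   qed
   moreover have "sg i bi = ec i" using sg_cong[OF same_i] by (simp add: ec_def)
   ultimately have "ec M = sg (M - N) b * sg k b' * (if x \<le> 0 then 1 else - 1) * ec i"
    using eM by (simp add: x_def)
   moreover have "sg (M - N) b * sg k b' * (if x \<le> 0 then 1 else - 1) = - 1"
    using xs sg_cases[of "M - N" b] sg_cases[of k b'] by auto
   ultimately show False using e ec_cases[of i] by auto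
  qed
  have v: "\<bar>v - qc M\<bar> \<le> r / 3 ^ M" "\<bar>v - qc i\<bar> \<le> r' / 3 ^ i"
   using cap_height(1) z(1) uv r zi r' by blast+
  have "\<bar>qc M - qc i\<bar> + r / 3 ^ M < r' / 3 ^ i"
   using key[of 1] key[of "- 1"] v by auto
  moreover have "\<bar>u - pc i\<bar> \<le> \<bar>u - pc M\<bar>"
   using lt zi'(2) zM(2) ec_cases[of i] e by auto
  ultimately show False
   using nested_circles[of "u - pc M" "v - qc M" "r / 3 ^ M" "u - pc i" "qc M - qc i" "r' / 3 ^ i"]
    zM(1) zi'(1) r(1) by simp
 qed
qed

lemma cap_Int_dr_same:
 assumes "y < b" "0 \<le> h" "h \<le> 1" "0 \<le> r" "r \<le> 1/2" "z \<in> cap N r" "z \<in> dr N y h"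
 shows False
proof -
 have "0 < sg (N - N) b * ((T ^^ (N - N)) b - y)" using assms(1) by simp
 from cap_Int_dr[OF order_refl this assms(2-7)] show False .
qed

text \<open>The drawing has no self-intersection. Two semicircles of equal depth are told apart by
  their radii, a semicircle and another trace by \<open>T y < b\<close>, and in the remaining case
  one level is peeled off.\<close>

lemma dr_inj:
 assumes "z \<in> dr N y h" "z \<in> dr N y' h'" "a \<le> y" "y \<le> b" "a \<le> y'" "y' \<le> b"
  "0 \<le> h" "h \<le> 1" "0 \<le> h'" "h' \<le> 1"
 shows "y = y' \<and> h = h'"
 using assms
proof (induction N arbitrary: y h y' h')
 case (Suc N)
 have Tb: "T x < b" if "x ~= 1/2" "a \<le> x" "x \<le> b" for x
  using T_range[OF that(2,3)] T_eq_b_iff[of x] that(1) by simp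
 have hh: "0 \<le> 1/2 - h / 3" "1/2 - h / 3 \<le> 1/2" "0 < 1/2 - h / 3"
  "0 \<le> 1/2 - h' / 3" "1/2 - h' / 3 \<le> 1/2" "0 < 1/2 - h' / 3"
  using Suc.prems by auto
 consider "y = 1/2" "y' = 1/2" | "y = 1/2" "y' ~= 1/2" | "y ~= 1/2" "y' = 1/2"
  | "y ~= 1/2" "y' ~= 1/2" by blast
 thus ?case
 proof cases
  case 1
  hence "z \<in> cap N (1/2 - h / 3)" "z \<in> cap N (1/2 - h' / 3)"
   using Suc.prems(1,2) by simp_all
  hence "((1/2 - h / 3) / 3 ^ N)\<^sup>2 = ((1/2 - h' / 3) / 3 ^ N)\<^sup>2" by (auto simp: cap_def)
  hence "(1/2 - h / 3) / 3 ^ N = (1/2 - h' / 3) / 3 ^ N"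
   using hh by (subst (asm) power2_eq_iff_nonneg) auto
  thus ?thesis using 1 by simp
 next
  case 2
  hence "z \<in> cap N (1/2 - h / 3)" "z \<in> dr N (T y') (H (1/2 < y') h')" using Suc.prems(1,2) by simp_all
  from cap_Int_dr_same[OF Tb[OF 2(2) Suc.prems(5,6)] H_range[OF Suc.prems(9,10)] hh(1,2) this]
  show ?thesis ..
 next
  case 3
  hence "z \<in> cap N (1/2 - h' / 3)" "z \<in> dr N (T y) (H (1/2 < y) h)" using Suc.prems(1,2) by simp_all
  from cap_Int_dr_same[OF Tb[OF 3(1) Suc.prems(3,4)] H_range[OF Suc.prems(7,8)] hh(4,5) this]
  show ?thesis ..
 next
  case 4
  hence z: "z \<in> dr N (T y) (H (1/2 < y) h)" "z \<in> dr N (T y') (H (1/2 < y') h')"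
   using Suc.prems(1,2) by simp_all
  have e: "T y = T y'" "H (1/2 < y) h = H (1/2 < y') h'"
   using Suc.IH[OF z T_range[OF Suc.prems(3,4)] T_range[OF Suc.prems(5,6)]
     H_range[OF Suc.prems(7,8)] H_range[OF Suc.prems(9,10)]] by auto
  have e2: "(1/2 < y) = (1/2 < y') \<and> h = h'" by (rule iffD1[OF H_eq_iff[OF Suc.prems(7-10)] e(2)])
  have "y = br (1/2 < y) (T y)" using br_T[of y "1/2 < y"] by simp
  also have "\<dots> = br (1/2 < y') (T y')" by (simp only: e(1) conjunct1[OF e2])
  also have "\<dots> = y'" using br_T[of y' "1/2 < y'"] by simp
  finally show ?thesis using e2 by blast
 qed
qed simp

end

section \<open>Symbolic description of the planar continuum\<close>

declare le_divide_eq_numeral1 [simp del] divide_le_eq_numeral1 [simp del]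
 less_divide_eq_numeral1 [simp del] divide_less_eq_numeral1 [simp del]
 eq_divide_eq_numeral1 [simp del] divide_eq_eq_numeral1 [simp del]

lemma plex_total:
 assumes "length u = length v"
 shows "u = v \<or> plex_less u v \<or> plex_less v u"
proof (cases "u = v")
 case False
 then obtain k where "k < length u" "u ! k ~= v ! k" using assms nth_equalityI by blast
 hence ex: "\<exists>k. k < length u \<and> u ! k ~= v ! k" by blast
 define k where "k = (LEAST k. k < length u \<and> u ! k ~= v ! k)"
 have k: "k < length u" "u ! k ~= v ! k" using LeastI_ex[OF ex] by (simp_all add: k_def)
 have "u ! j = v ! j" if "j < k" for j
  using not_less_Least[OF that[unfolded k_def]] that k(1) by auto
 hence t: "take k u = take k v" using k(1) assms by (intro nth_equalityI) auto
 consider "u ! k < v ! k \<and> even (ones (take k u)) \<or> v ! k < u ! k \<and> odd (ones (take k u))"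
  | "v ! k < u ! k \<and> even (ones (take k v)) \<or> u ! k < v ! k \<and> odd (ones (take k v))"
  using k(2) t by (cases "u ! k"; cases "v ! k"; cases "even (ones (take k u))") auto
 thus ?thesis
 proof cases
  case 1
  hence "plex_less u v" using k(1) t assms unfolding plex_less_def by blast
  thus ?thesis by blast
 next
  case 2
  hence "plex_less v u" using k(1) t assms unfolding plex_less_def by metis
  thus ?thesis by blast
 qed
qed simp

context tent_rot
begin

definition compat :: "bool => real => bool" where
 "compat e t \<longleftrightarrow> (if e then 1/2 \<le> t else t \<le> 1/2)"

text \<open>The parity of the ones read so far is the orientation of the iterate, so the word order
  is the order of the points. Equal points can have different words only if the first differing
  symbol is read at 1/2.\<close>

lemma plex_less_imp_le:
 assumes w: "length w = N" "\<And>j. j < N ==> compat (w ! j) ((T ^^ j) t)"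
  and w': "length w' = N" "\<And>j. j < N ==> compat (w' ! j) ((T ^^ j) t')"
  and less: "plex_less w w'"
 shows "t \<le> t' \<and> (t = t' --> (\<exists>k. (T ^^ k) t = 1/2))"
proof -
 obtain k where k: "k < N" "take k w = take k w'"
  "w ! k < w' ! k \<and> even (ones (take k w)) \<or> w' ! k < w ! k \<and> odd (ones (take k w))"
  using less w(1) by (auto simp: plex_less_def)
 have diff: "(T ^^ j) t - (T ^^ j) t' = (- 1) ^ ones (take j w) * s ^ j * (t - t')" if "j \<le> k" for j
  using that
 proof (induction j)
  case (Suc j)
  have eq: "w ! j = w' ! j" using k(2) Suc.prems by (metis Suc_le_eq nth_take)
  have jN: "j < length w" using Suc.prems k w by simp
  have "T ((T ^^ j) t) - T ((T ^^ j) t') = (if w ! j then - 1 else 1) * s * ((T ^^ j) t - (T ^^ j) t')"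
   using w(2)[of j] w'(2)[of j] eq jN w(1) w'(1)
   by (auto simp: compat_def T_left T_right algebra_simps)
  thus ?case using Suc jN by (simp add: take_Suc_conv_app_nth ones_def)
 qed (simp add: ones_def)
 have d: "(T ^^ k) t - (T ^^ k) t' = (- 1) ^ ones (take k w) * s ^ k * (t - t')" using diff by simp
 have c: "compat (w ! k) ((T ^^ k) t)" "compat (w' ! k) ((T ^^ k) t')" using w w' k by auto
 have "(- 1) ^ ones (take k w) * ((T ^^ k) t - (T ^^ k) t') \<le> 0"
  using k(3) c by (cases "even (ones (take k w))") (auto simp: compat_def)
 moreover have "(- 1) ^ ones (take k w) * ((T ^^ k) t - (T ^^ k) t') = s ^ k * (t - t')"
  unfolding d by (simp add: mult.assoc[symmetric] power_mult_distrib[symmetric])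
 ultimately have "s ^ k * (t - t') \<le> 0" by simp
 hence "t \<le> t'" using s_pos zero_less_power[OF s_pos, of k] by (auto simp: mult_le_0_iff)
 moreover have "t = t' ==> (T ^^ k) t = 1/2"
  using c k(3) by (auto simp: compat_def)
 ultimately show ?thesis by blast
qed

lemma kneading_eq: "kneading s k \<longleftrightarrow> 1/2 \<le> (T ^^ Suc k) (1/2)"
proof -
 have "\<not> (\<exists>n>0. (T ^^ n) crit = crit)" using nonper by (auto simp: crit_def)
 hence "kneading s = (%k. crit \<le> (T ^^ Suc k) crit)"
  unfolding kneading_def Let_def by (rule if_not_P)
 thus ?thesis unfolding crit_def by simp
qed

lemma tent_core_eq: "tent_core s = {x. \<forall>i. a \<le> x i \<and> x i \<le> b \<and> T (x (Suc i)) = x i}"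
 by (auto simp: tent_core_def inverse_limit_def crit_def T_crit[simplified] T_b)

lemma core_limit: assumes "x \<in> tent_core s" shows "x \<in> tent_limit s"
proof -
 have "0 \<le> x i \<and> x i \<le> 1 \<and> T (x (Suc i)) = x i" for i
 proof -
  have "a \<le> x i" "x i \<le> b" "T (x (Suc i)) = x i" using assms by (auto simp: tent_core_eq)
  thus ?thesis using a_pos b_lt1 by simp
 qed
 thus ?thesis by (simp add: tent_limit_def inverse_limit_def)
qed

lemma coord_Suc: assumes "x \<in> tent_core s" shows "T (coord s x i) = coord s x (i + 1)"
proof (cases "i < 0")
 case True
 hence "nat (- i) = Suc (nat (- (i + 1)))" by simp
 thus ?thesis using True assms by (simp add: coord_def tent_core_eq)
next
 case False
 hence "nat (i + 1) = Suc (nat i)" by simp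
 thus ?thesis using False by (auto simp: coord_def)
qed

lemma coord_funpow: "x \<in> tent_core s ==> (T ^^ k) (coord s x i) = coord s x (i + int k)"
proof (induction k)
 case (Suc k)
 thus ?case using coord_Suc[of x "i + int k"] by (simp add: algebra_simps)
qed simp

lemma coord_range: assumes "x \<in> tent_core s" shows "a \<le> coord s x i" "coord s x i \<le> b"
proof -
 have "a \<le> x k" "x k \<le> b" for k using assms by (auto simp: tent_core_eq)
 thus "a \<le> coord s x i" "coord s x i \<le> b"
  using funpow_range[of "x 0"] by (auto simp: coord_def)
qed

text \<open>Every word read along the orbit lies between the itineraries of \<open>a\<close> and
  \<open>b\<close> because its point does. The order of words decides that of points except at the
  critical point, which the orbits of \<open>a\<close> and \<open>b\<close> avoid; so admissibility
  is automatic in the core.\<close>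

lemma represents_core:
 assumes x: "x \<in> tent_core s"
 shows "represents s \<sigma> x \<longleftrightarrow> (\<forall>i. compat (\<sigma> i) (coord s x i))"
proof
 assume "represents s \<sigma> x"
 hence "coord s x i \<in> (if \<sigma> i then {crit..1} else {0..crit})" for i
  unfolding represents_def by blast
 thus "\<forall>i. compat (\<sigma> i) (coord s x i)" by (fastforce simp: compat_def crit_def split: if_splits)
next
 assume c: "\<forall>i. compat (\<sigma> i) (coord s x i)"
 have pow: "(T ^^ j) b ~= 1/2" "(T ^^ j) a ~= 1/2" for j
  using pc_neq_crit[of j] pc_neq_crit[of "Suc j"] by (simp_all add: funpow_swap1 T_b)
 have ord: "plex_le (initial (%k. kneading s (Suc k)) N) (subword \<sigma> i N)"
  "plex_le (subword \<sigma> i N) (initial (kneading s) N)" for i N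
 proof -
  define w where "w = subword \<sigma> i N"
  define u where "u = initial (kneading s) N"
  define u' where "u' = initial (%k. kneading s (Suc k)) N"
  have len: "length w = N" "length u = N" "length u' = N"
   by (auto simp: w_def u_def u'_def subword_def initial_def)
  have cw: "compat (w ! j) ((T ^^ j) (coord s x i))" if "j < N" for j
   using c that by (simp add: w_def subword_def coord_funpow[OF x])
  have cu: "compat (u ! j) ((T ^^ j) b)" if "j < N" for j
  proof -
   have "(T ^^ Suc j) (1/2) = (T ^^ j) b" by (simp only: funpow_Suc_right o_apply T_crit)
   thus ?thesis using that kneading_eq[of j] by (auto simp: u_def initial_def compat_def)
  qed
  have cu': "compat (u' ! j) ((T ^^ j) a)" if "j < N" for j
  proof -
   have "(T ^^ Suc (Suc j)) (1/2) = (T ^^ j) a" by (simp only: funpow_Suc_right o_apply T_crit T_b)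
   thus ?thesis using that kneading_eq[of "Suc j"] by (auto simp: u'_def initial_def compat_def)
  qed
  have "\<not> plex_less u w"
  proof
   assume "plex_less u w"
   from plex_less_imp_le[OF len(2) cu len(1) cw this] coord_range(2)[OF x, of i] pow(1)
   show False by fastforce
  qed
  moreover have "\<not> plex_less w u'"
  proof
   assume "plex_less w u'"
   from plex_less_imp_le[OF len(1) cw len(3) cu' this] coord_range(1)[OF x, of i] pow(2)
   show False by fastforce
  qed
  ultimately show "plex_le u' w" "plex_le w u"
   using plex_total[of w u] plex_total[of w u'] len by (auto simp: plex_le_def)
 qed
 have drop: "drop p (subword \<sigma> i N) = subword \<sigma> (i + int p) (N - p)" for p i N
  by (intro nth_equalityI) (auto simp: subword_def algebra_simps)
 have "admissible_word s (subword \<sigma> i N)" for i N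
  unfolding admissible_word_def drop using ord by (simp add: subword_def)
 hence "\<sigma> \<in> Sigma_adm s" by (simp add: Sigma_adm_def)
 moreover have "coord s x i \<in> (if \<sigma> i then {crit..1} else {0..crit})" for i
  using c[rule_format, of i] coord_range[OF x, of i] a_pos b_lt1 by (auto simp: compat_def crit_def)
 ultimately show "represents s \<sigma> x" by (simp add: represents_def)
qed

lemma core_code:
 assumes x: "x \<in> tent_core s" and c: "\<And>k. compat (l k) (x (Suc k))"
 shows "Adm (x 0) l" and "bk (x 0) l k = x k"
proof -
 have r: "a \<le> x k" "x k \<le> b" "T (x (Suc k)) = x k" for k using x by (auto simp: tent_core_eq)
 show bk: "bk (x 0) l k = x k" for k
 proof (induction k)
  case (Suc k)
  have "br (l k) (T (x (Suc k))) = x (Suc k)"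
   using c[of k] s_pos by (auto simp: br_def compat_def T_left T_right)
  thus ?case using Suc r(3)[of k] by simp
 qed simp
 have "s * a \<le> x k" if "\<not> l k" for k
 proof -
  have "x k = s * x (Suc k)" using c[of k] that r(3)[of k] by (simp add: compat_def T_left)
  thus ?thesis using r(1)[of "Suc k"] s_pos by simp
 qed
 thus "Adm (x 0) l" using r bk by (simp add: Adm_def)
qed

lemma Adm_compat: assumes "Adm y l" shows "compat (l k) (bk y l (Suc k))"
 using Adm_range[OF assms, of k] br_True_range[of "bk y l k"] br_False_range[of "bk y l k"] assms
 by (cases "l k") (auto simp: compat_def Adm_def)

lemma Adm_core: "Adm y l ==> bk y l \<in> tent_core s"
 using Adm_range T_bk by (auto simp: tent_core_eq simp del: bk.simps)

section \<open>Codes, representatives and strands\<close>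

definition code_ext :: "real => (nat => bool) => int => bool" where
 "code_ext y l i = (if i < 0 then l (nat (- i - 1)) else 1/2 \<le> (T ^^ nat i) y)"

lemma left_part_code_ext: "left_part (code_ext y l) = l"
 by (auto simp: left_part_def code_ext_def)

lemma represents_code_ext: assumes "Adm y l" shows "represents s (code_ext y l) (bk y l)"
proof -
 have "compat (code_ext y l i) (coord s (bk y l) i)" for i
 proof (cases "i < 0")
  case True
  hence "nat (- i) = Suc (nat (- i - 1))" by simp
  thus ?thesis using True Adm_compat[OF assms, of "nat (- i - 1)"]
   by (simp add: code_ext_def coord_def del: bk.simps)
 next
  case False
  have "coord s (bk y l) i = (T ^^ nat i) y" using False by (auto simp: coord_def)
  thus ?thesis using False by (auto simp: code_ext_def compat_def)
 qed
 thus ?thesis using represents_core[OF Adm_core[OF assms]] by blast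
qed

lemma represents_Adm:
 assumes x: "x \<in> tent_core s" and r: "represents s \<sigma> x"
 shows "Adm (x 0) (left_part \<sigma>)" and "bk (x 0) (left_part \<sigma>) k = x k"
proof -
 have "compat (left_part \<sigma> k) (x (Suc k))" for k
 proof -
  have "compat (\<sigma> (- int (Suc k))) (coord s x (- int (Suc k)))" using r represents_core[OF x] by blast
  moreover have "nat (- (- int (Suc k))) = Suc k" by simp
  ultimately show ?thesis by (simp add: left_part_def coord_def del: of_nat_Suc)
 qed
 from core_code[OF x this] show "Adm (x 0) (left_part \<sigma>)" "bk (x 0) (left_part \<sigma>) k = x k" by auto
qed

text \<open>\<open>strand N y l z\<close>: the strand with code \<open>l\<close>, looked at from level \<open>N\<close> where it passes over
 \<open>y\<close>, is drawn through \<open>z\<close>.\<close>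

definition strand :: "nat => real => (nat => bool) => real \<times> real => bool" where
 "strand N y l z \<longleftrightarrow> Adm y l \<and> z \<in> dr N y (psi0 l)"

lemma strand_Adm: "strand N y l z ==> Adm y l" by (simp add: strand_def)

lemma strand_0: "strand 0 y l z \<longleftrightarrow> Adm y l \<and> z = (y, psi0 l)" by (simp add: strand_def)

lemma strand_crit: "strand (Suc j) (1/2) l z \<longleftrightarrow> Adm (1/2) l \<and> z \<in> cap j (1/2 - psi0 l / 3)"
 by (simp add: strand_def)

lemma psi0_case_nat: "psi0 (case_nat e l) = H e (psi0 l)"
 using psi0_rec[of "case_nat e l"] by simp

lemma H_crit: "H e h = 1/2 + (if e then 1 else - 1) * (1/2 - h / 3)" by (simp add: H_def)

lemma cap_end: "(pc N, vh N b (H e h)) \<in> cap N (1/2 - h / 3)"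
proof -
 have "vh N b (H e h) - qc N = sg N b * (H e h - 1/2) / 3 ^ N" unfolding qc_def by (rule vh_diff)
 hence "(vh N b (H e h) - qc N)\<^sup>2 = ((1/2 - h / 3) / 3 ^ N)\<^sup>2"
  using sg_cases[of N b] by (auto simp: H_crit power2_eq_square)
 thus ?thesis by (simp add: cap_def)
qed

lemma strand_Suc: assumes "strand N y l z" shows "strand (Suc N) (bk y l 1) (shift 1 l) z"
proof -
 let ?y = "bk y l 1"
 have A: "Adm y l" and z: "z \<in> dr N y (psi0 l)" using assms by (auto simp: strand_def)
 have T: "T ?y = y" using T_bk[OF A, of 0] by simp
 have psi: "psi0 l = H (l 0) (psi0 (shift 1 l))" by (rule psi0_rec)
 have "z \<in> dr (Suc N) ?y (psi0 (shift 1 l))"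
 proof (cases "?y = 1/2")
  case True
  hence "y = b" using T T_crit by simp
  hence "z = (pc N, vh N b (H (l 0) (psi0 (shift 1 l))))" using z psi by (simp add: dr_b)
  thus ?thesis using True cap_end by simp
 next
  case False
  hence "(1/2 < ?y) = l 0" using bk_sym[OF A, of 0] by simp
  thus ?thesis using False T z psi by simp
 qed
 thus ?thesis using Adm_bk[OF A, of 1] by (simp add: strand_def)
qed

lemma strand_add: "strand N y l z ==> strand (N + k) (bk y l k) (shift k l) z"
proof (induction k)
 case (Suc k)
 thus ?case using strand_Suc[of "N + k" "bk y l k" "shift k l" z] by simp
qed simp

lemma strand_down: assumes "strand (Suc N) y l z" "y ~= 1/2" shows "strand N (T y) (case_nat (1/2 < y) l) z"
 using assms Adm_cons(1)[of y l "1/2 < y"] by (simp add: strand_def psi0_case_nat)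

lemma strand_unique: assumes "strand N y l z" "strand N y' l' z" shows "y = y' \<and> l = l'"
proof -
 have "y = y' \<and> psi0 l = psi0 l'"
  using assms psi0_range by (intro dr_inj[of z N]) (auto simp: strand_def Adm_def)
 thus ?thesis using psi0_inj by blast
qed

text \<open>A normal form: levels are removed until level zero is reached or the point sits over
  1/2, that is, on a semicircle.\<close>

lemma strand_base:
 assumes "strand N y l z"
 shows "(\<exists>y' l'. strand 0 y' l' z \<and> l = shift N l' \<and> y = bk y' l' N) \<or>
  (\<exists>j k l'. N = Suc j + k \<and> strand (Suc j) (1/2) l' z \<and> l = shift k l' \<and> y = bk (1/2) l' k)"
 using assms
proof (induction N arbitrary: y l)
 case (Suc N)
 show ?case
 proof (cases "y = 1/2")
  case True
  show ?thesis
   by (rule disjI2, rule exI[of _ N], rule exI[of _ 0], rule exI[of _ l]) (use True Suc.prems in auto)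
 next
  case False
  let ?l = "case_nat (1/2 < y) l"
  have A: "Adm y l" using Suc.prems strand_Adm by blast
  have l: "l = shift 1 ?l" by auto
  have y: "y = bk (T y) ?l 1" using Adm_cons(2)[OF A False refl, of 0] by simp
  from Suc.IH[OF strand_down[OF Suc.prems False]] show ?thesis
  proof (elim disjE exE conjE)
   fix y' l' assume h: "strand 0 y' l' z" "?l = shift N l'" "T y = bk y' l' N"
   have "l = shift (Suc N) l'" using l h(2) by (metis add_Suc_right add.commute plus_1_eq_Suc)
   moreover have "y = bk y' l' (Suc N)" using y h(2,3) by (metis One_nat_def bk.simps plus_nat.add_0)
   ultimately show ?thesis using h(1) by blast
  next
   fix j k l' assume h: "N = Suc j + k" "strand (Suc j) (1/2) l' z" "?l = shift k l'" "T y = bk (1/2) l' k"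
   have "l = shift (Suc k) l'" using l h(3) by (metis add_Suc_right add.commute plus_1_eq_Suc)
   moreover have "y = bk (1/2) l' (Suc k)" using y h(3,4) by (metis One_nat_def bk.simps plus_nat.add_0)
   moreover have "Suc N = Suc j + Suc k" using h(1) by simp
   ultimately show ?thesis using h(2) by blast
  qed
 qed
qed auto

lemma vh_hg: assumes "Adm y l" "\<And>i. 0 < i ==> i \<le> j ==> bk y l i ~= 1/2"
 shows "vh j (bk y l j) h = hg l j h" and "sg j (bk y l j) = parity_sign l j"
proof -
 have "vh j (bk y l j) h = hg l j h \<and> sg j (bk y l j) = parity_sign l j"
  using assms(2)
 proof (induction j arbitrary: h)
  case (Suc j)
  have ne: "bk y l (Suc j) ~= 1/2" using Suc.prems by blast
  have sym: "(1/2 < bk y l (Suc j)) = l j" using bk_sym[OF assms(1) ne] .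
  have T: "T (bk y l (Suc j)) = bk y l j" by (rule T_bk[OF assms(1)])
  have IH: "vh j (bk y l j) h = hg l j h" "sg j (bk y l j) = parity_sign l j" for h
   using Suc by auto
  have "vh (Suc j) (bk y l (Suc j)) h = hg l (Suc j) h"
   by (simp only: vh.simps T sym IH hg.simps)
  moreover have "sg (Suc j) (bk y l (Suc j)) = parity_sign l (Suc j)"
   using sym ne unfolding sg_Suc T IH by (auto simp: parity_sign_def)
  ultimately show ?case by blast
 qed (simp add: parity_sign_def)
 thus "vh j (bk y l j) h = hg l j h" "sg j (bk y l j) = parity_sign l j" by auto
qed

text \<open>A code that reaches 1/2 after \<open>j + 1\<close> steps back is dictated by the orbit
  of \<open>b\<close> in its first \<open>j\<close> symbols; only the symbol at \<open>j\<close> is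
  free, and it selects the foot of the semicircle.\<close>

lemma crit_code:
 assumes A: "Adm y l" and c: "bk y l (Suc j) = 1/2"
 shows "y = pc j" "psi0 l = vh j b (H (l j) (psi0 (shift (Suc j) l)))" "ec j = parity_sign l j"
  "i < j ==> l i = (1/2 < (T ^^ (j - Suc i)) b)"
proof -
 have bj: "bk y l j = b" using T_bk[OF A, of j] c T_crit by simp
 have pow: "(T ^^ (j - i)) b = bk y l i" if "i \<le> j" for i
  using funpow_T_bk[OF A, of "j - i" i] bj that by simp
 thus "y = pc j" using pow[of 0] by (simp add: pc_def)
 have ne: "bk y l i ~= 1/2" if "i \<le> j" for i
  using pow[OF that] pc_neq_crit by metis
 have v: "vh j b h = hg l j h" "sg j b = parity_sign l j" for h
  using vh_hg[OF A, of j] ne bj by auto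
 thus "psi0 l = vh j b (H (l j) (psi0 (shift (Suc j) l)))"
  using psi0_hg[of l "Suc j"] by simp
 show "ec j = parity_sign l j" using v by (simp add: ec_def)
 show "l i = (1/2 < (T ^^ (j - Suc i)) b)" if "i < j"
  using bk_sym[OF A ne[of "Suc i"]] pow[of "Suc i"] that by simp
qed

text \<open>The parity of the word behind the identified index is the sign \<open>ec j\<close>, and
  the two heights are symmetric about \<open>qc j\<close>; this matches the drawing rule of the
  definition with the dynamical one.\<close>

lemma semicircle_cap:
 assumes A: "Adm y l" "bk y l (Suc j) = 1/2" and A': "Adm y l'" and d: "l j ~= l' j"
  and same: "\<And>i. i ~= j ==> l i = l' i"
 shows "semicircle (odd (ones (map (%i. l (j - Suc i)) [0..<j]))) y (psi0 l) (psi0 l')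
  = cap j (1/2 - psi0 (shift (Suc j) l) / 3)"
proof -
 define h where "h = psi0 (shift (Suc j) l)"
 have sh: "shift (Suc j) l' = shift (Suc j) l" using same by auto
 have bk': "bk y l' i = bk y l i" if "i \<le> j" for i using that same by (induction i) auto
 moreover have "bk y l j = b" using T_bk[OF A(1), of j] A(2) T_crit by simp
 ultimately have "bk y l' (Suc j) = 1/2" by (simp add: br_b)
 note c = crit_code[OF A] crit_code[OF A' this]
 define A where "A = ec j * ((1/2 - h / 3) / 3 ^ j)"
 have p: "psi0 l - qc j = (if l j then 1 else - 1) * A" "psi0 l' - qc j = (if l' j then 1 else - 1) * A"
  unfolding qc_def c(2) c(6) sh h_def[symmetric] vh_diff by (simp_all add: H_crit ec_def A_def)
 have mid: "(psi0 l + psi0 l') / 2 = qc j" using p d by (cases "l j") auto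
 have "(psi0 l - psi0 l') / 2 = (if l j then 1 else - 1) * A"
  using p d by (cases "l j") (auto simp: field_simps)
 hence rad: "((psi0 l - psi0 l') / 2)\<^sup>2 = ((1/2 - h / 3) / 3 ^ j)\<^sup>2"
  using ec_cases[of j] by (auto simp: A_def power2_eq_square)
 have "ones (map (%i. l (j - Suc i)) [0..<j]) = ones (initial l j)"
 proof -
  have "map (%i. l (j - Suc i)) [0..<j] = rev (initial l j)"
   by (intro nth_equalityI) (auto simp: initial_def rev_nth)
  thus ?thesis by (simp add: ones_def)
 qed
 hence "odd (ones (map (%i. l (j - Suc i)) [0..<j])) \<longleftrightarrow> ec j = - 1"
  using c(3) by (simp add: parity_sign_ones) (metis minus_one_power_iff one_neq_neg_one)
 thus ?thesis
  unfolding semicircle_def cap_def mid rad h_def[symmetric] c(1)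
  using ec_cases[of j] by auto
qed

lemma phi_core_subset:
 assumes x: "x \<in> tent_core s" and z: "z \<in> draw_point s L_ray x"
 shows "\<exists>N y l. strand N y l z \<and> (\<forall>k. bk y l k = x (k + N)) \<and>
  (\<exists>\<sigma>. represents s \<sigma> x \<and> l = shift N (left_part \<sigma>))"
proof -
 consider l where "z = (x 0, psi0 l)" "x \<in> basic_arc s l"
  | \<sigma> \<tau> k where "k < 0" "represents s \<sigma> x" "represents s \<tau> x" "identified_at s k \<sigma> \<tau>"
   "z \<in> semicircle (odd (ones (subword \<sigma> (k + 1) (nat (- k - 1))))) (x 0)
    (psi0 (left_part \<sigma>)) (psi0 (left_part \<tau>))"
  using z unfolding draw_point_def by blast
 thus ?thesis
 proof cases
  case 1
  then obtain \<sigma> where "represents s \<sigma> x" "left_part \<sigma> = l" by (auto simp: basic_arc_def)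
  thus ?thesis using represents_Adm[OF x, of \<sigma>] 1
   by (intro exI[of _ 0] exI[of _ "x 0"] exI[of _ l]) (auto simp: strand_0)
 next
  case 2
  define j where "j = nat (- k - 1)"
  have k: "k = - int (Suc j)" using 2(1) by (simp add: j_def)
  note A = represents_Adm[OF x 2(2)] represents_Adm[OF x 2(3)]
  have xk: "coord s x k = x (Suc j)" by (simp add: coord_def k del: of_nat_Suc)
  have "compat (\<sigma> k) (x (Suc j))" "compat (\<tau> k) (x (Suc j))"
   using 2(2,3) represents_core[OF x] xk by metis+
  hence c: "x (Suc j) = 1/2" using 2(4) by (auto simp: compat_def identified_at_def split: if_splits)
  have d: "left_part \<sigma> j ~= left_part \<tau> j" using 2(4) k by (simp add: left_part_def identified_at_def)
  have same: "left_part \<sigma> i = left_part \<tau> i" if "i ~= j" for i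
   using 2(4) k that by (simp add: left_part_def identified_at_def)
  have w: "subword \<sigma> (k + 1) (nat (- k - 1)) = map (%i. left_part \<sigma> (j - Suc i)) [0..<j]"
   unfolding subword_def j_def[symmetric]
   by (intro map_cong) (auto simp: left_part_def k of_nat_diff)
  have bkc: "bk (x 0) (left_part \<sigma>) (Suc j) = 1/2" using A(2)[of "Suc j"] c by simp
  have "z \<in> cap j (1/2 - psi0 (shift (Suc j) (left_part \<sigma>)) / 3)"
   using 2(5) semicircle_cap[OF A(1) bkc A(3) d same] unfolding w by simp
  moreover have "Adm (1/2) (shift (Suc j) (left_part \<sigma>))" using Adm_bk[OF A(1), of "Suc j"] bkc by simp
  ultimately have "strand (Suc j) (1/2) (shift (Suc j) (left_part \<sigma>)) z" by (simp add: strand_crit)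
  moreover have "bk (1/2) (shift (Suc j) (left_part \<sigma>)) k = x (k + Suc j)" for k
   using A(2)[of "k + Suc j"] bk_shift[of "x 0" "left_part \<sigma>" k "Suc j"] bkc by simp
  ultimately show ?thesis using 2(2) by blast
 qed
qed

lemma phi_core_supset:
 assumes "strand N y l z"
 shows "\<exists>x\<in>tent_core s. z \<in> draw_point s L_ray x \<and> (\<exists>l'. x \<in> basic_arc s l' \<and> l = shift N l')"
 using strand_base[OF assms]
proof (elim disjE exE conjE)
 fix y' l' assume h: "strand 0 y' l' z" "l = shift N l'" "y = bk y' l' N"
 have A: "Adm y' l'" and z: "z = (y', psi0 l')" using h by (auto simp: strand_0)
 have core: "bk y' l' \<in> tent_core s" by (rule Adm_core[OF A])
 hence "bk y' l' \<in> tent_limit s" by (rule core_limit)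
 hence "bk y' l' \<in> basic_arc s l'"
  using represents_code_ext[OF A] left_part_code_ext by (auto simp: basic_arc_def)
 thus ?thesis using core h(2) z unfolding draw_point_def by (intro bexI[of _ "bk y' l'"]) auto
next
 fix j k l' assume h: "N = Suc j + k" "strand (Suc j) (1/2) l' z" "l = shift k l'" "y = bk (1/2) l' k"
 have A: "Adm (1/2) l'" and z: "z \<in> cap j (1/2 - psi0 l' / 3)" using h(2) by (auto simp: strand_crit)
 \<comment> \<open>The fold can be left with either symbol; afterwards the forward orbit of
   \<open>b\<close> prescribes the code down to the foot.\<close>
 have ex: "\<exists>l2. Adm (pc j) l2 \<and> shift (Suc j) l2 = l' \<and> l2 j = e \<and> bk (pc j) l2 (Suc j) = 1/2
   \<and> (\<forall>i<j. l2 i = (1/2 < (T ^^ (j - Suc i)) b))" for e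
 proof -
  have "\<exists>l2. Adm (pc i) l2 \<and> shift (Suc i) l2 = l' \<and> l2 i = e \<and> bk (pc i) l2 (Suc i) = 1/2" for i
  proof (induction i)
   case 0
   show ?case using Adm_cons_crit(1)[OF A, of e] br_b
    by (intro exI[of _ "case_nat e l'"]) (auto simp: pc_def)
  next
   case (Suc i)
   then obtain l2 where l2: "Adm (pc i) l2" "shift (Suc i) l2 = l'" "l2 i = e" "bk (pc i) l2 (Suc i) = 1/2"
    by blast
   have ne: "pc i ~= 1/2" using pc_neq_crit by (simp add: pc_def)
   have "T (pc i) = pc (Suc i)" by (simp add: pc_def)
   thus ?case
    using Adm_cons[OF l2(1) ne refl] l2(2-4)
    by (intro exI[of _ "case_nat (1/2 < pc i) l2"]) (auto simp del: bk.simps)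
  qed
  then obtain l2 where "Adm (pc j) l2" "shift (Suc j) l2 = l'" "l2 j = e" "bk (pc j) l2 (Suc j) = 1/2"
   by blast
  thus ?thesis using crit_code(4)[of "pc j" l2 j] by blast
 qed
 obtain l2 where l2: "Adm (pc j) l2" "shift (Suc j) l2 = l'" "l2 j = True" "bk (pc j) l2 (Suc j) = 1/2"
   "\<And>i. i < j ==> l2 i = (1/2 < (T ^^ (j - Suc i)) b)" using ex[of True] by blast
 obtain l3 where l3: "Adm (pc j) l3" "shift (Suc j) l3 = l'" "l3 j = False" "bk (pc j) l3 (Suc j) = 1/2"
   "\<And>i. i < j ==> l3 i = (1/2 < (T ^^ (j - Suc i)) b)" using ex[of False] by blast
 have same: "l2 i = l3 i" if "i ~= j" for i
 proof (cases "i < j")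
  case True
  thus ?thesis using l2(5) l3(5) by simp
 next
  case False
  hence "i = (i - Suc j) + Suc j" using that by simp
  thus ?thesis using l2(2) l3(2) by metis
 qed
 define x where "x = bk (pc j) l2"
 have x3: "bk (pc j) l3 = x"
 proof
  fix i
  have lo: "i \<le> j ==> bk (pc j) l3 i = x i" for i using same by (induction i) (auto simp: x_def)
  show "bk (pc j) l3 i = x i"
  proof (cases "i \<le> j")
   case False
   hence "i = (i - Suc j) + Suc j" by simp
   thus ?thesis
    using bk_shift[of "pc j" l3 "i - Suc j" "Suc j"] bk_shift[of "pc j" l2 "i - Suc j" "Suc j"]
     l2(2,4) l3(2,4) by (simp add: x_def)
  qed (rule lo)
 qed
 have core: "x \<in> tent_core s" unfolding x_def by (rule Adm_core[OF l2(1)])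
 have r: "represents s (code_ext (pc j) l2) x" "represents s (code_ext (pc j) l3) x"
  using represents_code_ext[OF l2(1)] represents_code_ext[OF l3(1)] x3 by (auto simp: x_def)
 define k' where "k' = - int (Suc j)"
 have kn: "code_ext (pc j) ll (k' + 1 + int i) = kneading s i"
  if "\<And>i. i < j ==> ll i = (1/2 < (T ^^ (j - Suc i)) b)" for ll i
 proof (cases "i < j")
  case True
  have e: "k' + 1 + int i < 0" "nat (- (k' + 1 + int i) - 1) = j - Suc i"
   using True by (simp_all add: k'_def)
  have "j - Suc (j - Suc i) = i" using True by simp
  hence "code_ext (pc j) ll (k' + 1 + int i) = (1/2 < (T ^^ i) b)"
   using e that[of "j - Suc i"] True by (simp add: code_ext_def)
  moreover have "(T ^^ i) b = (T ^^ Suc i) (1/2)" by (simp only: funpow_Suc_right o_apply T_crit)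
  ultimately show ?thesis using kneading_eq[of i] pc_neq_crit[of i]
   by (simp add: order.strict_iff_order eq_commute)
 next
  case False
  have "(T ^^ (i - j)) (pc j) = (T ^^ Suc i) (1/2)"
   using False T_crit by (simp add: pc_def funpow_T_add funpow_swap1)
  moreover have "k' + 1 + int i = int (i - j)" using False by (simp add: k'_def of_nat_diff)
  ultimately show ?thesis using kneading_eq[of i] by (simp add: code_ext_def)
 qed
 have id: "identified_at s k' (code_ext (pc j) l2) (code_ext (pc j) l3)"
  unfolding identified_at_def
 proof (intro conjI allI impI)
  show "code_ext (pc j) l2 k' ~= code_ext (pc j) l3 k'" using l2(3) l3(3) by (simp add: code_ext_def k'_def)
  show "code_ext (pc j) l2 i = code_ext (pc j) l3 i" if "i ~= k'" for i
   using same[of "nat (- i - 1)"] that by (auto simp: code_ext_def k'_def)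
  show "code_ext (pc j) l2 (k' + 1 + int i) = kneading s i" for i using kn[of l2] l2(5) by blast
  show "code_ext (pc j) l3 (k' + 1 + int i) = kneading s i" for i using kn[of l3] l3(5) by blast
 qed
 have w: "subword (code_ext (pc j) l2) (k' + 1) (nat (- k' - 1)) = map (%i. l2 (j - Suc i)) [0..<j]"
  unfolding subword_def
  by (intro map_cong) (auto simp: code_ext_def k'_def of_nat_diff nat_diff_distrib')
 have sem: "z \<in> semicircle (odd (ones (subword (code_ext (pc j) l2) (k' + 1) (nat (- k' - 1))))) (x 0)
    (psi0 (left_part (code_ext (pc j) l2))) (psi0 (left_part (code_ext (pc j) l3)))"
 proof -
  have "semicircle (odd (ones (map (%i. l2 (j - Suc i)) [0..<j]))) (pc j) (psi0 l2) (psi0 l3)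
    = cap j (1/2 - psi0 (shift (Suc j) l2) / 3)"
   using l2(3) l3(3) by (intro semicircle_cap[OF l2(1,4) l3(1)]) (auto simp: same)
  thus ?thesis using z l2(2) unfolding w left_part_code_ext by (simp add: x_def)
 qed
 have "z \<in> draw_point s L_ray x"
  unfolding draw_point_def
 proof (rule UnI2, rule UnionI[OF _ sem], rule CollectI, intro exI conjI)
  show "k' < 0" by (simp add: k'_def)
 qed (rule refl r id)+
 moreover have "x \<in> tent_limit s" using core by (rule core_limit)
 hence "x \<in> basic_arc s l2" using r(1) left_part_code_ext by (auto simp: basic_arc_def)
 moreover have "l = shift N l2"
 proof
  fix i
  have "l i = l2 ((i + k) + Suc j)" using fun_cong[OF h(3), of i] fun_cong[OF l2(2), of "i + k"] by simp
  also have "(i + k) + Suc j = i + N" using h(1) by simp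
  finally show "l i = shift N l2 i" .
 qed
 ultimately show ?thesis using core by blast
qed

definition KK :: "(real \<times> real) set" where "KK = {z. \<exists>N y l. strand N y l z}"

lemma KK_eq_phi: "phi s L_ray (tent_core s) = KK"
proof
 show "phi s L_ray (tent_core s) \<subseteq> KK" using phi_core_subset unfolding phi_def KK_def by blast
 show "KK \<subseteq> phi s L_ray (tent_core s)" using phi_core_supset unfolding phi_def KK_def by blast
qed

end

section \<open>Closedness\<close>

text \<open>At the first differing symbol the heights lie in opposite outer thirds of an interval of
  the Cantor construction, at least its middle third apart.\<close>

lemma psi0_close_imp:
 assumes "\<bar>psi0 l - psi0 l'\<bar> < 1 / 3 ^ N" "k < N"
 shows "l k = l' k"
proof (rule ccontr)
 assume ne: "l k ~= l' k"
 define j where "j = (LEAST j. l j ~= l' j)"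
 have j: "l j ~= l' j" unfolding j_def by (rule LeastI[of "%j. l j ~= l' j", OF ne])
 have jk: "j \<le> k" unfolding j_def by (rule Least_le[of "%j. l j ~= l' j", OF ne])
 have same: "l i = l' i" if "i < j" for i using not_less_Least[OF that[unfolded j_def]] by blast
 define x y where "x = psi0 (shift (Suc j) l)" and "y = psi0 (shift (Suc j) l')"
 have "psi0 l = hg l j (H (l j) x)" "psi0 l' = hg l j (H (l' j) y)"
  using psi0_hg[of l "Suc j"] psi0_hg[of l' "Suc j"] hg_cong[of j l l'] same by (simp_all add: x_def y_def)
 hence "\<bar>psi0 l - psi0 l'\<bar> = \<bar>H (l j) x - H (l' j) y\<bar> / 3 ^ j" by (simp add: hg_diff abs_mult)
 also have "\<bar>H (l j) x - H (l' j) y\<bar> \<ge> 1 / 3"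
  using j psi0_range[of "shift (Suc j) l"] psi0_range[of "shift (Suc j) l'"]
  by (cases "l j") (auto simp: H_def x_def y_def abs_if field_simps)
 hence "\<bar>H (l j) x - H (l' j) y\<bar> / 3 ^ j \<ge> (1 / 3) / 3 ^ j" by (rule divide_right_mono) simp
 moreover have "(1 :: real) / 3 ^ N \<le> 1 / 3 ^ Suc j"
  using jk assms(2) by (intro divide_left_mono power_increasing) auto
 ultimately show False using assms(1) by simp
qed

context tent_rot
begin

lemma bk_cong: "(\<And>i. i < k ==> l i = l' i) ==> bk y l k = bk y l' k"
 by (induction k) auto

lemma bk_tendsto: "(f \<longlongrightarrow> y) F ==> ((%x. bk (f x) l k) \<longlongrightarrow> bk y l k) F"
proof (induction k)
 case (Suc k)
 hence "((%x. bk (f x) l k) \<longlongrightarrow> bk y l k) F" by simp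
 hence "((%x. bk (f x) l k / s) \<longlongrightarrow> bk y l k / s) F" using s_pos by (intro tendsto_intros) auto
 thus ?case by (cases "l k") (auto simp: br_def intro: tendsto_intros)
qed simp

text \<open>Convergence of heights stabilises every symbol, and each condition of admissibility
  involves finitely many symbols and a weak inequality, so it passes to the limit.\<close>

lemma Adm_limit:
 assumes A: "\<And>k. Adm (y k) (c k)" and y: "y \<longlonglongrightarrow> y'" and v: "(%k. psi0 (c k)) \<longlonglongrightarrow> v"
 shows "\<exists>l. Adm y' l \<and> v = psi0 l \<and> (\<forall>i. \<forall>\<^sub>F k in sequentially. c k i = l i)"
proof -
 have "Cauchy (%k. psi0 (c k))" using v LIMSEQ_imp_Cauchy by blast
 hence "\<exists>M. \<forall>k\<ge>M. \<forall>k'\<ge>M. \<bar>psi0 (c k) - psi0 (c k')\<bar> < 1 / 3 ^ N" for N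
  by (auto simp: Cauchy_def dist_real_def)
 hence "\<forall>N. \<exists>M. \<forall>k\<ge>M. \<forall>i<N. c k i = c M i"
  using psi0_close_imp by (metis order_refl)
 then obtain M where M: "\<And>N k i. M N \<le> k ==> i < N ==> c k i = c (M N) i" by metis
 define l where "l i = c (M (Suc i)) i" for i
 have ev: "\<forall>\<^sub>F k in sequentially. c k i = l i" for i
  unfolding eventually_sequentially l_def using M[of "Suc i"] by blast
 have ev1: "\<forall>\<^sub>F k in sequentially. \<forall>i<N. c k i = l i" for N
 proof -
  have "\<forall>\<^sub>F k in sequentially. \<forall>i\<in>{..<N}. c k i = l i" by (rule eventually_ball_finite) (auto simp: ev)
  thus ?thesis by (rule eventually_mono) auto
 qed
 have "(%k. psi0 (c k)) \<longlonglongrightarrow> psi0 l"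
 proof (rule tendstoI)
  fix e :: real assume "0 < e"
  then obtain N where N: "1 / 3 ^ N < e" using real_arch_pow_inv[of e "1/3"] by (auto simp: power_one_over)
  show "\<forall>\<^sub>F k in sequentially. dist (psi0 (c k)) (psi0 l) < e"
   using ev1[of N]
  proof eventually_elim
   case (elim k)
   hence "\<bar>psi0 (c k) - psi0 l\<bar> \<le> 1 / 3 ^ N" by (intro psi0_close) auto
   thus ?case using N by (simp add: dist_real_def)
  qed
 qed
 hence v': "v = psi0 l" using v LIMSEQ_unique by blast
 have "s * a \<le> bk y' l i" if "\<not> l i" for i
 proof (rule tendsto_lowerbound[OF bk_tendsto[OF y]])
  show "\<forall>\<^sub>F k in sequentially. s * a \<le> bk (y k) l i"
   using ev1[of "Suc i"]
  proof eventually_elim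
   case (elim k)
   hence "bk (y k) (c k) i = bk (y k) l i" "\<not> c k i" using that by (auto intro: bk_cong)
   thus ?case using A[of k] by (metis Adm_def)
  qed
 qed simp
 moreover have "a \<le> y'" "y' \<le> b"
  using tendsto_lowerbound[OF y, of a] tendsto_upperbound[OF y, of b] A by (auto simp: Adm_def)
 ultimately have "Adm y' l" by (simp add: Adm_def)
 thus ?thesis using v' ev by blast
qed

lemma closed_Str: "closed {z. \<exists>y l. strand 0 y l z \<and> (\<forall>i\<in>I. l i = e)}"
 unfolding closed_sequential_limits
proof (intro allI impI)
 fix x :: "nat => real \<times> real" and z
 assume h: "(\<forall>k. x k \<in> {z. \<exists>y l. strand 0 y l z \<and> (\<forall>i\<in>I. l i = e)}) \<and> x \<longlonglongrightarrow> z"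
 then obtain y c where yc: "\<And>k. Adm (y k) (c k)" "\<And>k. x k = (y k, psi0 (c k))" "\<And>k i. i \<in> I ==> c k i = e"
  unfolding strand_0 mem_Collect_eq by metis
 have "y \<longlonglongrightarrow> fst z" "(%k. psi0 (c k)) \<longlonglongrightarrow> snd z"
  using tendsto_fst[of x z sequentially] tendsto_snd[of x z sequentially] h yc(2) by auto
 from Adm_limit[OF yc(1) this] obtain l where
  l: "Adm (fst z) l" "snd z = psi0 l" "\<And>i. \<forall>\<^sub>F k in sequentially. c k i = l i" by blast
 have "l i = e" if "i \<in> I" for i
  using eventually_happens[OF l(3)[of i]] yc(3)[OF that] by auto
 hence "strand 0 (fst z) l z \<and> (\<forall>i\<in>I. l i = e)" using l by (simp add: strand_0 prod_eq_iff)
 thus "z \<in> {z. \<exists>y l. strand 0 y l z \<and> (\<forall>i\<in>I. l i = e)}" by blast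
qed

definition Yset :: "real => real set" where "Yset y = {psi0 l |l. Adm y l}"

lemma closed_Yset_sym: "closed {psi0 l |l. Adm y l \<and> (\<forall>i\<in>I. l i = e)}"
proof -
 have "{psi0 l |l. Adm y l \<and> (\<forall>i\<in>I. l i = e)}
   = (%v. (y, v)) -` {z. \<exists>y l. strand 0 y l z \<and> (\<forall>i\<in>I. l i = e)}"
  by (auto simp: strand_0)
 moreover have "closed ((%v. (y, v)) -` {z. \<exists>y l. strand 0 y l z \<and> (\<forall>i\<in>I. l i = e)})"
  by (rule closed_vimage[OF closed_Str]) (intro continuous_intros)
 ultimately show ?thesis by simp
qed

lemma closed_Yset: "closed (Yset y)"
 using closed_Yset_sym[of y "{}"] by (simp add: Yset_def)

definition height :: "nat => real \<times> real => real" where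
 "height j z = 3 * (1/2 - 3 ^ j * norm (z - (pc j, qc j)))"

lemma continuous_height: "continuous_on S (height j)"
 unfolding height_def by (intro continuous_intros)

lemma cap_height_iff:
 assumes "0 \<le> r"
 shows "z \<in> cap j r \<longleftrightarrow> 3 ^ j * norm (z - (pc j, qc j)) = r \<and> 0 \<le> ec j * (fst z - pc j)"
proof -
 obtain u v where z: "z = (u, v)" by (cases z)
 have "norm (z - (pc j, qc j)) = sqrt ((u - pc j)\<^sup>2 + (v - qc j)\<^sup>2)"
  by (simp add: z norm_prod_def)
 moreover have "(u - pc j)\<^sup>2 + (v - qc j)\<^sup>2 = (r / 3 ^ j)\<^sup>2 \<longleftrightarrow> sqrt ((u - pc j)\<^sup>2 + (v - qc j)\<^sup>2) = r / 3 ^ j"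
 proof
  assume "sqrt ((u - pc j)\<^sup>2 + (v - qc j)\<^sup>2) = r / 3 ^ j"
  hence "(sqrt ((u - pc j)\<^sup>2 + (v - qc j)\<^sup>2))\<^sup>2 = (r / 3 ^ j)\<^sup>2" by (rule arg_cong)
  thus "(u - pc j)\<^sup>2 + (v - qc j)\<^sup>2 = (r / 3 ^ j)\<^sup>2" by simp
 next
  assume "(u - pc j)\<^sup>2 + (v - qc j)\<^sup>2 = (r / 3 ^ j)\<^sup>2"
  thus "sqrt ((u - pc j)\<^sup>2 + (v - qc j)\<^sup>2) = r / 3 ^ j" using assms by simp
 qed
 ultimately show ?thesis by (auto simp: z cap_def field_simps)
qed

lemma cap_psi0_iff:
 "z \<in> cap j (1/2 - psi0 l / 3) \<longleftrightarrow> height j z = psi0 l \<and> 0 \<le> ec j * (fst z - pc j)"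
 using cap_height_iff[of "1/2 - psi0 l / 3" z j] psi0_range[of l] by (auto simp: height_def field_simps)

definition Caps :: "nat => (real \<times> real) set" where "Caps j = {z. \<exists>l. strand (Suc j) (1/2) l z}"

lemma closed_Caps_sym: "closed {z. \<exists>l. strand (Suc j) (1/2) l z \<and> (\<forall>i\<in>I. l i = e)}"
proof -
 have "{z. \<exists>l. strand (Suc j) (1/2) l z \<and> (\<forall>i\<in>I. l i = e)}
   = (height j -` {psi0 l |l. Adm (1/2) l \<and> (\<forall>i\<in>I. l i = e)}) \<inter> {z. 0 \<le> ec j * (fst z - pc j)}"
  unfolding strand_crit cap_psi0_iff by auto
 moreover have "closed (height j -` {psi0 l |l. Adm (1/2) l \<and> (\<forall>i\<in>I. l i = e)})"
  by (rule closed_vimage[OF closed_Yset_sym continuous_height])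
 moreover have "closed {z :: real \<times> real. 0 \<le> ec j * (fst z - pc j)}"
  by (intro closed_Collect_le continuous_intros)
 ultimately show ?thesis by (simp add: closed_Int)
qed

lemma closed_Caps: "closed (Caps j)"
 using closed_Caps_sym[of j "{}"] by (simp add: Caps_def)

section \<open>The points to which the semicircles shrink\<close>

definition cd :: "int => nat => bool" where "cd i k = lam (i + int k)"
definition Fold :: "int => real \<times> real" where "Fold i = (Z i, psi0 (cd i))"

lemma shift_cd: "shift N (cd i) = cd (i + int N)" by (auto simp: cd_def algebra_simps)

lemma bk_cd: "bk (Z i) (cd i) k = Z (i + int k)"
 by (induction k) (auto simp: cd_def Z_br algebra_simps)

lemma Adm_cd: "Adm (Z i) (cd i)"
 using Z_range[of i] not_lam_gt by (auto simp: Adm_def bk_cd cd_def less_imp_le)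

lemma strand_Fold: "strand 0 (Z i) (cd i) (Fold i)" by (simp add: strand_0 Adm_cd Fold_def)

lemma Fold_period: "Fold (i + int n * j) = Fold i"
proof -
 have "cd (i + int n * j) k = cd i k" for k
  using lam_period[of "i + int k" j] by (simp add: cd_def algebra_simps)
 hence "cd (i + int n * j) = cd i" by (rule ext)
 thus ?thesis by (simp add: Fold_def Z_period)
qed

lemma finite_Fold: "finite (range Fold)"
proof -
 have "range Fold \<subseteq> Fold ` {0..<int n}"
 proof
  fix x assume "x \<in> range Fold"
  then obtain i where i: "x = Fold i" by auto
  have "Fold i = Fold (i mod int n + int n * (i div int n))" by simp
  hence "x = Fold (i mod int n)" unfolding Fold_period using i by simp
  moreover have "i mod int n \<in> {0..<int n}" using n_pos by simp
  ultimately show "x \<in> Fold ` {0..<int n}" by blast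
 qed
 thus ?thesis by (rule finite_subset) simp
qed

lemma pc_eq: "pc j = (if j = 0 then b else if j = 1 then a else Z (2 - int j))"
proof -
 have "pc j = (T ^^ Suc j) (1/2)" unfolding pc_def by (simp only: funpow_Suc_right o_apply T_crit)
 thus ?thesis using crit_orbit_cases[of j] by (auto simp: of_nat_diff)
qed

lemma pc_pow: "(T ^^ i) (pc j) = pc (i + j)" unfolding pc_def by (rule funpow_T_add)

text \<open>The radius contributes at most \<open>1 / 3 ^ j\<close>. The centre shares
  \<open>j - 2\<close> symbols with the code of the limit point, which contributes
  \<open>9 / 3 ^ j\<close>.\<close>

lemma cap_near_Fold:
 assumes j: "2 \<le> j" and z: "z \<in> cap j r" and r: "0 \<le> r" "r \<le> 1/2"
 shows "dist z (Fold (2 - int j)) \<le> 10 / 3 ^ j"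
proof -
 obtain u v where uv: "z = (u, v)" by (cases z)
 obtain i where i: "j = i + 2" using j by (metis add.commute le_Suc_ex)
 have p: "pc j = Z (2 - int j)" using j pc_eq[of j] by simp
 have dz: "dist z (pc j, qc j) \<le> 1 / 3 ^ j"
  using z r cap_height_iff[of r z j] by (simp add: dist_norm field_simps)
 have bki: "bk (Z (2 - int j)) (cd (2 - int j)) i = pc 2" using i pc_eq[of 2] by (simp add: bk_cd)
 have q: "qc j = hg (cd (2 - int j)) i (vh 2 b (1/2))"
 proof -
  have "qc j = vh i (pc 2) (vh 2 b (1/2))"
   using vh_add[of 2 i b "1/2"] i by (simp add: qc_def pc_def add.commute)
  thus ?thesis using vh_hg(1)[OF Adm_cd, of i "2 - int j"] bki Z_neq_crit by (simp add: bk_cd)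
 qed
 have "psi0 (cd (2 - int j)) = hg (cd (2 - int j)) i (psi0 (shift i (cd (2 - int j))))" by (rule psi0_hg)
 hence "\<bar>qc j - psi0 (cd (2 - int j))\<bar>
   = \<bar>vh 2 b (1/2) - psi0 (shift i (cd (2 - int j)))\<bar> / 3 ^ i"
  unfolding q by (simp add: hg_diff abs_mult)
 also have "\<dots> \<le> 1 / 3 ^ i"
  using psi0_range[of "shift i (cd (2 - int j))"] vh_range[of "1/2" 2 b]
  by (intro divide_right_mono) (auto simp: abs_le_iff)
 also have "\<dots> = 9 / 3 ^ j" by (simp add: i)
 finally have "dist (pc j, qc j) (Fold (2 - int j)) \<le> 9 / 3 ^ j"
  by (simp add: Fold_def p dist_prod_def dist_real_def)
 hence "dist z (Fold (2 - int j)) \<le> 1 / 3 ^ j + 9 / 3 ^ j"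
  using dz dist_triangle[of z "Fold (2 - int j)" "(pc j, qc j)"] by linarith
 thus ?thesis by simp
qed

lemma Caps_near_Fold: "2 \<le> j ==> z \<in> Caps j ==> dist z (Fold (2 - int j)) \<le> 10 / 3 ^ j"
proof -
 assume j: "2 \<le> j" and "z \<in> Caps j"
 then obtain l where "z \<in> cap j (1/2 - psi0 l / 3)" by (auto simp: Caps_def strand_crit)
 thus ?thesis using psi0_range[of l] by (intro cap_near_Fold[OF j, where r = "1/2 - psi0 l / 3"]) auto
qed

lemma ex_pow3: "0 < e ==> \<exists>M. \<forall>j\<ge>M. 10 / 3 ^ j < (e :: real)"
proof -
 assume "0 < e"
 then obtain M where M: "(1 / 3 :: real) ^ M < e / 10" using real_arch_pow_inv[of "e / 10" "1/3"] by auto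
 have "10 / 3 ^ j < e" if "M \<le> j" for j
 proof -
  have "(1 / 3 :: real) ^ j \<le> (1 / 3) ^ M" using that by (intro power_decreasing) auto
  thus ?thesis using M by (simp add: power_one_over)
 qed
 thus ?thesis by blast
qed

text \<open>Infinitely many semicircles can accumulate only at points \<open>Fold i\<close>, since
  deep ones are tiny and close to such a point. Adding these points makes the union closed.\<close>

lemma closed_Fold_Caps:
 assumes "\<And>j. j \<in> J ==> 2 \<le> j"
 shows "closed ((%j. Fold (2 - int j)) ` J \<union> (\<Union>j\<in>J. Caps j))"
proof -
 define A where "A = (%j. Fold (2 - int j)) ` J"
 have finA: "finite A" unfolding A_def by (rule finite_subset[OF _ finite_Fold]) auto
 have "\<exists>e>0. \<forall>z'\<in>A \<union> (\<Union>j\<in>J. Caps j). e \<le> dist z z'" if z: "z \<notin> A \<union> (\<Union>j\<in>J. Caps j)" for z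
 proof -
  obtain d where d: "0 < d" "\<And>z'. z' \<in> A ==> d \<le> dist z z'"
   using separate_point_closed[of A z] finite_imp_closed[OF finA] z by auto
  obtain M where M: "\<And>j. M \<le> j ==> 10 / 3 ^ j < d / 2" using ex_pow3[of "d / 2"] d by auto
  have "closed (\<Union>j\<in>J \<inter> {..<M}. Caps j)" by (intro closed_UN) (auto simp: closed_Caps)
  then obtain d' where d': "0 < d'" "\<And>z'. z' \<in> (\<Union>j\<in>J \<inter> {..<M}. Caps j) ==> d' \<le> dist z z'"
   using separate_point_closed[of "\<Union>j\<in>J \<inter> {..<M}. Caps j" z] z by auto
  have "min (d / 2) d' \<le> dist z z'" if z': "z' \<in> A \<union> (\<Union>j\<in>J. Caps j)" for z'
  proof -
   consider "z' \<in> A" | j where "j \<in> J" "z' \<in> Caps j" "j < M" | j where "j \<in> J" "z' \<in> Caps j" "M \<le> j"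
    using z' by (metis UN_E UnE not_less)
   thus ?thesis
   proof cases
    case 1
    thus ?thesis using d(2)[of z'] d(1) by simp
   next
    case 2
    hence "z' \<in> (\<Union>j\<in>J \<inter> {..<M}. Caps j)" by blast
    thus ?thesis using d'(2)[of z'] by simp
   next
    case 3
    have "d \<le> dist z (Fold (2 - int j))" using d(2) 3(1) by (simp add: A_def)
    moreover have "dist z' (Fold (2 - int j)) < d / 2"
     using Caps_near_Fold[OF assms[OF 3(1)] 3(2)] M[OF 3(3)] by simp
    ultimately show ?thesis using dist_triangle[of z "Fold (2 - int j)" z'] by simp
   qed
  qed
  thus ?thesis using d(1) d'(1) by (intro exI[of _ "min (d / 2) d'"]) auto
 qed
 hence "open (- (A \<union> (\<Union>j\<in>J. Caps j)))"
  unfolding open_dist by (metis ComplD ComplI dist_commute not_less)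
 thus ?thesis unfolding A_def closed_def .
qed

text \<open>The points whose symbol at depth \<open>i\<close> is \<open>e\<close>. It is read from
  the code at level zero, from the code behind a shallower fold, or, at a deeper fold, from the
  critical orbit; only on \<open>Caps i\<close> may it be undetermined. Closedness of these sets
  lets connectedness speak about symbols.\<close>

definition R :: "nat => bool => (real \<times> real) set" where
 "R i e = {z. \<exists>y l. strand 0 y l z \<and> l i = e}
   \<union> {z. \<exists>j<i. \<exists>l. strand (Suc j) (1/2) l z \<and> l (i - Suc j) = e}
   \<union> (\<Union>j\<in>{j. i < j \<and> (1/2 < pc (j - Suc i)) = e}. Caps j)"

lemma closed_R: "closed (R i e)"
proof -
 define J where "J = {j. i < j \<and> (1/2 < pc (j - Suc i)) = e}"
 define J' where "J' = {j \<in> J. i + 3 \<le> j}"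
 \<comment> \<open>The limit points of the deep semicircles carry the symbol \<open>e\<close> as
   well, so they already belong to the first of the three pieces.\<close>
 have sub: "(%j. Fold (2 - int j)) ` J' \<subseteq> {z. \<exists>y l. strand 0 y l z \<and> l i = e}"
 proof
  fix z assume "z \<in> (%j. Fold (2 - int j)) ` J'"
  then obtain j where j: "z = Fold (2 - int j)" "i + 3 \<le> j" "(1/2 < pc (j - Suc i)) = e"
   by (auto simp: J'_def J_def)
  have "2 \<le> j - Suc i" "2 - int (j - Suc i) = (2 - int j + int i) + 1" using j(2) by auto
  moreover have "pc (j - Suc i) = Z (2 - int (j - Suc i))"
   using \<open>2 \<le> j - Suc i\<close> by (subst pc_eq) auto
  ultimately have "pc (j - Suc i) = Z ((2 - int j + int i) + 1)" by (simp only:)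
  hence "(1/2 < Z ((2 - int j + int i) + 1)) = e" using j(3) by (simp only:)
  hence "cd (2 - int j) i = e" unfolding cd_def Z_sym .
  thus "z \<in> {z. \<exists>y l. strand 0 y l z \<and> l i = e}" using strand_Fold j(1) by blast
 qed
 have J: "J = J' \<union> (J \<inter> {..<i + 3})" by (auto simp: J'_def)
 have "R i e = {z. \<exists>y l. strand 0 y l z \<and> (\<forall>k\<in>{i}. l k = e)}
   \<union> (\<Union>j\<in>{..<i}. {z. \<exists>l. strand (Suc j) (1/2) l z \<and> (\<forall>k\<in>{i - Suc j}. l k = e)})
   \<union> ((%j. Fold (2 - int j)) ` J' \<union> (\<Union>j\<in>J'. Caps j)) \<union> (\<Union>j\<in>J \<inter> {..<i + 3}. Caps j)"
  unfolding R_def J_def[symmetric] using sub by (subst J) auto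
 moreover have "closed {z. \<exists>y l. strand 0 y l z \<and> (\<forall>k\<in>{i}. l k = e)}" by (rule closed_Str)
 moreover have "closed (\<Union>j\<in>{..<i}. {z. \<exists>l. strand (Suc j) (1/2) l z \<and> (\<forall>k\<in>{i - Suc j}. l k = e)})"
  by (rule closed_UN) (simp, rule ballI, rule closed_Caps_sym)
 moreover have "closed ((%j. Fold (2 - int j)) ` J' \<union> (\<Union>j\<in>J'. Caps j))"
  by (rule closed_Fold_Caps) (auto simp: J'_def)
 moreover have "closed (\<Union>j\<in>J \<inter> {..<i + 3}. Caps j)"
  by (intro closed_UN) (auto simp: closed_Caps)
 ultimately show ?thesis by (auto intro!: closed_Un)
qed

definition Str :: "(real \<times> real) set" where "Str = {z. \<exists>y l. strand 0 y l z}"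

lemma KK_iff: "z \<in> KK \<longleftrightarrow> z \<in> Str \<or> (\<exists>j. z \<in> Caps j)"
proof
 assume "z \<in> KK"
 then obtain N y l where "strand N y l z" by (auto simp: KK_def)
 from strand_base[OF this] show "z \<in> Str \<or> (\<exists>j. z \<in> Caps j)" unfolding Str_def Caps_def by blast
qed (auto simp: KK_def Str_def Caps_def)

lemma closed_KK: "closed KK"
proof -
 have cS: "closed Str" using closed_Str[of "{}"] by (simp add: Str_def)
 have "range Fold \<subseteq> Str" using strand_Fold unfolding Str_def by blast
 hence F: "(%j. Fold (2 - int j)) ` {2..} \<subseteq> Str" by blast
 have "KK = Str \<union> Caps 0 \<union> Caps 1 \<union> ((%j. Fold (2 - int j)) ` {2..} \<union> (\<Union>j\<in>{2..}. Caps j))"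
 proof (intro set_eqI iffI)
  fix z assume "z \<in> KK"
  then consider "z \<in> Str" | j where "z \<in> Caps j" "2 \<le> j" | "z \<in> Caps 0" | "z \<in> Caps 1"
   unfolding KK_iff by (metis One_nat_def Suc_leI numeral_2_eq_2 not_less_eq_eq le_zero_eq le_Suc_eq)
  thus "z \<in> Str \<union> Caps 0 \<union> Caps 1 \<union> ((%j. Fold (2 - int j)) ` {2..} \<union> (\<Union>j\<in>{2..}. Caps j))"
   by cases blast+
 next
  fix z assume "z \<in> Str \<union> Caps 0 \<union> Caps 1 \<union> ((%j. Fold (2 - int j)) ` {2..} \<union> (\<Union>j\<in>{2..}. Caps j))"
  thus "z \<in> KK" unfolding KK_iff using F by blast
 qed
 moreover have "closed ((%j. Fold (2 - int j)) ` {2..} \<union> (\<Union>j\<in>{2..}. Caps j))"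
  by (rule closed_Fold_Caps) simp
 ultimately show ?thesis using cS closed_Caps by (simp only: closed_Un)
qed

lemma KK_bounds: assumes "(u, v) \<in> KK" shows "- 1 \<le> u" "u \<le> 2" "- 1 \<le> v" "v \<le> 2"
proof -
 have "- 1 \<le> u \<and> u \<le> 2 \<and> - 1 \<le> v \<and> v \<le> 2"
  using assms unfolding KK_iff
 proof (elim disjE exE)
  assume "(u, v) \<in> Str"
  then obtain y l where "Adm y l" "u = y" "v = psi0 l" by (auto simp: Str_def strand_0)
  thus ?thesis using psi0_range[of l] a_pos b_lt1 by (auto simp: Adm_def)
 next
  fix j assume "(u, v) \<in> Caps j"
  then obtain l where z: "(u, v) \<in> cap j (1/2 - psi0 l / 3)" by (auto simp: Caps_def strand_crit)
  have r: "0 \<le> 1/2 - psi0 l / 3" "1/2 - psi0 l / 3 \<le> 1/2" using psi0_range[of l] by auto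
  have "norm ((u, v) - (pc j, qc j)) \<le> 3 ^ j * norm ((u, v) - (pc j, qc j))"
   using mult_right_mono[of 1 "3 ^ j" "norm ((u, v) - (pc j, qc j))"] by simp
  hence "norm ((u, v) - (pc j, qc j)) \<le> 1/2" using z r cap_height_iff[OF r(1)] by simp
  hence "\<bar>u - pc j\<bar> \<le> 1/2" "\<bar>v - qc j\<bar> \<le> 1/2"
   using norm_fst_le[of "u - pc j" "v - qc j"] norm_snd_le[of "v - qc j" "u - pc j"] by auto
  moreover have "a \<le> pc j" "pc j \<le> b" using funpow_range[of b j] ab by (auto simp: pc_def)
  moreover have "0 \<le> qc j" "qc j \<le> 1" using vh_range[of "1/2" j b] by (auto simp: qc_def)
  ultimately show ?thesis using a_pos b_lt1 by linarith
 qed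
 thus "- 1 \<le> u" "u \<le> 2" "- 1 \<le> v" "v \<le> 2" by auto
qed

lemma compact_KK: "compact KK"
proof -
 have "KK \<subseteq> cbox (- 1, - 1) (2, 2)" using KK_bounds by (auto simp: cbox_Pair_eq)
 hence "bounded KK" by (rule bounded_subset[OF bounded_cbox])
 thus ?thesis using closed_KK by (simp only: compact_eq_bounded_closed)
qed

section \<open>Tails along paths\<close>

lemma Caps_pc: "strand 0 y l z ==> z \<in> Caps j ==> bk y l (Suc j) = 1/2 \<and> y = pc j"
proof -
 assume h: "strand 0 y l z" "z \<in> Caps j"
 then obtain l' where l': "strand (Suc j) (1/2) l' z" by (auto simp: Caps_def)
 have "strand (Suc j) (bk y l (Suc j)) (shift (Suc j) l) z" using strand_add[OF h(1), of "Suc j"] by simp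
 hence c: "bk y l (Suc j) = 1/2" using strand_unique[OF _ l'] by blast
 thus ?thesis using crit_code(1)[OF strand_Adm[OF h(1)] c] by simp
qed

lemma crit_bk: "Adm (1/2) l ==> 0 < k ==> bk (1/2) l k ~= 1/2"
 using funpow_T_bk[of "1/2" l k 0] nonper[of k] by auto

text \<open>A common point would put 1/2 twice on one backward orbit and make it periodic.\<close>

lemma Caps_disjoint: assumes "z \<in> Caps i" "z \<in> Caps j" shows "i = j"
proof -
 have "\<not> i < j" if z: "z \<in> Caps i" "z \<in> Caps j" for i j
 proof
  assume "i < j"
  obtain l l' where l: "strand (Suc i) (1/2) l z" "strand (Suc j) (1/2) l' z" using z by (auto simp: Caps_def)
  have "strand (Suc j) (bk (1/2) l (j - i)) (shift (j - i) l) z"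
   using strand_add[OF l(1), of "j - i"] \<open>i < j\<close> by simp
  hence "bk (1/2) l (j - i) = 1/2" using strand_unique[OF _ l(2)] by blast
  thus False using crit_bk[OF strand_Adm[OF l(1)]] \<open>i < j\<close> by simp
 qed
 thus ?thesis using assms by (metis linorder_neqE_nat)
qed

lemma KK_R: "z \<in> KK ==> z \<in> Caps i \<union> R i True \<union> R i False"
 unfolding KK_iff
proof (elim disjE exE)
 assume "z \<in> Str"
 then obtain y l where "strand 0 y l z" by (auto simp: Str_def)
 thus ?thesis by (cases "l i") (auto simp: R_def)
next
 fix j assume z: "z \<in> Caps j"
 then obtain l where l: "strand (Suc j) (1/2) l z" by (auto simp: Caps_def)
 consider "j < i" | "j = i" | "i < j" by linarith
 thus ?thesis
 proof cases
  case 1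
  thus ?thesis using l by (cases "l (i - Suc j)") (auto simp: R_def)
 next
  case 3
  thus ?thesis using z by (cases "1/2 < pc (j - Suc i)") (auto simp: R_def)
 qed (use z in simp)
qed

lemma R_sub_KK: "R i e \<subseteq> KK" unfolding R_def KK_def Caps_def by blast

text \<open>All descriptions of \<open>z\<close> lead to the same strand at level
  \<open>i + 1\<close>. Its base point is not 1/2, so the side on which it lies determines symbol
  \<open>i\<close>.\<close>

lemma R_code:
 assumes "z \<in> R i e" "strand N y l z" "N \<le> i" "z \<notin> Caps i"
 shows "l (i - N) = e"
proof -
 have up: "strand (Suc i) (bk y l (Suc i - N)) (shift (Suc i - N) l) z"
  using strand_add[OF assms(2), of "Suc i - N"] assms(3) by simp
 have A: "Adm y l" using assms(2) strand_Adm by blast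
 have symN: "(1/2 < bk y l (Suc i - N)) = l (i - N)" if "bk y l (Suc i - N) ~= 1/2"
  using bk_sym[OF A, of "i - N"] that assms(3) by (simp add: Suc_diff_le)
 have ne: "bk y l (Suc i - N) ~= 1/2"
  using up assms(4) unfolding Caps_def by auto
 consider y' l' where "strand 0 y' l' z" "l' i = e"
  | j l' where "j < i" "strand (Suc j) (1/2) l' z" "l' (i - Suc j) = e"
  | j where "i < j" "(1/2 < pc (j - Suc i)) = e" "z \<in> Caps j"
  using assms(1) unfolding R_def by blast
 thus ?thesis
 proof cases
  case 1
  have "strand (Suc i) (bk y' l' (Suc i)) (shift (Suc i) l') z" using strand_add[OF 1(1), of "Suc i"] by simp
  hence "bk y' l' (Suc i) = bk y l (Suc i - N)" using strand_unique[OF _ up] by blast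
  thus ?thesis using symN ne bk_sym[OF strand_Adm[OF 1(1)], of i] 1(2) by simp
 next
  case 2
  have "strand (Suc i) (bk (1/2) l' (i - j)) (shift (i - j) l') z"
   using strand_add[OF 2(2), of "i - j"] 2(1) by simp
  hence "bk (1/2) l' (i - j) = bk y l (Suc i - N)" using strand_unique[OF _ up] by blast
  moreover have "i - j = Suc (i - Suc j)" using 2(1) by simp
  ultimately show ?thesis using symN ne bk_sym[OF strand_Adm[OF 2(2)], of "i - Suc j"] 2(3) by simp
 next
  case 3
  obtain l' where l': "strand (Suc j) (1/2) l' z" using 3 by (auto simp: Caps_def)
  have "strand (Suc j) (bk y l (Suc j - N)) (shift (Suc j - N) l) z"
   using strand_add[OF assms(2), of "Suc j - N"] 3(1) assms(3) by simp
  hence "bk y l (Suc j - N) = 1/2" using strand_unique[OF _ l'] by blast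
  moreover have "Suc j - N = (j - i) + (Suc i - N)" using 3(1) assms(3) by simp
  ultimately have "(T ^^ (j - i)) (1/2) = bk y l (Suc i - N)"
   using funpow_T_bk[OF A, of "j - i" "Suc i - N"] by simp
  moreover have "(T ^^ (j - i)) (1/2) = pc (j - Suc i)"
  proof -
   have "j - i = Suc (j - Suc i)" using 3(1) by simp
   thus ?thesis unfolding pc_def by (simp only: funpow_Suc_right o_apply T_crit)
  qed
  ultimately show ?thesis using symN ne 3(2) by simp
 qed
qed

lemma R_Int: assumes "z \<in> R i True" "z \<in> R i False" shows "z \<in> Caps i"
proof (rule ccontr)
 assume n: "z \<notin> Caps i"
 obtain N y l where l: "strand N y l z" using subsetD[OF R_sub_KK assms(1)] by (auto simp: KK_def)
 show False
 proof (cases "N \<le> i")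
  case True
  thus False using R_code[OF assms(1) l True n] R_code[OF assms(2) l True n] by simp
 next
  case False
  from strand_base[OF l] show False
  proof (elim disjE exE conjE)
   fix y' l' assume "strand 0 y' l' z"
   thus False using R_code[OF assms(1) _ _ n] R_code[OF assms(2) _ _ n] by fastforce
  next
   fix j k l' assume j: "N = Suc j + k" "strand (Suc j) (1/2) l' z"
   hence zj: "z \<in> Caps j" by (auto simp: Caps_def)
   have ji: "j ~= i" using zj n by blast
   show False
   proof (cases "j < i")
    case True
    thus False using R_code[OF assms(1) j(2) _ n] R_code[OF assms(2) j(2) _ n] by simp
   next
    case False
    hence ij: "i < j" using ji by simp
    have deep: "(1/2 < pc (j - Suc i)) = e" if z: "z \<in> R i e" for e
    proof -
     consider y' l' where "strand 0 y' l' z" "l' i = e" | j' where "j' < i" "z \<in> Caps j'"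
      | j' where "(1/2 < pc (j' - Suc i)) = e" "z \<in> Caps j'"
      using z unfolding R_def Caps_def by blast
     thus ?thesis
     proof cases
      case 1
      have A: "Adm y' l'" using 1 strand_Adm by blast
      have "bk y' l' (Suc j) = 1/2" using Caps_pc[OF 1(1) zj] by blast
      from crit_code(4)[OF A this ij] show ?thesis using 1(2) by (simp add: pc_def)
     next
      case 2
      thus ?thesis using Caps_disjoint[OF 2(2) zj] ij by simp
     next
      case 3
      thus ?thesis using Caps_disjoint[OF 3(2) zj] by simp
     qed
    qed
    show False using deep[OF assms(1)] deep[OF assms(2)] by simp
   qed
  qed
 qed
qed

lemma Caps_R_end: assumes "z \<in> Caps i" "z \<in> R i e" shows "\<exists>l. strand 0 (pc i) l z \<and> bk (pc i) l (Suc i) = 1/2"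
proof -
 have "(\<exists>y' l'. strand 0 y' l' z) \<or> (\<exists>j'. (j' < i \<or> i < j') \<and> z \<in> Caps j')"
  using assms(2) unfolding R_def Caps_def by blast
 then consider y' l' where "strand 0 y' l' z" | j' where "j' ~= i" "z \<in> Caps j'"
  by (metis nat_neq_iff)
 thus ?thesis
 proof cases
  case 1
  thus ?thesis using Caps_pc[OF 1 assms(1)] by blast
 next
  case 2
  thus ?thesis using Caps_disjoint[OF assms(1)] by blast
 qed
qed

text \<open>Taking the same level \<open>N\<close> on both sides keeps the indices aligned, so tails
  are compared without a shift.\<close>

definition samet :: "real \<times> real => real \<times> real => bool" where
 "samet z z' \<longleftrightarrow> (\<exists>N y y' l. strand N y l z \<and> strand N y' l z')"

lemma samet_sym: "samet z z' ==> samet z' z" unfolding samet_def by blast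

lemma samet_trans: assumes "samet z z'" "samet z' z''" shows "samet z z''"
proof -
 obtain N y y' l where 1: "strand N y l z" "strand N y' l z'" using assms by (auto simp: samet_def)
 obtain N2 y2 y2' l2 where 2: "strand N2 y2 l2 z'" "strand N2 y2' l2 z''" using assms by (auto simp: samet_def)
 have "strand (N + N2) (bk y l N2) (shift N2 l) z" "strand (N + N2) (bk y' l N2) (shift N2 l) z'"
  "strand (N + N2) (bk y2 l2 N) (shift N l2) z'" "strand (N + N2) (bk y2' l2 N) (shift N l2) z''"
  using strand_add[OF 1(1), of N2] strand_add[OF 1(2), of N2] strand_add[OF 2(1), of N]
   strand_add[OF 2(2), of N] by (simp_all add: add.commute)
 moreover from this have "shift N2 l = shift N l2" using strand_unique by blast
 ultimately show ?thesis unfolding samet_def by metis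
qed

lemma tail_imp_samet:
 assumes "strand N y l z" "strand N y' l' z'" "\<And>k. k0 \<le> k ==> l k = l' k"
 shows "samet z z'"
proof -
 have "shift k0 l = shift k0 l'" using assms(3) by auto
 thus ?thesis using strand_add[OF assms(1), of k0] strand_add[OF assms(2), of k0]
  unfolding samet_def by metis
qed

lemma pc_gap: "\<exists>e>0. \<forall>i j. \<bar>pc i - pc j\<bar> < e --> pc i = pc j"
proof -
 define W where "W = {b, a} \<union> range Z"
 define F where "F = (%(x, y). \<bar>x - y\<bar>) ` (W \<times> W) - {0}"
 have "finite W" unfolding W_def using finite_range_Z by simp
 hence fin: "finite F" unfolding F_def by simp
 have pcW: "pc i \<in> W" for i using pc_eq[of i] by (auto simp: W_def)
 have inF: "pc i = pc j \<or> \<bar>pc i - pc j\<bar> \<in> F" for i j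
 proof -
  have "\<bar>pc i - pc j\<bar> \<in> (%(x, y). \<bar>x - y\<bar>) ` (W \<times> W)"
   using pcW by (intro rev_image_eqI[of "(pc i, pc j)"]) auto
  moreover have "pc i ~= pc j ==> \<bar>pc i - pc j\<bar> \<notin> {0}" by simp
  ultimately show ?thesis unfolding F_def by blast
 qed
 show ?thesis
 proof (cases "F = {}")
  case True
  thus ?thesis using inF by (intro exI[of _ 1]) auto
 next
  case False
  have "0 < Min F" using fin False by (subst Min_gr_iff) (auto simp: F_def)
  moreover have "pc i = pc j" if "\<bar>pc i - pc j\<bar> < Min F" for i j
  proof (rule ccontr)
   assume "pc i ~= pc j"
   hence "\<bar>pc i - pc j\<bar> \<in> F" using inF by blast
   thus False using Min_le[OF fin] that by fastforce
  qed
  ultimately show ?thesis by blast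
 qed
qed

lemma connected_split:
 assumes "connected C" "C \<subseteq> A \<union> B" "closed A" "closed B" "C \<inter> A ~= {}" "C \<inter> B ~= {}"
 shows "C \<inter> A \<inter> B ~= {}"
 using assms unfolding connected_closed by blast

text \<open>A connected set that misses \<open>Caps i\<close> cannot change symbol \<open>i\<close>,
  because \<open>R i True\<close> and \<open>R i False\<close> are closed and meet only in
  \<open>Caps i\<close>. A sufficiently small connected set meets the semicircles of at most one
  depth, so all symbols beyond it are constant.\<close>

lemma small_connected_samet:
 "\<exists>e>0. \<forall>C. connected C --> C \<subseteq> KK --> (\<forall>z\<in>C. \<forall>z'\<in>C. dist z z' < e) --> (\<forall>z\<in>C. \<forall>z'\<in>C. samet z z')"
proof -
 obtain e where e: "0 < e" "\<And>i j. \<bar>pc i - pc j\<bar> < e ==> pc i = pc j" using pc_gap by blast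
 have "samet z z'" if C: "connected C" "C \<subseteq> KK" "\<forall>z\<in>C. \<forall>z'\<in>C. dist z z' < e" "z \<in> C" "z' \<in> C" for C z z'
 proof -
  have avoid: "C \<subseteq> R i True \<or> C \<subseteq> R i False" if "C \<inter> Caps i = {}" for i
  proof (rule ccontr)
   assume "\<not> ?thesis"
   moreover have sub: "C \<subseteq> R i True \<union> R i False" using KK_R C(2) that by blast
   ultimately have "C \<inter> R i True ~= {}" "C \<inter> R i False ~= {}" by blast+
   from connected_split[OF C(1) sub closed_R closed_R this] show False using R_Int that by blast
  qed
  have ends: "\<exists>x\<in>C. \<exists>l. strand 0 (pc i) l x \<and> bk (pc i) l (Suc i) = 1/2"
   if "C \<inter> Caps i ~= {}" "\<not> C \<subseteq> Caps i" for i
  proof -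
   have sub: "C \<subseteq> Caps i \<union> (R i True \<union> R i False)" using KK_R C(2) by blast
   hence "C \<inter> (R i True \<union> R i False) ~= {}" using that(2) by blast
   from connected_split[OF C(1) sub closed_Caps closed_Un[OF closed_R closed_R] that(1) this]
   obtain x where "x \<in> C" "x \<in> Caps i" "x \<in> R i True \<or> x \<in> R i False" by blast
   thus ?thesis using Caps_R_end by blast
  qed
  \<comment> \<open>Two depths \<open>i < j\<close> would provide feet over \<open>pc i\<close> and
    \<open>pc j\<close>, which are equal by smallness, with the same symbols before
    \<open>i\<close>. The deeper foot would then reach 1/2 after \<open>i + 1\<close> and again
    after \<open>j + 1\<close> steps back.\<close>
  have noless: False if ij: "i < j" "C \<inter> Caps i ~= {}" "C \<inter> Caps j ~= {}"
    and least: "\<And>k. k < i ==> C \<inter> Caps k = {}" for i j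
  proof -
   obtain w w' where w: "w \<in> C" "w \<in> Caps i" "w' \<in> C" "w' \<in> Caps j" using ij(2,3) by blast
   have "\<not> C \<subseteq> Caps i" using w(3,4) Caps_disjoint[of w' i j] ij(1) by blast
   moreover have "\<not> C \<subseteq> Caps j" using w(1,2) Caps_disjoint[of w i j] ij(1) by blast
   ultimately obtain x l x' l' where x: "x \<in> C" "strand 0 (pc i) l x" "bk (pc i) l (Suc i) = 1/2"
    "x' \<in> C" "strand 0 (pc j) l' x'" "bk (pc j) l' (Suc j) = 1/2"
    using ends[OF ij(2)] ends[OF ij(3)] by blast
   have "dist x x' < e" using C(3) x by blast
   moreover have "x = (pc i, psi0 l)" "x' = (pc j, psi0 l')" using x by (auto simp: strand_0)
   ultimately have "\<bar>pc i - pc j\<bar> < e"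
    using dist_fst_le[of x x'] by (simp add: dist_real_def)
   hence eq: "pc i = pc j" by (rule e(2))
   have same: "l k = l' k" if k: "k < i" for k
   proof -
    have nk: "x \<notin> Caps k" "x' \<notin> Caps k" using least[OF k] x by blast+
    from avoid[OF least[OF k]] obtain ee where "x \<in> R k ee" "x' \<in> R k ee" using x by blast
    thus ?thesis using R_code[OF _ x(2) _ nk(1)] R_code[OF _ x(5) _ nk(2)] by fastforce
   qed
   have "bk (pc j) l' i = bk (pc i) l i" using eq bk_cong[of i l l' "pc j"] same by simp
   moreover have "bk (pc i) l i = b" using T_bk[OF strand_Adm[OF x(2)], of i] x(3) T_crit by simp
   ultimately have "bk (pc j) l' (Suc i) = 1/2" by (simp add: br_b)
   moreover have "(T ^^ (j - i)) (bk (pc j) l' ((j - i) + Suc i)) = bk (pc j) l' (Suc i)"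
    by (rule funpow_T_bk[OF strand_Adm[OF x(5)]])
   ultimately show False using x(6) nonper[of "j - i"] ij(1) by simp
  qed
  have one: "\<exists>i0. \<forall>i. i ~= i0 --> C \<inter> Caps i = {}"
  proof (cases "\<exists>i. C \<inter> Caps i ~= {}")
   case True
   define i0 where "i0 = (LEAST i. C \<inter> Caps i ~= {})"
   have i0: "C \<inter> Caps i0 ~= {}" using LeastI_ex[OF True] by (simp add: i0_def)
   have least: "C \<inter> Caps k = {}" if "k < i0" for k
    using not_less_Least[OF that[unfolded i0_def]] by blast
   have "C \<inter> Caps i = {}" if "i ~= i0" for i
    using noless[OF _ i0 _ least] least[of i] that by (metis linorder_neqE_nat)
   thus ?thesis by blast
  qed auto
  then obtain i0 where i0: "\<And>i. i ~= i0 ==> C \<inter> Caps i = {}" by blast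
  obtain N1 y1 l1 where 1: "strand N1 y1 l1 z" using C by (auto simp: KK_def)
  obtain N2 y2 l2 where 2: "strand N2 y2 l2 z'" using C by (auto simp: KK_def)
  define N where "N = max (Suc i0) (max N1 N2)"
  obtain y l where zl: "strand N y l z" using strand_add[OF 1, of "N - N1"] by (force simp: N_def)
  obtain y' l' where zl': "strand N y' l' z'" using strand_add[OF 2, of "N - N2"] by (force simp: N_def)
  have "l k = l' k" for k
  proof -
   have "k + N ~= i0" by (simp add: N_def)
   hence em: "C \<inter> Caps (k + N) = {}" by (rule i0)
   hence nk: "z \<notin> Caps (k + N)" "z' \<notin> Caps (k + N)" using C by blast+
   from avoid[OF em] obtain ee where "z \<in> R (k + N) ee" "z' \<in> R (k + N) ee" using C by blast
   thus ?thesis using R_code[OF _ zl _ nk(1)] R_code[OF _ zl' _ nk(2)] by fastforce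
  qed
  thus ?thesis using tail_imp_samet[OF zl zl', of 0] by blast
 qed
 thus ?thesis using e(1) by blast
qed

lemma path_samet:
 assumes g: "path g" "path_image g \<subseteq> KK" and "z \<in> path_image g" "z' \<in> path_image g"
 shows "samet z z'"
proof -
 obtain e where e: "0 < e" "\<And>C. connected C ==> C \<subseteq> KK ==> (\<forall>z\<in>C. \<forall>z'\<in>C. dist z z' < e) ==> \<forall>z\<in>C. \<forall>z'\<in>C. samet z z'"
  using small_connected_samet by blast
 have cg: "continuous_on {0..1} g" using g by (simp add: path_def)
 hence "uniformly_continuous_on {0..1} g" by (rule compact_uniformly_continuous) simp
 then obtain d where d: "0 < d" "\<And>t t'. t \<in> {0..1} ==> t' \<in> {0..1} ==> dist t t' < d ==> dist (g t) (g t') < e"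
  using uniformly_continuous_onE[OF _ e(1)] by metis
 have loc: "samet (g t) (g t')" if "t \<in> {0..1}" "t' \<in> {0..1}" "dist t t' < d" for t t'
 proof -
  have sub: "closed_segment t t' \<subseteq> {0..1}" using that by (intro closed_segment_subset) auto
  have "dist x x' < d" if "x \<in> closed_segment t t'" "x' \<in> closed_segment t t'" for x x'
   using that \<open>dist t t' < d\<close> by (auto simp: closed_segment_eq_real_ivl dist_real_def split: if_splits)
  hence "\<forall>z\<in>g ` closed_segment t t'. \<forall>z'\<in>g ` closed_segment t t'. dist z z' < e"
   using d(2) sub by blast
  moreover have "connected (g ` closed_segment t t')"
   using continuous_on_subset[OF cg sub] by (rule connected_continuous_image) simp
  moreover have "g ` closed_segment t t' \<subseteq> KK" using g(2) sub by (auto simp: path_image_def)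
  ultimately show ?thesis using e(2) by blast
 qed
 obtain t t' where t: "t \<in> {0..1}" "t' \<in> {0..1}" "z = g t" "z' = g t'" using assms by (auto simp: path_image_def)
 have "samet (g t) (g t')"
 proof (rule connected_equivalence_relation[where S = "{0..1}" and R = "%t t'. samet (g t) (g t')"])
  show "\<exists>T. openin (top_of_set {0..1}) T \<and> t \<in> T \<and> (\<forall>t'\<in>T. samet (g t) (g t'))" if "t \<in> {0..1}" for t
   using loc that d(1) by (intro exI[of _ "{0..1} \<inter> ball t d"]) (auto intro: openin_open_Int)
  show "samet (g x) (g x'')" if "samet (g x) (g x')" "samet (g x') (g x'')" for x x' x''
   using that by (rule samet_trans)
 qed (use t(1,2) in \<open>simp_all add: samet_sym\<close>)
 thus ?thesis using t by simp
qed

end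

section \<open>Increasing unions of arcs\<close>

text \<open>Seen in the parameter of \<open>g\<close>, the given chart is continuous and injective,
  hence monotone. After reversing \<open>g\<close> if necessary it is increasing, and two affine
  pieces extend it to a chart of the whole arc.\<close>

lemma extend_arc_chart:
 fixes f g :: "real => 'a :: t2_space"
 assumes L: "0 \<le> L" and f: "continuous_on {- L..L} f" "inj_on f {- L..L}" "f ` {- L..L} = A"
  and g: "arc g" "A \<subseteq> path_image g - {pathstart g, pathfinish g}"
 shows "\<exists>f'. continuous_on {- (L + 1)..L + 1} f' \<and> inj_on f' {- (L + 1)..L + 1} \<and>
  f' ` {- (L + 1)..L + 1} = path_image g \<and> (\<forall>t\<in>{- L..L}. f' t = f t)"
proof -
 obtain ph0 where ph0: "continuous_on {- L..L} ph0" "\<forall>t\<in>{- L..L}. g (ph0 t) = f t \<and> 0 < ph0 t \<and> ph0 t < 1"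
 proof -
  obtain h where h: "homeomorphism {0..1} (path_image g) g h"
   using homeomorphism_compact[of "{0..1}" g "path_image g"] g(1) unfolding path_image_def arc_def path_def by blast
  have fA: "f t \<in> path_image g - {g 0, g 1}" if "t \<in> {- L..L}" for t
   using f(3) g(2) that unfolding pathstart_def pathfinish_def by blast
  have "h (f t) \<in> {0..1}" "g (h (f t)) = f t" if "t \<in> {- L..L}" for t
   using h fA[OF that] unfolding homeomorphism_def by blast+
  hence "g (h (f t)) = f t \<and> 0 < h (f t) \<and> h (f t) < 1" if "t \<in> {- L..L}" for t
   using fA[OF that] that by (metis DiffE atLeastAtMost_iff insertCI order_le_less)
  moreover have "continuous_on {- L..L} (%t. h (f t))"
   by (rule continuous_on_compose2[OF _ f(1)]) (use h fA in \<open>auto simp: homeomorphism_def\<close>)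
  ultimately show ?thesis using that by blast
 qed
 obtain g' ph where g': "arc g'" "path_image g' = path_image g" and ph: "continuous_on {- L..L} ph"
  "\<forall>t\<in>{- L..L}. g' (ph t) = f t \<and> 0 < ph t \<and> ph t < 1" and lt: "ph (- L) \<le> ph L"
 proof (cases "ph0 (- L) \<le> ph0 L")
  case False
  have "continuous_on {- L..L} (%t. 1 - ph0 t)" by (intro continuous_intros ph0(1))
  thus ?thesis using that[OF arc_reversepath[OF g(1)] path_image_reversepath, of "%t. 1 - ph0 t"] ph0(2) False
   by (simp add: reversepath_def)
 qed (use that g(1) ph0 in blast)
 have iph: "inj_on ph {- L..L}" using ph(2) f(2) unfolding inj_on_def by metis
 have base: "ph (- L) < ph u" if "- L < u" "u \<le> L" for u
 proof (cases "u = L")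
  case True
  thus ?thesis using lt inj_onD[OF iph, of "- L" L] that by fastforce
 qed (use continuous_inj_imp_mono[OF _ _ ph(1) iph, of u] lt that in auto)
 have mono: "ph t < ph t'" if "- L \<le> t" "t < t'" "t' \<le> L" for t t'
 proof (cases "t = - L")
  case False
  have "continuous_on {- L..t'} ph" "inj_on ph {- L..t'}"
   using that by (auto intro: continuous_on_subset[OF ph(1)] inj_on_subset[OF iph])
  thus ?thesis using continuous_inj_imp_mono[of "- L" t t' ph] base[of t] False that by auto
 qed (use base that in simp)
 define cl where "cl t = max (- L) (min L t)" for t
 \<comment> \<open>The old parameter change, frozen outside \<open>{- L..L}\<close>, plus slopes
   that reach 0 and 1 exactly one unit further out.\<close>
 define q where "q t = ph (cl t) + min 0 (t + L) * ph (- L) + max 0 (t - L) * (1 - ph L)" for t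
 have cl: "cl t \<in> {- L..L}" for t using L by (auto simp: cl_def)
 have e: "0 < ph (- L)" "0 < 1 - ph L" using ph(2) L by auto
 have less: "q t < q t'" if "t < t'" for t t'
 proof -
  have "min 0 (t + L) * ph (- L) \<le> min 0 (t' + L) * ph (- L)" "max 0 (t - L) * (1 - ph L) \<le> max 0 (t' - L) * (1 - ph L)"
   using that e by (auto intro!: mult_right_mono)
  moreover have "cl t \<le> cl t'" using that by (simp add: cl_def)
  hence "ph (cl t) \<le> ph (cl t')" using mono[of "cl t" "cl t'"] cl[of t] cl[of t']
   by (cases "cl t = cl t'") auto
  moreover have "min 0 (t + L) * ph (- L) < min 0 (t' + L) * ph (- L)" if "t < - L"
   using that \<open>t < t'\<close> e by (intro mult_strict_right_mono) auto
  moreover have "max 0 (t - L) * (1 - ph L) < max 0 (t' - L) * (1 - ph L)" if "L < t'"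
   using that \<open>t < t'\<close> e by (intro mult_strict_right_mono) auto
  moreover have "ph (cl t) < ph (cl t')" if "- L \<le> t" "t' \<le> L"
   using mono[of t t'] that \<open>t < t'\<close> by (simp add: cl_def)
  ultimately show ?thesis unfolding q_def by linarith
 qed
 have cq: "continuous_on A q" for A
 proof -
  have "continuous_on A (%t. ph (cl t))"
   by (rule continuous_on_compose2[OF ph(1)]) (use cl in \<open>auto simp: cl_def intro!: continuous_intros\<close>)
  thus ?thesis unfolding q_def by (intro continuous_intros)
 qed
 have q01: "q (- (L + 1)) = 0" "q (L + 1) = 1" using L by (simp_all add: q_def cl_def)
 have inj: "inj_on q A" for A by (rule inj_onI) (metis less less_irrefl linorder_neqE)
 have onto: "q ` {- (L + 1)..L + 1} = {0..1}"
 proof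
  have "q t \<le> q t'" if "t \<le> t'" for t t' using less that by (cases "t = t'") (auto simp: less_imp_le)
  thus "q ` {- (L + 1)..L + 1} \<subseteq> {0..1}" using q01 by (metis atLeastAtMost_iff image_subsetI)
  show "{0..1} \<subseteq> q ` {- (L + 1)..L + 1}"
   using IVT'[of q "- (L + 1)" _ "L + 1", OF _ _ _ cq] q01 L by fastforce
 qed
 have "continuous_on {- (L + 1)..L + 1} (g' \<circ> q)" "inj_on (g' \<circ> q) {- (L + 1)..L + 1}"
  by (intro continuous_on_compose cq comp_inj_on inj; use g'(1) in \<open>simp only: onto arc_def path_def\<close>)+
 moreover have "(g' \<circ> q) ` {- (L + 1)..L + 1} = path_image g"
  using g'(2) by (simp only: image_comp[symmetric] onto path_image_def)
 moreover have "\<forall>t\<in>{- L..L}. (g' \<circ> q) t = f t" using ph(2) by (simp add: q_def cl_def)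
 ultimately show ?thesis by blast
qed

lemma line_increasing_arcs:
 fixes g :: "nat => real => real \<times> real"
 assumes g: "\<And>k. arc (g k)"
  and sub: "\<And>k. path_image (g k) \<subseteq> path_image (g (Suc k)) - {pathstart (g (Suc k)), pathfinish (g (Suc k))}"
 shows "line (\<Union>k. path_image (g k))"
proof -
 \<comment> \<open>Starting from a single interior point makes the first chart live on the
   degenerate interval, so that every arc is added by the same extension step.\<close>
 define A where "A k = (case k of 0 => {g 0 (1/2)} | Suc k => path_image (g k))" for k
 define P where "P k f \<longleftrightarrow> continuous_on {- real k..real k} f \<and> inj_on f {- real k..real k} \<and>
  f ` {- real k..real k} = A k" for k f
 have "P 0 (%_. g 0 (1/2))" by (simp add: P_def A_def)
 moreover have "\<exists>f'. P (Suc k) f' \<and> (\<forall>t\<in>{- real k..real k}. f' t = f t)" if "P k f" for k f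
 proof -
  have "g 0 (1/2) ~= g 0 0" "g 0 (1/2) ~= g 0 1"
   using g[of 0] inj_onD[of "g 0" "{0..1}"] unfolding arc_def by force+
  hence "A k \<subseteq> path_image (g k) - {pathstart (g k), pathfinish (g k)}"
   using sub by (cases k) (auto simp: A_def path_image_def pathstart_def pathfinish_def)
  thus ?thesis using extend_arc_chart[of "real k" f "A k" "g k"] that g
   by (simp add: P_def A_def add.commute)
 qed
 ultimately obtain F where F: "\<And>k. P k (F k)" "\<And>k. \<forall>t\<in>{- real k..real k}. F (Suc k) t = F k t"
  using dependent_nat_choice[of P "%k f f'. \<forall>t\<in>{- real k..real k}. f' t = f t"] by metis
 have mono: "F j t = F k t" if "k \<le> j" "t \<in> {- real k..real k}" for k j t
  using that(1)
 proof (induction j rule: dec_induct)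
  case (step j)
  thus ?case using F(2)[of j] that by auto
 qed simp
 define f where "f t = F (nat \<lceil>\<bar>t\<bar>\<rceil>) t" for t
 have f: "f t = F k t" if "t \<in> {- real k..real k}" for k t
 proof -
  define n where "n = nat \<lceil>\<bar>t\<bar>\<rceil>"
  have "\<bar>t\<bar> \<le> real n" unfolding n_def by linarith
  hence "- real n \<le> t" "t \<le> real n" by linarith+
  thus ?thesis using mono[of k n t] mono[of n k t] that
   unfolding f_def n_def[symmetric] by (cases "k \<le> n") auto
 qed
 have img: "f ` {- real k..real k} = A k" "inj_on f {- real k..real k}" for k
  using F(1)[of k] f[of _ k] unfolding P_def inj_on_def by force+
 have "isCont f t" for t
 proof -
  obtain k where k: "\<bar>t\<bar> < real k" using reals_Archimedean2 by blast
  have "continuous_on {- real k<..<real k} (F k)"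
   using F(1)[of k] unfolding P_def by (auto elim: continuous_on_subset)
  hence "continuous_on {- real k<..<real k} f"
   by (rule continuous_on_eq) (auto intro: f[symmetric])
  moreover have "t \<in> {- real k<..<real k}" using k by auto
  ultimately show "isCont f t" by (simp add: continuous_on_eq_continuous_at)
 qed
 hence "continuous_on UNIV f" by (simp add: continuous_at_imp_continuous_on)
 moreover have "inj f"
 proof (rule injI)
  fix t t' assume eq: "f t = f t'"
  obtain k where "max \<bar>t\<bar> \<bar>t'\<bar> < real k" using reals_Archimedean2 by blast
  thus "t = t'" using inj_onD[OF img(2) eq, of k] by (auto simp: abs_less_iff)
 qed
 moreover have "range f = (\<Union>k. path_image (g k))"
 proof
  show "range f \<subseteq> (\<Union>k. path_image (g k))"
  proof
   fix x assume "x \<in> range f"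
   then obtain t where t: "x = f t" by auto
   obtain k where "\<bar>t\<bar> < real k" using reals_Archimedean2 by blast
   hence "t \<in> {- real (Suc k)..real (Suc k)}" by auto
   hence "x \<in> f ` {- real (Suc k)..real (Suc k)}" unfolding t by (rule imageI)
   thus "x \<in> (\<Union>k. path_image (g k))" unfolding img by (auto simp: A_def)
  qed
  show "(\<Union>k. path_image (g k)) \<subseteq> range f"
  proof (rule UN_least)
   fix k
   have "path_image (g k) = f ` {- real (Suc k)..real (Suc k)}" unfolding img by (simp add: A_def)
   thus "path_image (g k) \<subseteq> range f" by blast
  qed
 qed
 ultimately show ?thesis unfolding line_def by blast
qed

section \<open>The lines\<close>

context tent_rot
begin

definition cpt :: "nat => real => real => real \<times> real" where
 "cpt j r t = (pc j + ec j * (r / 3 ^ j * sqrt (1 - t\<^sup>2)), qc j + r / 3 ^ j * t)"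

lemma cap_eq_cpt:
 assumes r: "0 < r"
 shows "cap j r = cpt j r ` {- 1..1}"
proof
 define R' where "R' = r / 3 ^ j"
 have R': "0 < R'" using r by (simp add: R'_def)
 have e2: "(ec j * x)\<^sup>2 = x\<^sup>2" "ec j * (ec j * x) = x" for x using ec_cases[of j] by auto
 have t2: "(R' * sqrt (1 - t\<^sup>2))\<^sup>2 = R'\<^sup>2 - (R' * t)\<^sup>2" "0 \<le> sqrt (1 - t\<^sup>2)" if "t \<in> {- 1..1}" for t
 proof -
  have "t\<^sup>2 \<le> 1" using that by (simp add: abs_square_le_1 abs_le_iff)
  thus "(R' * sqrt (1 - t\<^sup>2))\<^sup>2 = R'\<^sup>2 - (R' * t)\<^sup>2" "0 \<le> sqrt (1 - t\<^sup>2)"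
   by (simp_all add: power_mult_distrib right_diff_distrib)
 qed
 show "cpt j r ` {- 1..1} \<subseteq> cap j r"
  using t2 R' by (auto simp: cpt_def cap_def R'_def[symmetric] e2)
 show "cap j r \<subseteq> cpt j r ` {- 1..1}"
 proof
  fix z assume "z \<in> cap j r"
  then obtain u v where z: "z = (u, v)" and c: "(u - pc j)\<^sup>2 + (v - qc j)\<^sup>2 = R'\<^sup>2" "0 \<le> ec j * (u - pc j)"
   by (auto simp: cap_def R'_def)
  define t where "t = (v - qc j) / R'"
  have vt: "R' * t = v - qc j" using R' by (simp add: t_def)
  have "(v - qc j)\<^sup>2 \<le> R'\<^sup>2" using c(1) zero_le_power2[of "u - pc j"] by linarith
  hence "\<bar>v - qc j\<bar> \<le> R'" using R' abs_le_square_iff[of "v - qc j" R'] by simp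
  hence t: "t \<in> {- 1..1}" using R' by (auto simp: t_def abs_le_iff field_simps)
  have "(ec j * (u - pc j))\<^sup>2 = (R' * sqrt (1 - t\<^sup>2))\<^sup>2" unfolding t2[OF t] e2 vt using c(1) by simp
  hence "ec j * (u - pc j) = R' * sqrt (1 - t\<^sup>2)"
   by (rule power2_eq_imp_eq) (use c(2) R' t2(2)[OF t] in auto)
  hence "u - pc j = ec j * (R' * sqrt (1 - t\<^sup>2))" using e2(2)[of "u - pc j"] by simp
  hence "z = cpt j r t" using vt by (simp add: z cpt_def R'_def)
  thus "z \<in> cpt j r ` {- 1..1}" using t by blast
 qed
qed

lemma cap_arc:
 assumes r: "0 < r" and d: "d = 1 \<or> d = - 1"
 shows "\<exists>g. arc g \<and> path_image g = cap j r \<and> pathstart g = (pc j, qc j - d * (r / 3 ^ j))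
  \<and> pathfinish g = (pc j, qc j + d * (r / 3 ^ j))"
proof (intro exI conjI)
 define g where "g t = cpt j r (d * (2 * t - 1))" for t
 have "path g" unfolding path_def g_def cpt_def by (intro continuous_intros)
 moreover have "inj_on g {0..1}" using r d by (auto intro!: inj_onI simp: g_def cpt_def)
 ultimately show "arc g" by (simp add: arc_def)
 have "(%t. d * (2 * t - 1)) ` {0..1} = {- 1..1}"
 proof
  show "{- 1..1} \<subseteq> (%t. d * (2 * t - 1)) ` {0..1}"
  proof
   fix x :: real assume "x \<in> {- 1..1}"
   thus "x \<in> (%t. d * (2 * t - 1)) ` {0..1}" using d by (intro image_eqI[of _ _ "(1 + d * x) / 2"]) (auto simp: field_simps)
  qed
 qed (use d in auto)
 thus "path_image g = cap j r" unfolding path_image_def g_def cap_eq_cpt[OF r] by (metis image_image)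
 show "pathstart g = (pc j, qc j - d * (r / 3 ^ j))" "pathfinish g = (pc j, qc j + d * (r / 3 ^ j))"
  using d by (auto simp: pathstart_def pathfinish_def g_def cpt_def)
qed

section \<open>Strands over an interval are arcs\<close>

lemma T_image_Icc:
 assumes "p \<le> r"
 shows "r \<le> 1/2 ==> {T p..T r} \<subseteq> T ` {p..r}" and "1/2 \<le> p ==> {T r..T p} \<subseteq> T ` {p..r}"
proof -
 show "{T p..T r} \<subseteq> T ` {p..r}" if "r \<le> 1/2"
 proof
  fix x assume "x \<in> {T p..T r}"
  hence "p \<le> x / s" "x / s \<le> r" using assms that s_pos by (auto simp: T_left field_simps)
  thus "x \<in> T ` {p..r}" using that s_pos by (intro rev_image_eqI[of "x / s"]) (auto simp: T_left)
 qed
 show "{T r..T p} \<subseteq> T ` {p..r}" if "1/2 \<le> p"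
 proof
  fix x assume "x \<in> {T r..T p}"
  hence "p \<le> 1 - x / s" "1 - x / s \<le> r" using assms that s_pos by (auto simp: T_right field_simps)
  thus "x \<in> T ` {p..r}" using that s_pos by (intro rev_image_eqI[of "1 - x / s"]) (auto simp: T_right)
 qed
qed

lemma T_image: "p \<le> r ==> r \<le> 1/2 ==> T ` {p..r} = {T p..T r}" "p \<le> r ==> 1/2 \<le> p ==> T ` {p..r} = {T r..T p}"
proof -
 show "T ` {p..r} = {T p..T r}" if "p \<le> r" "r \<le> 1/2"
  using T_image_Icc(1)[OF that] that s_pos by (auto simp: T_left)
 show "T ` {p..r} = {T r..T p}" if "p \<le> r" "1/2 \<le> p"
  using T_image_Icc(2)[OF that] that s_pos by (auto simp: T_right)
qed

lemma T_less_left: "p < r ==> r \<le> 1/2 ==> T p < T r"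
 and T_less_right: "p < r ==> 1/2 \<le> p ==> T r < T p"
 using s_pos by (simp_all add: T_left T_right)

lemma dr_T:
 assumes "y \<le> 1/2 \<and> \<not> e \<or> 1/2 \<le> y \<and> e"
 shows "dr N (T y) (H e h) \<subseteq> dr (Suc N) y h"
proof (cases "y = 1/2")
 case True
 thus ?thesis using cap_end by (simp add: T_crit dr_b)
qed (use assms in auto)

text \<open>If an endpoint of the interval is precritical, its fibre is a semicircle, of which the arc
 may contain only one endpoint; hence the two inclusions.\<close>

lemma dr_arc:
 assumes "a \<le> p" "p < r" "r \<le> b" "0 \<le> h" "h \<le> 1"
 shows "\<exists>g. arc g \<and> (\<Union>y\<in>{p<..<r}. dr N y h) \<subseteq> path_image g \<and> path_image g \<subseteq> (\<Union>y\<in>{p..r}. dr N y h) \<and>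
  pathstart g \<in> dr N p h \<and> pathfinish g \<in> dr N r h"
 using assms
proof (induction N arbitrary: p r h)
 case 0
 have "closed_segment (p, h) (r, h) = (%x. (x, h)) ` closed_segment p r"
  by (auto simp: closed_segment_def image_iff algebra_simps) (metis add.commute diff_add_cancel distrib_right mult_1)+
 thus ?case using 0 by (intro exI[of _ "linepath (p, h) (r, h)"]) (auto simp: closed_segment_eq_real_ivl)
next
 case (Suc N)
 note HR = H_range[OF Suc.prems(4,5)]
 have half: "\<exists>g. arc g \<and> (\<Union>y\<in>{p'<..<r'}. dr (Suc N) y h) \<subseteq> path_image g \<and>
   path_image g \<subseteq> (\<Union>y\<in>{p'..r'}. dr N (T y) (H e h)) \<and>
   pathstart g \<in> dr N (T p') (H e h) \<and> pathfinish g \<in> dr N (T r') (H e h)"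
  if pr: "p \<le> p'" "p' < r'" "r' \<le> r" and e: "r' \<le> 1/2 \<and> \<not> e \<or> 1/2 \<le> p' \<and> e" for p' r' e
 proof -
  have TR: "a \<le> T x" "T x \<le> b" if "p' \<le> x" "x \<le> r'" for x using T_range[of x] that pr Suc.prems by auto
  have op: "dr (Suc N) y h = dr N (T y) (H e h)" if "y \<in> {p'<..<r'}" for y using that e by auto
  show ?thesis
  proof (cases e)
   case False
   hence r': "r' \<le> 1/2" using e by simp
   have "T y \<in> {T p'<..<T r'}" if "y \<in> {p'<..<r'}" for y using T_less_left[of p' y] T_less_left[of y r'] that r' by auto
   hence "dr (Suc N) y h \<subseteq> (\<Union>y\<in>{T p'<..<T r'}. dr N y (H e h))" if "y \<in> {p'<..<r'}" for y
    unfolding op[OF that] using that by (intro UN_upper) blast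
   moreover have "(\<Union>y\<in>{p'..r'}. dr N (T y) (H e h)) = (\<Union>y\<in>{T p'..T r'}. dr N y (H e h))"
    using T_image(1)[of p' r', symmetric] pr r' by simp
   moreover obtain g where "arc g" "(\<Union>y\<in>{T p'<..<T r'}. dr N y (H e h)) \<subseteq> path_image g"
    "path_image g \<subseteq> (\<Union>y\<in>{T p'..T r'}. dr N y (H e h))" "pathstart g \<in> dr N (T p') (H e h)" "pathfinish g \<in> dr N (T r') (H e h)"
    using Suc.IH[OF TR(1) T_less_left[OF pr(2) r'] TR(2) HR, of e] pr(2) by auto
   ultimately show ?thesis by (intro exI[of _ g]) (simp only:; blast)
  next
   case True
   hence p': "1/2 \<le> p'" using e by simp
   have "T y \<in> {T r'<..<T p'}" if "y \<in> {p'<..<r'}" for y using T_less_right[of p' y] T_less_right[of y r'] that p' by auto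
   hence "dr (Suc N) y h \<subseteq> (\<Union>y\<in>{T r'<..<T p'}. dr N y (H e h))" if "y \<in> {p'<..<r'}" for y
    unfolding op[OF that] using that by (intro UN_upper) blast
   moreover have "(\<Union>y\<in>{p'..r'}. dr N (T y) (H e h)) = (\<Union>y\<in>{T r'..T p'}. dr N y (H e h))"
    using T_image(2)[of p' r', symmetric] pr p' by simp
   moreover obtain g where "arc g" "(\<Union>y\<in>{T r'<..<T p'}. dr N y (H e h)) \<subseteq> path_image g"
    "path_image g \<subseteq> (\<Union>y\<in>{T r'..T p'}. dr N y (H e h))" "pathstart g \<in> dr N (T r') (H e h)" "pathfinish g \<in> dr N (T p') (H e h)"
    using Suc.IH[OF TR(1) T_less_right[OF pr(2) p'] TR(2) HR, of e] pr(2) by auto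
   ultimately show ?thesis by (intro exI[of _ "reversepath g"]) (simp only: arc_reversepath path_image_reversepath pathstart_reversepath pathfinish_reversepath; blast)
  qed
 qed
 have half': ?case if e: "r \<le> 1/2 \<and> \<not> e \<or> 1/2 \<le> p \<and> e" for e
 proof -
  have sub: "dr N (T y) (H e h) \<subseteq> dr (Suc N) y h" if "y \<in> {p..r}" for y using that e by (intro dr_T) auto
  hence "(\<Union>y\<in>{p..r}. dr N (T y) (H e h)) \<subseteq> (\<Union>y\<in>{p..r}. dr (Suc N) y h)" by blast
  thus ?thesis using half[OF order_refl Suc.prems(2) order_refl e] sub[of p] sub[of r] Suc.prems(2)
   by (meson atLeastAtMost_iff less_imp_le order_refl order_trans subsetD)
 qed
 consider "r \<le> 1/2" | "1/2 \<le> p" | "p < 1/2" "1/2 < r" by linarith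
 thus ?case
 proof cases
  case 3
  define rr where "rr = 1/2 - h / 3"
  have rr: "0 < rr" "0 \<le> rr" "rr \<le> 1/2" using Suc.prems by (auto simp: rr_def)
  have TR: "a \<le> T x" "T x \<le> b" if "p \<le> x" "x \<le> r" for x using T_range[of x] that Suc.prems by auto
  obtain g1 where g1: "arc g1" "(\<Union>y\<in>{p<..<1/2}. dr (Suc N) y h) \<subseteq> path_image g1"
   "path_image g1 \<subseteq> (\<Union>y\<in>{p..1/2}. dr N (T y) (H False h))"
   "pathstart g1 \<in> dr N (T p) (H False h)" "pathfinish g1 = (pc N, vh N b (H False h))"
   using half[of p "1/2" False] 3 by (auto simp: T_crit dr_b)
  obtain g3 where g3: "arc g3" "(\<Union>y\<in>{1/2<..<r}. dr (Suc N) y h) \<subseteq> path_image g3"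
   "path_image g3 \<subseteq> (\<Union>y\<in>{1/2..r}. dr N (T y) (H True h))"
   "pathstart g3 = (pc N, vh N b (H True h))" "pathfinish g3 \<in> dr N (T r) (H True h)"
   using half[of "1/2" r True] 3 by (auto simp: T_crit dr_b)
  have vhe: "vh N b (H e h) = qc N + (if e then 1 else - 1) * (ec N * (rr / 3 ^ N))" for e
  proof -
   have "vh N b (H e h) - qc N = sg N b * (H e h - 1/2) / 3 ^ N" unfolding qc_def by (rule vh_diff)
   moreover have "H e h - 1/2 = (if e then 1 else - 1) * rr" by (simp add: H_def rr_def)
   ultimately have "vh N b (H e h) - qc N = ec N * ((if e then 1 else - 1) * rr) / 3 ^ N"
    by (simp only: ec_def)
   thus ?thesis by (cases e) auto
  qed
  obtain g2 where g2: "arc g2" "path_image g2 = cap N rr" "pathstart g2 = (pc N, vh N b (H False h))"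
   "pathfinish g2 = (pc N, vh N b (H True h))"
   using cap_arc[OF rr(1) ec_cases, of N N] vhe by auto
  have inter: "z = (pc N, vh N b (H e h))" if z: "z \<in> cap N rr" "z \<in> dr N (T y) (H e h)" "p \<le> y" "y \<le> r" for z y e
  proof (cases "T y = b")
   case False
   hence "T y < b" using TR(2)[of y] that by simp
   from cap_Int_dr_same[OF this HR rr(2,3) z(1,2)] show ?thesis ..
  qed (use z in \<open>simp add: dr_b\<close>)
  have g1D: "\<exists>y. p \<le> y \<and> y \<le> 1/2 \<and> z \<in> dr N (T y) (H False h)" if "z \<in> path_image g1" for z
   using subsetD[OF g1(3) that] by auto
  have g3D: "\<exists>y. 1/2 \<le> y \<and> y \<le> r \<and> z \<in> dr N (T y) (H True h)" if "z \<in> path_image g3" for z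
   using subsetD[OF g3(3) that] by auto
  have disj: "z \<notin> path_image g3" if z: "z \<in> path_image g1" for z
  proof
   assume "z \<in> path_image g3"
   then obtain y y' where y: "p \<le> y" "y \<le> 1/2" "z \<in> dr N (T y) (H False h)"
    "1/2 \<le> y'" "y' \<le> r" "z \<in> dr N (T y') (H True h)" using g1D[OF z] g3D by blast
   hence "H False h = H True h" using dr_inj[OF y(3,6) TR TR HR HR] 3 by simp
   thus False using H_eq_iff[OF Suc.prems(4,5) Suc.prems(4,5), of False True] by simp
  qed
  have i1: "z = pathstart g2" if z: "z \<in> path_image g1" "z \<in> cap N rr" for z
  proof -
   obtain y where "p \<le> y" "y \<le> 1/2" "z \<in> dr N (T y) (H False h)" using g1D[OF z(1)] by blast
   thus ?thesis using inter[OF z(2)] 3(2) unfolding g2 by force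
  qed
  have i3: "z = pathstart g3" if z: "z \<in> path_image g3" "z \<in> cap N rr" for z
  proof -
   obtain y where "1/2 \<le> y" "y \<le> r" "z \<in> dr N (T y) (H True h)" using g3D[OF z(1)] by blast
   thus ?thesis using inter[OF z(2)] 3(1) unfolding g3(4) by force
  qed
  have e1: "pathfinish g1 = pathstart g2" and e2: "pathfinish g2 = pathstart g3" by (simp_all add: g1 g2 g3)
  have "path_image g1 \<inter> path_image g2 \<subseteq> {pathstart g2}" using i1 g2(2) by blast
  hence a12: "arc (g1 +++ g2)" by (rule arc_join[OF g1(1) g2(1) e1])
  have "path_image (g1 +++ g2) \<inter> path_image g3 \<subseteq> {pathstart g3}"
   using disj i3 g2(2) unfolding path_image_join[OF e1] by blast
  hence "arc ((g1 +++ g2) +++ g3)" by (intro arc_join[OF a12 g3(1)]) (simp_all add: e2)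
  moreover have img: "path_image ((g1 +++ g2) +++ g3) = path_image g1 \<union> dr (Suc N) (1/2) h \<union> path_image g3"
   by (simp add: path_image_join e1 e2 g2(2) rr_def)
  moreover have "{p<..<r} = {p<..<1/2} \<union> {1/2} \<union> {1/2<..<r}" using 3 by auto
  hence "(\<Union>y\<in>{p<..<r}. dr (Suc N) y h) \<subseteq> path_image ((g1 +++ g2) +++ g3)" unfolding img using g1(2) g3(2) by blast
  moreover have "path_image g1 \<subseteq> (\<Union>y\<in>{p..r}. dr (Suc N) y h)" "path_image g3 \<subseteq> (\<Union>y\<in>{p..r}. dr (Suc N) y h)"
   "dr (Suc N) (1/2) h \<subseteq> (\<Union>y\<in>{p..r}. dr (Suc N) y h)"
  proof -
   show "path_image g1 \<subseteq> (\<Union>y\<in>{p..r}. dr (Suc N) y h)"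
    by (rule order_trans[OF g1(3) UN_mono], use 3 in force, rule dr_T, simp)
   show "path_image g3 \<subseteq> (\<Union>y\<in>{p..r}. dr (Suc N) y h)"
    by (rule order_trans[OF g3(3) UN_mono], use 3 in force, rule dr_T, simp)
   show "dr (Suc N) (1/2) h \<subseteq> (\<Union>y\<in>{p..r}. dr (Suc N) y h)" using 3 by (intro UN_upper) auto
  qed
  moreover have "pathstart ((g1 +++ g2) +++ g3) \<in> dr (Suc N) p h" "pathfinish ((g1 +++ g2) +++ g3) \<in> dr (Suc N) r h"
   using g1(4) g3(5) 3 by simp_all
  ultimately show ?thesis by (intro exI[of _ "(g1 +++ g2) +++ g3"]) (simp del: dr.simps)
 qed (use half'[of False] half'[of True] in blast)+
qed


section \<open>Points with a given rotation tail\<close>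

definition U :: "int => (real \<times> real) set" where
 "U i = {z. \<exists>N y l. strand N y l z \<and> (\<exists>k0. \<forall>k\<ge>k0. l k = lam (int k + int N + i))}"

lemma U_sub_KK: "U i \<subseteq> KK" unfolding U_def KK_def by blast

lemma U_strand:
 assumes "z \<in> U i" "strand N y l z"
 shows "\<exists>k0. \<forall>k\<ge>k0. l k = lam (int k + int N + i)"
proof -
 obtain N' y' l' k0 where 1: "strand N' y' l' z" "\<And>k. k0 \<le> k ==> l' k = lam (int k + int N' + i)"
  using assms(1) by (auto simp: U_def)
 have "strand (N + N') (bk y l N') (shift N' l) z" "strand (N + N') (bk y' l' N) (shift N l') z"
  using strand_add[OF assms(2), of N'] strand_add[OF 1(1), of N] by (simp_all add: add.commute)
 hence eq: "shift N' l = shift N l'" using strand_unique by blast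
 have "l k = lam (int k + int N + i)" if "k0 + N' \<le> k" for k
 proof -
  have "l k = l' (k - N' + N)" using fun_cong[OF eq, of "k - N'"] that by simp
  also have "\<dots> = lam (int (k - N' + N) + int N' + i)" using that by (intro 1(2)) simp
  also have "int (k - N' + N) + int N' + i = int k + int N + i" using that by simp
  finally show ?thesis .
 qed
 thus ?thesis by blast
qed

lemma U_I: "strand N y l z ==> \<exists>k0. \<forall>k\<ge>k0. l k = lam (int k + int N + i) ==> z \<in> U i"
 unfolding U_def by blast

lemma U_samet: assumes "z \<in> U i" "samet z z'" shows "z' \<in> U i"
proof -
 obtain N y y' l where l: "strand N y l z" "strand N y' l z'" using assms(2) unfolding samet_def by blast
 show ?thesis by (rule U_I[OF l(2) U_strand[OF assms(1) l(1)]])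
qed

text \<open>Both tails describe the same code beyond some depth. Adding a large multiple of
  \<open>n\<close> moves any given nonpositive index into that range.\<close>

lemma U_Int: assumes "z \<in> U i" "z \<in> U j" shows "int n dvd (i - j)"
proof -
 obtain N y l where l: "strand N y l z" using assms(1) by (auto simp: U_def)
 obtain k0 k1 where k: "\<And>k. k0 \<le> k ==> l k = lam (int k + int N + i)" "\<And>k. k1 \<le> k ==> l k = lam (int k + int N + j)"
  using U_strand[OF assms(1) l] U_strand[OF assms(2) l] by blast
 have "lam ((i - j) + k) = lam k" if "k \<le> 0" for k
 proof -
  obtain K where K0: "0 \<le> K" "int k0 + int k1 + \<bar>k\<bar> + \<bar>int N + j\<bar> \<le> K" by (metis abs_ge_zero order_trans le_cases)
  have K: "K \<le> int n * K" using n_pos mult_right_mono[of 1 "int n" K] K0(1) by simp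
  define x where "x = nat (k + int n * K - int N - j)"
  have x: "int x = k + int n * K - int N - j" "k0 \<le> x" "k1 \<le> x"
   using K K0 unfolding x_def by linarith+
  have "lam (int x + int N + i) = lam (int x + int N + j)" using k x by metis
  moreover have "int x + int N + i = ((i - j) + k) + int n * K" "int x + int N + j = k + int n * K"
   using x(1) by auto
  ultimately show ?thesis by (simp only: lam_period)
 qed
 thus ?thesis by (rule lam_shift_imp_dvd)
qed

lemma U_mod: "U (i + int n * j) = U i"
proof -
 have "lam (int k + int N + (i + int n * j)) = lam (int k + int N + i)" for k N
  using lam_period[of "int k + int N + i" j] by (simp add: add.assoc)
 thus ?thesis by (simp add: U_def)
qed

lemma Fold_U: "Fold i \<in> U i"
 using strand_Fold by (force simp: U_def cd_def add.commute)

lemma bk_diff: "\<bar>bk y l k - bk y' l k\<bar> = \<bar>y - y'\<bar> / s ^ k"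
proof (induction k)
 case (Suc k)
 have "\<bar>bk y l (Suc k) - bk y' l (Suc k)\<bar> = \<bar>bk y l k - bk y' l k\<bar> / s"
  using s_pos by (simp add: br_diff abs_mult)
 thus ?case using Suc by (simp add: field_simps)
qed simp

text \<open>The finite orbit stays a positive distance inside all the constraints that its own code
  imposes, and inverse branches do not increase distances. So one radius serves for all indices and
  all depths.\<close>

lemma Adm_near: "\<exists>\<mu>>0. \<forall>i y. \<bar>y - Z i\<bar> \<le> \<mu> --> Adm y (cd i)"
proof -
 define F where "F = (%x. x - s * a) ` {x \<in> range Z. s * a < x} \<union> (%x. x - a) ` range Z \<union> (%x. b - x) ` range Z"
 have fin: "finite F" using finite_range_Z by (auto simp: F_def)
 have ne: "F ~= {}" by (auto simp: F_def)
 have pos: "0 < Min F" using fin ne Z_range by (subst Min_gr_iff) (auto simp: F_def)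
 have le: "Min F \<le> x" if "x \<in> F" for x using fin that by simp
 have "Adm y (cd i)" if y: "\<bar>y - Z i\<bar> \<le> Min F" for y i
 proof -
  have "Z i - a \<in> F" "b - Z i \<in> F" unfolding F_def by (auto intro!: imageI)
  from le[OF this(1)] le[OF this(2)] have "a \<le> y" "y \<le> b" using y by auto
  moreover have "s * a \<le> bk y (cd i) k" if k: "\<not> cd i k" for k
  proof -
   have "\<bar>bk y (cd i) k - Z (i + int k)\<bar> = \<bar>y - Z i\<bar> / s ^ k"
    using bk_diff[of y "cd i" k "Z i"] by (simp add: bk_cd)
   also have "\<dots> \<le> \<bar>y - Z i\<bar> / 1" using s_gt1 by (intro divide_left_mono) auto
   finally have "\<bar>bk y (cd i) k - Z (i + int k)\<bar> \<le> Min F" using y by simp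
   moreover have "Min F \<le> Z (i + int k) - s * a"
    using k not_lam_gt[of "i + int k"] by (intro le) (auto simp: F_def cd_def intro!: imageI)
   ultimately show ?thesis by linarith
  qed
  ultimately show ?thesis by (simp add: Adm_def)
 qed
 thus ?thesis using pos by blast
qed

definition mu :: real where "mu = (SOME \<mu>. 0 < \<mu> \<and> (\<forall>i y. \<bar>y - Z i\<bar> \<le> \<mu> --> Adm y (cd i)))"

lemma mu: "0 < mu" "\<bar>y - Z i\<bar> \<le> mu ==> Adm y (cd i)"
proof -
 have "0 < mu \<and> (\<forall>i y. \<bar>y - Z i\<bar> \<le> mu --> Adm y (cd i))"
  unfolding mu_def by (rule someI_ex[OF Adm_near])
 thus "0 < mu" "\<bar>y - Z i\<bar> \<le> mu ==> Adm y (cd i)" by blast+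
qed

lemma cd_period: "cd (i + int (n * M)) = cd i"
proof
 fix k show "cd (i + int (n * M)) k = cd i k"
  using lam_period[of "i + int k" "int M"] by (simp add: cd_def algebra_simps)
qed

text \<open>Going back \<open>n\<close> levels returns to the same code and contracts the distance
  from \<open>Z i\<close> by \<open>s ^ n\<close>. Hence the arc over the interval of radius
  \<open>mu\<close> at one level avoids the ends of the next one, and every point with this tail is
  absorbed sooner or later.\<close>

lemma U_arcs: "\<exists>g. (\<forall>M. arc (g M) \<and> path_image (g M) \<subseteq> path_image (g (Suc M)) - {pathstart (g (Suc M)), pathfinish (g (Suc M))}) \<and>
  U i = (\<Union>M. path_image (g M))"
proof -
 have "\<exists>g. arc g \<and> (\<forall>z y. \<bar>y - Z i\<bar> < mu \<and> strand (n * M) y (cd i) z --> z \<in> path_image g) \<and>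
   (\<forall>z\<in>path_image g. \<exists>y. \<bar>y - Z i\<bar> \<le> mu \<and> strand (n * M) y (cd i) z) \<and>
   (\<forall>z\<in>{pathstart g, pathfinish g}. \<exists>y. \<bar>y - Z i\<bar> = mu \<and> strand (n * M) y (cd i) z)" for M
 proof -
  have ends: "Adm (Z i - mu) (cd i)" "Adm (Z i + mu) (cd i)" using mu by auto
  hence "a \<le> Z i - mu" "Z i + mu \<le> b" by (auto simp: Adm_def)
  then obtain g where g: "arc g" "(\<Union>y\<in>{Z i - mu<..<Z i + mu}. dr (n * M) y (psi0 (cd i))) \<subseteq> path_image g"
   "path_image g \<subseteq> (\<Union>y\<in>{Z i - mu..Z i + mu}. dr (n * M) y (psi0 (cd i)))"
   "pathstart g \<in> dr (n * M) (Z i - mu) (psi0 (cd i))" "pathfinish g \<in> dr (n * M) (Z i + mu) (psi0 (cd i))"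
   using dr_arc[of "Z i - mu" "Z i + mu" "psi0 (cd i)" "n * M"] mu(1) psi0_range[of "cd i"] by auto
  have "z \<in> path_image g" if "\<bar>y - Z i\<bar> < mu" "strand (n * M) y (cd i) z" for z y
   by (rule subsetD[OF g(2)]) (use that in \<open>auto simp: strand_def abs_less_iff intro!: bexI[of _ y]\<close>)
  moreover have "\<exists>y. \<bar>y - Z i\<bar> \<le> mu \<and> strand (n * M) y (cd i) z" if z: "z \<in> path_image g" for z
  proof -
   obtain y where "y \<in> {Z i - mu..Z i + mu}" "z \<in> dr (n * M) y (psi0 (cd i))" using subsetD[OF g(3) z] by blast
   thus ?thesis using mu(2)[of y i] by (intro exI[of _ y]) (auto simp: strand_def abs_le_iff)
  qed
  moreover have "strand (n * M) (Z i - mu) (cd i) (pathstart g)" "strand (n * M) (Z i + mu) (cd i) (pathfinish g)"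
   using g(4,5) ends by (simp_all add: strand_def)
  hence "\<forall>z\<in>{pathstart g, pathfinish g}. \<exists>y. \<bar>y - Z i\<bar> = mu \<and> strand (n * M) y (cd i) z"
   using mu(1) by (auto intro: exI[of _ "Z i - mu"] exI[of _ "Z i + mu"])
  ultimately show ?thesis using g(1) by blast
 qed
 then obtain g where g: "\<And>M. arc (g M)" "\<And>M z y. \<bar>y - Z i\<bar> < mu ==> strand (n * M) y (cd i) z ==> z \<in> path_image (g M)"
  "\<And>M z. z \<in> path_image (g M) ==> \<exists>y. \<bar>y - Z i\<bar> \<le> mu \<and> strand (n * M) y (cd i) z"
  "\<And>M z. z \<in> {pathstart (g M), pathfinish (g M)} ==> \<exists>y. \<bar>y - Z i\<bar> = mu \<and> strand (n * M) y (cd i) z" by metis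
 have step: "z \<in> path_image (g (Suc M)) - {pathstart (g (Suc M)), pathfinish (g (Suc M))}" if z: "z \<in> path_image (g M)" for z M
 proof -
  obtain y where y: "\<bar>y - Z i\<bar> \<le> mu" "strand (n * M) y (cd i) z" using g(3)[OF z] by blast
  define y' where "y' = bk y (cd i) n"
  have s': "strand (n * Suc M) y' (cd i) z"
   using strand_add[OF y(2), of n] cd_period[of i 1] by (simp add: shift_cd y'_def add.commute)
  have "1 < s ^ n" using s_gt1 n_pos by (intro one_less_power) auto
  hence "\<bar>y - Z i\<bar> < mu * s ^ n" using y(1) mult_strict_left_mono[of 1 "s ^ n" mu] mu(1) unfolding mult_1_right by linarith
  hence "\<bar>y - Z i\<bar> / s ^ n < mu" using s_pos by (simp add: divide_less_eq)
  moreover have "\<bar>y' - Z i\<bar> = \<bar>y - Z i\<bar> / s ^ n"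
   using bk_diff[of y "cd i" n "Z i"] Z_period[of i 1] by (simp add: bk_cd y'_def)
  ultimately have lt: "\<bar>y' - Z i\<bar> < mu" by simp
  have "z \<notin> {pathstart (g (Suc M)), pathfinish (g (Suc M))}"
   using g(4)[of z "Suc M"] strand_unique[OF s'] lt by (metis less_irrefl)
  thus ?thesis using g(2)[OF lt s'] by blast
 qed
 have "U i = (\<Union>M. path_image (g M))"
 proof
  show "(\<Union>M. path_image (g M)) \<subseteq> U i"
  proof
   fix z assume "z \<in> (\<Union>M. path_image (g M))"
   then obtain M y where y: "strand (n * M) y (cd i) z" using g(3) by blast
   have "cd i k = lam (int k + int (n * M) + i)" for k
    using fun_cong[OF cd_period[of i M], of k] by (simp add: cd_def algebra_simps)
   thus "z \<in> U i" using y unfolding U_def by blast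
  qed
  show "U i \<subseteq> (\<Union>M. path_image (g M))"
  proof
   fix z assume "z \<in> U i"
   then obtain N y l k0 where l: "strand N y l z" "\<And>k. k0 \<le> k ==> l k = lam (int k + int N + i)"
    by (auto simp: U_def)
   define M0 where "M0 = N + k0"
   have M0: "n * M0 = N + (n * M0 - N)" "k0 \<le> n * M0 - N"
   proof -
    have "M0 \<le> n * M0" using n_pos by simp
    moreover have "M0 = N + k0" by (fact M0_def)
    ultimately show "n * M0 = N + (n * M0 - N)" "k0 \<le> n * M0 - N" by linarith+
   qed
   define y0 where "y0 = bk y l (n * M0 - N)"
   have "shift (n * M0 - N) l = cd i"
   proof
    fix k
    have "shift (n * M0 - N) l k = lam (int (k + (n * M0 - N)) + int N + i)" using M0(2) by (intro l(2)) simp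
    also have "int (k + (n * M0 - N)) + int N + i = (i + int (n * M0)) + int k" using M0(1) by linarith
    finally show "shift (n * M0 - N) l k = cd i k" using fun_cong[OF cd_period[of i M0], of k] by (simp add: cd_def)
   qed
   hence s0: "strand (n * M0) y0 (cd i) z"
    using strand_add[OF l(1), of "n * M0 - N"] M0(1) by (simp add: y0_def)
   obtain M where M: "\<bar>y0 - Z i\<bar> / mu < s ^ M" using real_arch_pow[OF s_gt1] by blast
   have "s ^ M \<le> s ^ (n * M)" using s_gt1 n_pos by (intro power_increasing) auto
   hence "\<bar>y0 - Z i\<bar> / mu < s ^ (n * M)" using M by linarith
   hence "\<bar>y0 - Z i\<bar> / s ^ (n * M) < mu" using mu(1) s_pos by (simp add: field_simps)
   moreover have "\<bar>bk y0 (cd i) (n * M) - Z i\<bar> = \<bar>y0 - Z i\<bar> / s ^ (n * M)"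
    using bk_diff[of y0 "cd i" "n * M" "Z i"] Z_period[of i "int M"] by (simp add: bk_cd)
   moreover have "strand (n * (M0 + M)) (bk y0 (cd i) (n * M)) (cd i) z"
    using strand_add[OF s0, of "n * M"] cd_period[of i M] by (simp add: shift_cd distrib_left)
   ultimately have "z \<in> path_image (g (M0 + M))" by (intro g(2)[of "bk y0 (cd i) (n * M)"]) auto
   thus "z \<in> (\<Union>M. path_image (g M))" by blast
  qed
 qed
 thus ?thesis using g(1) step by blast
qed

lemma line_U: "line (U i)"
proof -
 obtain g where g: "\<And>M. arc (g M)" "\<And>M. path_image (g M) \<subseteq> path_image (g (Suc M)) - {pathstart (g (Suc M)), pathfinish (g (Suc M))}"
  "U i = (\<Union>M. path_image (g M))" using U_arcs[of i] by blast
 show ?thesis unfolding g(3) by (rule line_increasing_arcs) (rule g)+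
qed

lemma U_arc:
 assumes "z \<in> U i" "z' \<in> U i" "z ~= z'"
 shows "\<exists>g. arc g \<and> path_image g \<subseteq> U i \<and> pathstart g = z \<and> pathfinish g = z'"
proof -
 obtain G where G: "\<And>M. arc (G M)" "\<And>M. path_image (G M) \<subseteq> path_image (G (Suc M))" "U i = (\<Union>M. path_image (G M))"
  using U_arcs[of i] by blast
 have mono: "path_image (G M) \<subseteq> path_image (G M')" if "M \<le> M'" for M M' using that by (rule lift_Suc_mono_le[of "%M. path_image (G M)", OF G(2)])
 obtain M M' where "z \<in> path_image (G M)" "z' \<in> path_image (G M')" using assms G(3) by blast
 then obtain g where g: "arc g" "z \<in> path_image g" "z' \<in> path_image g" "path_image g \<subseteq> U i"
  using G(1,3) subsetD[OF mono[OF max.cobounded1]] subsetD[OF mono[OF max.cobounded2]] by blast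
 obtain t t' where t: "t \<in> {0..1}" "t' \<in> {0..1}" "z = g t" "z' = g t'" using g(2,3) unfolding path_image_def by blast
 have "arc (subpath t t' g)" using g(1) t assms(3) by (intro arc_subpath_arc) auto
 moreover have "path_image (subpath t t' g) \<subseteq> U i"
  using path_image_subpath_subset[of t t' g] t g(4) by blast
 ultimately show ?thesis using t by (intro exI[of _ "subpath t t' g"]) auto
qed

lemma arc_component_U:
 assumes "w \<in> U i"
 shows "arc_component KK w = U i"
proof
 show "arc_component KK w \<subseteq> U i"
 proof
  fix z assume "z \<in> arc_component KK w"
  then consider "z = w" | g where "arc g" "path_image g \<subseteq> KK" "w \<in> path_image g" "z \<in> path_image g"
   unfolding arc_component_def by blast
  thus "z \<in> U i"
  proof cases
   case 2
   thus ?thesis using path_samet[OF arc_imp_path[OF 2(1)] 2(2,3,4)] U_samet[OF assms] by blast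
  qed (use assms in simp)
 qed
 show "U i \<subseteq> arc_component KK w"
 proof
  fix z assume z: "z \<in> U i"
  show "z \<in> arc_component KK w"
  proof (cases "z = w")
   case False
   then obtain g where g: "arc g" "path_image g \<subseteq> U i" "pathstart g = w" "pathfinish g = z"
    using U_arc[OF assms z] by metis
   have "z \<in> path_image g" "w \<in> path_image g" using g(3,4) pathstart_in_path_image pathfinish_in_path_image by metis+
   moreover have "path_image g \<subseteq> KK" using g(2) U_sub_KK[of i] by (rule subset_trans)
   ultimately show ?thesis using g(1) unfolding arc_component_def by blast
  qed (simp add: arc_component_def)
 qed
qed

lemma U_in_arc_components: "U i \<in> arc_components KK"
 unfolding arc_components_def arc_component_U[OF Fold_U, symmetric] using Fold_U U_sub_KK by (intro imageI) blast

text \<open>The reversed kneading sequence reads the rotation in the opposite direction. The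
  residues below \<open>2 * m\<close> are symmetric under \<open>r\<close> going to
  \<open>2 * m - 1 - r\<close>, and \<open>w\<close> solves \<open>w * m = m - 1\<close> modulo
  \<open>n\<close>.\<close>

lemma lam_reflect: "\<exists>w. \<forall>k. lam (1 - k) = lam (k + w)"
proof -
 obtain u v where uv: "u * int m + v * int n = 1"
  using bezout_int[of "int m" "int n"] co by (auto simp: coprime_iff_gcd_eq_1)
 define w where "w = u * (int m - 1)"
 have w: "w * int m = int m - 1 - int n * (v * (int m - 1))"
 proof -
  have "w * int m = (u * int m + v * int n) * (int m - 1) - int n * (v * (int m - 1))"
   by (simp add: w_def algebra_simps)
  thus ?thesis by (simp add: uv)
 qed
 have "lam (1 - k) = lam (k + w)" for k
 proof -
  define r where "r = ((1 - k) * int m) mod int n"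
  have r: "0 \<le> r" "r < int n" using n_pos by (auto simp: r_def)
  have "(1 - k) * int m = r + int n * (((1 - k) * int m) div int n)" by (simp add: r_def)
  hence "(k + w) * int m = (2 * int m - 1 - r) + int n * (- (((1 - k) * int m) div int n) - v * (int m - 1))"
   using w by (simp add: algebra_simps)
  hence e: "((k + w) * int m) mod int n = (2 * int m - 1 - r) mod int n" by (simp only: mod_mult_self2)
  show ?thesis
  proof (cases "r < 2 * int m")
   case True
   hence "(2 * int m - 1 - r) mod int n = 2 * int m - 1 - r" using r mn by (intro mod_pos_pos_trivial) auto
   thus ?thesis using True e r by (simp add: lam_def r_def[symmetric])
  next
   case False
   have "(2 * int m - 1 - r) mod int n = (2 * int m - 1 - r + int n) mod int n" by simp
   also have "\<dots> = 2 * int m - 1 - r + int n" using False r by (intro mod_pos_pos_trivial) auto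
   finally show ?thesis using False e r by (simp add: lam_def r_def[symmetric])
  qed
 qed
 thus ?thesis by blast
qed

lemma kneading_lam: "2 \<le> k ==> kneading s k = lam (1 - int k)"
proof -
 assume "2 \<le> k"
 then obtain j where j: "k = j + 2" by (metis add.commute le_Suc_ex)
 have k3: "Suc k = j + 3" using j by simp
 have "- (int j + 1) = 1 - int k" using j by simp
 thus ?thesis using kneading_eq[of k] itin_lam[of j] unfolding k3 by metis
qed

text \<open>A backward orbit meets 1/2 at most once, as 1/2 is not periodic; beyond that place each
  symbol is forced by the point.\<close>

lemma two_codes:
 assumes x: "x \<in> tent_core s" and r: "represents s \<sigma> x" "represents s \<tau> x"
 shows "\<exists>k0. \<forall>k\<ge>k0. left_part \<sigma> k = left_part \<tau> k"
proof -
 have sym: "left_part \<rho> k = (1/2 < x (Suc k))" if "represents s \<rho> x" "x (Suc k) ~= 1/2" for \<rho> k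
  using bk_sym[OF represents_Adm(1)[OF x that(1)], of k] represents_Adm(2)[OF x that(1), of "Suc k"] that(2) by simp
 have pow: "(T ^^ j) (x (k + j)) = x k" for j k
  using funpow_T_bk[OF represents_Adm(1)[OF x r(1)], of j k] represents_Adm(2)[OF x r(1)] by (simp add: add.commute)
 show ?thesis
 proof (cases "\<exists>k. x k = 1/2")
  case True
  then obtain k0 where k0: "x k0 = 1/2" by blast
  have "x k ~= 1/2" if "k0 < k" for k
   using pow[of "k - k0" k0] nonper[of "k - k0"] that k0 by auto
  thus ?thesis using sym[OF r(1)] sym[OF r(2)] by (metis le_imp_less_Suc)
 next
  case False
  thus ?thesis using sym[OF r(1)] sym[OF r(2)] by metis
 qed
qed

lemma tail_shift_U: "tail_shift_of_kneading s L_ray (U i')"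
proof -
 obtain w where w: "\<And>k. lam (1 - k) = lam (k + w)" using lam_reflect by blast
 define i where "i = w - i'"
 have key: "(\<forall>\<^sub>F k in sequentially. l (nat (int k + i)) = kneading s k) \<longleftrightarrow> (\<exists>k0. \<forall>k\<ge>k0. l k = lam (int k + i'))" for l
 proof
  assume "\<forall>\<^sub>F k in sequentially. l (nat (int k + i)) = kneading s k"
  then obtain K where K: "\<And>k. K \<le> k ==> l (nat (int k + i)) = kneading s k" by (auto simp: eventually_sequentially)
  have "l k = lam (int k + i')" if k: "K + 2 + nat \<bar>i\<bar> \<le> k" for k
  proof -
   define j where "j = nat (int k - i)"
   have j: "int j = int k - i" "K \<le> j" "2 \<le> j" using k by (auto simp: j_def)
   hence "l k = kneading s j" using K[of j] by simp
   also have "\<dots> = lam (int j + w)" using kneading_lam[OF j(3)] w by simp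
   also have "int j + w = int k + i'" using j(1) by (simp add: i_def)
   finally show ?thesis .
  qed
  thus "\<exists>k0. \<forall>k\<ge>k0. l k = lam (int k + i')" by blast
 next
  assume "\<exists>k0. \<forall>k\<ge>k0. l k = lam (int k + i')"
  then obtain k0 where k0: "\<And>k. k0 \<le> k ==> l k = lam (int k + i')" by blast
  have "l (nat (int k + i)) = kneading s k" if k: "k0 + 2 + nat \<bar>i\<bar> \<le> k" for k
  proof -
   define j where "j = nat (int k + i)"
   have j: "int j = int k + i" "k0 \<le> j" using k by (auto simp: j_def)
   have "l j = lam (int j + i')" using k0[OF j(2)] .
   also have "int j + i' = int k + w" using j(1) by (simp add: i_def)
   also have "lam (int k + w) = kneading s k" using kneading_lam[of k] w k by simp
   finally show ?thesis by (simp add: j_def)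
  qed
  thus "\<forall>\<^sub>F k in sequentially. l (nat (int k + i)) = kneading s k" unfolding eventually_sequentially by blast
 qed
 let ?X = "tent_core s \<inter> \<Union>{basic_arc s l | l. \<exists>k0. \<forall>k\<ge>k0. l k = lam (int k + i')}"
 have "U i' = phi s L_ray ?X"
 proof
  show "U i' \<subseteq> phi s L_ray ?X"
  proof
   fix z assume z: "z \<in> U i'"
   then obtain N y l where l: "strand N y l z" by (auto simp: U_def)
   obtain k0 where k0: "\<And>k. k0 \<le> k ==> l k = lam (int k + int N + i')" using U_strand[OF z l] by blast
   obtain x l' where x: "x \<in> tent_core s" "z \<in> draw_point s L_ray x" "x \<in> basic_arc s l'" "l = shift N l'"
    using phi_core_supset[OF l] by blast
   have "l' k = lam (int k + i')" if "k0 + N \<le> k" for k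
   proof -
    have "l' k = l (k - N)" using x(4) that by simp
    also have "\<dots> = lam (int (k - N) + int N + i')" using that by (intro k0) simp
    finally show ?thesis using that by simp
   qed
   hence "x \<in> ?X" using x by blast
   thus "z \<in> phi s L_ray ?X" using x(2) unfolding phi_def by blast
  qed
  show "phi s L_ray ?X \<subseteq> U i'"
  proof
   fix z assume "z \<in> phi s L_ray ?X"
   then obtain x l0 k0 where x: "x \<in> tent_core s" "z \<in> draw_point s L_ray x" "x \<in> basic_arc s l0"
    "\<And>k. k0 \<le> k ==> l0 k = lam (int k + i')" unfolding phi_def by blast
   obtain N y l \<sigma> where l: "strand N y l z" "represents s \<sigma> x" "l = shift N (left_part \<sigma>)"
    using phi_core_subset[OF x(1,2)] by blast
   obtain \<tau> where t: "represents s \<tau> x" "left_part \<tau> = l0" using x(3) by (auto simp: basic_arc_def)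
   obtain k1 where k1: "\<And>k. k1 \<le> k ==> left_part \<sigma> k = left_part \<tau> k"
    using two_codes[OF x(1) l(2) t(1)] by blast
   have "l k = lam (int k + int N + i')" if "max k0 k1 \<le> k" for k
    using k1[of "k + N"] x(4)[of "k + N"] that by (simp add: l(3) t(2) add.assoc)
   thus "z \<in> U i'" using l(1) unfolding U_def by blast
  qed
 qed
 thus ?thesis unfolding tail_shift_of_kneading_def key[symmetric] by blast
qed

section \<open>Density\<close>

lemma funpow_image_add: "(T ^^ (j + k)) ` S = (T ^^ j) ` ((T ^^ k) ` S)"
 by (auto simp: funpow_add image_comp)

text \<open>On one side of 1/2 the length grows by \<open>s\<close>. An interval across 1/2 may be
  folded in half, leaving the factor \<open>s / 2\<close>, but its image reaches \<open>b\<close>: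
  either that image lies right of 1/2 and the next step contributes another \<open>s\<close>, or it
  contains \<open>{1/2..b}\<close>, which maps onto the whole core. The worst factor
  \<open>s * s / 2\<close> exceeds 1 because \<open>s > sqrt 2\<close>.\<close>

lemma expand_step:
 assumes "a \<le> p" "p < r" "r \<le> b"
 shows "(\<exists>j. {a..b} \<subseteq> (T ^^ j) ` {p..r}) \<or>
  (\<exists>j p' r'. a \<le> p' \<and> p' < r' \<and> r' \<le> b \<and> {p'..r'} \<subseteq> (T ^^ j) ` {p..r} \<and> (s * s / 2) * (r - p) \<le> r' - p')"
proof -
 have s1: "s * s / 2 \<le> s" using s_pos s_lt by (simp add: field_simps)
 have TR: "a \<le> T x" "T x \<le> b" if "p \<le> x" "x \<le> r" for x using T_range[of x] that assms by auto
 consider "r \<le> 1/2" | "1/2 \<le> p" | "p < 1/2" "1/2 < r" by linarith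
 thus ?thesis
 proof cases
  case 1
  have "T r - T p = s * (r - p)" using 1 assms by (simp add: T_left algebra_simps)
  moreover have "s * s / 2 * (r - p) \<le> s * (r - p)" using s1 assms by (intro mult_right_mono) auto
  moreover have "{T p..T r} \<subseteq> (T ^^ 1) ` {p..r}" using T_image_Icc(1) assms 1 by simp
  ultimately show ?thesis using TR[of p] TR[of r] T_less_left[OF assms(2) 1] assms
   by (intro disjI2 exI[of _ "1::nat"], intro exI[of _ "T p"] exI[of _ "T r"]) simp
 next
  case 2
  have "T p - T r = s * (r - p)" using 2 assms by (simp add: T_right algebra_simps)
  moreover have "s * s / 2 * (r - p) \<le> s * (r - p)" using s1 assms by (intro mult_right_mono) auto
  moreover have "{T r..T p} \<subseteq> (T ^^ 1) ` {p..r}" using T_image_Icc(2) assms 2 by simp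
  ultimately show ?thesis using TR[of p] TR[of r] T_less_right[OF assms(2) 2] assms
   by (intro disjI2 exI[of _ "1::nat"], intro exI[of _ "T r"] exI[of _ "T p"]) simp
 next
  case 3
  define e where "e = min (T p) (T r)"
  have Tp: "T p = s * p" "T r = s * (1 - r)" using 3 by (auto simp: T_left T_right)
  have sub1: "{e..b} \<subseteq> (T ^^ 1) ` {p..r}"
  proof -
   have "{T p..b} \<subseteq> T ` {p..1/2}" "{T r..b} \<subseteq> T ` {1/2..r}"
    using T_image_Icc(1)[of p "1/2"] T_image_Icc(2)[of "1/2" r] 3 by (simp_all add: T_crit)
   moreover have "T ` {p..1/2} \<subseteq> T ` {p..r}" "T ` {1/2..r} \<subseteq> T ` {p..r}" using 3 by (auto intro!: image_mono)
   ultimately have "{T p..b} \<subseteq> T ` {p..r}" "{T r..b} \<subseteq> T ` {p..r}" by blast+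
   thus ?thesis by (cases "T p \<le> T r") (auto simp: e_def min_def)
  qed
  have elen: "s / 2 * (r - p) \<le> b - e"
  proof -
   have "(b - T p) + (b - T r) = s * (r - p)" by (simp add: Tp b_def algebra_simps)
   moreover have "b - T p \<le> b - e" "b - T r \<le> b - e" by (auto simp: e_def)
   ultimately show ?thesis by simp
  qed
  have eb: "e < b" using elen assms s_pos by (smt (verit) divide_pos_pos mult_pos_pos)
  have ea: "a \<le> e" using TR[of p] TR[of r] assms by (auto simp: e_def)
  show ?thesis
  proof (cases "1/2 \<le> e")
   case True
   have "{T b..T e} \<subseteq> T ` {e..b}" using T_image_Icc(2)[of e b] True eb by simp
   also have "\<dots> \<subseteq> (T ^^ (1 + 1)) ` {p..r}" unfolding funpow_image_add using sub1 by (simp add: image_mono)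
   finally have 1: "{a..T e} \<subseteq> (T ^^ (1 + 1)) ` {p..r}" by (simp only: T_b)
   have "T e - T b = s * (b - e)" using True b_gt by (simp add: T_right algebra_simps)
   hence 2: "T e - a = s * (b - e)" by (simp only: T_b)
   have "s * s / 2 * (r - p) \<le> T e - a"
    using mult_left_mono[OF elen, of s] s_pos unfolding 2 by (simp add: mult.assoc)
   moreover have "a < T e" using 2 eb s_pos by (smt (verit) mult_pos_pos)
   moreover have "T e \<le> b" using T_range[of e] ea eb by simp
   ultimately show ?thesis using 1 by blast
  next
   case False
   have "{T b..T (1/2)} \<subseteq> T ` {1/2..b}" using T_image_Icc(2)[of "1/2" b] b_gt by simp
   also have "\<dots> \<subseteq> T ` {e..b}" using False by (intro image_mono) auto
   also have "\<dots> \<subseteq> (T ^^ (1 + 1)) ` {p..r}" unfolding funpow_image_add using sub1 by (simp add: image_mono)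
   finally have "{a..b} \<subseteq> (T ^^ (1 + 1)) ` {p..r}" by (simp only: T_b T_crit)
   thus ?thesis by blast
  qed
 qed
qed

lemma locally_eventually_onto:
 assumes "a \<le> p" "p < r" "r \<le> b"
 shows "\<exists>K. \<forall>k\<ge>K. {a..b} \<subseteq> (T ^^ k) ` {p..r}"
proof -
 have "\<exists>j. {a..b} \<subseteq> (T ^^ j) ` {p..r}"
 proof (rule ccontr)
  assume no: "\<nexists>j. {a..b} \<subseteq> (T ^^ j) ` {p..r}"
  have "\<exists>j p' r'. a \<le> p' \<and> p' < r' \<and> r' \<le> b \<and> {p'..r'} \<subseteq> (T ^^ j) ` {p..r} \<and> (s * s / 2) ^ k * (r - p) \<le> r' - p'" for k
  proof (induction k)
   case 0
   show ?case using assms by (intro exI[of _ "0::nat"], intro exI[of _ p] exI[of _ r]) simp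
  next
   case (Suc k)
   then obtain j p' r' where 1: "a \<le> p'" "p' < r'" "r' \<le> b" "{p'..r'} \<subseteq> (T ^^ j) ` {p..r}"
    "(s * s / 2) ^ k * (r - p) \<le> r' - p'" by blast
   have sub: "(T ^^ j') ` {p'..r'} \<subseteq> (T ^^ (j' + j)) ` {p..r}" for j'
    unfolding funpow_image_add using 1(4) by (rule image_mono)
   have "\<not> {a..b} \<subseteq> (T ^^ j') ` {p'..r'}" for j' using no sub by blast
   then obtain j' p2 r2 where 2: "a \<le> p2" "p2 < r2" "r2 \<le> b" "{p2..r2} \<subseteq> (T ^^ j') ` {p'..r'}"
    "(s * s / 2) * (r' - p') \<le> r2 - p2" using expand_step[OF 1(1-3)] by blast
   have "(s * s / 2) ^ Suc k * (r - p) = (s * s / 2) * ((s * s / 2) ^ k * (r - p))" by simp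
   also have "\<dots> \<le> (s * s / 2) * (r' - p')" using 1(5) by (intro mult_left_mono) auto
   also have "\<dots> \<le> r2 - p2" by (rule 2(5))
   finally show ?case using 2 sub[of j'] by blast
  qed
  hence bd: "(s * s / 2) ^ k * (r - p) \<le> b - a" for k by (meson diff_mono order_trans)
  have "1 < s * s / 2" using s_sq by simp
  then obtain k where "(b - a) / (r - p) < (s * s / 2) ^ k" using real_arch_pow by blast
  thus False using bd[of k] assms by (simp add: field_simps)
 qed
 then obtain j where j: "{a..b} \<subseteq> (T ^^ j) ` {p..r}" by blast
 have onto: "{a..b} \<subseteq> T ` {a..b}"
 proof -
  have "{a..b} \<subseteq> T ` {1/2..b}" using T_image_Icc(2)[of "1/2" b] b_gt by (simp add: T_b T_crit)
  thus ?thesis using a_lt by (force)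
 qed
 have "{a..b} \<subseteq> (T ^^ (i + j)) ` {p..r}" for i
 proof (induction i)
  case (Suc i)
  have "{a..b} \<subseteq> T ` {a..b}" by (rule onto)
  also have "\<dots> \<subseteq> T ` ((T ^^ (i + j)) ` {p..r})" using Suc by (rule image_mono)
  finally show ?case by (simp add: image_comp)
 qed (use j in simp)
 thus ?thesis by (metis add.commute le_Suc_ex)
qed

section \<open>Splicing codes\<close>

definition pre :: "nat => (nat => bool) => (nat => bool) => nat => bool" where
 "pre N l l' k = (if k < N then l k else l' (k - N))"

lemma bk_pre: "k \<le> N ==> bk y (pre N l l') k = bk y l k"
 by (rule bk_cong) (simp add: pre_def)

lemma shift_pre: "shift N (pre N l l') = l'" by (auto simp: pre_def)

lemma bk_pre': "bk y (pre N l l') (N + k) = bk (bk y l N) l' k"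
 using bk_shift[of y "pre N l l'" k N] by (simp add: bk_pre shift_pre add.commute)

lemma Adm_pre: assumes "Adm y l" "Adm (bk y l N) l'" shows "Adm y (pre N l l')"
proof -
 have "s * a \<le> bk y (pre N l l') k" if "\<not> pre N l l' k" for k
 proof (cases "k < N")
  case True
  thus ?thesis using that assms(1) by (simp add: pre_def bk_pre Adm_def)
 next
  case False
  hence k: "k = N + (k - N)" by simp
  have "\<not> l' (k - N)" using that False by (simp add: pre_def)
  hence "s * a \<le> bk (bk y l N) l' (k - N)" using assms(2) by (simp add: Adm_def)
  thus ?thesis using bk_pre'[of y N l l' "k - N"] k by simp
 qed
 thus ?thesis using assms(1) by (simp add: Adm_def)
qed

lemma Adm_forward:
 assumes "Adm x c"
 shows "\<exists>l. Adm ((T ^^ K) x) l \<and> shift K l = c \<and> bk ((T ^^ K) x) l K = x"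
proof (induction K)
 case 0
 show ?case using assms by auto
next
 case (Suc K)
 then obtain l where l: "Adm ((T ^^ K) x) l" "shift K l = c" "bk ((T ^^ K) x) l K = x" by blast
 define y where "y = (T ^^ K) x"
 have "Adm (T y) (case_nat (1/2 < y) l) \<and> bk (T y) (case_nat (1/2 < y) l) (Suc K) = bk y l K"
 proof (cases "y = 1/2")
  case True
  thus ?thesis using Adm_cons_crit(1)[of l] Adm_cons_crit(2)[of l _ K] l(1) by (simp add: y_def[symmetric] T_crit del: bk.simps)
 next
  case False
  thus ?thesis using Adm_cons(1)[of y l "1/2 < y"] Adm_cons(2)[of y l "1/2 < y" K] l(1) by (simp add: y_def[symmetric] del: bk.simps)
 qed
 moreover have "shift (Suc K) (case_nat (1/2 < y) l) = c" using l(2) by simp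
 moreover have "T y = (T ^^ Suc K) x" by (simp add: y_def)
 moreover have "bk y l K = x" using l(3) by (simp add: y_def)
 ultimately show ?case by metis
qed

text \<open>Small intervals around \<open>Z i\<close> eventually cover the core, so \<open>y\<close>
  is a forward image of some point near \<open>Z i\<close>. The code of \<open>y\<close> follows
  that orbit back and then continues with \<open>cd i\<close>.\<close>

lemma tail_exists:
 assumes "a \<le> y" "y \<le> b"
 shows "\<exists>l. Adm y l \<and> (\<exists>k0. \<forall>k\<ge>k0. l k = lam (int k + i))"
proof -
 have "\<forall>j. \<exists>K. \<forall>k\<ge>K. {a..b} \<subseteq> (T ^^ k) ` {Z j - mu..Z j + mu}"
 proof
  fix j
  have "Adm (Z j - mu) (cd j)" "Adm (Z j + mu) (cd j)" using mu by auto
  thus "\<exists>K. \<forall>k\<ge>K. {a..b} \<subseteq> (T ^^ k) ` {Z j - mu..Z j + mu}"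
   using mu(1) by (intro locally_eventually_onto) (auto simp: Adm_def)
 qed
 then obtain K where K: "\<And>j k. K j \<le> k ==> {a..b} \<subseteq> (T ^^ k) ` {Z j - mu..Z j + mu}" by metis
 \<comment> \<open>A multiple of \<open>n\<close>, so that the attached tail keeps its
   index.\<close>
 define k where "k = n * K i"
 have "K i \<le> k" using n_pos by (simp add: k_def)
 from K[OF this] assms obtain x where x: "x \<in> {Z i - mu..Z i + mu}" "y = (T ^^ k) x" by force
 have "Adm x (cd i)" using x(1) by (intro mu(2)) (auto simp: abs_le_iff)
 from Adm_forward[OF this, of k] obtain l where l: "Adm y l" "shift k l = cd i" using x(2) by blast
 have "l j = lam (int j + i)" if "k \<le> j" for j
 proof -
  have "l j = cd i (j - k)" using fun_cong[OF l(2), of "j - k"] that by simp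
  also have "\<dots> = cd (i + int (n * K i)) (j - k)" by (simp only: cd_period)
  also have "\<dots> = lam (int j + i)" using that by (simp add: cd_def k_def of_nat_diff algebra_simps)
  finally show ?thesis .
 qed
 thus ?thesis using l(1) by blast
qed

lemma approx_tail:
 assumes "Adm y l"
 shows "\<exists>l2. Adm y l2 \<and> (\<forall>k<N. l2 k = l k) \<and> (\<exists>k0. \<forall>k\<ge>k0. l2 k = lam (int k + i))"
proof -
 obtain l' k0 where l': "Adm (bk y l N) l'" "\<And>k. k0 \<le> k ==> l' k = lam (int k + (int N + i))"
  using tail_exists[OF Adm_range[OF assms, of N], of "int N + i"] by blast
 have "pre N l l' k = lam (int k + i)" if "k0 + N \<le> k" for k
  using l'(2)[of "k - N"] that by (simp add: pre_def of_nat_diff)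
 thus ?thesis using Adm_pre[OF assms l'(1)] by (intro exI[of _ "pre N l l'"] conjI) (auto simp only: pre_def if_True)
qed

lemma cap_rescale:
 assumes z: "z \<in> cap j r" and r: "0 < r" "0 < r2"
 shows "\<exists>z2\<in>cap j r2. dist z z2 \<le> \<bar>r - r2\<bar> / 3 ^ j"
proof -
 obtain t where t: "t \<in> {- 1..1}" "z = cpt j r t" using z cap_eq_cpt[OF r(1)] by auto
 define x where "x = (r - r2) / 3 ^ j"
 have t2: "0 \<le> 1 - t\<^sup>2" using t(1) by (simp add: abs_square_le_1 abs_le_iff)
 have "z - cpt j r2 t = (ec j * (x * sqrt (1 - t\<^sup>2)), x * t)"
  by (simp add: t(2) cpt_def x_def diff_divide_distrib algebra_simps)
 moreover have "(ec j * (x * sqrt (1 - t\<^sup>2)))\<^sup>2 + (x * t)\<^sup>2 = x\<^sup>2"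
  using ec_cases[of j] t2 by (auto simp: power_mult_distrib algebra_simps)
 ultimately have "dist z (cpt j r2 t) = \<bar>x\<bar>"
  by (simp only: dist_norm norm_Pair real_norm_def power2_abs real_sqrt_abs)
 moreover have "cpt j r2 t \<in> cap j r2" using cap_eq_cpt[OF r(2)] t(1) by auto
 ultimately show ?thesis by (intro bexI[of _ "cpt j r2 t"]) (simp_all add: x_def abs_divide)
qed

lemma U_dense: "KK \<subseteq> closure (U i)"
proof
 fix z assume z: "z \<in> KK"
 show "z \<in> closure (U i)"
  unfolding closure_approachable
 proof (intro allI impI)
  fix e :: real assume e: "0 < e"
  obtain M where M: "10 / 3 ^ M < e" using ex_pow3[OF e] by blast
  have close: "\<bar>psi0 l2 - psi0 l\<bar> < e" if "\<forall>k<M. l2 k = l k" for l l2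
  proof -
   have "\<bar>psi0 l2 - psi0 l\<bar> \<le> 1 / 3 ^ M" using that by (intro psi0_close) auto
   also have "\<dots> \<le> 10 / 3 ^ M" by (simp add: divide_right_mono)
   finally show ?thesis using M by simp
  qed
  from z[unfolded KK_iff] show "\<exists>z'\<in>U i. dist z' z < e"
  proof (elim disjE exE)
   assume "z \<in> Str"
   then obtain y l where l: "Adm y l" "z = (y, psi0 l)" by (auto simp: Str_def strand_0)
   obtain l2 where l2: "Adm y l2" "\<forall>k<M. l2 k = l k" "\<exists>k0. \<forall>k\<ge>k0. l2 k = lam (int k + i)"
    using approx_tail[OF l(1), of M i] by blast
   have "strand 0 y l2 (y, psi0 l2)" using l2(1) by (simp add: strand_0)
   from U_I[OF this, of i] l2(3) have "(y, psi0 l2) \<in> U i" by simp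
   moreover have "dist (y, psi0 l2) z < e" using close[OF l2(2)] by (simp add: l(2) dist_prod_def dist_real_def)
   ultimately show ?thesis by blast
  next
   fix j assume "z \<in> Caps j"
   then obtain l where l: "Adm (1/2) l" "z \<in> cap j (1/2 - psi0 l / 3)" by (auto simp: Caps_def strand_crit)
   obtain l2 k0 where l2: "Adm (1/2) l2" "\<forall>k<M. l2 k = l k" "\<And>k. k0 \<le> k ==> l2 k = lam (int k + (int (Suc j) + i))"
    using approx_tail[OF l(1), of M "int (Suc j) + i"] by blast
   define r r2 where "r = 1/2 - psi0 l / 3" and "r2 = 1/2 - psi0 l2 / 3"
   have r: "0 < r" "0 < r2" using psi0_range[of l] psi0_range[of l2] by (auto simp: r_def r2_def)
   obtain z2 where z2: "z2 \<in> cap j r2" "dist z z2 \<le> \<bar>r - r2\<bar> / 3 ^ j"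
    using cap_rescale l(2) r unfolding r_def by blast
   hence "strand (Suc j) (1/2) l2 z2" using l2(1) z2(1) by (simp add: strand_crit r2_def)
   hence "z2 \<in> U i" using l2(3) by (intro U_I[of _ _ l2] exI[of _ k0]) (auto simp: add.assoc)
   moreover have "\<bar>r - r2\<bar> / 3 ^ j \<le> \<bar>r - r2\<bar> / 1" by (intro divide_left_mono) auto
   hence "dist z2 z < e" using z2(2) close[OF l2(2)] by (simp add: r_def r2_def dist_commute)
   ultimately show ?thesis by blast
  qed
 qed
qed

lemma connected_U: "connected (U i)"
proof (rule connected_iff_eq_connected_component_set[THEN iffD2], rule)
 fix z assume z: "z \<in> U i"
 have "U i \<subseteq> connected_component_set (U i) z"
 proof
  fix z' assume z': "z' \<in> U i"
  show "z' \<in> connected_component_set (U i) z"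
  proof (cases "z = z'")
   case False
   obtain g where g: "arc g" "path_image g \<subseteq> U i" "pathstart g = z" "pathfinish g = z'"
    using U_arc[OF z z' False] by blast
   hence "connected (path_image g)" "z \<in> path_image g" "z' \<in> path_image g"
    using connected_path_image[OF arc_imp_path] by auto
   thus ?thesis using g(2) unfolding mem_Collect_eq connected_component_def by blast
  qed (use z in simp)
 qed
 thus "connected_component_set (U i) z = U i" using connected_component_subset by blast
qed

lemma closure_U: "closure (U i) = KK"
 using U_dense closure_minimal[OF U_sub_KK closed_KK] by blast

lemma connected_KK: "connected KK"
 using connected_intermediate_closure[OF connected_U U_sub_KK, of 0] closure_U[of 0] by simp


section \<open>Strands that are not approached from one side\<close>

text \<open>Ones are never constrained, so a tail of ones completes any admissible
  beginning.\<close>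

lemma Adm_alt_tail: "a \<le> y ==> y \<le> b ==> e \<or> s * a \<le> y ==> Adm y (case_nat e (%_. True))"
 unfolding Adm_def by (auto split: nat.splits)

lemma Adm_alt:
 assumes "Adm y l" "l N ==> s * a \<le> bk y l N"
 shows "\<exists>l'. Adm y l' \<and> (\<forall>k<N. l' k = l k) \<and> l' N ~= l N"
proof -
 have "Adm (bk y l N) (case_nat (\<not> l N) (%_. True))"
  using Adm_range[OF assms(1)] assms(2) by (intro Adm_alt_tail) auto
 from Adm_pre[OF assms(1) this] show ?thesis
  by (intro exI[of _ "pre N l (case_nat (\<not> l N) (%_. True))"]) (simp add: pre_def)
qed

lemma psi0_flip:
 assumes "\<And>k. k < N ==> l' k = l k" "l' N ~= l N"
 shows "0 < parity_sign l N * (if l N then - 1 else 1) * (psi0 l' - psi0 l)"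
proof -
 define x x' where "x = psi0 (shift N l)" and "x' = psi0 (shift N l')"
 have r: "0 \<le> psi0 (shift 1 (shift N l))" "psi0 (shift 1 (shift N l)) \<le> 1"
  "0 \<le> psi0 (shift 1 (shift N l'))" "psi0 (shift 1 (shift N l')) \<le> 1" using psi0_range by auto
 have x: "x = H (l N) (psi0 (shift 1 (shift N l)))" "x' = H (l' N) (psi0 (shift 1 (shift N l')))"
  using psi0_rec[of "shift N l"] psi0_rec[of "shift N l'"] by (simp_all add: x_def x'_def)
 have "0 < (if l N then - 1 else 1) * (x' - x)" using assms(2) r unfolding x H_def by (cases "l N"; cases "l' N") auto
 moreover have "psi0 l' - psi0 l = parity_sign l N * (x' - x) / 3 ^ N"
  unfolding psi0_hg[of l N] psi0_hg[of l' N] x_def x'_def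
  using hg_cong[of N l' l "psi0 (shift N l')"] assms(1) by (simp add: hg_diff)
 moreover have "parity_sign l N * parity_sign l N = 1"
  using abs_parity_sign[of l N] by (metis abs_mult_self_eq mult_1)
 moreover have "parity_sign l N = 1 \<or> parity_sign l N = - 1" using abs_parity_sign[of l N] by linarith
 ultimately show ?thesis by (elim disjE) (auto simp: divide_less_0_iff split: if_splits)
qed

text \<open>The strand is viewed from above for \<open>d = 1\<close> and from below for
  \<open>d = - 1\<close>. Every 1 that is passed reverses the view, and the value
  \<open>True\<close> means that at depth \<open>k\<close> the strand is seen from above.\<close>

definition stt :: "real => (nat => bool) => nat => bool" where
 "stt d l k \<longleftrightarrow> parity_sign l k * d = 1"

lemma parity_sign_Suc: "parity_sign l (Suc k) = parity_sign l k * (if l k then - 1 else 1)"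
 by (simp add: parity_sign_def)

lemma parity_sign_cases: "parity_sign l k = 1 \<or> parity_sign l k = - 1"
 using abs_parity_sign[of l k] by linarith

lemma stt_Suc: "d = 1 \<or> d = - 1 ==> stt d l (Suc k) = (stt d l k ~= l k)"
 using parity_sign_cases[of l k] by (auto simp: stt_def parity_sign_Suc)

definition rule_at :: "real => (nat => bool) => (nat => bool) => nat => bool" where
 "rule_at y l st k \<longleftrightarrow> l k = (st k \<or> bk y l k < s * a)"

text \<open>Where the rule fails, the other symbol is admissible, and by the parity at that depth it
  moves the height to side \<open>d\<close>.\<close>

lemma not_rule:
 assumes A: "Adm y l" and d: "d = 1 \<or> d = - 1" and nr: "\<not> rule_at y l (stt d l) k"
 shows "\<exists>l'. Adm y l' \<and> (\<forall>i<k. l' i = l i) \<and> 0 < d * (psi0 l' - psi0 l)"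
proof -
 have "\<not> l k ==> s * a \<le> bk y l k" using A by (simp add: Adm_def)
 hence 1: "l k ==> s * a \<le> bk y l k" "stt d l k = (\<not> l k)" using nr by (auto simp: rule_at_def)
 obtain l' where l': "Adm y l'" "\<forall>i<k. l' i = l i" "l' k ~= l k" using Adm_alt[OF A 1(1)] by blast
 have "0 < parity_sign l k * (if l k then - 1 else 1) * (psi0 l' - psi0 l)"
  using l' by (intro psi0_flip) auto
 hence "0 < d * (psi0 l' - psi0 l)" using 1(2) d parity_sign_cases[of l k] by (auto simp: stt_def split: if_splits)
 thus ?thesis using l' by blast
qed

lemma rule_run:
 assumes A: "Adm y l" and st: "\<And>k. st (Suc k) = (st k ~= l k)" and r: "\<And>k. K \<le> k ==> rule_at y l st k"
 shows "run (%k. bk y l (k + K)) (shift K l) (%k. st (k + K))"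
 using r Adm_range[OF A] st unfolding run_def rule_at_def by simp

definition isolated_side :: "real => (nat => bool) => real => bool" where
 "isolated_side y l d \<longleftrightarrow> (\<exists>e>0. \<forall>l'. Adm y l' --> 0 < d * (psi0 l' - psi0 l) --> e \<le> \<bar>psi0 l' - psi0 l\<bar>)"

text \<open>A failure of the rule at depth \<open>k\<close> would produce a strand on side
  \<open>d\<close> within distance \<open>1 / 3 ^ k\<close>.\<close>

lemma isolated_rule:
 assumes A: "Adm y l" and d: "d = 1 \<or> d = - 1" and i: "isolated_side y l d"
 shows "\<exists>K. \<forall>k\<ge>K. rule_at y l (stt d l) k"
proof -
 obtain e where e: "0 < e" "\<And>l'. Adm y l' ==> 0 < d * (psi0 l' - psi0 l) ==> e \<le> \<bar>psi0 l' - psi0 l\<bar>"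
  using i by (auto simp: isolated_side_def)
 obtain M where M: "\<And>j. M \<le> j ==> 10 / 3 ^ j < e" using ex_pow3[OF e(1)] by blast
 have "rule_at y l (stt d l) k" if k: "M \<le> k" for k
 proof (rule ccontr)
  assume "\<not> rule_at y l (stt d l) k"
  from not_rule[OF A d this] obtain l' where l': "Adm y l'" "\<forall>i<k. l' i = l i" "0 < d * (psi0 l' - psi0 l)" by blast
  have "\<bar>psi0 l' - psi0 l\<bar> \<le> 1 / 3 ^ k" using l'(2) by (intro psi0_close) auto
  also have "\<dots> \<le> 10 / 3 ^ k" by (simp add: divide_right_mono)
  finally show False using M[OF k] e(2)[OF l'(1,3)] by linarith
 qed
 thus ?thesis by blast
qed

lemma isolated_tail:
 assumes A: "Adm y l" and d: "d = 1 \<or> d = - 1" and i: "isolated_side y l d"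
 shows "\<exists>i k0. \<forall>k\<ge>k0. l k = lam (i + int k)"
proof -
 obtain K where "\<And>k. K \<le> k ==> rule_at y l (stt d l) k" using isolated_rule[OF A d i] by blast
 from run_tail[OF rule_run[OF A stt_Suc[OF d] this]] obtain i k0 where k0: "\<And>k. k0 \<le> k ==> l (k + K) = lam (i + int k)"
  by blast
 have "l k = lam ((i - int K) + int k)" if "k0 + K \<le> k" for k
  using k0[of "k - K"] that by (simp add: of_nat_diff algebra_simps)
 thus ?thesis by blast
qed

lemma br_le: assumes "s * a \<le> y" "y \<le> b" shows "br e y \<le> 1 - a"
proof (cases e)
 case True
 have "a \<le> y / s" using assms s_pos by (simp add: field_simps)
 thus ?thesis using True by (simp add: br_def)
next
 case False
 have "br False y \<le> 1/2" using br_False_range[OF assms] by simp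
 thus ?thesis using False a_lt by simp
qed

text \<open>After the codes part at \<open>N\<close>, nothing may lie above the lower strand or
  below the upper one within their cylinders. In both cases the state at \<open>N + 1\<close> is
  topmost, over the two preimages of one point; these are at most \<open>1 - a\<close>, so both runs
  start in the arc without orbit positions.\<close>

lemma adjacent_tail:
 assumes A: "Adm y l" and A': "Adm y l'" and less: "psi0 l < psi0 l'"
  and no: "\<And>l2. Adm y l2 ==> \<not> (psi0 l < psi0 l2 \<and> psi0 l2 < psi0 l')"
 shows "\<exists>k0. \<forall>k\<ge>k0. l k = l' k"
proof -
 have "l ~= l'" using less by auto
 hence ex: "\<exists>k. l k ~= l' k" by blast
 define N where "N = (LEAST k. l k ~= l' k)"
 have N: "l N ~= l' N" unfolding N_def using ex by (rule LeastI_ex)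
 have same: "l k = l' k" if "k < N" for k using not_less_Least[of k "%k. l k ~= l' k"] that by (auto simp: N_def)
 have par: "parity_sign l' N = parity_sign l N" using same by (simp add: parity_sign_def)
 have "0 < parity_sign l N * (if l N then - 1 else 1) * (psi0 l' - psi0 l)"
  using same N by (intro psi0_flip) auto
 hence sg: "parity_sign l N * (if l N then - 1 else 1) = 1"
  using less parity_sign_cases[of l N] by (auto split: if_splits simp: zero_less_mult_iff)
 have upper: "psi0 l2 < psi0 l'" if "\<And>i. i \<le> N ==> l2 i = l i" for l2
 proof -
  have "0 < parity_sign l2 N * (if l2 N then - 1 else 1) * (psi0 l' - psi0 l2)"
   using same N that by (intro psi0_flip) auto
  moreover have "parity_sign l2 N = parity_sign l N" using that by (simp add: parity_sign_def)
  ultimately show ?thesis using that[of N] sg by simp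
 qed
 have lower: "psi0 l < psi0 l2" if "\<And>i. i \<le> N ==> l2 i = l' i" for l2
 proof -
  have "0 < parity_sign l N * (if l N then - 1 else 1) * (psi0 l2 - psi0 l)"
   using same N that by (intro psi0_flip) auto
  thus ?thesis using sg by simp
 qed
 have r1: "rule_at y l (stt 1 l) k" if k: "Suc N \<le> k" for k
 proof (rule ccontr)
  assume "\<not> rule_at y l (stt 1 l) k"
  then obtain l2 where "Adm y l2" "\<forall>i<k. l2 i = l i" "0 < 1 * (psi0 l2 - psi0 l)" using not_rule[OF A, of 1] by blast
  thus False using no[of l2] upper[of l2] k by auto
 qed
 have r2: "rule_at y l' (stt (- 1) l') k" if k: "Suc N \<le> k" for k
 proof (rule ccontr)
  assume "\<not> rule_at y l' (stt (- 1) l') k"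
  then obtain l2 where "Adm y l2" "\<forall>i<k. l2 i = l' i" "0 < - 1 * (psi0 l2 - psi0 l')" using not_rule[OF A', of "- 1"] by blast
  thus False using no[of l2] lower[of l2] k by auto
 qed
 have run1: "run (%k. bk y l (k + Suc N)) (shift (Suc N) l) (%k. stt 1 l (k + Suc N))"
  by (rule rule_run[OF A stt_Suc r1]) auto
 have run2: "run (%k. bk y l' (k + Suc N)) (shift (Suc N) l') (%k. stt (- 1) l' (k + Suc N))"
  by (rule rule_run[OF A' stt_Suc r2]) auto
 have yN: "bk y l' N = bk y l N" using same by (intro bk_cong) auto
 \<comment> \<open>One of the two codes has a 0 at \<open>N\<close>, and its admissibility gives the
   bound for the common base point.\<close>
 have "s * a \<le> bk y l N"
 proof (cases "l N")
  case False
  thus ?thesis using A by (simp add: Adm_def)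
 next
  case True
  hence "s * a \<le> bk y l' N" using A' N by (simp add: Adm_def)
  thus ?thesis using yN by simp
 qed
 hence le: "br e (bk y l N) \<le> 1 - a" for e using Adm_range[OF A, of N] by (intro br_le) auto
 have "\<exists>k0. \<forall>k\<ge>k0. shift (Suc N) l k = shift (Suc N) l' k"
 proof (rule run_tail_eq[OF run1 run2])
  show "stt 1 l (0 + Suc N)" using sg by (simp add: stt_def parity_sign_Suc)
  show "stt (- 1) l' (0 + Suc N)" using sg N by (simp add: stt_def parity_sign_Suc par split: if_splits)
  show "bk y l (0 + Suc N) \<le> 1 - a" using le by simp
  show "bk y l' (0 + Suc N) \<le> 1 - a" using le yN by simp
 qed
 then obtain k0 where k0: "\<And>k. k0 \<le> k ==> l (k + Suc N) = l' (k + Suc N)" by blast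
 have "l k = l' k" if "k0 + Suc N \<le> k" for k using k0[of "k - Suc N"] that by simp
 thus ?thesis by blast
qed

section \<open>Charts\<close>

lemma bk_convex: "bk (y' + t * (y - y')) l k = bk y' l k + t * (bk y l k - bk y' l k)"
proof (induction k)
 case (Suc k)
 have "br e (p + t * (r - p)) = br e p + t * (br e r - br e p)" for e p r
  using s_pos by (cases e) (simp_all add: br_def field_simps)
 thus ?case using Suc by simp
qed simp

text \<open>Between the two base points there is one at which the first violated constraint is an
  equality. From \<open>s * a\<close> the symbol 0 leads to \<open>a\<close>, then 1 leads to
  \<open>b\<close> and the next step to 1/2, so a semicircle of depth \<open>k + 2\<close> has a
  foot there.\<close>

lemma violation:
 assumes A: "Adm y l" and r: "a \<le> y'" "y' \<le> b" and na: "\<not> Adm y' l"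
 shows "\<exists>k t l'. \<not> l k \<and> bk y' l k < s * a \<and> \<bar>t - y\<bar> \<le> \<bar>y' - y\<bar> \<and> \<bar>t - y'\<bar> \<le> \<bar>y' - y\<bar> \<and> Adm t l' \<and>
  (\<forall>i\<le>k. l' i = l i) \<and> bk t l' (k + 3) = 1/2"
proof -
 define P where "P k \<longleftrightarrow> \<not> l k \<and> bk y' l k < s * a" for k
 have "\<exists>k. P k" using na r by (auto simp: Adm_def P_def)
 hence Pk: "P (LEAST k. P k)" by (rule LeastI_ex)
 define k where "k = (LEAST k. P k)"
 have k: "\<not> l k" "bk y' l k < s * a" using Pk by (auto simp: k_def P_def)
 have before: "s * a \<le> bk y' l i" if "i < k" "\<not> l i" for i
  using not_less_Least[of i P] that by (auto simp: k_def P_def)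
 have yk: "s * a \<le> bk y l k" using A k(1) by (simp add: Adm_def)
 define c where "c = (s * a - bk y' l k) / (bk y l k - bk y' l k)"
 have c: "0 \<le> c" "c \<le> 1" "c * (bk y l k - bk y' l k) = s * a - bk y' l k"
  using k(2) yk by (auto simp: c_def field_simps)
 define t where "t = y' + c * (y - y')"
 have bt: "bk t l i = bk y' l i + c * (bk y l i - bk y' l i)" for i unfolding t_def by (rule bk_convex)
 have ge: "x \<le> p + c * (q - p)" if "x \<le> p" "x \<le> q" for x p q
 proof -
  have "c * (x - p) \<le> c * (q - p)" using c that by (intro mult_left_mono) auto
  moreover have "1 * (x - p) \<le> c * (x - p)" using c that by (intro mult_right_mono_neg) auto
  ultimately show ?thesis by simp
 qed
 have le: "p + c * (q - p) \<le> x" if "p \<le> x" "q \<le> x" for x p q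
  using ge[of "- x" "- p" "- q"] that by (simp add: algebra_simps)
 have tk: "bk t l k = s * a" using bt[of k] c(3) by simp
 \<comment> \<open>Ones after the critical zero lead through \<open>a\<close> and \<open>b\<close>
   to 1/2 and keep the code admissible.\<close>
 define l' where "l' = pre (Suc k) l (%_. True)"
 have l'l: "l' i = l i" if "i \<le> k" for i using that by (simp add: l'_def pre_def)
 have bl': "bk t l' i = bk t l i" if "i \<le> Suc k" for i using that unfolding l'_def by (rule bk_pre)
 have l'T: "l' i" if "k < i" for i using that by (simp add: l'_def pre_def)
 have 1: "bk t l' k = s * a" using bl' tk by simp
 hence "bk t l' (Suc k) = a" using l'l[of k] k(1) by (simp add: br_sa)
 hence "bk t l' (Suc (Suc k)) = b" using l'T[of "Suc k"] by (simp add: br_a)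
 hence 3: "bk t l' (k + 3) = 1/2" by (simp add: numeral_3_eq_3 br_b)
 have "Adm t l'"
  unfolding Adm_def
 proof (intro conjI allI impI)
  have "a \<le> y" "y \<le> b" using A by (auto simp: Adm_def)
  thus "a \<le> t" "t \<le> b" using ge[of a y' y] le[of y' b y] r by (auto simp: t_def)
  fix i assume i: "\<not> l' i"
  hence ik: "i \<le> k" using l'T by (meson not_le)
  hence li: "\<not> l i" using i l'l by simp
  show "s * a \<le> bk t l' i"
  proof (cases "i = k")
   case False
   hence "s * a \<le> bk y' l i" using before ik li by simp
   moreover have "s * a \<le> bk y l i" using A li by (simp add: Adm_def)
   ultimately have "s * a \<le> bk t l i" unfolding bt by (rule ge)
   thus ?thesis using bl'[of i] ik by simp
  qed (use 1 in simp)
 qed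
 moreover have "\<bar>t - y'\<bar> \<le> \<bar>y' - y\<bar>"
 proof -
  have "\<bar>t - y'\<bar> = c * \<bar>y' - y\<bar>" using c by (simp add: t_def abs_mult abs_minus_commute)
  also have "\<dots> \<le> 1 * \<bar>y' - y\<bar>" using c by (intro mult_right_mono) auto
  finally show ?thesis by simp
 qed
 moreover have "\<bar>t - y\<bar> \<le> \<bar>y' - y\<bar>"
 proof -
  have "t - y = (1 - c) * (y' - y)" by (simp add: t_def algebra_simps)
  hence "\<bar>t - y\<bar> = (1 - c) * \<bar>y' - y\<bar>" using c by (simp add: abs_mult)
  also have "\<dots> \<le> 1 * \<bar>y' - y\<bar>" using c by (intro mult_right_mono) auto
  finally show ?thesis by simp
 qed
 ultimately show ?thesis using k 3 l'l by blast
qed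

lemma Caps_away:
 assumes F: "w \<notin> range Fold" and I: "\<And>i. i \<in> I ==> w \<notin> Caps i"
 shows "\<exists>e>0. \<forall>i\<in>I. ball w e \<inter> Caps i = {}"
proof -
 define C where "C = ((%j. Fold (2 - int j)) ` (I - {0, 1}) \<union> (\<Union>j\<in>I - {0, 1}. Caps j)) \<union> (\<Union>j\<in>I \<inter> {0, 1}. Caps j)"
 have "closed C" unfolding C_def
 proof (rule closed_Un)
  show "closed ((%j. Fold (2 - int j)) ` (I - {0, 1}) \<union> (\<Union>j\<in>I - {0, 1}. Caps j))"
   by (rule closed_Fold_Caps) (metis Diff_iff One_nat_def Suc_leI insertCI less_2_cases not_less)
 qed (auto intro: closed_Caps)
 moreover have "w \<notin> C" using F I by (auto simp: C_def)
 ultimately obtain e where e: "0 < e" "ball w e \<subseteq> - C" using open_contains_ball[of "- C"] by (auto simp: open_Compl)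
 have "ball w e \<inter> Caps i = {}" if "i \<in> I" for i
 proof -
  have "Caps i \<subseteq> C" using that by (auto simp: C_def)
  thus ?thesis using e(2) by blast
 qed
 thus ?thesis using e(1) by blast
qed

lemma Caps_I: assumes "Adm t l" "bk t l (Suc j) = 1/2" shows "(t, psi0 l) \<in> Caps j"
proof -
 have "strand 0 t l (t, psi0 l)" using assms(1) by (simp add: strand_0)
 from strand_add[OF this, of "Suc j"] assms(2) show ?thesis by (auto simp: Caps_def)
qed

text \<open>If moving the base point destroyed admissibility at a deep symbol,
  \<open>violation\<close> would yield a foot of a deep semicircle nearby. The first
  \<open>k0\<close> symbols agree with those of \<open>l0\<close>; their constraints stay as a
  premise because at the foot of a semicircle one of them may hold on one side only.\<close>

lemma local_product:
 assumes A: "Adm y0 l0" and e: "0 < e" "\<And>i. i ~= j ==> ball (y0, psi0 l0) e \<inter> Caps i = {}"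
 obtains e' k0 where "0 < e'" "j < k0" "\<And>l k. \<bar>psi0 l - psi0 l0\<bar> < e' ==> k < k0 ==> l k = l0 k"
  "\<And>y l. Adm y l ==> \<bar>y - y0\<bar> < e' ==> \<bar>psi0 l - psi0 l0\<bar> < e' ==> Adm y0 l"
  "\<And>y l. Adm y0 l ==> a \<le> y ==> y \<le> b ==> \<bar>y - y0\<bar> < e' ==> \<bar>psi0 l - psi0 l0\<bar> < e' ==>
    (\<And>k. k < k0 ==> \<not> l0 k ==> s * a \<le> bk y l0 k) ==> Adm y l"
proof -
 obtain M where M: "\<And>i. M \<le> i ==> 10 / 3 ^ i < e" using ex_pow3[OF e(1)] by blast
 define k0 where "k0 = M + Suc j"
 define e' where "e' = min (e / 10) (1 / 3 ^ k0)"
 have e': "0 < e'" "e' \<le> e / 10" "e' \<le> 1 / 3 ^ k0" using e(1) by (auto simp: e'_def)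
 have agree: "l k = l0 k" if "\<bar>psi0 l - psi0 l0\<bar> < e'" "k < k0" for l k
  using that e'(3) by (intro psi0_close_imp[of l l0 k0]) auto
 have key: "Adm y l"
  if Ax: "Adm x l" and y: "a \<le> y" "y \<le> b" and cx: "\<bar>x - y0\<bar> < e'" and cy: "\<bar>y - y0\<bar> < e'"
   and cl: "\<bar>psi0 l - psi0 l0\<bar> < e'" and pos: "\<And>k. k < k0 ==> \<not> l0 k ==> s * a \<le> bk y l0 k" for x y l
 proof (rule ccontr)
  assume "\<not> Adm y l"
  from violation[OF Ax y this] obtain k t l' where k: "\<not> l k" "bk y l k < s * a" and t: "\<bar>t - x\<bar> \<le> \<bar>y - x\<bar>"
   and l': "Adm t l'" "\<forall>i\<le>k. l' i = l i" "bk t l' (k + 3) = 1/2" by blast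
  show False
  proof (cases "k < k0")
   case True
   have "bk y l k = bk y l0 k" using agree[OF cl] True by (intro bk_cong) auto
   thus False using k pos[OF True] agree[OF cl True] by simp
  next
   case False
   have "bk t l' (Suc (k + 2)) = 1/2" using l'(3) by (simp add: numeral_3_eq_3 numeral_2_eq_2)
   from Caps_I[OF l'(1) this] have c: "(t, psi0 l') \<in> Caps (k + 2)" .
   have "\<bar>psi0 l' - psi0 l\<bar> \<le> 1 / 3 ^ k" using l'(2) by (intro psi0_close) auto
   also have "\<dots> < e / 10" using M[of k] False by (simp add: k0_def field_simps)
   finally have "\<bar>psi0 l' - psi0 l\<bar> < e / 10" .
   hence 1: "\<bar>psi0 l' - psi0 l0\<bar> < e / 5" using cl e'(2) e(1) by linarith
   have 2: "\<bar>t - y0\<bar> < e / 3" using t cx cy e'(2) e(1) by linarith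
   have "dist (t, psi0 l') (y0, psi0 l0) \<le> \<bar>t - y0\<bar> + \<bar>psi0 l' - psi0 l0\<bar>"
    unfolding dist_prod_def dist_real_def fst_conv snd_conv power2_abs by (rule sqrt_sum_squares_le_sum_abs)
   also have "\<dots> < e" using 1 2 e(1) by linarith
   finally have "(t, psi0 l') \<in> ball (y0, psi0 l0) e" by (simp add: dist_commute)
   moreover have "k + 2 ~= j" using False by (simp add: k0_def)
   ultimately show False using e(2) c by blast
  qed
 qed
 show thesis
 proof (rule that[of e' k0])
  show "0 < e'" by (rule e'(1))
  show "j < k0" by (simp add: k0_def)
  show "l k = l0 k" if "\<bar>psi0 l - psi0 l0\<bar> < e'" "k < k0" for l k using that by (rule agree)
  show "Adm y0 l" if "Adm y l" "\<bar>y - y0\<bar> < e'" "\<bar>psi0 l - psi0 l0\<bar> < e'" for y l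
  proof (rule key[OF that(1) _ _ that(2) _ that(3)])
   show "a \<le> y0" "y0 \<le> b" using A by (simp_all add: Adm_def)
   show "s * a \<le> bk y0 l0 k" if "\<not> l0 k" for k using A that by (simp add: Adm_def)
  qed (use e'(1) in simp)
  show "Adm y l" if h: "Adm y0 l" "a \<le> y" "y \<le> b" "\<bar>y - y0\<bar> < e'" "\<bar>psi0 l - psi0 l0\<bar> < e'"
   "\<And>k. k < k0 ==> \<not> l0 k ==> s * a \<le> bk y l0 k" for y l
   using e'(1) by (intro key[OF h(1,2,3) _ h(4,5,6)]) simp_all
 qed
qed


text \<open>\<open>h\<close> is a coordinate transversal to the strands: inside \<open>V\<close> the
  continuum is the set where \<open>h\<close> takes values in the closed set \<open>Yset y0\<close>,
  and the value determines the code. Connected sets in \<open>V\<close> are then handled by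
  intermediate values.\<close>

definition chart :: "real \<times> real => (real \<times> real) set => nat => real => (real \<times> real => real) => bool" where
 "chart w V N y0 h \<longleftrightarrow> open V \<and> w \<in> V \<and> continuous_on V h \<and> (\<exists>l. strand N y0 l w) \<and>
  (\<forall>z\<in>V \<inter> KK. h z \<in> Yset y0) \<and> (\<forall>z\<in>V. \<forall>l. Adm y0 l --> h z = psi0 l --> (\<exists>y. strand N y l z))"

lemma slack:
 assumes "\<And>k. k < k0 ==> P k ==> s * a < bk y0 l k"
 shows "\<exists>d>0. \<forall>y. \<bar>y - y0\<bar> < d --> (\<forall>k<k0. P k --> s * a \<le> bk y l k)"
 using assms
proof (induction k0)
 case 0
 show ?case by (intro exI[of _ 1]) simp
next
 case (Suc k0)
 then obtain d where d: "0 < d" "\<And>y k. \<bar>y - y0\<bar> < d ==> k < k0 ==> P k ==> s * a \<le> bk y l k" by (metis less_SucI)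
 define d' where "d' = (if P k0 then min d (bk y0 l k0 - s * a) else d)"
 have "0 < d'" using d(1) Suc.prems[of k0] by (simp add: d'_def)
 moreover have "s * a \<le> bk y l k" if y: "\<bar>y - y0\<bar> < d'" and k: "k < Suc k0" "P k" for y k
 proof (cases "k = k0")
  case True
  have "1 \<le> s ^ k0" using s_gt1 by simp
  hence "\<bar>bk y l k0 - bk y0 l k0\<bar> \<le> \<bar>y - y0\<bar>" unfolding bk_diff
   by (simp add: divide_le_eq mult_le_cancel_left1)
  moreover have "\<bar>y - y0\<bar> < bk y0 l k0 - s * a" using True k y by (simp add: d'_def)
  ultimately show ?thesis unfolding True by linarith
 next
  case False
  have "\<bar>y - y0\<bar> < d" using y by (simp add: d'_def split: if_splits)
  thus ?thesis using d(2) k False by simp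
 qed
 ultimately show ?case by blast
qed

lemma abs_le_dist: "\<bar>fst z - fst w\<bar> \<le> dist z w" "\<bar>snd z - snd w\<bar> \<le> dist (z :: real \<times> real) w"
 using dist_fst_le[of z w] dist_snd_le[of z w] by (simp_all add: dist_real_def)

text \<open>Equality would lead through \<open>a\<close> and \<open>b\<close> to 1/2 and put the
  point on a semicircle of depth \<open>k + 2\<close>.\<close>

lemma strict_Adm:
 assumes A: "Adm y0 l0" and k: "\<not> l0 k" "(y0, psi0 l0) \<notin> Caps (k + 2)"
 shows "s * a < bk y0 l0 k"
proof (rule ccontr)
 assume "\<not> s * a < bk y0 l0 k"
 hence "bk y0 l0 k = s * a" using A k(1) by (force simp: Adm_def)
 hence 1: "bk y0 l0 (Suc k) = a" using k(1) by (simp add: br_sa)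
 have "l0 (Suc k)"
 proof (rule ccontr)
  assume "\<not> l0 (Suc k)"
  hence "s * a \<le> bk y0 l0 (Suc k)" using A unfolding Adm_def by blast
  thus False using 1 a_lt_sa by simp
 qed
 hence "bk y0 l0 (Suc (Suc k)) = b" using 1 by (simp add: br_a)
 hence "bk y0 l0 (Suc (k + 2)) = 1/2" by (simp add: br_b)
 from Caps_I[OF A this] k(2) show False by simp
qed

lemma strict_range:
 assumes A: "Adm y0 l0"
 shows "(y0, psi0 l0) \<notin> Caps 0 ==> y0 < b" and "(y0, psi0 l0) \<notin> Caps 1 ==> a < y0"
proof -
 show "y0 < b" if c: "(y0, psi0 l0) \<notin> Caps 0"
 proof (rule ccontr)
  assume "\<not> y0 < b"
  hence "bk y0 l0 (Suc 0) = 1/2" using A by (simp add: Adm_def br_b)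
  from Caps_I[OF A this] c show False by simp
 qed
 show "a < y0" if c: "(y0, psi0 l0) \<notin> Caps 1"
 proof (rule ccontr)
  assume "\<not> a < y0"
  hence y0: "y0 = a" using A by (simp add: Adm_def)
  have "l0 0"
  proof (rule ccontr)
   assume "\<not> l0 0"
   hence "s * a \<le> bk y0 l0 0" using A unfolding Adm_def by blast
   thus False using y0 a_lt_sa by simp
  qed
  hence "bk y0 l0 (Suc 1) = 1/2" using y0 by (simp add: br_a br_b)
  from Caps_I[OF A this] c show False by simp
 qed
qed

lemma chart_Str:
 assumes A: "Adm y0 l0" and F: "(y0, psi0 l0) \<notin> range Fold" and C: "\<And>j. (y0, psi0 l0) \<notin> Caps j"
 shows "\<exists>V. chart (y0, psi0 l0) V 0 y0 snd \<and> (\<forall>j. V \<inter> Caps j = {})"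
proof -
 let ?w = "(y0, psi0 l0)"
 obtain e where e: "0 < e" "\<And>i. ball ?w e \<inter> Caps i = {}" using Caps_away[OF F, of UNIV] C by auto
 obtain e' k0 where e': "0 < e'"
  and down: "\<And>y l. Adm y l ==> \<bar>y - y0\<bar> < e' ==> \<bar>psi0 l - psi0 l0\<bar> < e' ==> Adm y0 l"
  and up: "\<And>y l. Adm y0 l ==> a \<le> y ==> y \<le> b ==> \<bar>y - y0\<bar> < e' ==> \<bar>psi0 l - psi0 l0\<bar> < e' ==>
    (\<And>k. k < k0 ==> \<not> l0 k ==> s * a \<le> bk y l0 k) ==> Adm y l"
  by (rule local_product[OF A e(1), of 0]) (use e(2) in blast)+
 obtain d where d: "0 < d" "\<And>y. \<bar>y - y0\<bar> < d ==> \<forall>k<k0. \<not> l0 k --> s * a \<le> bk y l0 k"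
  using slack[of k0 "%k. \<not> l0 k" y0 l0] strict_Adm[OF A] C by blast
 have ab0: "a < y0" "y0 < b" using strict_range[OF A] C by auto
 define r where "r = min (min e e') (min d (min (y0 - a) (b - y0)))"
 have r: "0 < r" "r \<le> e" "r \<le> e'" "r \<le> d" "r \<le> y0 - a" "r \<le> b - y0" using e(1) e' d(1) ab0 by (auto simp: r_def)
 have near: "\<bar>fst z - y0\<bar> < r \<and> \<bar>snd z - psi0 l0\<bar> < r" if "z \<in> ball ?w r" for z
  using abs_le_dist[of z ?w] that by (simp add: dist_commute)
 have cap: "ball ?w r \<inter> Caps j = {}" for j using e(2)[of j] subset_ball[OF r(2), of ?w] by blast
 have "chart ?w (ball ?w r) 0 y0 snd"
  unfolding chart_def
 proof (intro conjI ballI allI impI)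
  show "\<exists>l. strand 0 y0 l ?w" using A by (intro exI[of _ l0]) (simp add: strand_0)
  show "snd z \<in> Yset y0" if z: "z \<in> ball ?w r \<inter> KK" for z
  proof -
   have "z \<in> Str" using z cap KK_iff by blast
   then obtain y l where l: "Adm y l" "z = (y, psi0 l)" by (auto simp: Str_def strand_0)
   have "Adm y0 l" using near[of z] z l r(3) by (intro down[of y]) auto
   thus ?thesis using l(2) by (auto simp: Yset_def)
  qed
  show "\<exists>y. strand 0 y l z" if z: "z \<in> ball ?w r" and l: "Adm y0 l" "snd z = psi0 l" for z l
  proof -
   have nz: "\<bar>fst z - y0\<bar> < r" "\<bar>snd z - psi0 l0\<bar> < r" using near[OF z] by auto
   have "Adm (fst z) l"
   proof (rule up[OF l(1)])
    show "a \<le> fst z" "fst z \<le> b" "\<bar>fst z - y0\<bar> < e'" "\<bar>psi0 l - psi0 l0\<bar> < e'"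
     using nz r l(2) by linarith+
    show "s * a \<le> bk (fst z) l0 k" if "k < k0" "\<not> l0 k" for k using d(2)[of "fst z"] nz(1) r(4) that by simp
   qed
   thus ?thesis using l(2) by (auto simp: strand_0 prod_eq_iff)
  qed
 qed (use r(1) in \<open>auto intro: continuous_on_snd continuous_on_id\<close>)
 thus ?thesis using cap by blast
qed

lemma strand_down_iter:
 assumes "strand N y l z" "\<And>k. k < N ==> (T ^^ k) y ~= 1/2"
 shows "\<exists>l'. strand 0 ((T ^^ N) y) l' z \<and> shift N l' = l"
 using assms
proof (induction N arbitrary: y l)
 case (Suc N)
 have "strand N (T y) (case_nat (1/2 < y) l) z" using Suc.prems(2)[of 0] by (intro strand_down[OF Suc.prems(1)]) simp
 moreover have "(T ^^ k) (T y) ~= 1/2" if "k < N" for k using Suc.prems(2)[of "Suc k"] that by (simp add: funpow_swap1)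
 ultimately obtain l' where l': "strand 0 ((T ^^ N) (T y)) l' z" "shift N l' = case_nat (1/2 < y) l" using Suc.IH by blast
 have "l' (k + Suc N) = l k" for k using fun_cong[OF l'(2), of "Suc k"] by (simp add: add.commute)
 thus ?case using l'(1) by (auto simp: funpow_swap1)
qed auto

lemma vh_b_H: "vh j b (H e h) = qc j + ec j * (if e then 1 else - 1) * (1/2 - h / 3) / 3 ^ j"
proof -
 have "vh j b (H e h) - qc j = ec j * (H e h - 1/2) / 3 ^ j" unfolding qc_def ec_def by (rule vh_diff)
 thus ?thesis unfolding H_crit by (simp add: mult.assoc)
qed

lemma cap_foot:
 assumes w: "strand (Suc j) (1/2) l0 w" and p: "fst w = pc j"
 shows "\<exists>l1. Adm (pc j) l1 \<and> w = (pc j, psi0 l1) \<and> bk (pc j) l1 (Suc j) = 1/2 \<and> shift (Suc j) l1 = l0"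
proof -
 define r where "r = 1/2 - psi0 l0 / 3"
 have r: "0 < r" using psi0_range[of l0] by (simp add: r_def)
 have A: "Adm (1/2) l0" and c: "w \<in> cap j r" using w by (auto simp: strand_crit r_def)
 have "3 ^ j * norm (w - (pc j, qc j)) = r" using cap_height_iff[of r w j] c r by simp
 moreover have "norm (w - (pc j, qc j)) = \<bar>snd w - qc j\<bar>" using p by (simp add: norm_prod_def)
 ultimately have "\<bar>snd w - qc j\<bar> = r / 3 ^ j" by (simp add: field_simps)
 hence sw: "snd w = qc j + r / 3 ^ j \<or> snd w = qc j - r / 3 ^ j" by linarith
 have "\<exists>e. snd w = vh j b (H e (psi0 l0))"
 proof (cases "(snd w = qc j + r / 3 ^ j) = (ec j = 1)")
  case True
  hence "snd w = vh j b (H True (psi0 l0))" using sw ec_cases[of j] unfolding vh_b_H r_def[symmetric] by auto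
  thus ?thesis by blast
 next
  case False
  hence "snd w = vh j b (H False (psi0 l0))" using sw ec_cases[of j] unfolding vh_b_H r_def[symmetric] by auto
  thus ?thesis by blast
 qed
 then obtain e where e: "snd w = vh j b (H e (psi0 l0))" by blast
 have "w = (pc j, vh j b (psi0 (case_nat e l0)))" using p e by (simp add: psi0_case_nat prod_eq_iff)
 hence st: "strand j b (case_nat e l0) w" using Adm_cons_crit(1)[OF A] by (simp add: strand_def dr_b)
 obtain l1 where l1: "strand 0 (pc j) l1 w" "shift j l1 = case_nat e l0"
  using strand_down_iter[OF st] pc_neq_crit unfolding pc_def by metis
 have 1: "Adm (pc j) l1" "w = (pc j, psi0 l1)" using l1(1) by (simp_all add: strand_0)
 have sh: "shift (Suc j) l1 = l0"
 proof
  fix k show "shift (Suc j) l1 k = l0 k" using fun_cong[OF l1(2), of "Suc k"] by (simp add: add.commute)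
 qed
 have "strand (Suc j) (bk (pc j) l1 (Suc j)) (shift (Suc j) l1) w" using strand_add[OF l1(1), of "Suc j"] by simp
 hence "bk (pc j) l1 (Suc j) = 1/2" using strand_unique[OF w] by metis
 thus ?thesis using 1 sh by blast
qed

text \<open>Built from the distance to a horizontal half-line ending at the centre, so its level
  sets are semicircles prolonged by horizontal segments. This extends \<open>height\<close> across
  the feet, where a strand leaves the semicircle.\<close>

definition stad :: "nat => real \<times> real => real" where
 "stad j z = 3 * (1/2 - 3 ^ j * norm (max 0 (ec j * (fst z - pc j)), snd z - qc j))"

lemma stad_cap: "0 \<le> ec j * (fst z - pc j) ==> stad j z = height j z"
 using ec_cases[of j] unfolding stad_def height_def by (auto simp: norm_prod_def power2_commute[of "pc j"])

lemma stad_strip: "ec j * (fst z - pc j) \<le> 0 ==> stad j z = 3 * (1/2 - 3 ^ j * \<bar>snd z - qc j\<bar>)"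
 unfolding stad_def by (simp add: norm_prod_def max_def)

lemma continuous_stad: "continuous_on S (stad j)"
 unfolding stad_def by (intro continuous_intros)

lemma bk_diff_sgn: "bk y l k - bk y' l k = parity_sign l k * (y - y') / s ^ k"
proof (induction k)
 case 0
 show ?case by (simp add: parity_sign_def)
next
 case (Suc k)
 thus ?case by (simp add: br_diff parity_sign_Suc)
qed

lemma psi0_strict: assumes "Adm y l" shows "0 < psi0 l" "psi0 l < 1"
proof -
 have no: "\<not> Adm y (%_. False)" for y
 proof
  assume A: "Adm y (%_. False)"
  have bk: "bk y (%_. False) k = y / s ^ k" for k by (induction k) (simp_all add: br_def)
  have sa: "0 < s * a" using s_pos a_pos by simp
  obtain k where "b / (s * a) < s ^ k" using real_arch_pow[OF s_gt1] by blast
  hence "b / s ^ k < s * a" using sa s_pos by (simp add: field_simps)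
  moreover have "s * a \<le> bk y (%_. False) k" using A unfolding Adm_def by blast
  moreover have "y / s ^ k \<le> b / s ^ k" using A s_pos by (simp add: Adm_def divide_right_mono)
  ultimately show False using bk[of k] by simp
 qed
 have z: "psi0 (%_. False) = 0" using psi0_rec[of "%_. False"] by (simp add: H_def)
 have o: "psi0 (case_nat True (%_. False)) = 1" by (simp add: psi0_case_nat z H_def)
 have "l ~= (%_. False)" using assms no by blast
 hence "psi0 l ~= 0" using psi0_inj[of l "%_. False"] z by simp
 thus "0 < psi0 l" using psi0_range(1)[of l] by simp
 have "l ~= case_nat True (%_. False)"
 proof
  assume "l = case_nat True (%_. False)"
  hence "shift 1 l = (%_. False)" by simp
  thus False using Adm_bk[OF assms, of 1] no by simp
 qed
 hence "psi0 l ~= 1" using psi0_inj[of l "case_nat True (%_. False)"] o by simp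
 thus "psi0 l < 1" using psi0_range(2)[of l] by simp
qed

lemma third_eq: "x = 1/2 - 3 * (1/2 - x) / 3" for x :: real
proof -
 have "3 * (1/2 - x) / 3 = 1/2 - x" by (rule nonzero_mult_div_cancel_left) simp
 thus ?thesis by (simp only: diff_diff_eq2)
qed

lemma chart_cap_side:
 assumes "0 \<le> ec j * (fst z - pc j)" "0 \<le> stad j z" "stad j z \<le> 1"
 shows "z \<in> KK ==> (\<And>i. i ~= j ==> z \<notin> Caps i) ==> stad j z \<in> Yset (1/2)"
  and "Adm (1/2) l ==> stad j z = psi0 l ==> strand (Suc j) (1/2) l z"
proof -
 have st: "stad j z = height j z" using stad_cap[OF assms(1)] .
 show "strand (Suc j) (1/2) l z" if "Adm (1/2) l" "stad j z = psi0 l"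
  unfolding strand_crit cap_psi0_iff using that assms(1) st by simp
 assume z: "z \<in> KK" "\<And>i. i ~= j ==> z \<notin> Caps i"
 show "stad j z \<in> Yset (1/2)"
 proof (cases "z \<in> Caps j")
  case True
  then obtain l where "strand (Suc j) (1/2) l z" by (auto simp: Caps_def)
  hence "Adm (1/2) l" "height j z = psi0 l" by (auto simp: strand_crit cap_psi0_iff)
  thus ?thesis using st by (auto simp: Yset_def)
 next
  case False
  hence "z \<in> Str" using z KK_iff by metis
  then obtain y l where l: "strand 0 y l z" by (auto simp: Str_def)
  have sj: "strand (Suc j) (bk y l (Suc j)) (shift (Suc j) l) z" using strand_add[OF l, of "Suc j"] by simp
  hence A: "Adm (bk y l (Suc j)) (shift (Suc j) l)" "z \<in> dr (Suc j) (bk y l (Suc j)) (psi0 (shift (Suc j) l))"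
   by (simp_all only: strand_def)
  have "z \<in> cap j (1/2 - stad j z / 3)"
  proof -
   have "3 ^ j * norm (z - (pc j, qc j)) = 1/2 - stad j z / 3" unfolding st height_def by (rule third_eq)
   thus ?thesis using cap_height_iff[of "1/2 - stad j z / 3" z j] assms by simp
  qed
  hence "z \<in> dr (Suc j) (1/2) (stad j z)" by simp
  from dr_inj[OF A(2) this] have "bk y l (Suc j) = 1/2 \<and> psi0 (shift (Suc j) l) = stad j z"
   using A(1) a_lt b_gt psi0_range assms by (simp add: Adm_def del: bk.simps)
  thus ?thesis using A(1) unfolding Yset_def by (metis (mono_tags, lifting) mem_Collect_eq)
 qed
qed

lemma open_stad: "open {z. 0 < stad j z \<and> stad j z < 1}"
 by (intro open_Collect_conj open_Collect_less continuous_stad continuous_on_const)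

lemma chart_Caps:
 assumes w: "strand (Suc j) (1/2) l0 w" and F: "w \<notin> range Fold"
 shows "\<exists>V. chart w V (Suc j) (1/2) (stad j)"
proof -
 have wC: "w \<in> Caps j" using w by (auto simp: Caps_def)
 hence "w \<notin> Caps i" if "i ~= j" for i using Caps_disjoint[of w i j] that by blast
 then obtain e where e: "0 < e" "\<And>i. i ~= j ==> ball w e \<inter> Caps i = {}" using Caps_away[OF F, of "- {j}"] by auto
 have A0: "Adm (1/2) l0" and hw: "height j w = psi0 l0" "0 \<le> ec j * (fst w - pc j)"
  using w by (auto simp: strand_crit cap_psi0_iff)
 have sw: "stad j w = psi0 l0" using stad_cap[OF hw(2)] hw(1) by simp
 have wH: "0 < stad j w \<and> stad j w < 1" using psi0_strict[OF A0] sw by simp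
 show ?thesis
 proof (cases "0 < ec j * (fst w - pc j)")
  case True
  define V where "V = ball w e \<inter> {z. 0 < stad j z \<and> stad j z < 1} \<inter> {z. 0 < ec j * (fst z - pc j)}"
  have "chart w V (Suc j) (1/2) (stad j)"
   unfolding chart_def
  proof (intro conjI ballI allI impI)
   have "open {z :: real \<times> real. 0 < ec j * (fst z - pc j)}" by (intro open_Collect_less continuous_intros)
   thus "open V" unfolding V_def by (intro open_Int open_ball open_stad)
   show "w \<in> V" using e(1) wH True by (simp add: V_def)
   show "continuous_on V (stad j)" by (rule continuous_stad)
   show "\<exists>l. strand (Suc j) (1/2) l w" using w by blast
   show "stad j z \<in> Yset (1/2)" if z: "z \<in> V \<inter> KK" for z
   proof (rule chart_cap_side(1))
    show "z \<notin> Caps i" if "i ~= j" for i using e(2)[OF that] z by (auto simp: V_def)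
   qed (use z in \<open>auto simp: V_def\<close>)
   show "\<exists>y. strand (Suc j) y l z" if z: "z \<in> V" and l: "Adm (1/2) l" "stad j z = psi0 l" for z l
    using chart_cap_side(2)[of j z l] z l by (auto simp: V_def)
  qed
  thus ?thesis by blast
 next
  case False
  hence "fst w = pc j" using hw(2) ec_cases[of j] by auto
  from cap_foot[OF w this] obtain l1 where l1: "Adm (pc j) l1" "w = (pc j, psi0 l1)" "bk (pc j) l1 (Suc j) = 1/2"
   "shift (Suc j) l1 = l0" by blast
  obtain e' k0 where e': "0 < e'" and jk: "j < k0"
   and agree: "\<And>l k. \<bar>psi0 l - psi0 l1\<bar> < e' ==> k < k0 ==> l k = l1 k"
   and down: "\<And>y l. Adm y l ==> \<bar>y - pc j\<bar> < e' ==> \<bar>psi0 l - psi0 l1\<bar> < e' ==> Adm (pc j) l"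
   and up: "\<And>y l. Adm (pc j) l ==> a \<le> y ==> y \<le> b ==> \<bar>y - pc j\<bar> < e' ==> \<bar>psi0 l - psi0 l1\<bar> < e' ==>
    (\<And>k. k < k0 ==> \<not> l1 k ==> s * a \<le> bk y l1 k) ==> Adm y l"
  proof (rule local_product[OF l1(1) e(1), of j])
   show "ball (pc j, psi0 l1) e \<inter> Caps i = {}" if "i ~= j" for i using e(2)[OF that] l1(2) by simp
  qed blast
  have notC: "(pc j, psi0 l1) \<notin> Caps i" if "i ~= j" for i
   using Caps_disjoint[of w i j] wC that l1(2) by auto
  have strict: "s * a < bk (pc j) l1 k" if "\<not> l1 k \<and> k + 2 ~= j" for k
   using strict_Adm[OF l1(1)] notC that by blast
  obtain d where d: "0 < d" "\<And>y. \<bar>y - pc j\<bar> < d ==> \<forall>k<k0. \<not> l1 k \<and> k + 2 ~= j --> s * a \<le> bk y l1 k"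
   using slack[of k0 "%k. \<not> l1 k \<and> k + 2 ~= j" "pc j" l1] strict by blast
  \<comment> \<open>A zero at depth \<open>j - 2\<close> means that at the foot its constraint is an
    equality. The sign \<open>ec j\<close> shows that moving away from the semicircle cannot violate
    it.\<close>
  have pos: "s * a \<le> bk y l1 k" if y: "\<bar>y - pc j\<bar> < d" "ec j * (y - pc j) \<le> 0" and k: "k < k0" "\<not> l1 k" for y k
  proof (cases "k + 2 = j")
   case True
   have "l1 (Suc k)" using crit_code(4)[OF l1(1,3), of "Suc k"] True b_gt by auto
   hence "ec j = - parity_sign l1 k"
    using crit_code(3)[OF l1(1,3)] k(2) by (simp add: True[symmetric] numeral_2_eq_2 parity_sign_Suc)
   hence "0 \<le> parity_sign l1 k * (y - pc j)" using y(2) by simp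
   hence "0 \<le> bk y l1 k - bk (pc j) l1 k" unfolding bk_diff_sgn using s_pos by simp
   moreover have "s * a \<le> bk (pc j) l1 k" using l1(1) k(2) unfolding Adm_def by blast
   ultimately show ?thesis by simp
  next
   case False
   thus ?thesis using d(2)[OF y(1)] k by blast
  qed
  obtain g where g: "0 < g" "\<And>y. \<bar>y - pc j\<bar> < g ==> ec j * (y - pc j) \<le> 0 ==> a \<le> y \<and> y \<le> b"
  proof -
   consider "j = 0" | "j = 1" | "j ~= 0" "j ~= 1" by blast
   thus thesis
   proof cases
    case 1
    hence "pc j = b" "ec j = 1" by (simp_all add: pc_def ec_def)
    thus thesis using ab by (intro that[of "b - a"]) (auto simp: abs_if split: if_splits)
   next
    case 2
    hence "pc j = a" "ec j = - 1" using b_gt sg_Suc[of 0 b] by (simp_all add: pc_def ec_def T_b)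
    thus thesis using ab by (intro that[of "b - a"]) (auto simp: abs_if split: if_splits)
   next
    case 3
    hence "a < pc j" "pc j < b" using strict_range[OF l1(1)] notC by auto
    thus thesis by (intro that[of "min (pc j - a) (b - pc j)"]) (auto simp: abs_if split: if_splits)
   qed
  qed
  \<comment> \<open>The last bound separates the two feet, which in the scale \<open>3 ^ j\<close>
    are at least 1/3 apart.\<close>
  define r where "r = min (min e e') (min (min d g) ((1/4) / 3 ^ j))"
  have r: "0 < r" "r \<le> e" "r \<le> e'" "r \<le> d" "r \<le> g" "r \<le> (1/4) / 3 ^ j" using e(1) e' d(1) g(1) by (auto simp: r_def)
  have near: "\<bar>fst z - pc j\<bar> < r" "\<bar>snd z - psi0 l1\<bar> < r" if "z \<in> ball w r" for z
   using abs_le_dist[of z w] that l1(2) by (auto simp: dist_commute)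
  define V where "V = ball w r \<inter> {z. 0 < stad j z \<and> stad j z < 1}"
  have cap: "z \<notin> Caps i" if "z \<in> V" "i ~= j" for z i
   using e(2)[OF that(2)] subset_ball[OF r(2), of w] that(1) by (auto simp: V_def)
  have "chart w V (Suc j) (1/2) (stad j)"
   unfolding chart_def
  proof (intro conjI ballI allI impI)
   show "open V" unfolding V_def by (intro open_Int open_ball open_stad)
   show "w \<in> V" using r(1) wH by (simp add: V_def)
   show "continuous_on V (stad j)" by (rule continuous_stad)
   show "\<exists>l. strand (Suc j) (1/2) l w" using w by blast
   show "stad j z \<in> Yset (1/2)" if z: "z \<in> V \<inter> KK" for z
   proof (cases "0 \<le> ec j * (fst z - pc j)")
    case True
    thus ?thesis using z cap by (intro chart_cap_side(1)) (auto simp: V_def)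
   next
    case neg: False
    have "z \<notin> Caps j"
    proof
     assume "z \<in> Caps j"
     thus False using neg by (auto simp: Caps_def strand_crit cap_psi0_iff)
    qed
    hence "z \<in> Str" using z cap KK_iff by (metis IntD1 IntD2)
    then obtain y lz where lz: "Adm y lz" "z = (y, psi0 lz)" by (auto simp: Str_def strand_0)
    have nz: "\<bar>y - pc j\<bar> < e'" "\<bar>psi0 lz - psi0 l1\<bar> < e'" using near[of z] z lz(2) r(3) by (auto simp: V_def)
    have A: "Adm (pc j) lz" by (rule down[OF lz(1) nz])
    have "bk (pc j) lz (Suc j) = bk (pc j) l1 (Suc j)" using agree[OF nz(2)] jk by (intro bk_cong) auto
    hence c: "bk (pc j) lz (Suc j) = 1/2" using l1(3) by simp
    have "psi0 lz = qc j + ec j * (if lz j then 1 else - 1) * (1/2 - psi0 (shift (Suc j) lz) / 3) / 3 ^ j"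
     using crit_code(2)[OF A c] unfolding vh_b_H .
    hence "\<bar>snd z - qc j\<bar> = (1/2 - psi0 (shift (Suc j) lz) / 3) / 3 ^ j"
     using lz(2) ec_cases[of j] psi0_range[of "shift (Suc j) lz"] by (auto simp: abs_mult abs_divide)
    hence "stad j z = psi0 (shift (Suc j) lz)" using stad_strip[of j z] neg by simp
    moreover have "Adm (1/2) (shift (Suc j) lz)" using Adm_bk[OF A, of "Suc j"] unfolding c .
    ultimately show ?thesis unfolding Yset_def by blast
   qed
   show "\<exists>y. strand (Suc j) y l z" if z: "z \<in> V" and l: "Adm (1/2) l" "stad j z = psi0 l" for z l
   proof (cases "0 \<le> ec j * (fst z - pc j)")
    case True
    thus ?thesis using chart_cap_side(2)[of j z l] z l by (auto simp: V_def)
   next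
    case neg: False
    define lz where "lz = pre (Suc j) l1 l"
    have A: "Adm (pc j) lz" unfolding lz_def by (rule Adm_pre[OF l1(1)]) (use l1(3) l(1) in simp)
    have c: "bk (pc j) lz (Suc j) = 1/2" unfolding lz_def using bk_pre[of "Suc j" "Suc j" "pc j" l1 l] l1(3) by simp
    have sh: "shift (Suc j) lz = l" unfolding lz_def by (rule shift_pre)
    have lzj: "lz j = l1 j" by (simp add: lz_def pre_def)
    define k where "k = ec j * (if l1 j then 1 else - 1)"
    have k: "k = 1 \<or> k = - 1" using ec_cases[of j] by (auto simp: k_def)
    have p1: "psi0 l1 = qc j + k * (1/2 - psi0 l0 / 3) / 3 ^ j"
     using crit_code(2)[OF l1(1,3)] unfolding vh_b_H l1(4) k_def .
    have p2: "psi0 lz = qc j + k * (1/2 - psi0 l / 3) / 3 ^ j"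
     using crit_code(2)[OF A c] unfolding vh_b_H sh lzj k_def .
    define X where "X = 3 ^ j * (snd z - qc j)"
    have "\<bar>X\<bar> = 3 ^ j * \<bar>snd z - qc j\<bar>" by (simp add: X_def abs_mult)
    moreover have "psi0 l = 3 * (1/2 - 3 ^ j * \<bar>snd z - qc j\<bar>)" using stad_strip[of j z] neg l(2) by linarith
    ultimately have X: "\<bar>X\<bar> = 1/2 - psi0 l / 3" by (simp only: third_eq[symmetric])
    have zb: "z \<in> ball w r" using z by (simp add: V_def)
    have "\<bar>snd z - psi0 l1\<bar> < (1/4) / 3 ^ j" using near(2)[OF zb] r(6) by linarith
    hence "3 ^ j * \<bar>snd z - psi0 l1\<bar> < 1/4" by (simp add: field_simps)
    moreover have "3 ^ j * (snd z - psi0 l1) = X - k * (1/2 - psi0 l0 / 3)"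
    proof -
     have e: "3 ^ j * (x - (q + r / 3 ^ j)) = 3 ^ j * (x - q) - r" for x q r :: real by (simp add: field_simps)
     show ?thesis unfolding X_def p1 by (rule e)
    qed
    ultimately have "\<bar>X - k * (1/2 - psi0 l0 / 3)\<bar> < 1/4" by (metis abs_mult abs_numeral power_abs)
    hence "X = k * (1/2 - psi0 l / 3)"
     using X k psi0_range[of l] psi0_range[of l0] by (auto simp: abs_if split: if_splits)
    hence "snd z = qc j + k * (1/2 - psi0 l / 3) / 3 ^ j" by (simp add: X_def field_simps)
    hence zs: "snd z = psi0 lz" using p2 by simp
    have "Adm (fst z) lz"
    proof (rule up[OF A])
     have small: "\<bar>fst z - pc j\<bar> < g" "\<bar>fst z - pc j\<bar> < d" "ec j * (fst z - pc j) \<le> 0" using near(1)[OF zb] r neg by auto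
     show "a \<le> fst z" "fst z \<le> b" using g(2)[OF small(1,3)] by auto
     show "\<bar>fst z - pc j\<bar> < e'" "\<bar>psi0 lz - psi0 l1\<bar> < e'" using near[OF zb] r(3) zs by auto
     show "s * a \<le> bk (fst z) l1 k" if "k < k0" "\<not> l1 k" for k using pos[OF small(2,3) that] .
    qed
    hence "strand 0 (fst z) lz z" using zs by (simp add: strand_0 prod_eq_iff)
    from strand_add[OF this, of "Suc j"] show ?thesis unfolding sh by auto
   qed
  qed
  thus ?thesis by blast
 qed
qed

lemma chart_exists:
 assumes "w \<in> KK" "w \<notin> range Fold"
 shows "\<exists>V N y0 h. chart w V N y0 h"
proof (cases "\<exists>j. w \<in> Caps j")
 case True
 then obtain j l where "strand (Suc j) (1/2) l w" by (auto simp: Caps_def)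
 thus ?thesis using chart_Caps[OF _ assms(2)] by blast
next
 case False
 hence "w \<in> Str" using assms(1) KK_iff by metis
 then obtain y l where l: "Adm y l" "w = (y, psi0 l)" by (auto simp: Str_def strand_0)
 have "\<exists>V. chart (y, psi0 l) V 0 y snd \<and> (\<forall>j. V \<inter> Caps j = {})"
  by (rule chart_Str[OF l(1)]) (use False assms(2) l(2) in auto)
 thus ?thesis unfolding l(2) by blast
qed

end

section \<open>Arcs and crosscuts seen in a chart\<close>

lemma accessible_small_connected:
 assumes "accessible K z" "open V" "z \<in> V"
 shows "\<exists>C. connected C \<and> C \<subseteq> V \<and> C \<inter> K = {z} \<and> C ~= {z}"
proof -
 obtain g where g: "arc g" "path_image g \<inter> K = {z}" and zK: "z \<in> K" using assms(1) by (auto simp: accessible_def)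
 hence "z \<in> g ` {0..1}" by (auto simp: path_image_def)
 then obtain t where t: "t \<in> {0..1}" "z = g t" by blast
 have cg: "continuous_on {0..1} g" using g(1) by (auto simp: arc_def path_def)
 hence "openin (top_of_set {0..1}) ({0..1} \<inter> g -` V)" using assms(2) by (rule continuous_openin_preimage_gen)
 moreover have "t \<in> {0..1} \<inter> g -` V" using t assms(3) by simp
 ultimately obtain d where d: "0 < d" "ball t d \<inter> {0..1} \<subseteq> {0..1} \<inter> g -` V" by (rule openin_contains_ball[THEN iffD1, THEN conjunct2, THEN bspec, THEN exE]) auto
 define C where "C = g ` (ball t d \<inter> {0..1})"
 have "connected (ball t d \<inter> {0..1})" by (intro convex_connected convex_Int convex_ball) simp
 hence "connected C" unfolding C_def
  by (intro connected_continuous_image[OF continuous_on_subset[OF cg]]) simp_all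
 moreover have "C \<subseteq> V" using d(2) by (auto simp: C_def)
 moreover have "z \<in> C" using t d(1) by (auto simp: C_def)
 moreover have "C \<subseteq> path_image g" by (auto simp: C_def path_image_def)
 moreover obtain t' where t': "t' \<in> ball t d \<inter> {0..1}" "t' ~= t"
 proof (cases "t < 1")
  case True
  thus thesis using t(1) d(1) by (intro that[of "min 1 (t + d / 2)"]) (auto simp: dist_real_def)
 next
  case False
  thus thesis using t(1) d(1) by (intro that[of "max 0 (t - d / 2)"]) (auto simp: dist_real_def)
 qed
 moreover have "g t' ~= z"
  using g(1) t t' inj_onD[of g "{0..1}" t' t] by (auto simp: arc_def)
 ultimately show ?thesis using g(2) zK by (intro exI[of _ C]) (auto simp: C_def)
qed

lemma crosscut_accessible:
 assumes g: "arc g" "path_image g \<inter> K = {pathstart g, pathfinish g}"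
 shows "accessible K (pathstart g)" "accessible K (pathfinish g)"
proof -
 have main: "accessible K (pathstart g)" if g: "arc g" "path_image g \<inter> K = {pathstart g, pathfinish g}" for g :: "real => real \<times> real"
 proof -
  have a: "arc (subpath 0 (1/2) g)" using g(1) by (intro arc_subpath_arc) auto
  have "pathfinish g \<notin> path_image (subpath 0 (1/2) g)"
  proof
   assume "pathfinish g \<in> path_image (subpath 0 (1/2) g)"
   then obtain t where "t \<in> {0..1/2}" "g 1 = g t" by (auto simp: path_image_subpath pathfinish_def)
   thus False using g(1) inj_onD[of g "{0..1}" 1 t] by (auto simp: arc_def)
  qed
  moreover have "path_image (subpath 0 (1/2) g) \<subseteq> path_image g"
   using arc_imp_path[OF g(1)] by (intro path_image_subpath_subset) auto
  moreover have "pathstart g \<in> path_image (subpath 0 (1/2) g)"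
   using pathstart_in_path_image[of "subpath 0 (1/2) g"] by (simp add: pathstart_def subpath_def)
  ultimately have "path_image (subpath 0 (1/2) g) \<inter> K = {pathstart g}" using g(2) by auto
  thus ?thesis using a unfolding accessible_def by blast
 qed
 show "accessible K (pathstart g)" by (rule main[OF g])
 have "path_image (reversepath g) \<inter> K = {pathstart (reversepath g), pathfinish (reversepath g)}"
  using g(2) by (simp add: insert_commute)
 from main[OF _ this] g(1) show "accessible K (pathfinish g)" by (simp add: arc_reversepath)
qed

context tent_rot
begin

lemma chart_D:
 assumes "chart w V N y0 h"
 shows "open V" "w \<in> V" "continuous_on V h" "z \<in> V ==> z \<in> KK ==> h z \<in> Yset y0"
  "z \<in> V ==> Adm y0 l ==> h z = psi0 l ==> \<exists>y. strand N y l z" "\<exists>l. strand N y0 l w"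
 using assms unfolding chart_def by blast+

lemma strand_KK: "strand N y l z ==> z \<in> KK" unfolding KK_def by blast

lemma chart_between:
 assumes c: "chart w V N y0 h" and C: "connected C" "C \<subseteq> V" "x \<in> C" "x' \<in> C"
  and l: "Adm y0 l" "h x \<le> psi0 l" "psi0 l \<le> h x'"
 shows "\<exists>z\<in>C \<inter> KK. h z = psi0 l"
proof -
 have "connected (h ` C)" using C by (intro connected_continuous_image continuous_on_subset[OF chart_D(3)[OF c]])
 hence "{h x..h x'} \<subseteq> h ` C" using C by (intro connected_contains_Icc) auto
 hence "psi0 l \<in> h ` C" using l by auto
 then obtain z where z: "z \<in> C" "h z = psi0 l" by auto
 hence "z \<in> KK" using chart_D(5)[OF c, of z l] C(2) l(1) strand_KK by blast
 thus ?thesis using z by blast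
qed

lemma chart_center:
 assumes c: "chart w V N y0 h"
 shows "\<exists>l. strand N y0 l w \<and> Adm y0 l \<and> h w = psi0 l"
proof -
 obtain l where l: "strand N y0 l w" using chart_D(6)[OF c] by blast
 have "h w \<in> Yset y0" using chart_D(4)[OF c chart_D(2)[OF c]] strand_KK[OF l] .
 then obtain l' where l': "Adm y0 l'" "h w = psi0 l'" by (auto simp: Yset_def)
 then obtain y where "strand N y l' w" using chart_D(5)[OF c chart_D(2)[OF c]] by blast
 hence "l' = l" using strand_unique[OF l] by blast
 thus ?thesis using l l' by blast
qed

text \<open>A small piece of the access arc reaches a value \<open>h x\<close> different from
  \<open>h w\<close>. A strand with a height strictly between these values would be met on the way,
  and the arc meets the continuum only in \<open>w\<close>.\<close>

lemma chart_accessible: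
 assumes c: "chart w V N y0 h" and a: "accessible KK w"
 shows "\<exists>l d. strand N y0 l w \<and> Adm y0 l \<and> (d = 1 \<or> d = - 1) \<and> isolated_side y0 l d"
proof -
 obtain l where l: "strand N y0 l w" "Adm y0 l" "h w = psi0 l" using chart_center[OF c] by blast
 obtain C where C: "connected C" "C \<subseteq> V" "C \<inter> KK = {w}" "C ~= {w}"
  using accessible_small_connected[OF a chart_D(1,2)[OF c]] by blast
 then obtain x where x: "x \<in> C" "x ~= w" by blast
 have w: "w \<in> C" using C(3) by blast
 have no: "h z ~= psi0 l'" if "z \<in> C" "z ~= w" "Adm y0 l'" for z l'
 proof
  assume "h z = psi0 l'"
  hence "z \<in> KK" using chart_D(5)[OF c, of z l'] that C(2) strand_KK by blast
  thus False using C(3) that by blast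
 qed
 have ne: "h x ~= h w" using no[OF x l(2)] l(3) by simp
 define d where "d = (if h w < h x then 1 else - 1 :: real)"
 have "isolated_side y0 l d"
  unfolding isolated_side_def
 proof (intro exI[of _ "\<bar>h x - h w\<bar>"] conjI allI impI)
  show "0 < \<bar>h x - h w\<bar>" using ne by simp
  fix l' assume l': "Adm y0 l'" "0 < d * (psi0 l' - psi0 l)"
  show "\<bar>h x - h w\<bar> \<le> \<bar>psi0 l' - psi0 l\<bar>"
  proof (rule ccontr)
   assume n: "\<not> \<bar>h x - h w\<bar> \<le> \<bar>psi0 l' - psi0 l\<bar>"
   have "\<exists>z\<in>C \<inter> KK. h z = psi0 l'"
   proof (cases "h w < h x")
    case True
    thus ?thesis using l'(2) n l(3)
     by (intro chart_between[OF c C(1,2) w x(1) l'(1)]) (auto simp: d_def)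
   next
    case False
    thus ?thesis using l'(2) n l(3)
     by (intro chart_between[OF c C(1,2) x(1) w l'(1)]) (auto simp: d_def)
   qed
   hence "h w = psi0 l'" using C(3) by auto
   thus False using l'(2) l(3) by simp
  qed
 qed
 thus ?thesis using l by (intro exI[of _ l] exI[of _ d]) (auto simp: d_def)
qed

lemma tail_U:
 assumes "strand N y l z" "\<And>k. k0 \<le> k ==> l k = lam (i + int k)"
 shows "z \<in> U (i - int N)"
 using assms(2) by (intro U_I[OF assms(1)] exI[of _ k0]) (simp add: add.commute)

lemma accessible_U: assumes "accessible KK w" shows "\<exists>i. w \<in> U i"
proof (cases "w \<in> range Fold")
 case True
 thus ?thesis using Fold_U by blast
next
 case False
 have "w \<in> KK" using assms by (simp add: accessible_def)
 then obtain V N y0 h where c: "chart w V N y0 h" using chart_exists False by blast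
 obtain l d where l: "strand N y0 l w" "Adm y0 l" "d = 1 \<or> d = - 1" "isolated_side y0 l d"
  using chart_accessible[OF c assms] by blast
 then obtain i k0 where "\<And>k. k0 \<le> k ==> l k = lam (i + int k)" using isolated_tail by blast
 from tail_U[OF l(1) this] show ?thesis by blast
qed

text \<open>By intermediate values no strand lies between the two ends, so their codes are
  neighbours over one base point.\<close>

lemma chart_crosscut_less:
 assumes c: "chart w V N y0 h" and Q: "connected Q" "Q \<inter> KK = {x, x'}" "Q \<subseteq> V" and le: "h x \<le> h x'"
 shows "samet x x'"
proof -
 have x: "x \<in> V" "x' \<in> V" "x \<in> KK" "x' \<in> KK" "x \<in> Q" "x' \<in> Q" using Q by auto
 obtain l l' where l: "Adm y0 l" "h x = psi0 l" and l': "Adm y0 l'" "h x' = psi0 l'"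
  using chart_D(4)[OF c x(1,3)] chart_D(4)[OF c x(2,4)] by (auto simp: Yset_def)
 obtain y y' where y: "strand N y l x" "strand N y' l' x'"
  using chart_D(5)[OF c x(1) l] chart_D(5)[OF c x(2) l'] by blast
 show ?thesis
 proof (cases "psi0 l = psi0 l'")
  case True
  hence "l = l'" by (simp add: psi0_inj)
  thus ?thesis using y unfolding samet_def by blast
 next
  case False
  have "\<exists>k0. \<forall>k\<ge>k0. l k = l' k"
  proof (rule adjacent_tail[OF l(1) l'(1)])
   show "psi0 l < psi0 l'" using False le l(2) l'(2) by simp
   fix l2 assume l2: "Adm y0 l2"
   show "\<not> (psi0 l < psi0 l2 \<and> psi0 l2 < psi0 l')"
   proof
    assume h: "psi0 l < psi0 l2 \<and> psi0 l2 < psi0 l'"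
    have "\<exists>z\<in>Q \<inter> KK. h z = psi0 l2"
     using h l(2) l'(2) by (intro chart_between[OF c Q(1,3) x(5,6) l2]) auto
    thus False using h l(2) l'(2) Q(2) by auto
   qed
  qed
  then obtain k0 where "\<And>k. k0 \<le> k ==> l k = l' k" by blast
  from tail_imp_samet[OF y this] show ?thesis by blast
 qed
qed

lemma chart_crosscut:
 assumes c: "chart w V N y0 h" and g: "arc g" "path_image g \<inter> KK = {pathstart g, pathfinish g}" "path_image g \<subseteq> V"
 shows "\<exists>i. pathstart g \<in> U i \<and> pathfinish g \<in> U i"
proof -
 have con: "connected (path_image g)" using g(1) by (simp add: arc_imp_path connected_path_image)
 have "samet (pathstart g) (pathfinish g)"
 proof (cases "h (pathstart g) \<le> h (pathfinish g)")
  case True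
  thus ?thesis by (rule chart_crosscut_less[OF c con g(2,3)])
 next
  case False
  hence "samet (pathfinish g) (pathstart g)"
   using g(2) by (intro chart_crosscut_less[OF c con _ g(3)]) auto
  thus ?thesis by (rule samet_sym)
 qed
 moreover obtain i where "pathstart g \<in> U i" using accessible_U[OF crosscut_accessible(1)[OF g(1,2)]] by blast
 ultimately show ?thesis using U_samet by blast
qed

section \<open>Points that every arc meets from one side\<close>

lemma cap_bounds: assumes "z \<in> cap j r" "0 \<le> r" shows "\<bar>fst z - pc j\<bar> \<le> r / 3 ^ j" "0 \<le> ec j * (fst z - pc j)"
proof -
 have 1: "3 ^ j * norm (z - (pc j, qc j)) = r" "0 \<le> ec j * (fst z - pc j)" using cap_height_iff[OF assms(2)] assms(1) by auto
 have "\<bar>fst z - pc j\<bar> \<le> norm (z - (pc j, qc j))" using abs_le_dist(1)[of z "(pc j, qc j)"] by (simp add: dist_norm)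
 also have "\<dots> = r / 3 ^ j" using 1(1) by (simp add: field_simps)
 finally show "\<bar>fst z - pc j\<bar> \<le> r / 3 ^ j" .
 show "0 \<le> ec j * (fst z - pc j)" by (rule 1(2))
qed

text \<open>Over 1/2 the lowest strand gives the widest semicircle; at depth 0 it bulges right of
  \<open>b\<close>, at depth 1 left of \<open>a\<close>. Both extreme points carry the same code,
  but at consecutive levels, so their tails differ by a shift of one, which is no multiple of
  \<open>n\<close>.\<close>

lemma extreme_points:
 "\<exists>p q. p \<in> KK \<and> q \<in> KK \<and> (\<forall>z\<in>KK. fst z \<le> fst p) \<and> (\<forall>z\<in>KK. fst q \<le> fst z) \<and> (\<forall>i. \<not> (p \<in> U i \<and> q \<in> U i))"
proof -
 have "Adm (1/2) (case_nat True (%_. True))" using a_lt b_gt by (intro Adm_alt_tail) auto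
 hence ne: "Yset (1/2) ~= {}" unfolding Yset_def by blast
 have "bounded (Yset (1/2))" using psi0_range by (intro bounded_subset[OF bounded_closed_interval[of 0 1]]) (auto simp: Yset_def)
 hence "compact (Yset (1/2))" using closed_Yset by (simp add: compact_eq_bounded_closed)
 then obtain x where x: "x \<in> Yset (1/2)" "\<And>y. y \<in> Yset (1/2) ==> x \<le> y" using compact_attains_inf[OF _ ne] by blast
 then obtain l where l: "Adm (1/2) l" "x = psi0 l" by (auto simp: Yset_def)
 have min: "psi0 l \<le> psi0 l'" if "Adm (1/2) l'" for l' using x(2)[of "psi0 l'"] that l(2) by (auto simp: Yset_def)
 define r where "r = 1/2 - psi0 l / 3"
 have r: "1/6 \<le> r" "r \<le> 1/2" using psi0_range[of l] by (auto simp: r_def)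
 have e: "ec 0 = 1" "ec 1 = - 1" "pc 0 = b" "pc 1 = a" using b_gt sg_Suc[of 0 b] by (simp_all add: ec_def pc_def T_b)
 define p q where "p = (b + r, qc 0)" and "q = (a - r / 3, qc 1)"
 have "p \<in> cap 0 r" "q \<in> cap 1 r" using e r by (auto simp: p_def q_def cap_def power2_eq_square)
 hence st: "strand (Suc 0) (1/2) l p" "strand (Suc 1) (1/2) l q" using l(1) by (simp_all add: strand_crit r_def)
 have pcr: "a \<le> pc j" "pc j \<le> b" for j using funpow_range[of b j] ab by (auto simp: pc_def)
 have bd: "fst z \<le> b + r \<and> a - r / 3 \<le> fst z" if z: "z \<in> KK" for z
 proof -
  consider "z \<in> Str" | j where "z \<in> Caps j" using z KK_iff by blast
  thus ?thesis
  proof cases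
   case 1
   hence "a \<le> fst z" "fst z \<le> b" by (auto simp: Str_def strand_0 Adm_def)
   thus ?thesis using r by simp
  next
   case 2
   then obtain l' where l': "Adm (1/2) l'" "z \<in> cap j (1/2 - psi0 l' / 3)" by (auto simp: Caps_def strand_crit)
   define r' where "r' = 1/2 - psi0 l' / 3"
   have r': "0 \<le> r'" "r' \<le> r" using min[OF l'(1)] psi0_range[of l'] by (auto simp: r'_def r_def)
   have cb: "\<bar>fst z - pc j\<bar> \<le> r' / 3 ^ j" "0 \<le> ec j * (fst z - pc j)" using cap_bounds l'(2) r'(1) by (auto simp: r'_def)
   consider "j = 0" | "j = 1" | i where "j = i + 2" by (metis add.commute One_nat_def add_2_eq_Suc not0_implies_Suc)
   thus ?thesis
   proof cases
    case 1
    thus ?thesis using cb r' r e ab by auto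
   next
    case 2
    thus ?thesis using cb r' r e ab by auto
   next
    case 3
    \<comment> \<open>Deeper semicircles have radius at most 1/18, and \<open>r / 3\<close> is at
      least that.\<close>
    have "(1::real) \<le> 3 ^ i" by simp
    hence "(9::real) \<le> 3 ^ j" unfolding 3 by (simp add: power_add)
    hence "r' / 3 ^ j \<le> (1/2) / 9" using r' r by (intro frac_le) auto
    thus ?thesis using cb(1) pcr[of j] r by linarith
   qed
  qed
 qed
 have "\<not> (p \<in> U i \<and> q \<in> U i)" for i
 proof
  assume pq: "p \<in> U i \<and> q \<in> U i"
  obtain k0 where k0: "\<And>k. k0 \<le> k ==> l k = lam (int k + int (Suc 0) + i)" using U_strand st(1) pq by blast
  hence "p \<in> U (1 + i - int (Suc 0))" by (intro tail_U[OF st(1), of k0]) (simp add: algebra_simps)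
  moreover have "q \<in> U (1 + i - int (Suc 1))" using k0 by (intro tail_U[OF st(2), of k0]) (simp add: algebra_simps)
  ultimately have "int n dvd (i - (1 + i - int (Suc 1)))" using pq U_Int by blast
  thus False using n_ge3 by (simp add: zdvd_not_zless)
 qed
 moreover have "p \<in> KK" "q \<in> KK" using st strand_KK by auto
 ultimately show ?thesis using bd by (intro exI[of _ p] exI[of _ q]) (auto simp: p_def q_def)
qed

section \<open>Accessible and inaccessible points on each line\<close>

lemma parity_cd: "parity_sign (cd i) k = sgn_top i * sgn_top (i + int k)"
proof (induction k)
 case 0
 show ?case by (simp add: parity_sign_def sgn_top_def)
next
 case (Suc k)
 have "top (i + int (Suc k)) \<longleftrightarrow> (top (i + int k) ~= lam (i + int k))"
  using top_step[of "i + int k"] by (simp add: algebra_simps)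
 thus ?case using Suc by (auto simp: parity_sign_Suc cd_def sgn_top_def)
qed

lemma sgn_top_cases: "sgn_top i = 1 \<or> sgn_top i = - 1" by (simp add: sgn_top_def)

lemma sgn_top_sq: "sgn_top i * sgn_top i = 1" by (simp add: sgn_top_def)

lemma bk_near_Z: "bk y (cd i) k = Z (i + int k) + sgn_top i * sgn_top (i + int k) * (y - Z i) / s ^ k"
 using bk_diff_sgn[of y "cd i" k "Z i"] by (simp add: bk_cd parity_cd)

text \<open>A converse to \<open>not_rule\<close>: if the rule never fails, any other admissible
  code departs from this one towards the side opposite to \<open>d\<close>.\<close>

lemma extremal_rule:
 assumes A: "Adm y l" and d: "d = 1 \<or> d = - 1" and r: "\<And>k. rule_at y l (stt d l) k" and A': "Adm y l'"
 shows "d * (psi0 l' - psi0 l) \<le> 0"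
proof (cases "l' = l")
 case False
 hence ex: "\<exists>k. l' k ~= l k" by blast
 define N where "N = (LEAST k. l' k ~= l k)"
 have N: "l' N ~= l N" unfolding N_def using ex by (rule LeastI_ex)
 have same: "l' k = l k" if "k < N" for k using not_less_Least[of k "%k. l' k ~= l k"] that by (auto simp: N_def)
 have flip: "0 < parity_sign l N * (if l N then - 1 else 1) * (psi0 l' - psi0 l)" using same N by (intro psi0_flip) auto
 have bk: "bk y l' N = bk y l N" using same by (intro bk_cong) auto
 have "\<not> l' N ==> s * a \<le> bk y l' N" using A' by (simp add: Adm_def)
 hence "l N = stt d l N" using r[of N] N bk by (auto simp: rule_at_def)
 hence "parity_sign l N * (if l N then - 1 else 1) = - d"
  using d parity_sign_cases[of l N] by (auto simp: stt_def split: if_splits)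
 thus ?thesis using flip by simp
qed simp

lemma generic_near_Z:
 assumes c: "c = 1 \<or> c = - 1"
 shows "\<exists>e. 0 < e \<and> e < mu \<and> Z i + c * e \<notin> range Z \<and> Z i + c * e \<notin> range pc"
proof -
 have "range pc \<subseteq> {a, b} \<union> range Z" using pc_eq by auto
 hence fin: "finite ({a, b} \<union> range Z)" "range pc \<subseteq> {a, b} \<union> range Z" using finite_range_Z by auto
 have "finite ((%x. c * (x - Z i)) ` ({a, b} \<union> range Z))" using fin(1) by blast
 moreover have "infinite {0<..<mu}" using mu(1) by (simp add: infinite_Ioo)
 ultimately have "\<not> {0<..<mu} \<subseteq> (%x. c * (x - Z i)) ` ({a, b} \<union> range Z)" using finite_subset by blast
 then obtain e where e: "0 < e" "e < mu" "e \<notin> (%x. c * (x - Z i)) ` ({a, b} \<union> range Z)"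
  unfolding subset_eq by (metis greaterThanLessThan_iff)
 have "Z i + c * e \<notin> {a, b} \<union> range Z"
 proof
  assume h: "Z i + c * e \<in> {a, b} \<union> range Z"
  have "c * (Z i + c * e - Z i) = e" using c by auto
  thus False using e(3) imageI[OF h, of "%x. c * (x - Z i)"] by metis
 qed
 thus ?thesis using e fin(2) by blast
qed

lemma near_Fold:
 assumes "\<bar>y - Z i\<bar> < mu" "y \<notin> range Z" "y \<notin> range pc"
 shows "Adm y (cd i)" "(y, psi0 (cd i)) \<in> U i" "(y, psi0 (cd i)) \<notin> range Fold" "(y, psi0 (cd i)) \<notin> Caps j"
proof -
 show A: "Adm y (cd i)" using assms(1) by (intro mu(2)) simp
 have st: "strand 0 y (cd i) (y, psi0 (cd i))" using A by (simp add: strand_0)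
 have "(y, psi0 (cd i)) \<in> U (i - int 0)" by (rule tail_U[OF st, of 0]) (simp add: cd_def)
 thus "(y, psi0 (cd i)) \<in> U i" by simp
 show "(y, psi0 (cd i)) \<notin> range Fold" using assms(2) by (auto simp: Fold_def)
 show "(y, psi0 (cd i)) \<notin> Caps j" using Caps_pc[OF st] assms(3) by auto
qed

text \<open>The base point is moved off \<open>Z i\<close> in the direction that turns the weak
  inequality \<open>Z (i + int k) <= s * a\<close> into a strict one whenever the strand is
  bottommost with symbol 1. The rule then holds at every depth, the strand is extremal over its base
  point, and a short vertical segment gives access.\<close>

lemma U_accessible: "\<exists>w\<in>U i. accessible KK w"
proof -
 define d where "d = - sgn_top i"
 have d: "d = 1 \<or> d = - 1" using sgn_top_cases[of i] by (auto simp: d_def)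
 obtain e where e: "0 < e" "e < mu" "Z i + d * e \<notin> range Z" "Z i + d * e \<notin> range pc" using generic_near_Z[OF d] by blast
 define y where "y = Z i + d * e"
 define w where "w = (y, psi0 (cd i))"
 have ny: "\<bar>y - Z i\<bar> < mu" using d e(1,2) by (auto simp: y_def)
 note nf = near_Fold[OF ny e(3,4)[folded y_def], folded w_def]
 have stt: "stt d (cd i) k = top (i + int k)" for k
  using sgn_top_cases[of i] by (auto simp: stt_def parity_cd d_def sgn_top_def)
 have rule: "rule_at y (cd i) (stt d (cd i)) k" for k
  unfolding rule_at_def stt
 proof (cases "lam (i + int k)")
  case False
  hence "s * a \<le> bk y (cd i) k" using nf(1) by (simp add: Adm_def cd_def)
  thus "cd i k = (top (i + int k) \<or> bk y (cd i) k < s * a)" using False top_lam[of "i + int k"] by (auto simp: cd_def)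
 next
  case True
  show "cd i k = (top (i + int k) \<or> bk y (cd i) k < s * a)"
  proof (cases "top (i + int k)")
   case False
   have "sgn_top i * (y - Z i) = - e" using sgn_top_cases[of i] by (auto simp: y_def d_def)
   hence "bk y (cd i) k = Z (i + int k) - e / s ^ k" using False by (simp add: bk_near_Z sgn_top_def[of "i + int k"])
   moreover have "0 < e / s ^ k" using e(1) s_pos by simp
   moreover have "Z (i + int k) \<le> s * a" using lam_not_top[OF True False] .
   ultimately show ?thesis using True by (simp add: cd_def)
  qed (use True in \<open>simp add: cd_def\<close>)
 qed
 have ext: "d * (psi0 l' - psi0 (cd i)) \<le> 0" if "Adm y l'" for l' by (rule extremal_rule[OF nf(1) d rule that])
 obtain V where V: "chart w V 0 y snd" "\<And>j. V \<inter> Caps j = {}"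
  using chart_Str[OF nf(1)] nf(3,4) unfolding w_def by blast
 obtain r where r: "0 < r" "ball w r \<subseteq> V" using chart_D(1,2)[OF V(1)] open_contains_ball by blast
 define x where "x = (y, psi0 (cd i) + d * (r / 2))"
 have dist: "dist w x < r" using r(1) d by (auto simp: w_def x_def dist_prod_def dist_real_def)
 have "closed_segment w x \<subseteq> ball w r" using r(1) dist by (intro closed_segment_subset) auto
 hence sub: "closed_segment w x \<subseteq> V" using r(2) by blast
 have "z = w" if z: "z \<in> closed_segment w x" "z \<in> KK" for z
 proof -
  obtain t where t: "0 \<le> t" "t \<le> 1" "z = (1 - t) *\<^sub>R w + t *\<^sub>R x" using z(1) by (auto simp: in_segment)
  have zz: "z = (y, psi0 (cd i) + t * (d * (r / 2)))" unfolding t(3) w_def x_def by (simp add: algebra_simps)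
  have "z \<in> Str" using z sub V(2) KK_iff by blast
  then obtain l' where l': "Adm y l'" "psi0 l' = psi0 (cd i) + t * (d * (r / 2))" using zz by (auto simp: Str_def strand_0)
  have "d * (t * (d * (r / 2))) \<le> 0" using ext[OF l'(1)] l'(2) by simp
  hence "t * (r / 2) \<le> 0" using d by auto
  moreover have "0 < t * (r / 2)" if "0 < t" using that r(1) by simp
  ultimately have "t = 0" using t(1) by linarith
  thus ?thesis using zz by (simp add: w_def)
 qed
 moreover have wK: "w \<in> KK" using nf(2) U_sub_KK by blast
 ultimately have "path_image (linepath w x) \<inter> KK = {w}" by auto
 moreover have "arc (linepath w x)" using r(1) d by (intro arc_linepath) (auto simp: w_def x_def)
 ultimately have "accessible KK w" using wK unfolding accessible_def by blast
 thus ?thesis using nf(2) by blast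
qed

lemma late_index: "\<exists>k\<ge>K. int n dvd (i + int k - j)"
proof -
 define k where "k = nat (j - i + int n * (int K + \<bar>j\<bar> + \<bar>i\<bar>))"
 have "int K + \<bar>j\<bar> + \<bar>i\<bar> \<le> int n * (int K + \<bar>j\<bar> + \<bar>i\<bar>)" using n_pos mult_right_mono[of 1 "int n" "int K + \<bar>j\<bar> + \<bar>i\<bar>"] by simp
 hence k: "int k = j - i + int n * (int K + \<bar>j\<bar> + \<bar>i\<bar>)" "int K \<le> int k" by (auto simp: k_def)
 hence "i + int k - j = int n * (int K + \<bar>j\<bar> + \<bar>i\<bar>)" by simp
 hence "int n dvd (i + int k - j)" by simp
 thus ?thesis using k(2) by auto
qed

lemma not_lam_exists: "\<exists>j. \<not> lam j"
proof (rule ccontr)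
 assume "\<nexists>j. \<not> lam j"
 hence "int n dvd 1" using lam_shift_imp_dvd[of 0 1] by blast
 thus False using n_ge3 by (simp add: zdvd_not_zless)
qed

text \<open>On the other side of \<open>Z i\<close> the rule fails at infinitely many depths for
  both views. From one side it asks for a 0 whenever the orbit passes \<open>Z 0 = s * a\<close>,
  since the moved point is then above \<open>s * a\<close>; from the other side it asks for a 1 at
  every 0 of \<open>lam\<close>.\<close>

lemma U_not_accessible: "\<exists>w\<in>U i. \<not> accessible KK w"
proof -
 define c where "c = sgn_top i"
 have c: "c = 1 \<or> c = - 1" using sgn_top_cases by (simp add: c_def)
 obtain e where e: "0 < e" "e < mu" "Z i + c * e \<notin> range Z" "Z i + c * e \<notin> range pc" using generic_near_Z[OF c] by blast
 define y where "y = Z i + c * e"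
 define w where "w = (y, psi0 (cd i))"
 have ny: "\<bar>y - Z i\<bar> < mu" using c e(1,2) by (auto simp: y_def)
 note nf = near_Fold[OF ny e(3,4)[folded y_def], folded w_def]
 obtain V where V: "chart w V 0 y snd" using chart_Str[OF nf(1)] nf(3,4) unfolding w_def by blast
 have "\<not> accessible KK w"
 proof
  assume "accessible KK w"
  from chart_accessible[OF V this] obtain l d where l: "strand 0 y l w" "d = 1 \<or> d = - 1" "isolated_side y l d" by blast
  have "l = cd i" using l(1) psi0_inj[of "cd i" l] by (simp add: strand_0 w_def)
  then obtain K where K: "\<And>k. K \<le> k ==> rule_at y (cd i) (stt d (cd i)) k" using isolated_rule[OF nf(1) l(2)] l(3) by blast
  show False
  proof (cases "d = - c")
   case True
   obtain k where k: "K \<le> k" "int n dvd (i + int k - 0)" using late_index by blast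
   hence rho: "rho (i + int k) = 0" by (simp add: rho_0_iff)
   hence lam: "lam (i + int k)" and top: "\<not> top (i + int k)" using m_pos by (simp_all add: lam_rho top_def)
   have "\<not> stt d (cd i) k" using top True sgn_top_cases[of i] by (auto simp: stt_def parity_cd c_def sgn_top_def[of "i + int k"])
   moreover have "s * a \<le> bk y (cd i) k"
   proof -
    obtain j where "i + int k = 0 + int n * j" using k(2) by (auto elim: dvdE)
    hence "Z (i + int k) = s * a" using Z_period[of 0 j] Z_0 by simp
    moreover have "sgn_top i * (y - Z i) = e" using sgn_top_sq[of i] by (simp add: y_def c_def mult.assoc[symmetric])
    ultimately show ?thesis using top e(1) s_pos by (simp add: bk_near_Z sgn_top_def[of "i + int k"])
   qed
   ultimately show False using K[OF k(1)] lam by (simp add: rule_at_def cd_def)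
  next
   case False
   hence dc: "d = c" using l(2) c by auto
   obtain j where j: "\<not> lam j" using not_lam_exists by blast
   obtain k where k: "K \<le> k" "int n dvd (i + int k - j)" using late_index by blast
   then obtain x where "i + int k - j = int n * x" by (elim dvdE)
   hence "i + int k = j + int n * x" by simp
   hence nl: "\<not> lam (i + int k)" using lam_period[of j x] j by simp
   hence "\<not> top (i + int k)" using top_lam by blast
   hence "stt d (cd i) k" using dc sgn_top_sq[of i] by (simp add: stt_def parity_cd c_def sgn_top_def[of "i + int k"])
   thus False using K[OF k(1)] nl by (simp add: rule_at_def cd_def)
  qed
 qed
 thus ?thesis using nf(2) by blast
qed

lemma partially_accessible_U: "partially_accessible KK (U i)"
 unfolding partially_accessible_def using U_accessible U_not_accessible by simp

end

section \<open>Plane topology\<close>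

text \<open>An isometry onto the complex numbers, where separation of the plane is expressed through
  logarithms and the Jordan and Janiszewski theorems.\<close>

definition cpl :: "real \<times> real => complex" where "cpl p = Complex (fst p) (snd p)"

lemma dist_cpl [simp]: "dist (cpl p) (cpl q) = dist p q"
 by (simp add: cpl_def dist_prod_def dist_real_def dist_complex_def cmod_def complex_eq_iff power2_abs)

lemma inj_cpl: "inj cpl" by (auto simp: inj_def cpl_def prod_eq_iff)

lemma surj_cpl: "range cpl = UNIV"
proof
 show "UNIV \<subseteq> range cpl" by (auto intro!: range_eqI[of _ _ "(Re z, Im z)" for z] simp: cpl_def complex_eq_iff)
qed simp

lemma bij_cpl: "bij cpl" using inj_cpl surj_cpl by (simp add: bij_def)

definition lpc :: "complex => real \<times> real" where "lpc z = (Re z, Im z)"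

lemma lpc_cpl [simp]: "lpc (cpl p) = p" by (simp add: lpc_def cpl_def)

lemma cpl_lpc [simp]: "cpl (lpc z) = z" by (simp add: lpc_def cpl_def complex_eq_iff)

lemma linear_cpl: "linear cpl" by (rule linearI) (simp_all add: cpl_def complex_eq_iff)

lemma homeo_cpl: "homeomorphism S (cpl ` S) cpl lpc"
proof (rule homeomorphismI)
 show "continuous_on S cpl" unfolding continuous_on_iff by auto
 show "continuous_on (cpl ` S) lpc" unfolding lpc_def by (intro continuous_intros)
qed auto

lemma cpl_Compl: "cpl ` (- S) = - (cpl ` S)" using bij_image_Compl_eq[OF bij_cpl] .

lemma connected_cpl [simp]: "connected (cpl ` S) \<longleftrightarrow> connected S"
 using homeomorphic_connectedness homeo_cpl[of S] unfolding homeomorphic_def by blast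

lemma compact_cpl [simp]: "compact (cpl ` S) \<longleftrightarrow> compact S"
 using homeomorphic_compactness homeo_cpl[of S] unfolding homeomorphic_def by blast

lemma open_cpl [simp]: "open (cpl ` S) \<longleftrightarrow> open S"
 and closed_cpl [simp]: "closed (cpl ` S) \<longleftrightarrow> closed S"
 and closure_cpl: "closure (cpl ` S) = cpl ` closure S"
 by (simp_all only: open_bijective_linear_image_eq[OF linear_cpl bij_cpl] closed_injective_linear_image_eq[OF linear_cpl inj_cpl]
  closure_injective_linear_image[OF linear_cpl inj_cpl])

lemma bounded_cpl [simp]: "bounded (cpl ` S) \<longleftrightarrow> bounded S"
proof -
 have "(\<exists>x e. \<forall>y\<in>S. dist x (cpl y) \<le> e) \<longleftrightarrow> (\<exists>x e. \<forall>y\<in>S. dist x y \<le> e)"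
  using dist_cpl cpl_lpc by metis
 thus ?thesis unfolding bounded_def by simp
qed

lemma component_cpl: "connected_component (cpl ` S) (cpl x) (cpl y) \<longleftrightarrow> connected_component S x y"
 using connected_component_homeomorphism_iff[OF homeo_cpl[of S], of x y] connected_component_in[of "cpl ` S" "cpl x" "cpl y"]
 by (auto simp: inj_image_mem_iff[OF inj_cpl])

lemma component_set_cpl: "x \<in> S ==> connected_component_set (cpl ` S) (cpl x) = cpl ` connected_component_set S x"
 by (rule connected_component_set_homeomorphism[OF homeo_cpl])

lemma components_cpl: "C \<in> components S ==> cpl ` C \<in> components (cpl ` S)"
proof -
 assume "C \<in> components S"
 then obtain x where x: "x \<in> S" "C = connected_component_set S x" unfolding components_def by blast
 show ?thesis unfolding components_def x(2) component_set_cpl[OF x(1), symmetric] using x(1) by (intro imageI)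
qed

lemma inside_cpl: "inside (cpl ` S) = cpl ` inside S"
proof -
 have "cpl x \<in> inside (cpl ` S) \<longleftrightarrow> x \<in> inside S" for x
  using component_set_cpl[of x "- S"] by (auto simp: inside_def cpl_Compl inj_image_mem_iff[OF inj_cpl])
 from this[of "lpc _"] show ?thesis by (intro set_eqI) (simp add: image_iff, metis cpl_lpc lpc_cpl)
qed

lemma outside_cpl: "outside (cpl ` S) = cpl ` outside S"
 using inside_cpl[of S] cpl_Compl[of "S \<union> inside S"] by (simp add: outside_inside image_Un)

lemma frontier_cpl: "frontier (cpl ` S) = cpl ` frontier S"
proof -
 have "frontier (cpl ` S) = closure (cpl ` S) \<inter> closure (cpl ` (- S))" unfolding cpl_Compl by (rule frontier_closures)
 also have "\<dots> = cpl ` (closure S \<inter> closure (- S))" unfolding closure_cpl using inj_cpl by (simp add: image_Int)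
 finally show ?thesis by (simp add: frontier_closures)
qed

lemma Janiszewski_plane:
 fixes S T :: "(real \<times> real) set"
 assumes "compact S" "closed T" "connected (S \<inter> T)" "connected_component (- S) x y" "connected_component (- T) x y"
 shows "connected_component (- (S \<union> T)) x y"
proof -
 have "connected_component (- (cpl ` S \<union> cpl ` T)) (cpl x) (cpl y)"
 proof (rule Janiszewski)
  show "connected (cpl ` S \<inter> cpl ` T)" using assms(3) inj_cpl by (simp add: image_Int[symmetric])
  show "connected_component (- (cpl ` S)) (cpl x) (cpl y)" "connected_component (- (cpl ` T)) (cpl x) (cpl y)"
   using assms(4,5) by (simp_all add: cpl_Compl[symmetric] component_cpl)
 qed (use assms in auto)
 thus ?thesis by (simp add: image_Un[symmetric] cpl_Compl[symmetric] component_cpl del: Compl_Un)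
qed

lemma Janiszewski_plane_connected:
 fixes S T :: "(real \<times> real) set"
 assumes "compact S" "closed T" "connected (S \<inter> T)" "connected (- S)" "connected (- T)"
 shows "connected (- (S \<union> T))"
 using Janiszewski_plane[OF assms(1-3)] assms(4,5)
 by (metis IntD1 IntD2 compl_sup connected_iff_connected_component)

lemma Janiszewski_plane_dual:
 fixes S T :: "(real \<times> real) set"
 assumes "compact S" "compact T" "connected S" "connected T" "connected (- (S \<union> T))"
 shows "connected (S \<inter> T)"
proof -
 have "connected (cpl ` S \<inter> cpl ` T)"
  using assms by (intro Janiszewski_dual) (simp_all add: image_Un[symmetric] cpl_Compl[symmetric] del: Compl_Un)
 thus ?thesis using inj_cpl by (simp add: image_Int[symmetric])
qed

lemma Jordan_plane:
 fixes c :: "real => real \<times> real"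
 assumes c: "simple_path c" "pathfinish c = pathstart c" and J: "J = path_image c"
 shows "open (inside J)" "connected (inside J)" "inside J ~= {}" "open (outside J)" "connected (outside J)"
  "bounded (inside J)" "\<not> bounded (outside J)" "inside J \<inter> outside J = {}" "inside J \<union> outside J = - J"
  "frontier (inside J) = J" "frontier (outside J) = J"
proof -
 have "simple_path (cpl \<circ> c)" "pathfinish (cpl \<circ> c) = pathstart (cpl \<circ> c)" "path_image (cpl \<circ> c) = cpl ` J"
  using c by (simp_all add: simple_path_linear_image_eq[OF linear_cpl inj_cpl] pathfinish_compose pathstart_compose path_image_compose J)
 hence *: "inside (cpl ` J) ~= {} \<and> open (inside (cpl ` J)) \<and> connected (inside (cpl ` J)) \<and>
  outside (cpl ` J) ~= {} \<and> open (outside (cpl ` J)) \<and> connected (outside (cpl ` J)) \<and> bounded (inside (cpl ` J)) \<and>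
  \<not> bounded (outside (cpl ` J)) \<and> inside (cpl ` J) \<inter> outside (cpl ` J) = {} \<and>
  inside (cpl ` J) \<union> outside (cpl ` J) = - (cpl ` J) \<and> frontier (inside (cpl ` J)) = cpl ` J \<and>
  frontier (outside (cpl ` J)) = cpl ` J"
  using Jordan_inside_outside[of "cpl \<circ> c"] by simp
 have inj: "cpl ` A = cpl ` B \<longleftrightarrow> A = B" for A B using inj_cpl by (simp add: inj_image_eq_iff)
 show "open (inside J)" "connected (inside J)" "inside J ~= {}" "open (outside J)" "connected (outside J)"
  "bounded (inside J)" "\<not> bounded (outside J)" "frontier (inside J) = J" "frontier (outside J) = J"
  using * unfolding inside_cpl outside_cpl frontier_cpl inj by simp_all
 show "inside J \<inter> outside J = {}" "inside J \<union> outside J = - J"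
  by (simp_all add: inside_Int_outside inside_Un_outside)
qed

section \<open>Crosscuts of a non-separating continuum\<close>

text \<open>The logarithm is extended over \<open>C\<close> and used there in place of the factor
  that vanishes at \<open>b1\<close>. The result is a nonvanishing function on the plane that equals
  \<open>(z - b1) powi e1\<close> outside \<open>closure C\<close>; it has a logarithm, so its
  winding number \<open>e1\<close> along a large circle is zero.\<close>

lemma no_logarithm:
 fixes M C :: "complex set"
 assumes M: "compact M" and C: "C \<in> components (- M)" "bounded C" and b: "b1 \<in> C" "b2 \<notin> M" "b2 \<notin> C"
  and G: "continuous_on M G" "\<And>z. z \<in> M ==> exp (G z) = (z - b1) powi e1 * (z - b2) powi e2"
 shows "e1 = 0"
proof -
 have clM: "closed M" using M by (rule compact_imp_closed)
 obtain L where L: "continuous_on UNIV L" "\<And>z. z \<in> M ==> L z = G z"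
  using Tietze_unbounded[OF G(1), of UNIV] clM by (auto simp: closed_closedin[symmetric])
 have opC: "open C" using C(1) clM open_components by (metis open_Compl)
 have fr: "frontier C \<subseteq> M" using frontier_of_components_closed_complement[OF clM C(1)] .
 have CM: "C \<inter> M = {}" using in_components_subset[OF C(1)] by blast
 have clC: "closure C \<subseteq> C \<union> M" using fr opC by (auto simp: frontier_def interior_open)
 \<comment> \<open>The two definitions agree where they meet, because the frontier of
   \<open>C\<close> lies in \<open>M\<close>.\<close>
 define P where "P z = (if z \<in> closure C then exp (L z) * (z - b2) powi (- e2) else (z - b1) powi e1)" for z
 have nz: "z - b2 ~= 0" if "z \<in> closure C" for z using clC b that by auto
 have nz': "z - b1 ~= 0" if "z \<in> - C" for z using b that by auto
 have "continuous_on (closure C \<union> - C) P"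
  unfolding P_def
 proof (rule continuous_on_cases)
  show "closed (- C)" using opC by auto
  show "continuous_on (closure C) (%z. exp (L z) * (z - b2) powi (- e2))"
   using nz by (intro continuous_intros continuous_on_subset[OF L(1)]) auto
  show "continuous_on (- C) (%z. (z - b1) powi e1)" using nz' by (intro continuous_intros) auto
  show "\<forall>z. z \<in> closure C \<and> z \<notin> closure C \<or> z \<in> - C \<and> z \<in> closure C -->
    exp (L z) * (z - b2) powi (- e2) = (z - b1) powi e1"
  proof (intro allI impI)
   fix z assume "z \<in> closure C \<and> z \<notin> closure C \<or> z \<in> - C \<and> z \<in> closure C"
   hence z: "z \<in> closure C" "z \<in> M" using clC by auto
   have "exp (L z) = (z - b1) powi e1 * (z - b2) powi e2" using L(2)[OF z(2)] G(2)[OF z(2)] by simp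
   thus "exp (L z) * (z - b2) powi (- e2) = (z - b1) powi e1"
    using nz[OF z(1)] by (simp add: power_int_minus)
  qed
 qed auto
 moreover have "closure C \<union> - C = UNIV" using closure_subset by auto
 ultimately have contP: "continuous_on UNIV P" by simp
 have "P z ~= 0" for z using nz[of z] nz'[of z] closure_subset[of C] by (auto simp: P_def power_int_eq_0_iff)
 then obtain W where W: "continuous_on UNIV W" "\<And>z. P z = exp (W z)"
  using continuous_logarithm_on_contractible[OF contP contractible_UNIV] by auto
 obtain r where r: "0 < r" "closure C \<subseteq> ball b1 r"
  using bounded_subset_ballD[of "closure C" b1] C(2) by auto
 \<comment> \<open>The difference of two logarithms of one function along the circle takes values in
   the multiples of \<open>2 * pi * \<i>\<close> and is therefore constant; its values at 0 and
   \<open>2 * pi\<close> are compared.\<close>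
 define f where "f t = W (b1 + of_real r * exp (\<i> * of_real t)) - \<i> * of_int e1 * of_real t - of_int e1 * of_real (ln r)" for t :: real
 have expf: "exp (f t) = 1" for t
 proof -
  define z where "z = b1 + of_real r * exp (\<i> * of_real t)"
  have "dist b1 z = r" using r(1) by (simp add: z_def dist_norm norm_mult)
  hence "z \<notin> closure C" using r(2) by auto
  hence "exp (W z) = (of_real r * exp (\<i> * of_real t)) powi e1" using W(2)[of z] by (simp add: P_def z_def)
  also have "of_real r * exp (\<i> * of_real t) = exp (of_real (ln r) + \<i> * of_real t)" using r(1) by (simp add: exp_add exp_of_real)
  also have "\<dots> powi e1 = exp (of_int e1 * (of_real (ln r) + \<i> * of_real t))" by (rule exp_power_int)
  finally have "exp (W z) = exp (of_int e1 * (of_real (ln r) + \<i> * of_real t))" .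
  hence "exp (W z - of_int e1 * (of_real (ln r) + \<i> * of_real t)) = 1" by (simp add: exp_diff)
  moreover have "f t = W z - of_int e1 * (of_real (ln r) + \<i> * of_real t)" by (simp add: f_def z_def algebra_simps)
  ultimately show ?thesis by simp
 qed
 have "f constant_on (UNIV :: real set)"
 proof (rule continuous_discrete_range_constant)
  show "continuous_on UNIV f" unfolding f_def
   by (intro continuous_intros continuous_on_compose2[OF W(1)]) auto
  fix x show "\<exists>e>0. \<forall>y. y \<in> UNIV \<and> f y ~= f x --> e \<le> norm (f y - f x)"
  proof (intro exI[of _ "2 * pi"] conjI allI impI)
   fix y assume y: "y \<in> UNIV \<and> f y ~= f x"
   have "exp (f y) = exp (f x)" using expf by simp
   then obtain k :: int where k: "f y = f x + (of_int (2 * k) * pi) * \<i>" unfolding exp_eq by blast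
   hence "k ~= 0" using y by auto
   hence "1 \<le> \<bar>real_of_int k\<bar>" by linarith
   hence "2 * pi * 1 \<le> 2 * pi * \<bar>real_of_int k\<bar>" by (intro mult_left_mono) auto
   moreover have "norm (f y - f x) = 2 * pi * \<bar>real_of_int k\<bar>" using k by (simp add: norm_mult)
   ultimately show "2 * pi \<le> norm (f y - f x)" by simp
  qed simp
 qed simp
 hence "f 0 = f (2 * pi)" unfolding constant_on_def by auto
 thus ?thesis by (simp add: f_def exp_two_pi_i' mult.commute[of \<i>] exp_two_pi_i)
qed

lemma logarithm_on_nonseparating:
 fixes K :: "complex set" and f :: "complex => complex"
 assumes "compact K" "connected (- K)" "continuous_on K f" "\<And>z. z \<in> K ==> f z ~= 0"
 shows "\<exists>g. continuous_on K g \<and> (\<forall>z\<in>K. f z = exp (g z))"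
proof -
 have "Borsukian K" using Borsukian_separation_compact[OF assms(1)] assms(2) by blast
 moreover have "f \<in> K \<rightarrow> - {0}" using assms(4) by auto
 ultimately show ?thesis using assms(3) unfolding Borsukian_continuous_logarithm by simp
qed

text \<open>Logarithms of \<open>z - b1\<close> on \<open>K\<close> and on \<open>S\<close> that agree at \<open>p\<close> differ at \<open>q\<close> by \<open>2 \<pi> i d1\<close>, and likewise
 for \<open>b2\<close>; so some non-trivial \<open>(z - b1)^e1 (z - b2)^e2\<close> has a logarithm on \<open>K \<union> S\<close>, whatever \<open>b1\<close> and \<open>b2\<close>.\<close>

lemma bounded_component_unique_complex:
 fixes K S :: "complex set"
 assumes K: "compact K" "connected (- K)" and S: "compact S" "connected (- S)" and pq: "K \<inter> S = {p, q}"
  and C1: "C1 \<in> components (- (K \<union> S))" "bounded C1" and C2: "C2 \<in> components (- (K \<union> S))" "bounded C2"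
 shows "C1 = C2"
proof (rule ccontr)
 assume ne: "C1 ~= C2"
 hence dis: "C1 \<inter> C2 = {}" using components_eq[OF C1(1) C2(1)] by blast
 obtain b1 where b1: "b1 \<in> C1" using in_components_nonempty[OF C1(1)] by blast
 obtain b2 where b2: "b2 \<in> C2" using in_components_nonempty[OF C2(1)] by blast
 have nM: "b1 \<notin> K" "b1 \<notin> S" "b2 \<notin> K" "b2 \<notin> S"
  using in_components_subset[OF C1(1)] in_components_subset[OF C2(1)] b1 b2 by blast+
 have main: "\<exists>g h d. continuous_on K g \<and> continuous_on S h \<and> (\<forall>z\<in>K. exp (g z) = z - x) \<and> (\<forall>z\<in>S. exp (h z) = z - x) \<and>
   h p = g p \<and> h q = g q + of_int d * (2 * pi * \<i>)" if x: "x \<notin> K" "x \<notin> S" for x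
 proof -
  obtain g where g: "continuous_on K g" "\<And>z. z \<in> K ==> z - x = exp (g z)"
  proof -
   have "continuous_on K (%z. z - x)" by (intro continuous_intros)
   from logarithm_on_nonseparating[OF K this] x that show thesis by fastforce
  qed
  obtain h where h: "continuous_on S h" "\<And>z. z \<in> S ==> z - x = exp (h z)"
  proof -
   have "continuous_on S (%z. z - x)" by (intro continuous_intros)
   from logarithm_on_nonseparating[OF S this] x that show thesis by fastforce
  qed
  have pK: "p \<in> K" "p \<in> S" "q \<in> K" "q \<in> S" using pq by auto
  define h' where "h' z = h z + (g p - h p)" for z
  have "exp (g p - h p) = 1" using g(2)[OF pK(1)] h(2)[OF pK(2)] by (simp add: exp_diff)
  hence h': "exp (h' z) = z - x" if "z \<in> S" for z using h(2)[OF that] by (simp add: h'_def exp_add)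
  have "exp (h' q) = exp (g q)" using h'[OF pK(4)] g(2)[OF pK(3)] by simp
  then obtain d :: int where "h' q = g q + (of_int (2 * d) * pi) * \<i>" unfolding exp_eq by blast
  hence "h' q = g q + of_int d * (2 * pi * \<i>)" by simp
  moreover have "continuous_on S h'" unfolding h'_def by (intro continuous_intros h(1))
  moreover have "h' p = g p" by (simp add: h'_def)
  ultimately show ?thesis using g h' by metis
 qed
 obtain g1 h1 d1 where 1: "continuous_on K g1" "continuous_on S h1" "\<And>z. z \<in> K ==> exp (g1 z) = z - b1"
  "\<And>z. z \<in> S ==> exp (h1 z) = z - b1" "h1 p = g1 p" "h1 q = g1 q + of_int d1 * (2 * pi * \<i>)"
  using main[OF nM(1,2)] by blast
 obtain g2 h2 d2 where 2: "continuous_on K g2" "continuous_on S h2" "\<And>z. z \<in> K ==> exp (g2 z) = z - b2"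
  "\<And>z. z \<in> S ==> exp (h2 z) = z - b2" "h2 p = g2 p" "h2 q = g2 q + of_int d2 * (2 * pi * \<i>)"
  using main[OF nM(3,4)] by blast
 obtain e1 e2 :: int where e: "e1 * d1 + e2 * d2 = 0" "e1 ~= 0 \<or> e2 ~= 0"
 proof (cases "d1 = 0")
  case True
  thus thesis by (intro that[of 1 0]) auto
 next
  case False
  thus thesis by (intro that[of d2 "- d1"]) auto
 qed
 define G where "G z = (if z \<in> K then of_int e1 * g1 z + of_int e2 * g2 z else of_int e1 * h1 z + of_int e2 * h2 z)" for z
 have "continuous_on (K \<union> S) G"
  unfolding G_def
 proof (rule continuous_on_cases)
  show "closed K" "closed S" using K(1) S(1) by (auto intro: compact_imp_closed)
  show "\<forall>z. z \<in> K \<and> z \<notin> K \<or> z \<in> S \<and> z \<in> K -->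
    of_int e1 * g1 z + of_int e2 * g2 z = of_int e1 * h1 z + of_int e2 * h2 z"
  proof (intro allI impI)
   fix z assume "z \<in> K \<and> z \<notin> K \<or> z \<in> S \<and> z \<in> K"
   then consider "z = p" | "z = q" using pq by blast
   thus "of_int e1 * g1 z + of_int e2 * g2 z = of_int e1 * h1 z + of_int e2 * h2 z"
   proof cases
    case 2
    have "of_int e1 * h1 q + of_int e2 * h2 q
     = of_int e1 * g1 q + of_int e2 * g2 q + of_int (e1 * d1 + e2 * d2) * (2 * pi * \<i>)"
     by (simp add: 1 \<open>h2 q = _\<close> algebra_simps)
    thus ?thesis using e(1) 2 by simp
   qed (simp add: 1 2)
  qed
 qed (intro continuous_intros 1 2)+
 moreover have "exp (G z) = (z - b1) powi e1 * (z - b2) powi e2" if "z \<in> K \<union> S" for z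
 proof (cases "z \<in> K")
  case True
  thus ?thesis using 1(3)[OF True] 2(3)[OF True] by (simp add: G_def exp_add exp_power_int[symmetric])
 next
  case False
  hence z: "z \<in> S" using that by blast
  show ?thesis using False 1(4)[OF z] 2(4)[OF z] by (simp add: G_def exp_add exp_power_int[symmetric])
 qed
 moreover have M: "compact (K \<union> S)" using K(1) S(1) by blast
 ultimately have "e1 = 0" "e2 = 0"
  using no_logarithm[OF M C1, of b1 b2 G e1 e2] no_logarithm[OF M C2, of b2 b1 G e2 e1] b1 b2 nM dis
  by (auto simp: mult.commute)
 thus False using e(2) by simp
qed

lemma crosscut_bounded_unique:
 fixes K :: "(real \<times> real) set"
 assumes K: "compact K" "connected (- K)" and Q: "crosscut K Q"
  and C: "C1 \<in> components (- (K \<union> Q))" "bounded C1" "C2 \<in> components (- (K \<union> Q))" "bounded C2"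
 shows "C1 = C2"
proof -
 obtain g where g: "arc g" "Q = path_image g" "Q \<inter> K = {pathstart g, pathfinish g}" using Q by (auto simp: crosscut_def)
 have cQ: "compact Q" "connected (- Q)" using g(1) connected_arc_complement[OF g(1)] by (auto simp: g(2) compact_arc_image)
 have co: "cpl ` C \<in> components (- (cpl ` K \<union> cpl ` Q))" if "C \<in> components (- (K \<union> Q))" for C
  using components_cpl[OF that] by (simp only: cpl_Compl image_Un)
 have "cpl ` C1 = cpl ` C2"
 proof (rule bounded_component_unique_complex[OF _ _ _ _ _ co[OF C(1)] _ co[OF C(3)]])
  show "compact (cpl ` K)" "compact (cpl ` Q)" using K(1) cQ(1) by simp_all
  show "connected (- (cpl ` K))" "connected (- (cpl ` Q))" using K(2) cQ(2) by (simp_all add: cpl_Compl[symmetric])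
  show "cpl ` K \<inter> cpl ` Q = {cpl (pathstart g), cpl (pathfinish g)}"
   using g(3) inj_cpl by (simp add: image_Int[symmetric] Int_commute)
  show "bounded (cpl ` C1)" "bounded (cpl ` C2)" using C by simp_all
 qed
 thus ?thesis using inj_cpl by (simp add: inj_image_eq_iff)
qed

text \<open>If a piece of \<open>Q\<close> stayed away from the closure of \<open>C\<close>, then
  \<open>C\<close> would remain a component after that piece is removed. What is left of
  \<open>Q\<close> consists of two arcs attached to \<open>K\<close> at one point each, and by
  Janiszewski's theorem these do not separate; so \<open>C\<close> would be everything, including
  the removed piece.\<close>

lemma crosscut_closure:
 fixes K :: "(real \<times> real) set"
 assumes K: "compact K" "connected K" "connected (- K)" and Q: "crosscut K Q" and C: "C \<in> components (- (K \<union> Q))"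
 shows "Q \<subseteq> closure C"
proof (rule ccontr)
 assume "\<not> Q \<subseteq> closure C"
 obtain g where g: "arc g" "Q = path_image g" "Q \<inter> K = {pathstart g, pathfinish g}" using Q by (auto simp: crosscut_def)
 have cg: "continuous_on {0..1} g" and ig: "inj_on g {0..1}" using g(1) by (auto simp: arc_def path_def)
 obtain t0 where t0: "t0 \<in> {0..1}" "g t0 \<notin> closure C" using \<open>\<not> Q \<subseteq> closure C\<close> unfolding g(2) path_image_def by blast
 have "openin (top_of_set {0..1}) ({0..1} \<inter> g -` (- closure C))" using cg by (rule continuous_openin_preimage_gen) auto
 then obtain d where d: "0 < d" "ball t0 d \<inter> {0..1} \<subseteq> {0..1} \<inter> g -` (- closure C)"
  using t0 openin_contains_ball by (metis ComplI IntI vimageI2)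
 define p q where "p = max (t0 - d) 0" and "q = min (t0 + d) 1"
 have pq: "p < q" "0 \<le> p" "q \<le> 1" "t0 - d \<le> p" "q \<le> t0 + d" using t0(1) d(1) by (auto simp: p_def q_def)
 define u t v where "u = (3 * p + q) / 4" and "t = (p + q) / 2" and "v = (p + 3 * q) / 4"
 have uv: "p < u" "u < t" "t < v" "v < q" using pq(1) by (auto simp: u_def t_def v_def field_simps)
 have t: "0 < u" "t \<in> {0..1}" "v < 1" using uv pq by auto
 have away: "g x \<notin> closure C" if "u \<le> x" "x \<le> v" for x
 proof -
  have "x \<in> ball t0 d \<inter> {0..1}" using that uv pq by (auto simp: dist_real_def)
  thus ?thesis using d(2) by blast
 qed
 define A B where "A = g ` {0..u}" and "B = g ` {v..1}"
 have arcs: "arc (subpath 0 u g)" "arc (subpath v 1 g)" using g(1) t uv by (auto intro: arc_subpath_arc)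
 have im: "path_image (subpath 0 u g) = A" "path_image (subpath v 1 g) = B" using t uv by (auto simp: A_def B_def path_image_subpath)
 have cA: "compact A" "compact B" "connected (- A)" "connected (- B)"
  using arcs compact_arc_image[OF arcs(1)] compact_arc_image[OF arcs(2)] connected_arc_complement[OF arcs(1)]
   connected_arc_complement[OF arcs(2)] unfolding im by auto
 have ends: "g 0 \<in> K" "g 1 \<in> K" using g(3) by (auto simp: pathstart_def pathfinish_def)
 have Kg: "K \<inter> g ` S = g ` (S \<inter> {0, 1})" if "S \<subseteq> {0..1}" for S
 proof -
  have "x = 0 \<or> x = 1" if x: "x \<in> {0..1}" "g x \<in> K" for x
  proof -
   have "g x = g 0 \<or> g x = g 1" using g(2,3) x by (auto simp: path_image_def pathstart_def pathfinish_def)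
   thus ?thesis using inj_onD[OF ig, of x 0] inj_onD[OF ig, of x 1] x(1) by auto
  qed
  thus ?thesis using that ends by blast
 qed
 have "{0..u} \<inter> {0, 1} = {0}" "{v..1} \<inter> {0, 1} = {1}" using t uv by auto
 hence KA: "K \<inter> A = {g 0}" and KB: "K \<inter> B = {g 1}"
  using Kg[of "{0..u}"] Kg[of "{v..1}"] t uv by (auto simp: A_def B_def)
 have "A \<inter> B = g ` ({0..u} \<inter> {v..1})" unfolding A_def B_def
  by (rule inj_on_image_Int[OF ig, symmetric]) (use t uv in auto)
 hence "(K \<union> A) \<inter> B = {g 1}" using KB uv by auto
 moreover have "connected (- (K \<union> A))" using K cA KA compact_imp_closed[OF cA(1)] by (intro Janiszewski_plane_connected[of K]) simp_all
 moreover have "compact (K \<union> A)" using K(1) cA(1) by blast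
 ultimately have con: "connected (- ((K \<union> A) \<union> B))"
  using cA compact_imp_closed[OF cA(2)] by (intro Janiszewski_plane_connected[of "K \<union> A"]) (simp_all only: connected_sing)
 let ?K = "(K \<union> A) \<union> B"
 have AB: "A \<subseteq> Q" "B \<subseteq> Q" using t uv by (auto simp: A_def B_def g(2) path_image_def)
 have cl: "closed (K \<union> Q)" using K(1) compact_arc_image[OF g(1)] by (auto simp: g(2) intro: compact_imp_closed)
 have opC: "open C" using C cl open_components by (metis open_Compl)
 have sub: "C \<subseteq> - ?K" using in_components_subset[OF C] AB by blast
 have "closure C \<inter> - ?K \<subseteq> C"
 proof
  fix z assume z: "z \<in> closure C \<inter> - ?K"
  show "z \<in> C"
  proof (rule ccontr)
   assume "z \<notin> C"
   hence "z \<in> frontier C" using z opC by (simp add: frontier_def interior_open)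
   hence "z \<in> Q" using frontier_of_components_closed_complement[OF cl C] z by blast
   then obtain x where x: "x \<in> {0..1}" "z = g x" by (auto simp: g(2) path_image_def)
   hence "\<not> (x \<le> u)" "\<not> (v \<le> x)" using z by (auto simp: A_def B_def)
   thus False using away[of x] z x by auto
  qed
 qed
 hence "closedin (top_of_set (- ?K)) C" using sub closure_subset[of C]
  unfolding closedin_closed by (intro exI[of _ "closure C"]) auto
 moreover have "openin (top_of_set (- ?K)) C" using opC sub by (simp add: open_subset)
 ultimately have "C = {} \<or> C = - ?K" using con unfolding connected_clopen by blast
 hence eq: "C = - ?K" using in_components_nonempty[OF C] by blast
 have gt: "g t \<notin> g ` S" if "S \<subseteq> {0..1} - {t}" for S
  using inj_on_image_mem_iff[OF ig t(2), of S] that by blast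
 have "g t \<notin> A" "g t \<notin> B" unfolding A_def B_def using t uv by (intro gt; auto)+
 hence "g t \<notin> ?K" using Kg[of "{t}"] t uv by auto
 hence "g t \<in> C" using eq by blast
 moreover have "g t \<in> Q" using t by (auto simp: g(2) path_image_def)
 ultimately show False using in_components_subset[OF C] by blast
qed

text \<open>There are exactly two components: the dual of Janiszewski's theorem excludes one, as
  \<open>K\<close> and \<open>Q\<close> meet in two points, and uniqueness of the bounded one
  excludes three. This gives the description in \<open>B_set\<close> its meaning.\<close>

lemma crosscut_B:
 fixes K :: "(real \<times> real) set"
 assumes K: "compact K" "connected K" "connected (- K)" and Q: "crosscut K Q"
 shows "B_set K Q \<in> components (- (K \<union> Q))" "bounded (B_set K Q)" "open (B_set K Q)" "connected (B_set K Q)"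
  "\<And>C. C \<in> components (- (K \<union> Q)) ==> bounded C ==> C = B_set K Q"
  "connected (- (K \<union> Q \<union> B_set K Q))" "Q \<subseteq> closure (B_set K Q)" "Q \<subseteq> closure (- (K \<union> Q \<union> B_set K Q))"
proof -
 let ?M = "K \<union> Q"
 obtain g where g: "arc g" "Q = path_image g" "Q \<inter> K = {pathstart g, pathfinish g}" using Q by (auto simp: crosscut_def)
 have cQ: "compact Q" "connected Q" using g(1) by (auto simp: g(2) compact_arc_image connected_arc_image)
 have cM: "compact ?M" using K(1) cQ(1) by blast
 have bM: "bounded (- (- ?M))" using compact_imp_bounded[OF cM] by (simp only: double_complement)
 have dis: "\<not> connected (- ?M)"
 proof
  assume "connected (- ?M)"
  hence "connected (K \<inter> Q)" using K cQ by (intro Janiszewski_plane_dual)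
  hence "connected {pathstart g, pathfinish g}" using g(3) by (simp add: Int_commute)
  then obtain x where "{pathstart g, pathfinish g} = {x}" using connected_finite_iff_sing by blast
  thus False using arc_distinct_ends[OF g(1)] by auto
 qed
 obtain x where x: "x \<in> - ?M" "\<not> bounded (connected_component_set (- ?M) x)" using cobounded_unbounded_component[OF bM] by blast
 define O' where "O' = connected_component_set (- ?M) x"
 have O': "O' \<in> components (- ?M)" "\<not> bounded O'" using x by (auto simp: O'_def componentsI)
 have bd: "bounded C" if C: "C \<in> components (- ?M)" "C ~= O'" for C
 proof (rule ccontr)
  assume nb: "\<not> bounded C"
  obtain y where y: "C = connected_component_set (- ?M) y" using C(1) by (auto simp: components_def)
  have "connected_component_set (- ?M) x = connected_component_set (- ?M) y"
   using x(2) nb y by (intro cobounded_unique_unbounded_component[OF bM]) auto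
  thus False using C(2) y by (simp add: O'_def)
 qed
 have "\<exists>B\<in>components (- ?M). B ~= O'"
 proof (rule ccontr)
  assume "\<not> ?thesis"
  hence "\<Union> (components (- ?M)) \<subseteq> O'" by blast
  hence "- ?M \<subseteq> O'" by (simp only: Union_components)
  hence "- ?M = O'" using in_components_subset[OF O'(1)] by (rule subset_antisym)
  thus False using dis in_components_connected[OF O'(1)] by simp
 qed
 then obtain B where B: "B \<in> components (- ?M)" "B ~= O'" by blast
 have bB: "bounded B" using bd B by blast
 have uni: "C = B" if "C \<in> components (- ?M)" "bounded C" for C
  using crosscut_bounded_unique[OF K(1,3) Q that B(1) bB] .
 have the: "B_set K Q = B"
  unfolding B_set_def using B(1) bB uni by (intro the_equality) blast+
 show "B_set K Q \<in> components (- ?M)" "bounded (B_set K Q)" unfolding the by (fact B(1), fact bB)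
 show "open (B_set K Q)" unfolding the using open_components[OF open_Compl[OF compact_imp_closed[OF cM]] B(1)] .
 show "connected (B_set K Q)" unfolding the by (rule in_components_connected[OF B(1)])
 show "C = B_set K Q" if "C \<in> components (- ?M)" "bounded C" for C unfolding the using uni that .
 have comp: "components (- ?M) = {B, O'}" using uni bd B O' by blast
 have "- ?M = B \<union> O'" using Union_components[of "- ?M"] unfolding comp by simp
 moreover have "B \<inter> O' = {}" using components_eq[OF B(1) O'(1)] B(2) by blast
 ultimately have OO: "- (K \<union> Q \<union> B_set K Q) = O'" unfolding the by blast
 show "connected (- (K \<union> Q \<union> B_set K Q))" unfolding OO by (rule in_components_connected[OF O'(1)])
 show "Q \<subseteq> closure (B_set K Q)" unfolding the by (rule crosscut_closure[OF K Q B(1)])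
 show "Q \<subseteq> closure (- (K \<union> Q \<union> B_set K Q))" unfolding OO by (rule crosscut_closure[OF K Q O'(1)])
qed

section \<open>The complement of the core is connected\<close>

definition tame :: "(real \<times> real) set => bool" where
 "tame S \<longleftrightarrow> compact S \<and> connected S \<and> connected (- S)"

lemma tame_Un:
 assumes "tame S" "tame S'" "connected (S \<inter> S')" "S \<inter> S' ~= {}"
 shows "tame (S \<union> S')"
 unfolding tame_def
proof (intro conjI)
 show "compact (S \<union> S')" using assms by (simp add: tame_def compact_Un)
 show "connected (S \<union> S')" using assms by (simp add: tame_def connected_Un)
 show "connected (- (S \<union> S'))"
  using assms by (intro Janiszewski_plane_connected) (simp_all add: tame_def compact_imp_closed)
qed

lemma tame_convex: "compact S ==> convex S ==> tame S"
 unfolding tame_def by (simp add: compact_imp_bounded connected_complement_bounded_convex convex_connected)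

lemma tame_homeomorphic_convex:
 fixes S :: "(real \<times> real) set" and T :: "(real \<times> real) set"
 assumes "S homeomorphic T" "compact T" "convex T"
 shows "tame S"
 unfolding tame_def
proof (intro conjI)
 show "compact S" "connected S"
  using assms homeomorphic_compactness homeomorphic_connectedness convex_connected by blast+
 show "connected (- S)" using assms by (intro connected_complement_homeomorphic_convex_compact) auto
qed

context tent_rot
begin

lemma vh_affine: "vh N y h = vh N y 0 + sg N y * h / 3 ^ N"
 using vh_diff[of N y h 0] by simp

lemma connected_vertical: "connected ((%h. (p, vh N y h)) ` {h1..h2})"
proof -
 have "continuous_on {h1..h2} (%h. (p, vh N y 0 + sg N y * h / 3 ^ N))" by (intro continuous_intros) auto
 hence "continuous_on {h1..h2} (%h. (p, vh N y h))"
 proof (rule continuous_on_eq)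
  fix x show "(p, vh N y 0 + sg N y * x / 3 ^ N) = (p, vh N y x)" using vh_affine[of N y x] by simp
 qed
 thus ?thesis by (rule connected_continuous_image) simp
qed

section \<open>Discs that shrink to the continuum\<close>

definition annulus :: "nat => real => real => (real \<times> real) set" where
 "annulus N r1 r2 = (\<Union>r\<in>{r1..r2}. cap N r)"

lemma tame_annulus:
 assumes r: "0 < r1" "r1 \<le> r2"
 shows "tame (annulus N r1 r2)"
proof -
 define f where "f = (%(r, t). cpt N r t)"
 define D where "D = {r1..r2} \<times> {- 1..1 :: real}"
 have cont: "continuous_on D f" unfolding f_def case_prod_unfold cpt_def by (intro continuous_intros) auto
 have "f ` D = (\<Union>r\<in>{r1..r2}. cpt N r ` {- 1..1})" by (force simp: f_def D_def)
 also have "\<dots> = annulus N r1 r2" using r by (auto simp: annulus_def cap_eq_cpt)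
 finally have fD: "f ` D = annulus N r1 r2" .
 have "inj_on f D"
 proof (rule inj_onI, clarify)
  fix r t r' t' assume D: "(r, t) \<in> D" "(r', t') \<in> D" and eq: "f (r, t) = f (r', t')"
  hence p: "0 < r" "0 < r'" using r by (auto simp: D_def)
  have "f (r, t) \<in> cap N r" "f (r', t') \<in> cap N r'" using D p by (auto simp: f_def D_def cap_eq_cpt)
  hence "r = r'" using eq p cap_height_iff[of r "f (r, t)" N] cap_height_iff[of r' "f (r, t)" N] by simp
  thus "r = r' \<and> t = t'" using eq p by (simp add: f_def cpt_def)
 qed
 moreover have cD: "compact D" "convex D" by (auto simp: D_def compact_Times convex_Times)
 ultimately have "D homeomorphic annulus N r1 r2" using cont fD by (intro homeomorphic_compact[of D f]) auto
 thus ?thesis using cD homeomorphic_sym tame_homeomorphic_convex by blast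
qed

definition Dr :: "nat => real => real => real => real => (real \<times> real) set" where
 "Dr N p r h1 h2 = (\<Union>y\<in>{p..r}. \<Union>h\<in>{h1..h2}. dr N y h)"

lemma H_image: "H False ` {h1..h2} = {H False h1..H False h2}" "H True ` {h1..h2} = {H True h2..H True h1}"
proof -
 show "H False ` {h1..h2} = {H False h1..H False h2}"
 proof
  show "{H False h1..H False h2} \<subseteq> H False ` {h1..h2}"
  proof
   fix x assume "x \<in> {H False h1..H False h2}"
   thus "x \<in> H False ` {h1..h2}" by (intro image_eqI[of _ _ "3 * x"]) (auto simp: H_def)
  qed
 qed (auto simp: H_def)
 show "H True ` {h1..h2} = {H True h2..H True h1}"
 proof
  show "{H True h2..H True h1} \<subseteq> H True ` {h1..h2}"
  proof
   fix x assume "x \<in> {H True h2..H True h1}"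
   thus "x \<in> H True ` {h1..h2}" by (intro image_eqI[of _ _ "3 * (1 - x)"]) (auto simp: H_def diff_divide_distrib)
  qed
 qed (auto simp: H_def)
qed

lemma Dr_I: "y \<in> {p..r} ==> h \<in> {h1..h2} ==> z \<in> dr N y h ==> z \<in> Dr N p r h1 h2"
 unfolding Dr_def by blast

lemma Dr_end: "b \<in> {p..r} ==> h \<in> {h1..h2} ==> (pc N, vh N b h) \<in> Dr N p r h1 h2"
 by (rule Dr_I[of b _ _ h]) (simp_all add: dr_b)

lemma Dr_image: "(\<Union>y\<in>X. \<Union>h\<in>Y. dr N (T y) (H e h)) = (\<Union>y\<in>T ` X. \<Union>h\<in>H e ` Y. dr N y h)"
 by simp

lemma Dr_left:
 assumes "p \<le> r" "r < 1/2"
 shows "Dr (Suc N) p r h1 h2 = Dr N (T p) (T r) (H False h1) (H False h2)"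
proof -
 have "Dr (Suc N) p r h1 h2 = (\<Union>y\<in>{p..r}. \<Union>h\<in>{h1..h2}. dr N (T y) (H False h))"
  unfolding Dr_def using assms by (intro SUP_cong refl) auto
 also have "\<dots> = Dr N (T p) (T r) (H False h1) (H False h2)"
  unfolding Dr_image Dr_def H_image using assms by (simp add: T_image)
 finally show ?thesis .
qed

lemma Dr_right:
 assumes "p \<le> r" "1/2 < p"
 shows "Dr (Suc N) p r h1 h2 = Dr N (T r) (T p) (H True h2) (H True h1)"
proof -
 have "Dr (Suc N) p r h1 h2 = (\<Union>y\<in>{p..r}. \<Union>h\<in>{h1..h2}. dr N (T y) (H True h))"
  unfolding Dr_def using assms by (intro SUP_cong refl) auto
 also have "\<dots> = Dr N (T r) (T p) (H True h2) (H True h1)"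
  unfolding Dr_image Dr_def H_image using assms by (simp add: T_image)
 finally show ?thesis .
qed

lemma Dr_mid:
 assumes "p \<le> 1/2" "1/2 \<le> r"
 shows "Dr (Suc N) p r h1 h2 = (Dr N (T p) b (H False h1) (H False h2) \<union> annulus N (1/2 - h2 / 3) (1/2 - h1 / 3))
  \<union> Dr N (T r) b (H True h2) (H True h1)" (is "_ = (?L \<union> ?A) \<union> ?R")
proof -
 have A: "cap N (1/2 - h / 3) \<subseteq> ?A" if "h \<in> {h1..h2}" for h
  using that unfolding annulus_def by (intro UN_upper) auto
 have Im: "T ` {p..1/2} = {T p..b}" "T ` {1/2..r} = {T r..b}" using assms by (simp_all add: T_image T_crit)
 have L: "?L = (\<Union>y\<in>{p..1/2}. \<Union>h\<in>{h1..h2}. dr N (T y) (H False h))"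
  unfolding Dr_image Dr_def H_image Im ..
 have R: "?R = (\<Union>y\<in>{1/2..r}. \<Union>h\<in>{h1..h2}. dr N (T y) (H True h))"
  unfolding Dr_image Dr_def H_image Im ..
 show ?thesis
 proof
  show "Dr (Suc N) p r h1 h2 \<subseteq> (?L \<union> ?A) \<union> ?R"
  proof
   fix z assume "z \<in> Dr (Suc N) p r h1 h2"
   then obtain y h where yh: "y \<in> {p..r}" "h \<in> {h1..h2}" "z \<in> dr (Suc N) y h" unfolding Dr_def by blast
   consider "y = 1/2" | "y < 1/2" | "1/2 < y" by linarith
   thus "z \<in> (?L \<union> ?A) \<union> ?R"
   proof cases
    case 1
    thus ?thesis using yh A[OF yh(2)] by auto
   next
    case 2
    hence "y \<in> {p..1/2}" "z \<in> dr N (T y) (H False h)" using yh by auto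
    thus ?thesis unfolding L using yh(2) by blast
   next
    case 3
    hence "y \<in> {1/2..r}" "z \<in> dr N (T y) (H True h)" using yh by auto
    thus ?thesis unfolding R using yh(2) by blast
   qed
  qed
  have half: "cap N (1/2 - h / 3) \<subseteq> Dr (Suc N) p r h1 h2" if "h \<in> {h1..h2}" for h
   using assms that by (intro subsetI Dr_I[of "1/2" _ _ h]) auto
  have crit: "dr N (T y) (H e h) \<subseteq> Dr (Suc N) p r h1 h2"
   if "y \<in> {p..r}" "h \<in> {h1..h2}" "y = 1/2 \<or> e = (1/2 < y)" for y h e
  proof (cases "y = 1/2")
   case True
   hence "dr N (T y) (H e h) \<subseteq> cap N (1/2 - h / 3)" using cap_end[of N e h] by (simp add: T_crit dr_b)
   thus ?thesis using half[OF that(2)] by blast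
  next
   case False
   hence "dr N (T y) (H e h) = dr (Suc N) y h" using that(3) by simp
   thus ?thesis using that Dr_I[of y p r h h1 h2] by blast
  qed
  have "?L \<subseteq> Dr (Suc N) p r h1 h2" unfolding L
   by (intro UN_least crit) (use assms in auto)
  moreover have "?R \<subseteq> Dr (Suc N) p r h1 h2" unfolding R
   by (intro UN_least crit) (use assms in auto)
  moreover have "?A \<subseteq> Dr (Suc N) p r h1 h2"
  proof
   fix z assume "z \<in> ?A"
   then obtain x where x: "x \<in> {1/2 - h2 / 3..1/2 - h1 / 3}" "z \<in> cap N x" by (auto simp: annulus_def)
   define h where "h = 3 * (1/2 - x)"
   have "h \<in> {h1..h2}" "x = 1/2 - h / 3" using x(1) by (auto simp: h_def field_simps)
   thus "z \<in> Dr (Suc N) p r h1 h2" using half x(2) by blast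
  qed
  ultimately show "(?L \<union> ?A) \<union> ?R \<subseteq> Dr (Suc N) p r h1 h2" by blast
 qed
qed

lemma annulus_Int_Dr:
 assumes p: "a \<le> p" "p \<le> b" and h: "0 \<le> h1" "h1 \<le> h2" "h2 \<le> 1"
 shows "Dr N p b (min (H e h1) (H e h2)) (max (H e h1) (H e h2)) \<inter> annulus N (1/2 - h2 / 3) (1/2 - h1 / 3)
  = (%h. (pc N, vh N b h)) ` {min (H e h1) (H e h2)..max (H e h1) (H e h2)}" (is "?D \<inter> ?A = ?S")
proof
 have H01: "0 \<le> min (H e h1) (H e h2)" "max (H e h1) (H e h2) \<le> 1" using H_range h by auto
 have He: "H e ` {h1..h2} = {min (H e h1) (H e h2)..max (H e h1) (H e h2)}"
 proof (cases e)
  case True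
  have "min (H e h1) (H e h2) = H e h2" "max (H e h1) (H e h2) = H e h1" using h True by (auto simp: H_def)
  thus ?thesis using True H_image by simp
 next
  case False
  have "min (H e h1) (H e h2) = H e h1" "max (H e h1) (H e h2) = H e h2" using h False by (auto simp: H_def)
  thus ?thesis using False H_image by simp
 qed
 show "?D \<inter> ?A \<subseteq> ?S"
 proof
  fix z assume z: "z \<in> ?D \<inter> ?A"
  then obtain y h' where y: "y \<in> {p..b}" "h' \<in> {min (H e h1) (H e h2)..max (H e h1) (H e h2)}" "z \<in> dr N y h'"
   by (auto simp: Dr_def)
  obtain x where x: "x \<in> {1/2 - h2 / 3..1/2 - h1 / 3}" "z \<in> cap N x" using z by (auto simp: annulus_def)
  have "\<not> y < b"
  proof
   assume "y < b"
   moreover have "0 \<le> h'" "h' \<le> 1" using y(2) H01 unfolding atLeastAtMost_iff by linarith+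
   moreover have "0 \<le> x" "x \<le> 1/2" using x(1) h unfolding atLeastAtMost_iff by linarith+
   ultimately show False using cap_Int_dr_same[of y h' x z N] y(3) x(2) by simp
  qed
  hence "y = b" using y(1) by simp
  thus "z \<in> ?S" using y by (auto simp: dr_b)
 qed
 show "?S \<subseteq> ?D \<inter> ?A"
 proof
  fix z assume "z \<in> ?S"
  hence "z \<in> (%h. (pc N, vh N b h)) ` H e ` {h1..h2}" unfolding He .
  then obtain h where hh: "h \<in> {h1..h2}" "z = (pc N, vh N b (H e h))" by auto
  have "H e h \<in> {min (H e h1) (H e h2)..max (H e h1) (H e h2)}" using imageI[OF hh(1), of "H e"] unfolding He .
  hence "z \<in> ?D" using p unfolding hh(2) by (intro Dr_end) auto
  moreover have "z \<in> ?A" unfolding hh(2) annulus_def using hh(1) cap_end[of N e h] by (intro UN_I[of "1/2 - h / 3"]) auto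
  ultimately show "z \<in> ?D \<inter> ?A" by blast
 qed
qed

text \<open>A band across 1/2 becomes, one level lower, two bands joined by a half annulus, and
  consecutive pieces overlap in a vertical segment; Janiszewski's theorem glues them. A band on one
  side of 1/2 just moves down.\<close>

lemma tame_Dr:
 assumes "a \<le> p" "p \<le> r" "r \<le> b" "0 \<le> h1" "h1 \<le> h2" "h2 \<le> 1"
 shows "tame (Dr N p r h1 h2)"
 using assms
proof (induction N arbitrary: p r h1 h2)
 case 0
 have "Dr 0 p r h1 h2 = cbox (p, h1) (r, h2)" by (auto simp: Dr_def cbox_Pair_eq)
 thus ?case by (simp add: tame_convex)
next
 case (Suc N)
 have HF: "0 \<le> H False h1" "H False h1 \<le> H False h2" "H False h2 \<le> 1" "H False h2 \<le> 1/3"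
  and HT: "0 \<le> H True h2" "H True h2 \<le> H True h1" "H True h1 \<le> 1" "2/3 \<le> H True h2"
  using Suc.prems by (auto simp: H_def)
 have Tr: "a \<le> T y \<and> T y \<le> b" if "y \<in> {p, r}" for y using T_range[of y] that Suc.prems by auto
 consider "r < 1/2" | "1/2 < p" | "p \<le> 1/2" "1/2 \<le> r" by linarith
 thus ?case
 proof cases
  case 1
  have "T p \<le> T r" using 1 Suc.prems s_pos by (simp add: T_left)
  thus ?thesis unfolding Dr_left[OF Suc.prems(2) 1] using Tr HF by (intro Suc.IH) auto
 next
  case 2
  have "T r \<le> T p" using 2 Suc.prems s_pos by (simp add: T_right)
  thus ?thesis unfolding Dr_right[OF Suc.prems(2) 2] using Tr HT by (intro Suc.IH) auto
 next
  case 3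
  let ?L = "Dr N (T p) b (H False h1) (H False h2)" and ?R = "Dr N (T r) b (H True h2) (H True h1)"
   and ?A = "annulus N (1/2 - h2 / 3) (1/2 - h1 / 3)"
  have tl: "tame ?L" "tame ?R" using Tr HF HT by (auto intro!: Suc.IH)
  have ta: "tame ?A" using Suc.prems by (intro tame_annulus) auto
  have mF: "min (H False h1) (H False h2) = H False h1" "max (H False h1) (H False h2) = H False h2"
   and mT: "min (H True h1) (H True h2) = H True h2" "max (H True h1) (H True h2) = H True h1" using HF HT by auto
  have LA: "?L \<inter> ?A = (%h. (pc N, vh N b h)) ` {H False h1..H False h2}"
   using annulus_Int_Dr[of "T p" h1 h2 N False] Tr Suc.prems unfolding mF by simp
  have RA: "?R \<inter> ?A = (%h. (pc N, vh N b h)) ` {H True h2..H True h1}"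
   using annulus_Int_Dr[of "T r" h1 h2 N True] Tr Suc.prems unfolding mT by simp
  have "?L \<inter> ?R = {}"
  proof (rule ccontr)
   assume "?L \<inter> ?R ~= {}"
   then obtain z where z: "z \<in> ?L" "z \<in> ?R" by blast
   obtain y h where 1: "y \<in> {T p..b}" "h \<in> {H False h1..H False h2}" "z \<in> dr N y h" using z(1) by (auto simp: Dr_def)
   obtain y' h' where 2: "y' \<in> {T r..b}" "h' \<in> {H True h2..H True h1}" "z \<in> dr N y' h'" using z(2) by (auto simp: Dr_def)
   have "y = y' \<and> h = h'" by (rule dr_inj[OF 1(3) 2(3)]) (use 1 2 Tr[of p] Tr[of r] HF HT in auto)
   thus False using 1(2) 2(2) HF HT by auto
  qed
  hence "(?L \<union> ?A) \<inter> ?R = ?R \<inter> ?A" by blast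
  hence LAR: "(?L \<union> ?A) \<inter> ?R = (%h. (pc N, vh N b h)) ` {H True h2..H True h1}" using RA by simp
  have tLA: "tame (?L \<union> ?A)"
  proof (rule tame_Un[OF tl(1) ta])
   show "connected (?L \<inter> ?A)" unfolding LA by (rule connected_vertical)
   show "?L \<inter> ?A ~= {}" unfolding LA using HF by simp
  qed
  show ?thesis
   unfolding Dr_mid[OF 3]
  proof (rule tame_Un[OF tLA tl(2)])
   show "connected ((?L \<union> ?A) \<inter> ?R)" unfolding LAR by (rule connected_vertical)
   show "(?L \<union> ?A) \<inter> ?R ~= {}" unfolding LAR using HT by simp
  qed
 qed
qed

text \<open>A half disc filled with the semicircles of depth \<open>j\<close> of all radii up to the
  largest possible one.\<close>

definition HD :: "nat => (real \<times> real) set" where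
 "HD j = cball (pc j, qc j) ((1/2) / 3 ^ j) \<inter> {z. 0 \<le> ec j * (fst z - pc j)}"

lemma HD_cap: "z \<in> HD j \<longleftrightarrow> (\<exists>r. 0 \<le> r \<and> r \<le> 1/2 \<and> z \<in> cap j r)"
proof
 assume z: "z \<in> HD j"
 define r where "r = 3 ^ j * norm (z - (pc j, qc j))"
 have "norm (z - (pc j, qc j)) \<le> (1/2) / 3 ^ j" using z by (simp add: HD_def dist_norm norm_minus_commute)
 hence "r \<le> 1/2" by (simp add: r_def field_simps)
 moreover have "0 \<le> r" by (simp add: r_def)
 moreover from this have "z \<in> cap j r" using cap_height_iff[of r z j] z by (simp add: r_def HD_def)
 ultimately show "\<exists>r. 0 \<le> r \<and> r \<le> 1/2 \<and> z \<in> cap j r" by blast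
next
 assume "\<exists>r. 0 \<le> r \<and> r \<le> 1/2 \<and> z \<in> cap j r"
 then obtain r where r: "0 \<le> r" "r \<le> 1/2" "z \<in> cap j r" by blast
 hence "3 ^ j * norm (z - (pc j, qc j)) = r" "0 \<le> ec j * (fst z - pc j)" using cap_height_iff[of r z j] by auto
 thus "z \<in> HD j" using r(2) by (simp add: HD_def dist_norm norm_minus_commute field_simps)
qed

lemma tame_HD: "tame (HD j)"
proof (rule tame_convex)
 have half: "{z. 0 \<le> ec j * (fst z - pc j)} = {z. ec j * pc j \<le> (ec j, 0) \<bullet> z}" by (auto simp: algebra_simps inner_prod_def)
 show "compact (HD j)" unfolding HD_def half by (intro compact_Int_closed compact_cball closed_halfspace_ge)
 show "convex (HD j)" unfolding HD_def half by (intro convex_Int convex_cball convex_halfspace_ge)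
qed

lemma dr_b_in_HD:
 assumes "0 \<le> h" "h \<le> 1"
 shows "(pc N, vh N b h) \<in> HD N"
proof -
 have "vh N b h - qc N = ec N * (h - 1/2) / 3 ^ N" unfolding qc_def ec_def by (rule vh_diff)
 hence "\<bar>vh N b h - qc N\<bar> = \<bar>h - 1/2\<bar> / 3 ^ N" using ec_cases[of N] by (auto simp: abs_divide)
 also have "\<dots> \<le> (1/2) / 3 ^ N" using assms by (intro divide_right_mono) auto
 finally have "\<bar>vh N b h - qc N\<bar> \<le> (1/2) / 3 ^ N" .
 thus ?thesis by (simp add: HD_def dist_prod_def dist_real_def abs_minus_commute)
qed

lemma Dr_Int_HD: "Dr N a b 0 1 \<inter> HD N = (%h. (pc N, vh N b h)) ` {0..1}"
proof
 show "Dr N a b 0 1 \<inter> HD N \<subseteq> (%h. (pc N, vh N b h)) ` {0..1}"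
 proof
  fix z assume z: "z \<in> Dr N a b 0 1 \<inter> HD N"
  then obtain y h where y: "y \<in> {a..b}" "h \<in> {0..1}" "z \<in> dr N y h" by (auto simp: Dr_def)
  obtain r where r: "0 \<le> r" "r \<le> 1/2" "z \<in> cap N r" using z HD_cap by blast
  have "y = b" using cap_Int_dr_same[of y h r z N] y r by force
  thus "z \<in> (%h. (pc N, vh N b h)) ` {0..1}" using y by (auto simp: dr_b)
 qed
 show "(%h. (pc N, vh N b h)) ` {0..1} \<subseteq> Dr N a b 0 1 \<inter> HD N"
  using dr_b_in_HD ab by (auto intro: Dr_end)
qed

lemma dr_a: "dr N a h = {(pc (Suc N), vh N a h)}"
proof -
 have "(T ^^ k) a = pc (Suc k)" for k using pc_pow[of k 1] by (simp add: pc_def T_b)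
 moreover have "pc k ~= 1/2" for k using pc_neq_crit by (simp add: pc_def)
 ultimately show ?thesis using dr_nocrit[of N a h] by simp
qed

lemma qc_Suc: "qc (Suc N) = vh N a (5/6)"
 using b_gt by (simp add: qc_def T_b H_def)

text \<open>The end over \<open>a\<close> is the end over \<open>b\<close> continued by symbol 1, so
  its fold occupies only the heights \<open>H True\<close> of the unit interval, from 2/3 to 1 with
  centre 5/6.\<close>

lemma Dr_Int_HD_Suc: "Dr N a b 0 1 \<inter> HD (Suc N) = (%h. (pc (Suc N), vh N a h)) ` {2/3..1}"
proof -
 have diff: "\<bar>vh N a h - qc (Suc N)\<bar> = \<bar>h - 5/6\<bar> / 3 ^ N" for h
  unfolding qc_Suc vh_diff using sg_cases[of N a] by (auto simp: abs_divide abs_mult)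
 have dist: "(pc (Suc N), vh N a h) \<in> HD (Suc N) \<longleftrightarrow> \<bar>h - 5/6\<bar> \<le> 1/6" for h
 proof -
  have "(pc (Suc N), vh N a h) \<in> HD (Suc N) \<longleftrightarrow> \<bar>vh N a h - qc (Suc N)\<bar> \<le> (1/2) / 3 ^ Suc N"
   by (simp add: HD_def dist_prod_def dist_real_def abs_minus_commute)
  also have "\<dots> \<longleftrightarrow> \<bar>h - 5/6\<bar> / 3 ^ N \<le> (1/6) / 3 ^ N" unfolding diff by simp
  also have "\<dots> \<longleftrightarrow> \<bar>h - 5/6\<bar> \<le> 1/6" by (rule divide_le_cancel[THEN trans]) simp
  finally show ?thesis .
 qed
 show ?thesis
 proof
  show "Dr N a b 0 1 \<inter> HD (Suc N) \<subseteq> (%h. (pc (Suc N), vh N a h)) ` {2/3..1}"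
  proof
   fix z assume z: "z \<in> Dr N a b 0 1 \<inter> HD (Suc N)"
   then obtain y h where y: "y \<in> {a..b}" "h \<in> {0..1}" "z \<in> dr N y h" by (auto simp: Dr_def)
   obtain r where r: "0 \<le> r" "r \<le> 1/2" "z \<in> cap (Suc N) r" using z HD_cap by blast
   have "y = a"
   proof (rule ccontr)
    assume "y ~= a"
    hence "a < y" using y(1) by simp
    moreover have "sg (Suc 0) b = - 1" using b_gt sg_Suc[of 0 b] by simp
    ultimately have "0 < sg (Suc N - N) b * ((T ^^ (Suc N - N)) b - y)" by (simp add: Suc_diff_le T_b del: sg_Suc)
    thus False using cap_Int_dr[of N "Suc N" y h r z] y r by simp
   qed
   hence zz: "z = (pc (Suc N), vh N a h)" using y(3) by (simp add: dr_a)
   hence "\<bar>h - 5/6\<bar> \<le> 1/6" using z dist by simp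
   hence "2/3 \<le> h" by linarith
   thus "z \<in> (%h. (pc (Suc N), vh N a h)) ` {2/3..1}" using zz y(2) by simp
  qed
  show "(%h. (pc (Suc N), vh N a h)) ` {2/3..1} \<subseteq> Dr N a b 0 1 \<inter> HD (Suc N)"
  proof
   fix z assume "z \<in> (%h. (pc (Suc N), vh N a h)) ` {2/3..1}"
   then obtain h where h: "2/3 \<le> h" "h \<le> 1" "z = (pc (Suc N), vh N a h)" by auto
   have "\<bar>h - 5/6\<bar> \<le> 1/6" using h by (simp add: abs_le_iff)
   hence "z \<in> HD (Suc N)" using dist h(3) by simp
   moreover have "z \<in> Dr N a b 0 1" using h ab by (intro Dr_I[of a _ _ h]) (auto simp: dr_a)
   ultimately show "z \<in> Dr N a b 0 1 \<inter> HD (Suc N)" by blast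
  qed
 qed
qed

lemma pc_Suc_neq: "pc N ~= pc (Suc N)"
proof
 assume e: "pc N = pc (Suc N)"
 have const: "pc (k + N) = pc N" for k
 proof (induction k)
  case (Suc k)
  thus ?case using e by (simp add: pc_def)
 qed simp
 have "lam (1 + k) = lam k" if k: "k \<le> - (int N + 3)" for k
 proof -
  have Zc: "Z j = pc N" if "j \<le> - int N" for j
  proof -
   have k: "2 \<le> nat (2 - j - int N) + N" "2 - int (nat (2 - j - int N) + N) = j" using that by linarith+
   have "pc K = Z (2 - int K)" if "2 \<le> K" for K using that by (simp add: pc_eq)
   from this[OF k(1)] have "pc (nat (2 - j - int N) + N) = Z j" unfolding k(2) .
   thus ?thesis using const by simp
  qed
  show ?thesis unfolding Z_sym[symmetric] using Zc[of "k + 1"] Zc[of "1 + k + 1"] k by simp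
 qed
 hence "int n dvd 1" by (rule lam_shift_imp_dvd)
 thus False using n_ge3 by (simp add: zdvd_not_zless)
qed

lemma HD_disjoint: "\<exists>N0. \<forall>N\<ge>N0. HD N \<inter> HD (Suc N) = {}"
proof -
 obtain e where e: "0 < e" "\<And>i j. \<bar>pc i - pc j\<bar> < e ==> pc i = pc j" using pc_gap by blast
 obtain N0 where N0: "\<And>N. N0 \<le> N ==> 10 / 3 ^ N < e" using ex_pow3[OF e(1)] by blast
 have "HD N \<inter> HD (Suc N) = {}" if N: "N0 \<le> N" for N
 proof (rule ccontr)
  assume "HD N \<inter> HD (Suc N) ~= {}"
  then obtain z where z: "z \<in> HD N" "z \<in> HD (Suc N)" by blast
  have 1: "\<bar>fst z - pc N\<bar> \<le> (1/2) / 3 ^ N" using z(1) abs_le_dist(1)[of z "(pc N, qc N)"] by (simp add: HD_def dist_commute)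
  have 2: "\<bar>fst z - pc (Suc N)\<bar> \<le> (1/2) / 3 ^ Suc N"
   using z(2) abs_le_dist(1)[of z "(pc (Suc N), qc (Suc N))"] by (simp add: HD_def dist_commute del: power_Suc)
  have "(1/2) / 3 ^ Suc N \<le> (1/2) / (3 ^ N :: real)" by (intro divide_left_mono) auto
  moreover have "(1/2) / 3 ^ N * 2 \<le> 10 / (3 ^ N :: real)" by (simp add: divide_right_mono)
  ultimately have "\<bar>pc N - pc (Suc N)\<bar> < e" using 1 2 N0[OF N] by linarith
  thus False using e(2) pc_Suc_neq by blast
 qed
 thus ?thesis by blast
qed

text \<open>The band of level \<open>N\<close> contains the semicircles of smaller depth. Those of
  depths \<open>N\<close> and \<open>N + 1\<close> stick out beyond its ends over \<open>b\<close>
  and \<open>a\<close> and are covered by half discs; for large \<open>N\<close> the deeper ones lie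
  in the band again, by \<open>cap_in_Dr\<close>.\<close>

definition DD :: "nat => (real \<times> real) set" where
 "DD N = (Dr N a b 0 1 \<union> HD N) \<union> HD (Suc N)"

lemma tame_DD: "\<exists>N0. \<forall>N\<ge>N0. tame (DD N)"
proof -
 obtain N0 where N0: "\<And>N. N0 \<le> N ==> HD N \<inter> HD (Suc N) = {}" using HD_disjoint by blast
 have "tame (DD N)" if N: "N0 \<le> N" for N
  unfolding DD_def
 proof (rule tame_Un[OF tame_Un[OF _ tame_HD] tame_HD])
  show "tame (Dr N a b 0 1)" using ab by (intro tame_Dr) auto
  have "(Dr N a b 0 1 \<union> HD N) \<inter> HD (Suc N) = (%h. (pc (Suc N), vh N a h)) ` {2/3..1}"
   using Dr_Int_HD_Suc[of N] N0[OF N] by blast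
  thus "connected ((Dr N a b 0 1 \<union> HD N) \<inter> HD (Suc N))" "(Dr N a b 0 1 \<union> HD N) \<inter> HD (Suc N) ~= {}"
   by (simp_all add: connected_vertical)
 qed (simp_all add: Dr_Int_HD connected_vertical)
 thus ?thesis by blast
qed

text \<open>While the orbit of \<open>y0\<close> stays \<open>d\<close> away from 1/2, the inverse
  branches along it are defined on an interval of radius \<open>d\<close>, since they only
  contract.\<close>

lemma local_inverse:
 assumes d: "\<And>k. k < N ==> d \<le> \<bar>(T ^^ k) y0 - 1/2\<bar>" and u: "\<bar>u - (T ^^ N) y0\<bar> < d"
 shows "\<exists>y. \<bar>y - y0\<bar> \<le> \<bar>u - (T ^^ N) y0\<bar> \<and> (T ^^ N) y = u \<and> sameit N y y0 \<and> (\<forall>k<N. (T ^^ k) y ~= 1/2)"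
 using assms
proof (induction N arbitrary: y0)
 case 0
 show ?case by (intro exI[of _ u]) simp
next
 case (Suc N)
 have d0: "d \<le> \<bar>y0 - 1/2\<bar>" "0 < d" using Suc.prems(1)[of 0] Suc.prems(2) by auto
 have "d \<le> \<bar>(T ^^ k) (T y0) - 1/2\<bar>" if "k < N" for k using Suc.prems(1)[of "Suc k"] that by (simp add: funpow_swap1)
 moreover have uN: "\<bar>u - (T ^^ N) (T y0)\<bar> < d" using Suc.prems(2) by (simp add: funpow_swap1)
 ultimately obtain y1 where y1: "\<bar>y1 - T y0\<bar> \<le> \<bar>u - (T ^^ N) (T y0)\<bar>" "(T ^^ N) y1 = u" "sameit N y1 (T y0)"
  "\<forall>k<N. (T ^^ k) y1 ~= 1/2" using Suc.IH by blast
 define e where "e = (1/2 < y0)"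
 define y where "y = br e y1"
 have b0: "br e (T y0) = y0" using d0 by (intro br_T) (auto simp: e_def)
 have "\<bar>y - y0\<bar> = \<bar>y1 - T y0\<bar> / s" using br_diff[of e y1 "T y0"] s_pos unfolding b0 y_def[symmetric] by (auto simp: abs_divide abs_minus_commute)
 moreover have "\<bar>y1 - T y0\<bar> / s \<le> \<bar>y1 - T y0\<bar>"
  using mult_left_mono[of 1 s "\<bar>y1 - T y0\<bar>"] s_gt1 s_pos by (simp add: divide_le_eq)
 ultimately have yy: "\<bar>y - y0\<bar> \<le> \<bar>u - (T ^^ N) (T y0)\<bar>" using y1(1) by linarith
 hence side: "(1/2 < y) = e" "y ~= 1/2" using uN d0 by (auto simp: e_def abs_if split: if_splits)
 have Ty: "T y = y1"
 proof (cases e)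
  case True
  hence "T y = s * (1 - y)" using side by (intro T_right) simp
  thus ?thesis using True s_pos by (simp add: y_def br_def)
 next
  case False
  hence "T y = s * y" using side by (intro T_left) simp
  thus ?thesis using False s_pos by (simp add: y_def br_def)
 qed
 have "(T ^^ k) y ~= 1/2" if "k < Suc N" for k
 proof (cases k)
  case (Suc k')
  thus ?thesis using y1(4) that Ty by (simp add: funpow_swap1)
 qed (use side in simp)
 moreover have "(T ^^ Suc N) y = u" using y1(2) Ty by (simp add: funpow_swap1)
 moreover have "sameit (Suc N) y y0" unfolding sameit_Suc using y1(3) Ty side(1) by (simp add: e_def)
 moreover have "\<bar>y - y0\<bar> \<le> \<bar>u - (T ^^ Suc N) y0\<bar>" using yy by (simp add: funpow_swap1)
 ultimately show ?case by blast
qed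

text \<open>These semicircles are centred over points of the periodic orbit, which keeps a positive
  distance from \<open>a\<close>, \<open>b\<close> and 1/2. Once they are small, the inverse branch
  of \<open>T ^^ N\<close> at the centre covers them entirely.\<close>

lemma cap_in_Dr:
 "\<exists>N0. \<forall>N\<ge>N0. \<forall>i\<ge>2. \<forall>r z. 0 \<le> r --> r \<le> 1/2 --> z \<in> cap (N + i) r --> z \<in> Dr N a b 0 1"
proof -
 define F where "F = (%x. \<bar>x - 1/2\<bar>) ` (range Z) \<union> (%x. x - a) ` range Z \<union> (%x. b - x) ` range Z"
 have fin: "finite F" "F ~= {}" using finite_range_Z by (auto simp: F_def)
 have pos: "0 < Min F" using fin Z_range Z_neq_crit by (subst Min_gr_iff) (auto simp: F_def)
 have le: "Min F \<le> x" if "x \<in> F" for x using fin that by simp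
 have leZ: "Min F \<le> \<bar>Z i - 1/2\<bar>" "Min F \<le> Z i - a" "Min F \<le> b - Z i" for i
  by (intro le; unfold F_def; blast)+
 obtain N0 where N0: "\<And>N. N0 \<le> N ==> 10 / 3 ^ N < Min F" using ex_pow3[OF pos] by blast
 have "z \<in> Dr N a b 0 1" if N: "N0 \<le> N" and i: "2 \<le> i" and r: "0 \<le> r" "r \<le> 1/2" and z: "z \<in> cap (N + i) r" for N i r z
 proof -
  have pcZ: "pc k = Z (2 - int k)" if "2 \<le> k" for k using that by (simp add: pc_eq)
  obtain u v where uv: "z = (u, v)" by (cases z)
  have "\<bar>u - pc (N + i)\<bar> \<le> r / 3 ^ (N + i)" using cap_bounds(1)[OF z r(1)] by (simp add: uv)
  also have "\<dots> \<le> 10 / 3 ^ N" using r by (intro frac_le) auto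
  finally have u: "\<bar>u - pc (N + i)\<bar> < Min F" using N0[OF N] by simp
  have Tp: "(T ^^ k) (pc i) = pc (k + i)" for k by (rule pc_pow)
  have d: "Min F \<le> \<bar>(T ^^ k) (pc i) - 1/2\<bar>" for k unfolding Tp using leZ i by (simp add: pcZ)
  obtain y where y: "\<bar>y - pc i\<bar> \<le> \<bar>u - (T ^^ N) (pc i)\<bar>" "(T ^^ N) y = u" "sameit N y (pc i)" "\<forall>k<N. (T ^^ k) y ~= 1/2"
   using local_inverse[where N = N and u = u and ?y0.0 = "pc i" and d = "Min F"] d u unfolding Tp by blast
  have "\<bar>y - pc i\<bar> < Min F" using y(1) u unfolding Tp by linarith
  hence ya: "a \<le> y" "y \<le> b" using leZ[of "2 - int i"] pcZ[OF i] by auto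
  obtain h where h: "0 \<le> h" "h \<le> 1" "v = vh (N + i) b h" using cap_height(2)[of u v "N + i" r] z r by (auto simp: uv)
  have "v = vh N (pc i) (vh i b h)" using h(3) vh_add[of i N b h] by (simp add: add.commute pc_def)
  also have "\<dots> = vh N y (vh i b h)" using vh_cong[OF y(3)] by simp
  finally have "z \<in> dr N y (vh i b h)" using dr_nocrit[of N y "vh i b h"] y(2,4) by (simp add: uv)
  thus ?thesis using ya vh_range[OF h(1,2), of i b] by (intro Dr_I[of y _ _ "vh i b h"]) auto
 qed
 thus ?thesis by blast
qed

lemma KK_sub_DD: "\<exists>N0. \<forall>N\<ge>N0. KK \<subseteq> DD N"
proof -
 obtain N0 where N0: "\<And>N i r z. N0 \<le> N ==> 2 \<le> i ==> 0 \<le> r ==> r \<le> 1/2 ==> z \<in> cap (N + i) r ==> z \<in> Dr N a b 0 1"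
  using cap_in_Dr by metis
 have "KK \<subseteq> DD N" if N: "N0 \<le> N" for N
 proof
  fix z assume z: "z \<in> KK"
  have up: "z \<in> Dr N a b 0 1" if M: "M \<le> N" and st: "strand M y l z" for M y l
  proof -
   have "strand N (bk y l (N - M)) (shift (N - M) l) z" using strand_add[OF st, of "N - M"] M by simp
   hence "Adm (bk y l (N - M)) (shift (N - M) l)" "z \<in> dr N (bk y l (N - M)) (psi0 (shift (N - M) l))" by (auto simp: strand_def)
   thus ?thesis using psi0_range by (intro Dr_I[of "bk y l (N - M)" _ _ "psi0 (shift (N - M) l)"]) (auto simp: Adm_def)
  qed
  from z[unfolded KK_iff] show "z \<in> DD N"
  proof (elim disjE exE)
   assume "z \<in> Str"
   then obtain y l where "strand 0 y l z" by (auto simp: Str_def)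
   thus ?thesis using up[of 0] by (auto simp: DD_def)
  next
   fix j assume j: "z \<in> Caps j"
   then obtain l where l: "strand (Suc j) (1/2) l z" by (auto simp: Caps_def)
   hence c: "z \<in> cap j (1/2 - psi0 l / 3)" by (simp add: strand_crit)
   have r: "0 \<le> 1/2 - psi0 l / 3" "1/2 - psi0 l / 3 \<le> 1/2" using psi0_range[of l] by auto
   consider "j < N" | "j = N" | "j = Suc N" | i where "j = N + i" "2 \<le> i"
   proof -
    have "j < N \<or> j = N \<or> j = Suc N \<or> j = N + (j - N) \<and> 2 \<le> j - N" by linarith
    thus thesis using that by blast
   qed
   thus ?thesis
   proof cases
    case 1
    thus ?thesis using up[OF _ l] by (simp add: DD_def)
   next
    case 2
    thus ?thesis using HD_cap[of z N] c r by (auto simp: DD_def)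
   next
    case 3
    thus ?thesis using HD_cap[of z "Suc N"] c r by (auto simp: DD_def)
   next
    case 4
    thus ?thesis using N0[OF N 4(2) r] c by (simp add: DD_def)
   qed
  qed
 qed
 thus ?thesis by blast
qed


text \<open>Every base point carries the strand whose code consists of ones, and \<open>N\<close>
  steps shrink height differences by \<open>3 ^ N\<close>.\<close>

lemma Dr_near_KK:
 assumes "z \<in> Dr N a b 0 1"
 shows "\<exists>z'\<in>KK. dist z z' \<le> 1 / 3 ^ N"
proof -
 obtain y h where y: "a \<le> y" "y \<le> b" "0 \<le> h" "h \<le> 1" "z \<in> dr N y h" using assms by (auto simp: Dr_def)
 define l where "l = case_nat True (%_. True)"
 have A: "Adm y l" unfolding l_def using y by (intro Adm_alt_tail) auto
 have near: "\<bar>h - psi0 l\<bar> \<le> 1" using y(3,4) psi0_range[of l] by auto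
 show ?thesis
 proof (cases rule: dr_cases[of N y h])
  case 1
  have "dr N y (psi0 l) = {((T ^^ N) y, vh N y (psi0 l))}" using 1(1) by (rule dr_nocrit)
  hence "strand N y l ((T ^^ N) y, vh N y (psi0 l))" using A by (simp add: strand_def)
  moreover have "dist z ((T ^^ N) y, vh N y (psi0 l)) \<le> 1 / 3 ^ N"
  proof -
   have zz: "z = ((T ^^ N) y, vh N y h)" using y(5) dr_nocrit[OF 1(1)] by simp
   have "dist z ((T ^^ N) y, vh N y (psi0 l)) = \<bar>vh N y h - vh N y (psi0 l)\<bar>" unfolding zz by (simp add: dist_prod_def dist_real_def)
   also have "\<dots> = \<bar>h - psi0 l\<bar> / 3 ^ N" unfolding vh_diff using sg_cases[of N y] by (auto simp: abs_divide abs_mult)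
   also have "\<dots> \<le> 1 / 3 ^ N" using near by (intro divide_right_mono) auto
   finally show ?thesis .
  qed
  ultimately show ?thesis using strand_KK by blast
 next
  case (2 k i)
  define r r2 where "r = 1/2 - vh k y h / 3" and "r2 = 1/2 - vh k y (psi0 l) / 3"
  have r: "0 < r" "0 < r2" using vh_range[OF y(3,4), of k y] vh_range[OF psi0_range, of k y l] by (auto simp: r_def r2_def)
  have "z \<in> cap i r" using y(5) dr_crit[OF 2(2,3), of i h] 2(1) by (simp add: r_def)
  then obtain z' where z': "z' \<in> cap i r2" "dist z z' \<le> \<bar>r - r2\<bar> / 3 ^ i" using cap_rescale r by blast
  have "z' \<in> dr N y (psi0 l)" using z'(1) dr_crit[OF 2(2,3), of i "psi0 l"] 2(1) by (simp add: r2_def)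
  hence "z' \<in> KK" using A strand_KK by (auto simp: strand_def)
  moreover have "\<bar>r - r2\<bar> / 3 ^ i \<le> 1 / 3 ^ N"
  proof -
   have "r - r2 = - (vh k y h - vh k y (psi0 l)) / 3" by (simp add: r_def r2_def diff_divide_distrib)
   hence "\<bar>r - r2\<bar> = \<bar>h - psi0 l\<bar> / 3 ^ k / 3" unfolding vh_diff using sg_cases[of k y] by (auto simp: abs_divide abs_mult)
   hence "\<bar>r - r2\<bar> / 3 ^ i = \<bar>h - psi0 l\<bar> / 3 ^ N" by (simp add: 2(1) power_add)
   also have "\<dots> \<le> 1 / 3 ^ N" using near by (intro divide_right_mono) auto
   finally show ?thesis .
  qed
  ultimately show ?thesis using z'(2) by (meson order_trans)
 qed
qed

lemma DD_near_KK:
 assumes "z \<in> DD N"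
 shows "\<exists>z'\<in>KK. dist z z' \<le> 2 / 3 ^ N"
proof -
 have HD: "\<exists>z'\<in>KK. dist z z' \<le> 2 / 3 ^ N" if z: "z \<in> HD j" "N \<le> j" and c: "(pc j, qc j) \<in> Dr N a b 0 1" for j
 proof -
  have "dist z (pc j, qc j) \<le> (1/2) / 3 ^ j" using z by (simp add: HD_def dist_commute)
  also have "\<dots> \<le> 1 / 3 ^ N" using z(2) by (intro frac_le) (auto intro: power_increasing)
  finally have 1: "dist z (pc j, qc j) \<le> 1 / 3 ^ N" .
  obtain z' where z': "z' \<in> KK" "dist (pc j, qc j) z' \<le> 1 / 3 ^ N" using Dr_near_KK[OF c] by blast
  have "dist z z' \<le> 1 / 3 ^ N + 1 / 3 ^ N" using dist_triangle[of z z' "(pc j, qc j)"] 1 z'(2) by linarith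
  thus ?thesis using z'(1) by auto
 qed
 have c1: "(pc N, qc N) \<in> Dr N a b 0 1" unfolding qc_def using ab by (intro Dr_end) auto
 have c2: "(pc (Suc N), qc (Suc N)) \<in> Dr N a b 0 1" unfolding qc_Suc using ab by (intro Dr_I[of a _ _ "5/6"]) (auto simp: dr_a)
 consider "z \<in> Dr N a b 0 1" | "z \<in> HD N" | "z \<in> HD (Suc N)" using assms by (auto simp: DD_def)
 thus ?thesis
 proof cases
  case 1
  then obtain z' where "z' \<in> KK" "dist z z' \<le> 1 / 3 ^ N" using Dr_near_KK by blast
  moreover have "1 / 3 ^ N \<le> 2 / (3 ^ N :: real)" by (intro divide_right_mono) auto
  ultimately show ?thesis by (meson order_trans)
 next
  case 2
  show ?thesis by (rule HD[OF 2 order_refl c1])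
 next
  case 3
  show ?thesis by (rule HD[OF 3 _ c2]) simp
 qed
qed

text \<open>Two points outside the closed set \<open>KK\<close> are also outside \<open>DD N\<close>
  for large \<open>N\<close>, and the complement of \<open>DD N\<close> is connected and avoids
  \<open>KK\<close>.\<close>

theorem connected_Compl_KK: "connected (- KK)"
 unfolding connected_iff_connected_component
proof (intro ballI)
 fix x y assume x: "x \<in> - KK" and y: "y \<in> - KK"
 obtain N1 where N1: "\<And>N. N1 \<le> N ==> tame (DD N)" using tame_DD by blast
 obtain N2 where N2: "\<And>N. N2 \<le> N ==> KK \<subseteq> DD N" using KK_sub_DD by blast
 have far: "\<exists>M. \<forall>N\<ge>M. z \<notin> DD N" if zK: "z \<in> - KK" for z
 proof -
  obtain e where e: "0 < e" "ball z e \<subseteq> - KK" using openE[OF open_Compl[OF closed_KK] zK] by blast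
  obtain M where M: "\<And>N. M \<le> N ==> 10 / 3 ^ N < e" using ex_pow3[OF e(1)] by blast
  have "z \<notin> DD N" if N: "M \<le> N" for N
  proof
   assume "z \<in> DD N"
   then obtain z' where z': "z' \<in> KK" "dist z z' \<le> 2 / 3 ^ N" using DD_near_KK by blast
   have "2 / 3 ^ N \<le> 10 / (3 ^ N :: real)" by (intro divide_right_mono) auto
   hence "z' \<in> ball z e" using z'(2) M[OF N] by simp
   thus False using e(2) z'(1) by blast
  qed
  thus ?thesis by blast
 qed
 obtain M1 M2 where M: "\<And>N. M1 \<le> N ==> x \<notin> DD N" "\<And>N. M2 \<le> N ==> y \<notin> DD N" using far[OF x] far[OF y] by blast
 define N where "N = N1 + N2 + M1 + M2"
 have "connected (- DD N)" using N1[of N] by (simp add: N_def tame_def)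
 moreover have "x \<in> - DD N" "y \<in> - DD N" using M by (auto simp: N_def)
 moreover have "- DD N \<subseteq> - KK" using N2[of N] by (auto simp: N_def)
 ultimately show "connected_component (- KK) x y" unfolding connected_component_def by blast
qed

end

section \<open>Gaps of a loop and discs cut off by crosscuts\<close>

lemma simple_pathD: "simple_path g ==> x \<in> {0..1} ==> y \<in> {0..1} ==> g x = g y ==> x = y \<or> x = 0 \<and> y = 1 \<or> x = 1 \<and> y = 0"
 unfolding simple_path_def loop_free_def by blast

lemma connected_componentI': "connected C ==> C \<subseteq> S ==> x \<in> C ==> y \<in> C ==> connected_component S x y"
 unfolding connected_component_def by blast

lemma gap_around:
 assumes F: "compact F" "0 \<in> F" "1 \<in> F" and u: "0 < u" "u < 1" "u \<notin> F"
 shows "\<exists>p q :: real. p \<in> F \<and> q \<in> F \<and> p < u \<and> u < q \<and> {p<..<q} \<inter> F = {}"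
proof -
 have c: "compact (F \<inter> {..u})" "compact (F \<inter> {u..})" using F(1) by (auto intro: compact_Int_closed)
 obtain p where p: "p \<in> F \<inter> {..u}" "\<And>x. x \<in> F \<inter> {..u} ==> x \<le> p"
  using compact_attains_sup[OF c(1)] F(2) u(1) by (metis IntI atMost_iff empty_iff less_imp_le)
 obtain q where q: "q \<in> F \<inter> {u..}" "\<And>x. x \<in> F \<inter> {u..} ==> q \<le> x"
  using compact_attains_inf[OF c(2)] F(3) u(2) by (metis IntI atLeast_iff empty_iff less_imp_le)
 have "{p<..<q} \<inter> F = {}"
 proof (rule ccontr)
  assume "{p<..<q} \<inter> F ~= {}"
  then obtain x where x: "p < x" "x < q" "x \<in> F" by auto
  thus False using p(2)[of x] q(2)[of x] by (cases "x \<le> u") auto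
 qed
 moreover have "p ~= u" "q ~= u" using p(1) q(1) u(3) by auto
 ultimately show ?thesis using p(1) q(1) by (intro exI[of _ p] exI[of _ q]) auto
qed

text \<open>If no gap of the loop separates, then the points \<open>t\<close> of \<open>F = g\<^sup>-\<^sup>1(K)\<close> for which \<open>K \<union> g[0,t]\<close> does not separate
 exhaust \<open>F\<close>: by Janiszewski's theorem one can pass over a gap, and also over a short stretch around a point of \<open>F\<close>,
 as that misses a given path from \<open>x\<close> to \<open>y\<close> in the complement of \<open>K\<close>.\<close>

lemma loop_gap:
 fixes K :: "(real \<times> real) set" and g :: "real => real \<times> real"
 assumes K: "compact K" "connected K" "connected (- K)" and g: "simple_path g" "pathfinish g = pathstart g" "pathstart g \<in> K"
  and x: "x \<notin> K" and y: "y \<notin> K" and sep: "\<not> connected_component (- path_image g) x y"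
 shows "\<exists>p q. 0 \<le> p \<and> p < q \<and> q \<le> 1 \<and> g p \<in> K \<and> g q \<in> K \<and> (\<forall>u\<in>{p<..<q}. g u \<notin> K) \<and>
  \<not> connected_component (- (K \<union> g ` {p..q})) x y"
proof (rule ccontr)
 assume none: "\<not> ?thesis"
 define good where "good p q \<longleftrightarrow> connected_component (- (K \<union> g ` {p..q})) x y" for p q
 have cg: "continuous_on {0..1} g" using g(1) by (auto simp: simple_path_def path_def)
 have clK: "closed K" using K(1) by (rule compact_imp_closed)
 hence "path_connected (- K)" using K(3) by (simp add: connected_open_path_connected open_Compl)
 then obtain h where h: "path h" "path_image h \<subseteq> - K" "pathstart h = x" "pathfinish h = y"
  using x y unfolding path_connected_def by blast
 define F where "F = {0..1} \<inter> g -` K"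
 have g0: "g 0 \<in> K" and F01: "0 \<in> F" "1 \<in> F" using g(2,3) by (auto simp: F_def pathstart_def pathfinish_def)
 have cF: "compact F"
  using continuous_closed_preimage[OF cg closed_atLeastAtMost clK] compact_Int_closed[of "{0..1}" F] by (simp add: F_def)
 have step: "good 0 q" if pq: "p \<in> F" "q \<in> F" "p \<le> q" and gd: "good 0 p" "good p q" for p q
 proof -
  have 01: "0 \<le> p" "q \<le> 1" using pq by (auto simp: F_def)
  have c: "compact (g ` {u..v})" if "0 \<le> u" "v \<le> 1" for u v
   using that by (intro compact_continuous_image continuous_on_subset[OF cg]) auto
  have "z \<in> K" if z: "z \<in> g ` {0..p}" "z \<in> g ` {p..q}" for z
  proof -
   obtain r r' where r: "r \<in> {0..p}" "r' \<in> {p..q}" "z = g r" "g r = g r'" using z by blast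
   have "r = r' \<or> r = 0 \<and> r' = 1 \<or> r = 1 \<and> r' = 0"
    using r 01 pq(3) by (intro simple_pathD[OF g(1)]) auto
   hence "r = p \<or> r = 0" using r(1,2) pq(1) by (auto simp: F_def)
   thus "z \<in> K" using r(3) pq(1) g0 by (auto simp: F_def)
  qed
  hence "(K \<union> g ` {0..p}) \<inter> (K \<union> g ` {p..q}) = K" by blast
  moreover have "compact (K \<union> g ` {0..p})" "compact (K \<union> g ` {p..q})" using K(1) c 01 pq(3) by (auto intro: compact_Un)
  ultimately have "connected_component (- ((K \<union> g ` {0..p}) \<union> (K \<union> g ` {p..q}))) x y"
   using K(2) gd unfolding good_def by - (rule Janiszewski_plane, simp_all only: compact_imp_closed)
  moreover have "{0..q} = {0..p} \<union> {p..q}" using 01 pq(3) by auto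
  hence "(K \<union> g ` {0..p}) \<union> (K \<union> g ` {p..q}) = K \<union> g ` {0..q}" by auto
  ultimately show ?thesis unfolding good_def by simp
 qed
 have near: "\<exists>d>0. \<forall>p\<in>F. \<forall>q\<in>F. T - d < p \<and> q < T + d --> good p q" if T: "T \<in> F" for T
 proof -
  have "closed (path_image h)" using h(1) by (simp add: closed_path_image)
  hence "openin (top_of_set {0..1}) ({0..1} \<inter> g -` (- path_image h))"
   by (intro continuous_openin_preimage_gen[OF cg]) auto
  moreover have "T \<in> {0..1} \<inter> g -` (- path_image h)" using T h(2) by (auto simp: F_def)
  ultimately obtain d where d: "0 < d" "ball T d \<inter> {0..1} \<subseteq> {0..1} \<inter> g -` (- path_image h)"
   using openin_contains_ball by metis
  have "good p q" if "p \<in> F" "q \<in> F" "T - d < p" "q < T + d" for p q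
  proof -
   have "{p..q} \<subseteq> ball T d \<inter> {0..1}" using that by (auto simp: F_def dist_real_def)
   hence "path_image h \<subseteq> - (K \<union> g ` {p..q})" using d(2) h(2) by blast
   thus ?thesis unfolding good_def
    using h connected_path_image[OF h(1)] pathstart_in_path_image[of h] pathfinish_in_path_image[of h]
    by (intro connected_componentI'[of "path_image h"]) auto
  qed
  thus ?thesis using d(1) by blast
 qed
 define G where "G = {t \<in> F. good 0 t}"
 define T where "T = Sup G"
 have G0: "0 \<in> G" using near[OF F01(1)] F01(1) by (auto simp: G_def)
 have bG: "bdd_above G" by (rule bdd_aboveI[of _ 1]) (auto simp: G_def F_def)
 have TG: "t \<le> T" if "t \<in> G" for t unfolding T_def using that bG by (rule cSup_upper)
 have "T \<in> F" unfolding T_def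
  using G0 bG compact_imp_closed[OF cF] by (intro closed_subset_contains_Sup) (auto simp: G_def)
 then obtain d where d: "0 < d" "\<And>p q. p \<in> F ==> q \<in> F ==> T - d < p ==> q < T + d ==> good p q" using near by blast
 have up: "q \<in> G" if "p \<in> G" "q \<in> F" "p \<le> q" "good p q" for p q using step[of p q] that by (simp add: G_def)
 have "T - d < Sup G" using d(1) by (simp add: T_def)
 then obtain t where "t \<in> G" "T - d < t" using less_cSup_iff[of G "T - d"] G0 bG by blast
 hence TinG: "T \<in> G" using up[of t T] TG[of t] d(2)[of t T] d(1) \<open>T \<in> F\<close> by (simp add: G_def)
 have "T = 1"
 proof (rule ccontr)
  assume "T ~= 1"
  hence T1: "0 \<le> T" "T < 1" using \<open>T \<in> F\<close> by (auto simp: F_def)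
  have no: "q \<notin> F" if "T < q" "q < T + d" for q
   using up[OF TinG, of q] TG[of q] d(2)[of T q] that d(1) \<open>T \<in> F\<close> by auto
  define u where "u = T + min d (1 - T) / 2"
  have u: "T < u" "u < 1" "u < T + d" using T1 d(1) by (auto simp: u_def min_def field_simps)
  then obtain p q where pq: "p \<in> F" "q \<in> F" "p < u" "u < q" "{p<..<q} \<inter> F = {}"
   using gap_around[OF cF F01, of u] no[of u] T1 by auto
  have "T \<notin> {p<..<q}" using pq(5) \<open>T \<in> F\<close> by blast
  hence pT: "p = T" using no[of p] pq(1,3,4) u by (cases p T rule: linorder_cases) auto
  have "0 \<le> p" "q \<le> 1" "g p \<in> K" "g q \<in> K" using pq(1,2) by (auto simp: F_def)
  moreover from this have "\<forall>u\<in>{p<..<q}. g u \<notin> K" using pq(5) by (auto simp: F_def)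
  ultimately have "good p q" using none less_trans[OF pq(3,4)] unfolding good_def by blast
  thus False using pT up[OF TinG pq(2)] TG[of q] pq(3,4) by auto
 qed
 hence "connected_component (- (K \<union> path_image g)) x y" using TinG by (simp add: G_def good_def path_image_def)
 thus False using sep unfolding connected_component_def by blast
qed

text \<open>The loop may start at any prescribed point of the circle, because
  \<open>loop_gap\<close> wants the base point on the continuum.\<close>

lemma circle_loop:
 assumes r: "0 < r" and w: "w \<in> sphere c r"
 shows "\<exists>g :: real => real \<times> real. simple_path g \<and> pathfinish g = pathstart g \<and> pathstart g = w \<and> path_image g = sphere c r"
proof -
 define f where "f t = lpc (cpl c + of_real r * exp (2 * pi * \<i> * of_real t))" for t :: real
 have cf: "cpl (f t) = cpl c + of_real r * exp (2 * pi * \<i> * of_real t)" for t by (simp add: f_def)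
 have sp: "simple_path f"
  unfolding simple_path_def loop_free_def
 proof (intro conjI ballI impI)
  show "path f" unfolding path_def f_def lpc_def by (intro continuous_intros)
  fix t t' :: real assume t: "t \<in> {0..1}" "t' \<in> {0..1}" "f t = f t'"
  have "exp (2 * pi * \<i> * of_real t) = exp (2 * pi * \<i> * of_real t')" using cf[of t] cf[of t'] t(3) r by simp
  then obtain n :: int where "2 * pi * \<i> * of_real t = 2 * pi * \<i> * of_real t' + (of_int (2 * n) * pi) * \<i>" unfolding exp_eq by blast
  hence "complex_of_real (2 * pi * t) * \<i> = complex_of_real (2 * pi * (t' + n)) * \<i>" by (simp add: algebra_simps)
  hence "complex_of_real (2 * pi * t) = complex_of_real (2 * pi * (t' + n))" by (metis complex_i_not_zero mult_right_cancel)
  hence "2 * pi * t = 2 * pi * (t' + n)" by (simp only: of_real_eq_iff)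
  hence tt: "t = t' + n" by simp
  have "n = 0 \<or> n = 1 \<or> n = - 1" using t(1,2) tt by auto
  thus "t = t' \<or> t = 0 \<and> t' = 1 \<or> t = 1 \<and> t' = 0" using t(1,2) tt by auto
 qed
 have loop: "pathfinish f = pathstart f" by (simp add: pathfinish_def pathstart_def f_def exp_two_pi_i)
 have im: "path_image f = sphere c r"
 proof
  show "path_image f \<subseteq> sphere c r"
  proof
   fix z assume "z \<in> path_image f"
   then obtain t where t: "z = f t" by (auto simp: path_image_def)
   have "dist c z = dist (cpl c) (cpl z)" by simp
   also have "\<dots> = r" unfolding t cf using r by (simp add: dist_norm norm_mult norm_exp_eq_Re)
   finally show "z \<in> sphere c r" by simp
  qed
  show "sphere c r \<subseteq> path_image f"
  proof
   fix z assume "z \<in> sphere c r"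
   hence n: "norm (cpl z - cpl c) = r" using dist_cpl[of z c] by (simp add: dist_norm[symmetric] dist_commute)
   define t where "t = Arg2pi (cpl z - cpl c)"
   have t: "0 \<le> t" "t < 2 * pi" "cpl z - cpl c = of_real r * exp (\<i> * of_real t)"
    using Arg2pi[of "cpl z - cpl c"] n by (auto simp: t_def is_Arg_def)
   have "2 * pi * \<i> * of_real (t / (2 * pi)) = \<i> * of_real t" by simp
   hence "cpl (f (t / (2 * pi))) = cpl z" unfolding cf using t(3) by (simp add: algebra_simps)
   hence "z = f (t / (2 * pi))" by (metis lpc_cpl)
   moreover have "t / (2 * pi) \<in> {0..1}" using t(1,2) by simp
   ultimately show "z \<in> path_image f" unfolding path_image_def by blast
  qed
 qed
 have "w \<in> f ` {0..1}" using w im by (simp add: path_image_def)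
 then obtain t where t: "t \<in> {0..1}" "w = f t" by blast
 show ?thesis
  using t simple_path_shiftpath[OF sp loop, of t] path_image_shiftpath[OF t(1) loop] im
  by (intro exI[of _ "shiftpath t f"]) (auto simp: pathstart_shiftpath pathfinish_shiftpath[OF _ loop])
qed

text \<open>The inverse of an arc is uniformly continuous on its image, so ends that are close have
  close parameters, and then the whole subarc is small.\<close>

lemma arc_small:
 fixes h :: "real => 'a :: metric_space"
 assumes h: "arc h" and e: "0 < e"
 shows "\<exists>d>0. \<forall>u\<in>{0..1}. \<forall>v\<in>{0..1}. dist (h u) (h v) < d --> h ` closed_segment u v \<subseteq> cball (h u) e"
proof -
 have ch: "continuous_on {0..1} h" and ih: "inj_on h {0..1}" using h by (auto simp: arc_def path_def)
 have "uniformly_continuous_on {0..1} h" using compact_uniformly_continuous[OF ch] by simp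
 then obtain d1 where d1: "0 < d1" "\<And>x x'. x \<in> {0..1} ==> x' \<in> {0..1} ==> dist x' x < d1 ==> dist (h x') (h x) < e"
  using e unfolding uniformly_continuous_on_def by metis
 define k where "k = the_inv_into {0..1} h"
 have kh: "k (h x) = x" if "x \<in> {0..1}" for x using the_inv_into_f_f[OF ih that] by (simp add: k_def)
 have "continuous_on (h ` {0..1}) k" using kh by (intro continuous_on_inv[OF ch]) auto
 hence "uniformly_continuous_on (h ` {0..1}) k"
  using compact_continuous_image[OF ch] by (intro compact_uniformly_continuous) auto
 then obtain d where d: "0 < d" "\<And>z z'. z \<in> h ` {0..1} ==> z' \<in> h ` {0..1} ==> dist z' z < d ==> dist (k z') (k z) < d1"
  using d1(1) unfolding uniformly_continuous_on_def by metis
 have "h ` closed_segment u v \<subseteq> cball (h u) e" if uv: "u \<in> {0..1}" "v \<in> {0..1}" "dist (h u) (h v) < d" for u v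
 proof
  fix z assume "z \<in> h ` closed_segment u v"
  then obtain x where x: "x \<in> closed_segment u v" "z = h x" by blast
  have "dist (k (h u)) (k (h v)) < d1" using uv by (intro d(2)) auto
  hence uvd: "\<bar>u - v\<bar> < d1" using kh uv by (simp add: dist_real_def)
  have "x \<in> {0..1}" "\<bar>u - x\<bar> \<le> \<bar>u - v\<bar>" using x(1) uv(1,2) by (auto simp: closed_segment_eq_real_ivl split: if_splits)
  hence "dist (h u) (h x) < e" using uvd uv(1) by (intro d1(2)) (auto simp: dist_real_def)
  thus "z \<in> cball (h u) e" using x(2) by simp
 qed
 thus ?thesis using d(1) by blast
qed

lemma tameD: "tame K ==> compact K" "tame K ==> connected K" "tame K ==> connected (- K)" "tame K ==> closed K"
 by (auto simp: tame_def compact_imp_closed)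

lemma crosscut_interior:
 assumes "crosscut K Q"
 shows "connected (Q - K)" "Q - K ~= {}" "Q \<subseteq> closure (Q - K)" "compact Q"
proof -
 obtain g where g: "arc g" "Q = path_image g" "Q \<inter> K = {pathstart g, pathfinish g}" using assms by (auto simp: crosscut_def)
 have cg: "continuous_on {0..1} g" and ig: "inj_on g {0..1}" using g(1) by (auto simp: arc_def path_def)
 have e: "Q - K = g ` {0<..<1}"
 proof
  show "Q - K \<subseteq> g ` {0<..<1}"
  proof
   fix z assume z: "z \<in> Q - K"
   then obtain t where t: "t \<in> {0..1}" "z = g t" by (auto simp: g(2) path_image_def)
   have "t ~= 0" "t ~= 1" using z g(3) t(2) by (auto simp: pathstart_def pathfinish_def)
   thus "z \<in> g ` {0<..<1}" using t by auto
  qed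
  show "g ` {0<..<1} \<subseteq> Q - K"
  proof
   fix z assume "z \<in> g ` {0<..<1}"
   then obtain t where t: "t \<in> {0<..<1}" "z = g t" by blast
   have "z \<in> Q" using t by (auto simp: g(2) path_image_def)
   moreover have "z \<notin> {g 0, g 1}" using inj_onD[OF ig, of t 0] inj_onD[OF ig, of t 1] t by auto
   ultimately show "z \<in> Q - K" using g(3) by (auto simp: pathstart_def pathfinish_def)
  qed
 qed
 show "connected (Q - K)" unfolding e by (intro connected_continuous_image continuous_on_subset[OF cg]) auto
 show "Q - K ~= {}" unfolding e by simp
 have "g ` closure {0<..<1} \<subseteq> closure (g ` {0<..<1})"
  using cg by (intro image_closure_subset) (auto simp: closure_subset)
 thus "Q \<subseteq> closure (Q - K)" unfolding e by (simp add: g(2) path_image_def)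
 show "compact Q" unfolding g(2) by (rule compact_arc_image[OF g(1)])
qed

lemma B_set_closure:
 assumes K: "tame K" and Q: "crosscut K Q"
 shows "closure (B_set K Q) \<subseteq> B_set K Q \<union> K \<union> Q" "B_set K Q \<inter> (K \<union> Q) = {}"
proof -
 note B = crosscut_B[OF tameD(1-3)[OF K] Q]
 have "closed (K \<union> Q)" using tameD(4)[OF K] crosscut_interior(4)[OF Q] by (simp add: compact_imp_closed closed_Un)
 hence "frontier (B_set K Q) \<subseteq> K \<union> Q" using B(1) by (rule frontier_of_components_closed_complement)
 thus "closure (B_set K Q) \<subseteq> B_set K Q \<union> K \<union> Q" using B(3) by (auto simp: frontier_def interior_open)
 show "B_set K Q \<inter> (K \<union> Q) = {}" using in_components_subset[OF B(1)] by blast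
qed

lemma crosscut_in_B:
 assumes K: "tame K" and Q: "crosscut K Q" and R: "crosscut K R" and dis: "Q \<inter> R = {}" and sub: "B_set K Q \<subseteq> B_set K R"
 shows "Q - K \<subseteq> B_set K R"
proof -
 have "Q \<subseteq> closure (B_set K Q)" by (rule crosscut_B(7)[OF tameD(1-3)[OF K] Q])
 also have "\<dots> \<subseteq> closure (B_set K R)" by (rule closure_mono[OF sub])
 also have "\<dots> \<subseteq> B_set K R \<union> K \<union> R" by (rule B_set_closure(1)[OF K R])
 finally show ?thesis using dis by blast
qed

text \<open>If \<open>z\<close> lay in \<open>B_set K R\<close>, the outer domain of
  \<open>R\<close> together with the interior of \<open>R\<close> would be a connected set avoiding
  \<open>K\<close> and \<open>z\<close>, and it contains both \<open>x\<close> and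
  \<open>y\<close>.\<close>

lemma separator_outside_B:
 assumes K: "tame K" and Q: "crosscut K Q" and R: "crosscut K R" and dis: "Q \<inter> R = {}" and sub: "B_set K R \<subseteq> B_set K Q"
  and x: "x \<in> Q - K" and y: "y \<in> R - K" and z: "connected z" "z \<inter> (K \<union> R) = {}"
  and sep: "\<not> connected_component (- (K \<union> z)) x y"
 shows "z \<inter> B_set K R = {}"
proof (rule ccontr)
 assume ne: "z \<inter> B_set K R ~= {}"
 note B = crosscut_B[OF tameD(1-3)[OF K] R]
 have zB: "z \<subseteq> B_set K R"
  by (rule components_maximal[OF B(1) z(1)]) (use z(2) ne in auto)
 define S where "S = - (K \<union> R \<union> B_set K R) \<union> (R - K)"
 have "R \<subseteq> closure (- (K \<union> R \<union> B_set K R))" by (rule B(8))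
 hence "S \<subseteq> closure (- (K \<union> R \<union> B_set K R))"
  unfolding S_def by (intro Un_least closure_subset order_trans[OF Diff_subset])
 hence "connected S" by (intro connected_intermediate_closure[OF B(6)]) (simp add: S_def)
 moreover have "S \<subseteq> - (K \<union> z)" using zB B_set_closure(2)[OF K R] by (auto simp: S_def)
 moreover have "x \<in> S" using x dis sub B_set_closure(2)[OF K Q] by (auto simp: S_def)
 moreover have "y \<in> S" using y by (simp add: S_def)
 ultimately show False using sep connected_componentI' by metis
qed

lemma two_arcs_loop:
 assumes "arc g" "arc h" "pathstart h = pathstart g" "pathfinish h = pathfinish g"
  "path_image g \<inter> path_image h \<subseteq> {pathstart g, pathfinish g}"
 shows "\<exists>c. simple_path c \<and> pathfinish c = pathstart c \<and> path_image c = path_image g \<union> path_image h"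
proof (intro exI[of _ "g +++ reversepath h"] conjI)
 show "simple_path (g +++ reversepath h)" using assms by (intro simple_path_join_loop) (auto simp: arc_reversepath)
qed (use assms in \<open>auto simp: path_image_join\<close>)

lemma Jordan_connected_inside:
 fixes c :: "real => real \<times> real"
 assumes c: "simple_path c" "pathfinish c = pathstart c" and S: "connected S" "S \<inter> path_image c = {}" "S \<inter> inside (path_image c) ~= {}"
 shows "S \<subseteq> inside (path_image c)"
proof (rule ccontr)
 assume "\<not> S \<subseteq> inside (path_image c)"
 hence "S \<inter> frontier (inside (path_image c)) ~= {}" using S by (intro connected_Int_frontier) auto
 thus False using Jordan_plane(10)[OF c refl] S(2) by simp
qed

lemma Jordan_inside_subset:
 fixes c :: "real => real \<times> real"
 assumes c: "simple_path c" "pathfinish c = pathstart c" and U: "connected U" "\<not> bounded U" "U \<inter> path_image c = {}"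
 shows "inside (path_image c) \<inter> U = {}"
proof (rule ccontr)
 assume "inside (path_image c) \<inter> U ~= {}"
 hence "U \<subseteq> inside (path_image c)" using U by (intro Jordan_connected_inside[OF c]) auto
 thus False using Jordan_plane(6)[OF c refl] U(2) bounded_subset by blast
qed

lemma Jordan_inside_cball:
 fixes c :: "real => real \<times> real"
 assumes c: "simple_path c" "pathfinish c = pathstart c" and sub: "path_image c \<subseteq> cball x e"
 shows "inside (path_image c) \<subseteq> cball x e"
proof -
 have "connected (- cball x e)" by (simp add: connected_complement_bounded_convex)
 moreover have "\<not> bounded (- cball x e)" using cobounded_imp_unbounded[of "- cball x e"] by simp
 ultimately have "inside (path_image c) \<inter> - cball x e = {}" using sub by (intro Jordan_inside_subset[OF c]) auto
 thus ?thesis by blast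
qed

text \<open>The inside of the loop is a bounded component of the complement of \<open>K\<close> and
  \<open>Q\<close>: any larger connected set would have to cross the loop, which consists of
  \<open>Q\<close> and points of \<open>K\<close>.\<close>

lemma disc_B:
 assumes K: "tame K" and Q: "crosscut K Q" and c: "simple_path c" "pathfinish c = pathstart c"
  and J: "path_image c = Q \<union> A" and A: "A \<subseteq> K" and no: "inside (path_image c) \<inter> K = {}"
 shows "B_set K Q = inside (path_image c)"
proof -
 note Jp = Jordan_plane[OF c refl]
 have "inside (path_image c) \<in> components (- (K \<union> Q))"
  unfolding in_components_maximal
 proof (intro conjI allI impI)
  show "inside (path_image c) \<subseteq> - (K \<union> Q)" using no inside_no_overlap[of "path_image c"] J by blast
  fix D assume D: "D ~= {} \<and> inside (path_image c) \<subseteq> D \<and> D \<subseteq> - (K \<union> Q) \<and> connected D"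
  have "D \<subseteq> inside (path_image c)"
   using D A J Jp(3) by (intro Jordan_connected_inside[OF c]) auto
  thus "D = inside (path_image c)" using D by blast
 qed (use Jp in auto)
 thus ?thesis using crosscut_B(5)[OF tameD(1-3)[OF K] Q _ Jp(6)] by simp
qed

lemma inner_disc:
 assumes K: "tame K" and c: "simple_path c" "pathfinish c = pathstart c" and no: "inside (path_image c) \<inter> K = {}"
  and h: "arc h" "path_image c \<inter> K = path_image h"
  and Q: "crosscut K Q" "Q \<subseteq> inside (path_image c) \<union> path_image c"
 shows "\<exists>u\<in>{0..1}. \<exists>v\<in>{0..1}. \<exists>c'. h u \<in> Q \<and> h v \<in> Q \<and> simple_path c' \<and> pathfinish c' = pathstart c' \<and>
  path_image c' = Q \<union> h ` closed_segment u v \<and> B_set K Q = inside (path_image c') \<and>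
  inside (path_image c') \<subseteq> inside (path_image c) \<union> path_image c"
proof -
 obtain g where g: "arc g" "Q = path_image g" "Q \<inter> K = {pathstart g, pathfinish g}" using Q(1) by (auto simp: crosscut_def)
 have ends: "pathstart g \<in> path_image h" "pathfinish g \<in> path_image h" using g(3) Q(2) no h(2) by blast+
 then obtain u v where u: "u \<in> {0..1}" "h u = pathstart g" and v: "v \<in> {0..1}" "h v = pathfinish g" by (auto simp: path_image_def)
 have uv: "u ~= v" using u(2) v(2) arc_distinct_ends[OF g(1)] by auto
 have a: "arc (subpath u v h)" by (rule arc_subpath_arc[OF h(1) u(1) v(1) uv])
 have im: "path_image (subpath u v h) = h ` closed_segment u v" by (rule path_image_subpath_gen)
 have seg: "closed_segment u v \<subseteq> {0..1}" using u(1) v(1) by (auto simp: closed_segment_eq_real_ivl split: if_splits)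
 hence sub: "h ` closed_segment u v \<subseteq> path_image h" by (auto simp: path_image_def)
 have "\<exists>c'. simple_path c' \<and> pathfinish c' = pathstart c' \<and> path_image c' = path_image g \<union> path_image (subpath u v h)"
 proof (rule two_arcs_loop[OF g(1) a])
  show "path_image g \<inter> path_image (subpath u v h) \<subseteq> {pathstart g, pathfinish g}"
   using g(2,3) sub h(2) unfolding im by blast
 qed (simp_all add: u(2) v(2))
 then obtain c' where c': "simple_path c'" "pathfinish c' = pathstart c'" "path_image c' = Q \<union> h ` closed_segment u v"
  unfolding im g(2)[symmetric] by blast
 note Jp = Jordan_plane[OF c refl] and Jp' = Jordan_plane[OF c'(1,2) refl]
 have "outside (path_image c) \<inter> path_image c' = {}"
  unfolding c'(3) using Q(2) sub h(2) Jp(8) outside_no_overlap[of "path_image c"] by blast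
 hence disj: "inside (path_image c') \<inter> outside (path_image c) = {}"
  by (intro Jordan_inside_subset[OF c'(1,2)] Jp)
 hence subs: "inside (path_image c') \<subseteq> inside (path_image c) \<union> path_image c" using Jp(9) by blast
 have "inside (path_image c') \<inter> closure (outside (path_image c)) = {}"
  using disj Jp'(1) by (simp add: open_Int_closure_eq_empty)
 moreover have "path_image c \<subseteq> closure (outside (path_image c))" using Jp(11) unfolding frontier_def by blast
 ultimately have no': "inside (path_image c') \<inter> K = {}" using subs no by blast
 have "B_set K Q = inside (path_image c')"
  by (rule disc_B[OF K Q(1) c'(1,2,3) _ no']) (use sub h(2) in blast)
 thus ?thesis using u v c' subs g(3) by (intro bexI[of _ u] bexI[of _ v] exI[of _ c']) auto
qed

lemma unbounded_rays: "\<not> bounded {x..}" "\<not> bounded {..x :: real}"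
proof -
 have "\<bar>x\<bar> + \<bar>e\<bar> + 1 \<in> {x..}" "- (\<bar>x\<bar> + \<bar>e\<bar> + 1) \<in> {..x}" "e < norm (\<bar>x\<bar> + \<bar>e\<bar> + 1)" "e < norm (- (\<bar>x\<bar> + \<bar>e\<bar> + 1))" for e
  by auto
 thus "\<not> bounded {x..}" "\<not> bounded {..x}" unfolding bounded_iff by (meson not_le)+
qed

lemma chains_D:
 assumes "Q \<in> chains K"
 shows "crosscut K (Q i)" "(%i. diameter (Q i)) \<longlonglongrightarrow> 0" "i \<le> j ==> B_set K (Q j) \<subseteq> B_set K (Q i)"
proof -
 show "crosscut K (Q i)" "(%i. diameter (Q i)) \<longlonglongrightarrow> 0" using assms by (auto simp: chains_def)
 have "\<And>k. B_set K (Q (Suc k)) \<subseteq> B_set K (Q k)" using assms by (auto simp: chains_def)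
 thus "i \<le> j ==> B_set K (Q j) \<subseteq> B_set K (Q i)" using lift_Suc_antimono_le[of "%k. B_set K (Q k)"] by blast
qed

text \<open>Once one crosscut of the chain lies in the closed disc, all later ones do. Each of them
  bounds its \<open>B_set\<close> together with a subarc of \<open>h\<close>, and as its ends
  approach each other this subarc becomes small too.\<close>

lemma disc_shrink:
 assumes K: "tame K" and c: "simple_path c" "pathfinish c = pathstart c" and no: "inside (path_image c) \<inter> K = {}"
  and h: "arc h" "path_image c \<inter> K = path_image h"
  and Q: "Q \<in> chains K" "Q k0 \<subseteq> inside (path_image c) \<union> path_image c" and e: "0 < e"
 shows "\<exists>j x. closure (B_set K (Q j)) \<subseteq> cball x e"
proof -
 let ?D = "inside (path_image c) \<union> path_image c"
 note Jp = Jordan_plane[OF c refl]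
 have cD: "closed ?D" using Jp(4) union_with_inside[of "path_image c"] by (simp add: Un_commute closed_def)
 have B0: "B_set K (Q k0) \<subseteq> ?D" using inner_disc[OF K c no h chains_D(1)[OF Q(1)] Q(2)] by blast
 have sub: "Q j \<subseteq> ?D" if j: "k0 \<le> j" for j
 proof -
  have "Q j \<subseteq> closure (B_set K (Q j))" by (rule crosscut_B(7)[OF tameD(1-3)[OF K] chains_D(1)[OF Q(1)]])
  also have "\<dots> \<subseteq> closure (B_set K (Q k0))" by (rule closure_mono[OF chains_D(3)[OF Q(1) j]])
  also have "\<dots> \<subseteq> ?D" by (rule closure_minimal[OF B0 cD])
  finally show ?thesis .
 qed
 obtain d where d: "0 < d" "\<And>u v. u \<in> {0..1} ==> v \<in> {0..1} ==> dist (h u) (h v) < d ==> h ` closed_segment u v \<subseteq> cball (h u) e"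
  using arc_small[OF h(1) e] by blast
 have "\<forall>\<^sub>F j in sequentially. diameter (Q j) < min d e"
  using d(1) e by (intro order_tendstoD(2)[OF chains_D(2)[OF Q(1)]]) simp
 then obtain j where j: "k0 \<le> j" "diameter (Q j) < min d e" unfolding eventually_sequentially by (metis le_cases order_refl)
 have bQ: "bounded (Q j)" using crosscut_interior(4)[OF chains_D(1)[OF Q(1)]] by (rule compact_imp_bounded)
 obtain u v c' where uv: "u \<in> {0..1}" "v \<in> {0..1}" "h u \<in> Q j" "h v \<in> Q j"
  and c': "simple_path c'" "pathfinish c' = pathstart c'" "path_image c' = Q j \<union> h ` closed_segment u v"
  and B: "B_set K (Q j) = inside (path_image c')"
  using inner_disc[OF K c no h chains_D(1)[OF Q(1)] sub[OF j(1)]] by blast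
 have "dist (h u) z \<le> e" if "z \<in> Q j" for z using diameter_bounded_bound[OF bQ uv(3) that] j(2) by simp
 moreover have "h ` closed_segment u v \<subseteq> cball (h u) e"
  using diameter_bounded_bound[OF bQ uv(3,4)] j(2) by (intro d(2) uv) simp
 ultimately have "path_image c' \<subseteq> cball (h u) e" unfolding c'(3) by auto
 hence "B_set K (Q j) \<subseteq> cball (h u) e" unfolding B by (rule Jordan_inside_cball[OF c'(1,2)])
 hence "closure (B_set K (Q j)) \<subseteq> cball (h u) e" by (intro closure_minimal) auto
 thus ?thesis by blast
qed

text \<open>Every late crosscut is in the closure of its own domain, which is contained in
  \<open>B\<close>.\<close>

lemma equivalent_chain_limit:
 assumes K: "tame K" and Q: "Q \<in> chains K" and lim: "\<And>e. 0 < e ==> \<forall>\<^sub>F i in sequentially. Q i \<subseteq> ball z e"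
  and sub: "B_set K (Q i) \<subseteq> B"
 shows "z \<in> closure B"
 unfolding closure_approachable
proof (intro allI impI)
 fix e :: real assume e: "0 < e"
 obtain N where N: "\<And>j. N \<le> j ==> Q j \<subseteq> ball z (e / 2)" using lim[of "e / 2"] e by (auto simp: eventually_sequentially)
 define j where "j = max N i"
 obtain y where y: "y \<in> Q j" using crosscut_interior(2)[OF chains_D(1)[OF Q, of j]] by blast
 have "y \<in> closure (B_set K (Q j))" using crosscut_B(7)[OF tameD(1-3)[OF K] chains_D(1)[OF Q, of j]] y by blast
 then obtain x where x: "x \<in> B_set K (Q j)" "dist x y < e / 2" unfolding closure_approachable using e by (meson half_gt_zero)
 have "dist z y < e / 2" using N[of j] y by (auto simp: j_def)
 hence "dist x z < e" using x(2) dist_triangle[of x z y] by (simp add: dist_commute)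
 moreover have "x \<in> B" using x(1) chains_D(3)[OF Q, of i j] sub by (auto simp: j_def)
 ultimately show "\<exists>y\<in>B. dist y z < e" by blast
qed

context tent_rot
begin

lemma tame_KK: "tame KK"
 unfolding tame_def using compact_KK connected_KK connected_Compl_KK by simp

text \<open>If the continuum entered the inside, the dense connected line \<open>U (i + 1)\<close>,
  which avoids the loop, would enter it and stay there, and with it its closure \<open>KK\<close>.
  The rays leaving \<open>p\<close> to the right and \<open>q\<close> to the left are unbounded, so
  both points would have to lie on the loop, in fact on the arc of \<open>U i\<close>.\<close>

lemma good_crosscut:
 assumes c: "simple_path c" "pathfinish c = pathstart c" and J: "path_image c = Q \<union> A" and A: "A \<subseteq> U i" and QK: "Q \<inter> KK \<subseteq> A"
  and p: "p \<in> KK" "\<And>z. z \<in> KK ==> fst z \<le> fst p" and q: "q \<in> KK" "\<And>z. z \<in> KK ==> fst q \<le> fst z"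
  and pq: "\<not> (p \<in> U i \<and> q \<in> U i)"
  and Qp: "\<And>x. fst p < x ==> (x, snd p) \<notin> Q" and Qq: "\<And>x. x < fst q ==> (x, snd q) \<notin> Q"
 shows "inside (path_image c) \<inter> KK = {}"
proof -
 note Jp = Jordan_plane[OF c refl]
 let ?J = "path_image c"
 have AK: "A \<subseteq> KK" using A U_sub_KK by blast
 have JK: "?J \<inter> KK \<subseteq> A" using J QK AK by blast
 have "U i \<inter> U (i + 1) = {}"
 proof (rule ccontr)
  assume "U i \<inter> U (i + 1) ~= {}"
  then obtain z where "z \<in> U i" "z \<in> U (i + 1)" by blast
  hence "int n dvd (i + 1 - i)" using U_Int by blast
  thus False using n_ge3 by (simp add: zdvd_not_zless)
 qed
 hence UJ: "U (i + 1) \<inter> ?J = {}" using JK A U_sub_KK[of "i + 1"] by blast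
 show ?thesis
 proof (rule ccontr)
  assume "inside ?J \<inter> KK ~= {}"
  hence "inside ?J \<inter> U (i + 1) ~= {}" using open_Int_closure_eq_empty[OF Jp(1), of "U (i + 1)"] closure_U[of "i + 1"] by simp
  hence "U (i + 1) \<subseteq> inside ?J" using UJ by (intro Jordan_connected_inside[OF c connected_U]) auto
  hence "closure (U (i + 1)) \<subseteq> closure (inside ?J)" by (rule closure_mono)
  also have "closure (inside ?J) \<subseteq> inside ?J \<union> ?J" using Jp(1,10) by (auto simp: frontier_def interior_open)
  finally have KJ: "KK \<subseteq> inside ?J \<union> ?J" unfolding closure_U .
  \<comment> \<open>An unbounded connected set that misses the loop cannot start inside it.\<close>
  have ray: "x \<in> A" if x: "x \<in> KK" and S: "connected S" "\<not> bounded S" "x \<in> S" "S \<inter> KK \<subseteq> {x}" "S \<inter> Q \<subseteq> {x}" for x S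
  proof (rule ccontr)
   assume "x \<notin> A"
   hence "x \<notin> ?J" using JK x by blast
   hence "S \<inter> ?J = {}" using S(4,5) J AK by blast
   hence "inside ?J \<inter> S = {}" by (rule Jordan_inside_subset[OF c S(1,2)])
   thus False using KJ x \<open>x \<notin> ?J\<close> S(3) by blast
  qed
  have "p \<in> A"
  proof (rule ray[OF p(1)])
   show "connected ((%x. (x, snd p)) ` {fst p..})" by (intro connected_continuous_image continuous_intros) auto
   show "\<not> bounded ((%x. (x, snd p)) ` {fst p..})"
    using bounded_fst[of "(%x. (x, snd p)) ` {fst p..}"] unbounded_rays(1) by (auto simp: image_image)
   show "p \<in> (%x. (x, snd p)) ` {fst p..}" by (auto intro!: image_eqI[of _ _ "fst p"])
   show "(%x. (x, snd p)) ` {fst p..} \<inter> KK \<subseteq> {p}" using p(2) by (force simp: prod_eq_iff)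
   show "(%x. (x, snd p)) ` {fst p..} \<inter> Q \<subseteq> {p}" using Qp by (force simp: prod_eq_iff)
  qed
  moreover have "q \<in> A"
  proof (rule ray[OF q(1)])
   show "connected ((%x. (x, snd q)) ` {..fst q})" by (intro connected_continuous_image continuous_intros) auto
   show "\<not> bounded ((%x. (x, snd q)) ` {..fst q})"
    using bounded_fst[of "(%x. (x, snd q)) ` {..fst q}"] unbounded_rays(2) by (auto simp: image_image)
   show "q \<in> (%x. (x, snd q)) ` {..fst q}" by (auto intro!: image_eqI[of _ _ "fst q"])
   show "(%x. (x, snd q)) ` {..fst q} \<inter> KK \<subseteq> {q}" using q(2) by (force simp: prod_eq_iff)
   show "(%x. (x, snd q)) ` {..fst q} \<inter> Q \<subseteq> {q}" using Qq by (force simp: prod_eq_iff)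
  qed
  ultimately show False using A pq by blast
 qed
qed

end

text \<open>Along a monotone subsequence of left ends, the right end of each gap is squeezed between
  consecutive left ends, so both ends converge to the same point.\<close>

lemma injective_gaps_accumulate:
 fixes p q :: "nat => real"
 assumes r: "\<And>k. 0 \<le> p k" "\<And>k. p k < q k" "\<And>k. q k \<le> 1"
  and no: "\<And>k l. p l \<notin> {p k<..<q k}" and inj: "\<And>k l. k < l ==> p k ~= p l"
 shows "\<exists>L\<in>{0..1}. \<forall>e>0. \<exists>k. \<bar>p k - L\<bar> < e \<and> \<bar>q k - L\<bar> < e"
proof -
 obtain f where f: "strict_mono f" "monoseq (%k. p (f k))" using seq_monosub by blast
 have p1: "p k \<le> 1" for k using r(2,3)[of k] by linarith
 have "Bseq (%k. p (f k))" using r(1) p1 by (intro BseqI'[of _ 1]) simp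
 hence "convergent (%k. p (f k))" using f(2) by (rule Bseq_monoseq_convergent)
 then obtain L where L: "(%k. p (f k)) \<longlonglongrightarrow> L" by (auto simp: convergent_def)
 have ne: "p (f k) ~= p (f (Suc k))" for k using f(1) by (intro inj) (simp add: strict_mono_Suc_iff)
 have after: "q (f k) \<le> p (f l)" if "p (f k) < p (f l)" for k l using no[of "f l" "f k"] that by auto
 have "L \<in> {0..1}" using r(1) p1 by (auto intro!: LIMSEQ_le_const[OF L] LIMSEQ_le_const2[OF L])
 moreover have "\<exists>k. \<bar>p k - L\<bar> < e \<and> \<bar>q k - L\<bar> < e" if e: "0 < e" for e
 proof -
  obtain N where N: "\<And>k. N \<le> k ==> \<bar>p (f k) - L\<bar> < e" using LIMSEQ_D[OF L e] by auto
  have N1: "\<bar>p (f N) - L\<bar> < e" "\<bar>p (f (Suc N)) - L\<bar> < e" using N by simp_all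
  from f(2) consider "incseq (%k. p (f k))" | "decseq (%k. p (f k))" unfolding monoseq_iff by blast
  thus ?thesis
  proof cases
   case 1
   have "p (f N) \<le> p (f (Suc N))" using incseqD[OF 1, of N "Suc N"] by simp
   hence "q (f N) \<le> p (f (Suc N))" using ne[of N] by (intro after) simp
   moreover have "p (f (Suc N)) \<le> L" by (rule incseq_le[OF 1 L])
   ultimately have "\<bar>q (f N) - L\<bar> < e" using N1 r(2)[of "f N"] by (simp add: abs_less_iff)
   thus ?thesis using N1(1) by blast
  next
   case 2
   have "p (f (Suc N)) \<le> p (f N)" using decseqD[OF 2, of N "Suc N"] by simp
   hence "q (f (Suc N)) \<le> p (f N)" using ne[of N] by (intro after) simp
   moreover have "L \<le> p (f (Suc N))" by (rule decseq_ge[OF 2 L])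
   ultimately have "\<bar>q (f (Suc N)) - L\<bar> < e" using N1 r(2)[of "f (Suc N)"] by (simp add: abs_less_iff)
   thus ?thesis using N1(2) by blast
  qed
 qed
 ultimately show ?thesis by blast
qed

section \<open>Equivalent chains with different limits\<close>

lemma prime_end_chains:
 assumes "P \<in> prime_ends K" "Q \<in> P" "R \<in> P"
 shows "Q \<in> chains K" "R \<in> chains K" "\<exists>j\<ge>M. B_set K (R j) \<subseteq> B_set K (Q i)"
proof -
 obtain X where X: "P = chain_equiv K `` {X}" using assms(1) by (auto simp: prime_ends_def quotient_def)
 hence Q: "(X, Q) \<in> chain_equiv K" and R: "(X, R) \<in> chain_equiv K" using assms by auto
 show "Q \<in> chains K" and Rc: "R \<in> chains K" using Q R by (auto simp: chain_equiv_def)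
 have "\<exists>k. B_set K (X k) \<subseteq> B_set K (Q i)" using Q by (simp add: chain_equiv_def)
 then obtain k where k: "B_set K (X k) \<subseteq> B_set K (Q i)" ..
 have "\<exists>j. B_set K (R j) \<subseteq> B_set K (X k)" using R by (simp add: chain_equiv_def)
 then obtain j where j: "B_set K (R j) \<subseteq> B_set K (X k)" ..
 have "B_set K (R (max j M)) \<subseteq> B_set K (Q i)" using chains_D(3)[OF Rc, of j "max j M"] k j by auto
 thus "\<exists>j\<ge>M. B_set K (R j) \<subseteq> B_set K (Q i)" by (intro exI[of _ "max j M"]) simp
qed

lemma interleave:
 assumes P: "P \<in> prime_ends K" "Q \<in> P" "R \<in> P"
 shows "\<exists>I J. \<forall>k. M \<le> I k \<and> M \<le> J k \<and> B_set K (R (J k)) \<subseteq> B_set K (Q (I k)) \<and> B_set K (Q (I (Suc k))) \<subseteq> B_set K (R (J k))"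
proof -
 have "\<exists>f. \<forall>k. (M \<le> fst (f k) \<and> M \<le> snd (f k) \<and> B_set K (R (snd (f k))) \<subseteq> B_set K (Q (fst (f k)))) \<and>
   B_set K (Q (fst (f (Suc k)))) \<subseteq> B_set K (R (snd (f k)))"
 proof (rule dependent_nat_choice)
  obtain j where "M \<le> j" "B_set K (R j) \<subseteq> B_set K (Q M)" using prime_end_chains(3)[OF P] by blast
  thus "\<exists>x. M \<le> fst x \<and> M \<le> snd x \<and> B_set K (R (snd x)) \<subseteq> B_set K (Q (fst x))" by (intro exI[of _ "(M, j)"]) simp
 next
  fix x :: "nat \<times> nat" and k :: nat
  obtain i where i: "M \<le> i" "B_set K (Q i) \<subseteq> B_set K (R (snd x))" using prime_end_chains(3)[OF P(1,3,2)] by blast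
  obtain j where j: "M \<le> j" "B_set K (R j) \<subseteq> B_set K (Q i)" using prime_end_chains(3)[OF P] by blast
  show "\<exists>y. (M \<le> fst y \<and> M \<le> snd y \<and> B_set K (R (snd y)) \<subseteq> B_set K (Q (fst y))) \<and> B_set K (Q (fst y)) \<subseteq> B_set K (R (snd x))"
   using i j by (intro exI[of _ "(i, j)"]) simp
 qed
 then obtain f where "\<And>k. M \<le> fst (f k) \<and> M \<le> snd (f k) \<and> B_set K (R (snd (f k))) \<subseteq> B_set K (Q (fst (f k))) \<and>
   B_set K (Q (fst (f (Suc k)))) \<subseteq> B_set K (R (snd (f k)))" by blast
 thus ?thesis by (intro exI[of _ "%k. fst (f k)"] exI[of _ "%k. snd (f k)"]) blast
qed

text \<open>Two limits \<open>z1\<close> and \<open>z2\<close> of equivalent chains are separated by a circle around \<open>z1\<close>. Between consecutive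
 crosscuts of the interleaved chains there is then a gap of the circle, and these gaps are distinct, so
 they accumulate at a point of \<open>K\<close>.\<close>

lemma gaps_between_chains:
 assumes K: "tame K" and P: "P \<in> prime_ends K" "Q \<in> P" "R \<in> P"
  and Q: "\<And>e. 0 < e ==> \<forall>\<^sub>F i in sequentially. Q i \<subseteq> ball z1 e" and R: "\<And>e. 0 < e ==> \<forall>\<^sub>F i in sequentially. R i \<subseteq> ball z2 e"
  and r: "0 < r" "r < dist z1 z2"
 shows "\<exists>w\<in>K \<inter> sphere z1 r. \<forall>V. open V --> w \<in> V --> (\<exists>g i j. arc g \<and> path_image g \<subseteq> V \<and>
  path_image g \<inter> K = {pathstart g, pathfinish g} \<and> Q i \<inter> path_image g = {} \<and> R j \<inter> path_image g = {} \<and>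
  (\<exists>x\<in>Q i - K. \<exists>y\<in>R j - K. \<not> connected_component (- (K \<union> path_image g)) x y))"
proof -
 note Kt = tameD(1-3)[OF K]
 have Qc: "crosscut K (Q i)" and Rc: "crosscut K (R i)" for i using prime_end_chains(1,2)[OF P] chains_D(1) by blast+
 obtain M1 where M1: "\<And>i. M1 \<le> i ==> Q i \<subseteq> ball z1 r" using Q[OF r(1)] by (auto simp: eventually_sequentially)
 obtain M2 where M2: "\<And>i. M2 \<le> i ==> R i \<subseteq> ball z2 (dist z1 z2 - r)" using R[of "dist z1 z2 - r"] r(2) by (auto simp: eventually_sequentially)
 define M where "M = max M1 M2"
 have Qb: "Q i \<subseteq> ball z1 r" if "M \<le> i" for i using M1 that by (simp add: M_def)
 have Rb: "R i \<inter> cball z1 r = {}" if "M \<le> i" for i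
 proof (rule ccontr)
  assume "R i \<inter> cball z1 r ~= {}"
  then obtain z where z: "z \<in> R i" "dist z1 z \<le> r" by auto
  hence "dist z2 z < dist z1 z2 - r" using M2[of i] that by (auto simp: M_def)
  thus False using z(2) dist_triangle2[of z1 z2 z] by simp
 qed
 obtain I J where IJ: "\<And>k. M \<le> I k" "\<And>k. M \<le> J k" "\<And>k. B_set K (R (J k)) \<subseteq> B_set K (Q (I k))"
  "\<And>k. B_set K (Q (I (Suc k))) \<subseteq> B_set K (R (J k))" using interleave[OF P, of M] by blast
 have QR: "Q (I k) \<inter> R (J l) = {}" for k l using Qb[OF IJ(1)[of k]] Rb[OF IJ(2)[of l]] ball_subset_cball[of z1 r] by blast
 have Qs: "Q (I k) \<inter> sphere z1 r = {}" and Rs: "R (J k) \<inter> sphere z1 r = {}" for k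
  using Qb[OF IJ(1)[of k]] Rb[OF IJ(2)[of k]] by auto
 have "K \<inter> sphere z1 r ~= {}"
 proof -
  obtain x y where "x \<in> Q (I 0) \<inter> K" "y \<in> R (J 0) \<inter> K" using Qc[of "I 0"] Rc[of "J 0"] unfolding crosscut_def by blast
  hence "K \<inter> ball z1 r ~= {}" "K - ball z1 r ~= {}" using Qb[OF IJ(1)[of 0]] Rb[OF IJ(2)[of 0]] ball_subset_cball[of z1 r] by blast+
  hence "K \<inter> frontier (ball z1 r) ~= {}" by (rule connected_Int_frontier[OF Kt(2)])
  thus ?thesis using r(1) by (simp add: frontier_ball)
 qed
 then obtain w0 where w0: "w0 \<in> K" "w0 \<in> sphere z1 r" by blast
 obtain g where g: "simple_path g" "pathfinish g = pathstart g" "pathstart g = w0" "path_image g = sphere z1 r"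
  using circle_loop[OF r(1) w0(2)] by blast
 have cg: "continuous_on {0..1} g" using g(1) by (auto simp: simple_path_def path_def)
 have "\<forall>k. \<exists>x. x \<in> Q (I k) - K" "\<forall>k. \<exists>x. x \<in> R (J k) - K" using crosscut_interior(2)[OF Qc] crosscut_interior(2)[OF Rc] by blast+
 then obtain x y where x: "\<And>k. x k \<in> Q (I k) - K" and y: "\<And>k. y k \<in> R (J k) - K" by metis
 have "\<not> connected_component (- path_image g) (x k) (y k)" for k
 proof
  assume "connected_component (- path_image g) (x k) (y k)"
  then obtain C where C: "connected C" "C \<subseteq> - sphere z1 r" "x k \<in> C" "y k \<in> C" unfolding connected_component_def g(4) by blast
  have "C \<inter> ball z1 r ~= {}" "C - ball z1 r ~= {}"
   using C(3,4) x[of k] y[of k] Qb[OF IJ(1)[of k]] Rb[OF IJ(2)[of k]] ball_subset_cball[of z1 r] by blast+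
  hence "C \<inter> frontier (ball z1 r) ~= {}" by (rule connected_Int_frontier[OF C(1)])
  thus False using C(2) r(1) by (auto simp: frontier_ball)
 qed
 hence "\<exists>p q. 0 \<le> p \<and> p < q \<and> q \<le> 1 \<and> g p \<in> K \<and> g q \<in> K \<and> (\<forall>u\<in>{p<..<q}. g u \<notin> K) \<and>
  \<not> connected_component (- (K \<union> g ` {p..q})) (x k) (y k)" for k
  using loop_gap[OF Kt g(1,2)] g(3) w0(1) x[of k] y[of k] by blast
 then obtain p q where pq: "\<And>k. 0 \<le> p k" "\<And>k. p k < q k" "\<And>k. q k \<le> 1" "\<And>k. g (p k) \<in> K" "\<And>k. g (q k) \<in> K"
  "\<And>k u. u \<in> {p k<..<q k} ==> g u \<notin> K" "\<And>k. \<not> connected_component (- (K \<union> g ` {p k..q k})) (x k) (y k)" by metis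
 define z where "z k = g ` {p k<..<q k}" for k
 have gz: "g ` {p k..q k} = {g (p k), g (q k)} \<union> z k" for k
 proof -
  have "{p k..q k} = {p k, q k} \<union> {p k<..<q k}" using pq(2)[of k] by auto
  thus ?thesis unfolding z_def by (simp add: image_Un)
 qed
 have Kz: "K \<union> g ` {p k..q k} = K \<union> z k" for k using pq(4,5)[of k] unfolding gz by auto
 have sep: "\<not> connected_component (- (K \<union> z k)) (x k) (y k)" for k using pq(7)[of k] unfolding Kz .
 have zK: "z k \<inter> K = {}" for k using pq(6) by (auto simp: z_def)
 have zs: "z k \<subseteq> sphere z1 r" for k using g(4) pq(1,3)[of k] by (auto simp: z_def path_image_def)
 have "connected (z k)" for k unfolding z_def using pq(1,3)[of k]
  by (intro connected_continuous_image continuous_on_subset[OF cg]) auto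
 hence zB: "z k \<inter> B_set K (R (J k)) = {}" for k
 proof (rule separator_outside_B[OF K Qc Rc QR IJ(3) x y])
  show "z k \<inter> (K \<union> R (J k)) = {}" using zK[of k] zs[of k] Rs[of k] by blast
 qed (rule sep)
 have mono: "B_set K (R (J l)) \<subseteq> B_set K (R (J k))" if "k \<le> l" for k l
  using that IJ(3,4) lift_Suc_antimono_le[of "%k. B_set K (R (J k))" k l] by blast
 \<comment> \<open>The later crosscuts of both chains have their interiors in
   \<open>B_set K (R (J k))\<close>, which is connected and misses the gap \<open>z k\<close>; so
   \<open>z k\<close> cannot separate the points chosen on them, whereas \<open>z l\<close>
   does.\<close>
 have dist: "z k ~= z l" if kl: "k < l" for k l
 proof
  assume e: "z k = z l"
  have 1: "B_set K (Q (I l)) \<subseteq> B_set K (R (J k))"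
  proof -
   obtain l' where l': "l = Suc l'" "k \<le> l'" using kl by (cases l) auto
   show ?thesis using IJ(4)[of l'] mono[OF l'(2)] l'(1) by auto
  qed
  have "Q (I l) - K \<subseteq> B_set K (R (J k))" by (rule crosscut_in_B[OF K Qc Rc QR 1])
  moreover have "R (J l) - K \<subseteq> B_set K (Q (I l))" using QR[of l l] by (intro crosscut_in_B[OF K Rc Qc _ IJ(3)]) blast
  ultimately have "x l \<in> B_set K (R (J k))" "y l \<in> B_set K (R (J k))" using x[of l] y[of l] 1 by blast+
  moreover have "B_set K (R (J k)) \<subseteq> - (K \<union> z k)" using zB[of k] B_set_closure(2)[OF K Rc[of "J k"]] by blast
  ultimately have "connected_component (- (K \<union> z k)) (x l) (y l)"
   using crosscut_B(4)[OF Kt Rc] by (intro connected_componentI')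
  thus False using sep[of l] e by simp
 qed
 have no: "p l \<notin> {p k<..<q k}" for k l using pq(4,6) by blast
 have no': "q l \<notin> {p k<..<q k}" for k l using pq(5,6) by blast
 have inj: "p k ~= p l" if kl: "k < l" for k l
 proof
  assume e: "p k = p l"
  have "q k = q l" using no'[of k l] no'[of l k] pq(2)[of k] pq(2)[of l] e by auto
  thus False using dist[OF kl] e by (simp add: z_def)
 qed
 obtain L where L: "L \<in> {0..1}" "\<And>e. 0 < e ==> \<exists>k. \<bar>p k - L\<bar> < e \<and> \<bar>q k - L\<bar> < e"
  using injective_gaps_accumulate[OF pq(1-3) no inj] by blast
 have near: "\<exists>k. g ` {p k..q k} \<subseteq> V \<and> q k - p k < 1" if V: "open V" "g L \<in> V" for V
 proof -
  have "openin (top_of_set {0..1}) ({0..1} \<inter> g -` V)" using cg V(1) by (rule continuous_openin_preimage_gen)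
  then obtain d where d: "0 < d" "ball L d \<inter> {0..1} \<subseteq> {0..1} \<inter> g -` V"
   using L(1) V(2) openin_contains_ball by (metis IntI vimageI2)
  obtain k where k: "\<bar>p k - L\<bar> < min d (1/2)" "\<bar>q k - L\<bar> < min d (1/2)" using L(2)[of "min d (1/2)"] d(1) by auto
  have "{p k..q k} \<subseteq> ball L d \<inter> {0..1}" using k pq(1,3)[of k] by (auto simp: dist_real_def)
  hence "g ` {p k..q k} \<subseteq> V" using d(2) by blast
  thus ?thesis using k by (intro exI[of _ k]) auto
 qed
 have gL: "g L \<in> K"
 proof (rule ccontr)
  assume "g L \<notin> K"
  then obtain k where "g ` {p k..q k} \<subseteq> - K" using near[of "- K"] tameD(4)[OF K] by auto
  thus False using pq(2,4)[of k] by force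
 qed
 show ?thesis
 proof (intro bexI[of _ "g L"] allI impI)
  show "g L \<in> K \<inter> sphere z1 r" using gL L(1) g(4) by (auto simp: path_image_def)
  fix V assume "open V" "g L \<in> V"
  then obtain k where k: "g ` {p k..q k} \<subseteq> V" "q k - p k < 1" using near by blast
  have pk: "p k \<in> {0..1}" "q k \<in> {0..1}" using pq(1-3)[of k] by auto
  have a: "arc (subpath (p k) (q k) g)" using pq(2)[of k] k(2) by (intro arc_simple_path_subpath_interior g(1) pk) auto
  have im: "path_image (subpath (p k) (q k) g) = g ` {p k..q k}" using pq(2)[of k] by (simp add: path_image_subpath)
  have ends: "path_image (subpath (p k) (q k) g) \<inter> K = {pathstart (subpath (p k) (q k) g), pathfinish (subpath (p k) (q k) g)}"
   using zK[of k] pq(4,5)[of k] unfolding im gz by auto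
  have s: "g ` {p k..q k} \<subseteq> sphere z1 r" using g(4) pk by (auto simp: path_image_def)
  let ?h = "subpath (p k) (q k) g"
  have dis: "Q (I k) \<inter> path_image ?h = {}" "R (J k) \<inter> path_image ?h = {}"
   unfolding im using Qs[of k] Rs[of k] s by blast+
  have sp: "\<not> connected_component (- (K \<union> path_image ?h)) (x k) (y k)" unfolding im by (rule pq(7))
  have sub: "path_image ?h \<subseteq> V" unfolding im by (rule k(1))
  show "\<exists>g i j. arc g \<and> path_image g \<subseteq> V \<and>
   path_image g \<inter> K = {pathstart g, pathfinish g} \<and> Q i \<inter> path_image g = {} \<and> R j \<inter> path_image g = {} \<and>
   (\<exists>x\<in>Q i - K. \<exists>y\<in>R j - K. \<not> connected_component (- (K \<union> path_image g)) x y)"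
   by (intro exI[of _ ?h] exI[of _ "I k"] exI[of _ "J k"] conjI bexI[of _ "x k"] bexI[of _ "y k"] sp x y a sub ends dis)
 qed
qed

context tent_rot
begin

text \<open>A crosscut that misses the gap and enters the disc stays in the closed disc. By
  \<open>disc_shrink\<close> a later domain of its chain then fits into a ball of radius a quarter
  of the distance of the two limits, although both limits belong to its closure.\<close>

lemma chain_not_in_disc:
 assumes P: "P \<in> prime_ends KK" "Q \<in> P" "Y \<in> P"
  and Q: "\<And>e. 0 < e ==> \<forall>\<^sub>F i in sequentially. Q i \<subseteq> ball z1 e" and Y: "\<And>e. 0 < e ==> \<forall>\<^sub>F i in sequentially. Y i \<subseteq> ball z2 e"
  and ne: "z1 ~= z2" and c: "simple_path c" "pathfinish c = pathstart c" and no: "inside (path_image c) \<inter> KK = {}"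
  and h: "arc h" "path_image c \<inter> KK = path_image h" and dis: "Q i \<inter> (path_image c - KK) = {}" and x: "x \<in> Q i - KK"
 shows "x \<notin> inside (path_image c)"
proof
 assume xi: "x \<in> inside (path_image c)"
 note Qc = prime_end_chains(1)[OF P] and Rc = prime_end_chains(2)[OF P]
 note Qi = crosscut_interior[OF chains_D(1)[OF Qc, of i]]
 have "Q i - KK \<subseteq> inside (path_image c)"
  using Qi(1) dis x xi by (intro Jordan_connected_inside[OF c]) auto
 hence "closure (Q i - KK) \<subseteq> closure (inside (path_image c))" by (rule closure_mono)
 also have "\<dots> \<subseteq> inside (path_image c) \<union> path_image c"
  using Jordan_plane(1,10)[OF c refl] by (auto simp: frontier_def interior_open)
 finally have sub: "Q i \<subseteq> inside (path_image c) \<union> path_image c" using Qi(3) by blast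
 have d: "0 < dist z1 z2 / 4" using ne by simp
 obtain j y where jy: "closure (B_set KK (Q j)) \<subseteq> cball y (dist z1 z2 / 4)"
  using disc_shrink[OF tame_KK c no h Qc sub d] by blast
 obtain j' where j': "B_set KK (Y j') \<subseteq> B_set KK (Q j)" using prime_end_chains(3)[OF P] by blast
 have "z1 \<in> cball y (dist z1 z2 / 4)" using equivalent_chain_limit[OF tame_KK Qc Q, of j] jy by blast
 moreover have "z2 \<in> cball y (dist z1 z2 / 4)" using equivalent_chain_limit[OF tame_KK Rc Y j'] jy by blast
 ultimately have "dist z1 z2 \<le> dist z1 z2 / 4 + dist z1 z2 / 4" using dist_triangle3[of z1 z2 y] by simp
 thus False using d by simp
qed

text \<open>Two different principal points of one prime end are already contradictory. The
  accumulating gaps provide one inside a chart; it closes up with an arc of a line to a loop around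
  an empty disc, and since the gap separates the two crosscuts, one of them must enter this
  disc.\<close>

lemma no_infinite_canal: "\<not> infinite_canal KK P"
proof
 assume "infinite_canal KK P"
 then obtain z1 z2 where P: "P \<in> prime_ends KK" and z: "z1 \<in> principal_set P" "z2 \<in> principal_set P" "z1 ~= z2"
  unfolding infinite_canal_def by blast
 obtain Q where Q: "Q \<in> P" "\<And>e. 0 < e ==> \<forall>\<^sub>F i in sequentially. Q i \<subseteq> ball z1 e" using z(1) unfolding principal_set_def by blast
 obtain Y where Y: "Y \<in> P" "\<And>e. 0 < e ==> \<forall>\<^sub>F i in sequentially. Y i \<subseteq> ball z2 e" using z(2) unfolding principal_set_def by blast
 obtain p q where pq: "p \<in> KK" "q \<in> KK" "\<forall>z\<in>KK. fst z \<le> fst p" "\<forall>z\<in>KK. fst q \<le> fst z" "\<forall>i. \<not> (p \<in> U i \<and> q \<in> U i)"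
  using extreme_points by blast
 \<comment> \<open>The circle must avoid the points without a chart as well as \<open>p\<close> and
   \<open>q\<close>, whose outward rays the gap is not allowed to touch.\<close>
 define F where "F = insert p (insert q (range Fold))"
 have "finite ((%v. dist z1 v) ` F)" using finite_Fold by (simp add: F_def)
 moreover have "infinite {0<..<dist z1 z2}" using z(3) by (simp add: infinite_Ioo)
 ultimately have "\<not> {0<..<dist z1 z2} \<subseteq> (%v. dist z1 v) ` F" using finite_subset by blast
 then obtain r where r: "0 < r" "r < dist z1 z2" "r \<notin> (%v. dist z1 v) ` F" unfolding subset_eq by (metis greaterThanLessThan_iff)
 obtain w where w: "w \<in> KK \<inter> sphere z1 r" and gaps: "\<And>V. open V ==> w \<in> V ==> \<exists>g i j. arc g \<and>
   path_image g \<subseteq> V \<and> path_image g \<inter> KK = {pathstart g, pathfinish g} \<and> Q i \<inter> path_image g = {} \<and> Y j \<inter> path_image g = {} \<and>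
   (\<exists>x\<in>Q i - KK. \<exists>y\<in>Y j - KK. \<not> connected_component (- (KK \<union> path_image g)) x y)"
  using gaps_between_chains[OF tame_KK P Q(1) Y(1) Q(2) Y(2) r(1,2)] by metis
 have "w \<notin> F" using w r(3) by auto
 hence wF: "w \<notin> range Fold" "w ~= p" "w ~= q" by (auto simp: F_def)
 obtain V N y0 hh where V: "chart w V N y0 hh" using chart_exists[OF _ wF(1)] w by blast
 \<comment> \<open>The horizontal rays from the extreme points, closed and away from
   \<open>w\<close>, are removed from the chart to meet the premises of
   \<open>good_crosscut\<close>.\<close>
 define S1 where "S1 = {z. snd z = snd p} \<inter> {z. fst p \<le> fst z}"
 define S2 where "S2 = {z. snd z = snd q} \<inter> {z. fst z \<le> fst q}"
 have cl: "closed S1" "closed S2" unfolding S1_def S2_def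
  by (intro closed_Int closed_Collect_eq closed_Collect_le continuous_intros)+
 have wS: "w \<notin> S1" "w \<notin> S2" using wF(2,3) pq(3,4) w by (force simp: S1_def S2_def prod_eq_iff)+
 have "open (V - S1 - S2)" using cl chart_D(1)[OF V] by (intro open_Diff)
 moreover have "w \<in> V - S1 - S2" using wS chart_D(2)[OF V] by blast
 ultimately obtain g i j x y where g: "arc g" "path_image g \<subseteq> V - S1 - S2"
   "path_image g \<inter> KK = {pathstart g, pathfinish g}" and QR: "Q i \<inter> path_image g = {}" "Y j \<inter> path_image g = {}"
  and xy: "x \<in> Q i - KK" "y \<in> Y j - KK" "\<not> connected_component (- (KK \<union> path_image g)) x y"
  using gaps by metis
 have gc: "crosscut KK (path_image g)" unfolding crosscut_def using g(1,3) by blast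
 obtain i0 where i0: "pathstart g \<in> U i0" "pathfinish g \<in> U i0" using chart_crosscut[OF V g(1,3)] g(2) by blast
 obtain h where h: "arc h" "path_image h \<subseteq> U i0" "pathstart h = pathstart g" "pathfinish h = pathfinish g"
  using U_arc[OF i0 arc_distinct_ends[OF g(1), symmetric]] by blast
 have hK: "path_image h \<subseteq> KK" using h(2) U_sub_KK by blast
 have hends: "pathstart g \<in> path_image h" "pathfinish g \<in> path_image h"
  using pathstart_in_path_image[of h] pathfinish_in_path_image[of h] h(3,4) by simp_all
 have "path_image g \<inter> path_image h \<subseteq> {pathstart g, pathfinish g}" using g(3) hK by blast
 then obtain c where c: "simple_path c" "pathfinish c = pathstart c" "path_image c = path_image g \<union> path_image h"
  using two_arcs_loop[OF g(1) h(1,3,4)] by blast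
 have cK: "path_image c \<inter> KK = path_image h" unfolding c(3) Int_Un_distrib2 g(3) using hK hends by auto
 have no: "inside (path_image c) \<inter> KK = {}"
 proof (rule good_crosscut[OF c h(2)])
  show "path_image g \<inter> KK \<subseteq> path_image h" unfolding g(3) using hends by simp
  show "\<not> (p \<in> U i0 \<and> q \<in> U i0)" using pq(5) by blast
  show "(x, snd p) \<notin> path_image g" if "fst p < x" for x using g(2) that by (auto simp: S1_def)
  show "(x, snd q) \<notin> path_image g" if "x < fst q" for x using g(2) that by (auto simp: S2_def)
 qed (use pq in auto)
 have B: "B_set KK (path_image g) = inside (path_image c)"
  by (rule disc_B[OF tame_KK gc c hK no])
 have "x \<in> inside (path_image c) \<or> y \<in> inside (path_image c)"
 proof (rule ccontr)
  assume "\<not> ?thesis"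
  hence "x \<in> - (KK \<union> path_image g \<union> B_set KK (path_image g))" "y \<in> - (KK \<union> path_image g \<union> B_set KK (path_image g))"
   using xy(1,2) QR unfolding B by blast+
  hence "connected_component (- (KK \<union> path_image g)) x y"
   using crosscut_B(6)[OF tameD(1-3)[OF tame_KK] gc] by (intro connected_componentI'[of "- (KK \<union> path_image g \<union> B_set KK (path_image g))"]) auto
  thus False using xy(3) by simp
 qed
 moreover have "Q i \<inter> (path_image c - KK) = {}" "Y j \<inter> (path_image c - KK) = {}" unfolding c(3) using QR hK by blast+
 ultimately show False
  using chain_not_in_disc[OF P Q(1) Y(1) Q(2) Y(2) z(3) c(1,2) no h(1) cK _ xy(1)]
   chain_not_in_disc[OF P Y(1) Q(1) Y(2) Q(2) z(3)[symmetric] c(1,2) no h(1) cK _ xy(2)] by blast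
qed

lemma core_conclusion:
 "(\<exists>\<L>. \<L> \<subseteq> arc_components KK \<and> finite \<L> \<and> card \<L> = n \<and>
      (\<forall>U\<in>\<L>. line U \<and> partially_accessible KK U \<and> tail_shift_of_kneading s L_ray U) \<and>
      (\<forall>a. accessible KK a --> a \<in> \<Union>\<L>))
     \<and> \<not> (\<exists>P. infinite_canal KK P)"
proof (intro conjI exI[of _ "U ` {0..<int n}"])
 show "U ` {0..<int n} \<subseteq> arc_components KK" using U_in_arc_components by blast
 have "inj_on U {0..<int n}"
 proof (rule inj_onI)
  fix i j assume ij: "i \<in> {0..<int n}" "j \<in> {0..<int n}" "U i = U j"
  have "Fold i \<in> U j" using Fold_U[of i] ij(3) by simp
  hence "int n dvd i - j" using U_Int Fold_U by blast
  thus "i = j" using ij(1,2) by (metis atLeastLessThan_iff mod_eq_dvd_iff mod_pos_pos_trivial)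
 qed
 thus "card (U ` {0..<int n}) = n" by (simp add: card_image)
 show "\<forall>a. accessible KK a --> a \<in> \<Union>(U ` {0..<int n})"
 proof (intro allI impI)
  fix z assume "accessible KK z"
  then obtain i where i: "z \<in> U i" using accessible_U by blast
  have "i = i mod int n + int n * (i div int n)" by simp
  hence "z \<in> U (i mod int n)" using i U_mod[of "i mod int n" "i div int n"] by metis
  moreover have "i mod int n \<in> {0..<int n}" using n_pos by simp
  ultimately show "z \<in> \<Union>(U ` {0..<int n})" by blast
 qed
 show "\<forall>V\<in>U ` {0..<int n}. line V \<and> partially_accessible KK V \<and> tail_shift_of_kneading s L_ray V"
  using line_U partially_accessible_U tail_shift_U by blast
 show "\<not> (\<exists>P. infinite_canal KK P)" using no_infinite_canal by blast
qed simp

end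

section \<open>From the kneading sequence to the working hypotheses\<close>

lemma kneading_periodic:
 assumes "0 < k" "(tent s ^^ k) crit = crit"
 shows "\<exists>N>0. \<forall>i j. kneading s (i + N * j) = kneading s i"
proof -
 have ex: "\<exists>n>0. (tent s ^^ n) crit = crit" using assms by blast
 define itin where "itin k \<longleftrightarrow> crit \<le> (tent s ^^ Suc k) crit" for k
 define N where "N = (LEAST n. n > 0 \<and> (tent s ^^ n) crit = crit)"
 have N: "0 < N" unfolding N_def using LeastI_ex[OF ex] by blast
 have "\<exists>e. kneading s = periodic_seq (initial itin (N - 1) @ [e])"
  unfolding kneading_def itin_def[symmetric] N_def[symmetric] Let_def using ex by auto
 then obtain e where e: "kneading s = periodic_seq (initial itin (N - 1) @ [e])" by blast
 have "length (initial itin (N - 1) @ [e]) = N" using N by (simp add: initial_def)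
 hence "kneading s (i + N * j) = kneading s i" for i j unfolding e periodic_seq_def by simp
 thus ?thesis using N by blast
qed

text \<open>The second symbol of \<open>rhe\<close> is 0, but at every positive multiple of
  \<open>n\<close> further on there is a 1. So the sequence is not purely periodic and the critical
  point is not periodic; likewise it does not end in zeros, as it would for
  \<open>s = 2\<close>.\<close>

lemma tent_rot_if_kneading_rhe:
 fixes q :: rat
 assumes s: "sqrt 2 < s" "s \<le> 2" and q: "0 < q" "q < 1/2" "q = of_nat m / of_nat n" and co: "coprime m n"
  and kn: "kneading s = rhe q"
 shows "tent_rot s m n"
proof -
 have n: "0 < n" using q(1,3) by (cases n) auto
 have m: "0 < m" using q(1,3) by (cases m) auto
 have "of_nat (2 * m) < (of_nat n :: rat)" using q(2,3) n by (simp add: field_simps)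
 hence mn: "2 * m < n" by (simp only: of_nat_less_iff)
 have rot: "rhe q (k + 2) \<longleftrightarrow> (- (int k + 1) * int m) mod int n < 2 * int m" for k
  by (rule rhe_rotation[OF q(3) m mn co])
 have late: "rhe q (1 + n * j)" if "0 < j" for j
 proof -
  have nj: "0 < n * j" using n that by simp
  then obtain k where k: "n * j = k + 1" by (metis Suc_eq_plus1 gr0_implies_Suc)
  have "int k + 1 = int n * int j" using k by (metis of_nat_1 of_nat_add of_nat_mult)
  hence "- (int k + 1) * int m = int n * (- int j * int m)" by simp
  hence "(- (int k + 1) * int m) mod int n = 0" by simp
  hence "rhe q (k + 2)" unfolding rot using m by simp
  thus ?thesis using k by (simp add: add.commute)
 qed
 have nonper: "(tent s ^^ k) crit ~= crit" if k: "0 < k" for k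
 proof
  assume "(tent s ^^ k) crit = crit"
  then obtain N where N: "0 < N" "\<And>i j. kneading s (i + N * j) = kneading s i" using kneading_periodic k by blast
  have "kneading s (1 + N * n) = kneading s 1" by (rule N(2))
  hence "rhe q (1 + n * N) = rhe q 1" unfolding kn by (simp add: mult.commute)
  thus False using late[OF N(1)] by (simp add: rhe_def)
 qed
 hence "\<not> (\<exists>n>0. (tent s ^^ n) crit = crit)" by blast
 hence itin: "kneading s k \<longleftrightarrow> crit \<le> (tent s ^^ Suc k) crit" for k
  unfolding kneading_def Let_def by (simp only: if_False)
 have "s ~= 2"
 proof
  assume s2: "s = 2"
  have "(tent s ^^ (k + 2)) crit = 0" for k by (induction k) (simp_all add: s2 tent_def crit_def numeral_2_eq_2)
  from this[of n] have "\<not> kneading s (1 + n * 1)" unfolding itin by (simp add: crit_def add.commute del: funpow.simps)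
  thus False using late[of 1] unfolding kn by simp
 qed
 hence s2: "s < 2" using s(2) by simp
 show ?thesis
 proof
  show "1/2 \<le> (tent s ^^ (k + 3)) (1/2) \<longleftrightarrow> (- (int k + 1) * int m) mod int n < 2 * int m" for k
  proof -
   have "Suc (k + 2) = k + 3" by simp
   thus ?thesis using itin[of "k + 2"] rot[of k] unfolding kn crit_def by metis
  qed
  show "(tent s ^^ k) (1/2) ~= 1/2" if "0 < k" for k using nonper[OF that] unfolding crit_def .
 qed (use s(1) s2 m mn co in auto)
qed

theorem theorem13p22:
  fixes s :: real and q :: rat and m n :: nat and K :: "(real \<times> real) set"
  assumes "sqrt 2 < s" and "s \<le> 2"
    and "0 < q" and "q < 1/2" and "q = of_nat m / of_nat n" and "coprime m n"
    and "kneading s = rhe q"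
    and "K = phi s L_ray (tent_core s)"
  shows "(\<exists>\<L>. \<L> \<subseteq> arc_components K \<and> finite \<L> \<and> card \<L> = n \<and>
            (\<forall>U\<in>\<L>. line U \<and> partially_accessible K U \<and> tail_shift_of_kneading s L_ray U) \<and>
            (\<forall>a. accessible K a \<longrightarrow> a \<in> \<Union>\<L>))
         \<and> \<not> (\<exists>P. infinite_canal K P)"
proof -
  interpret tent_rot s m n using tent_rot_if_kneading_rhe assms(1-7) by blast
  show ?thesis unfolding assms(8) KK_eq_phi by (rule core_conclusion)
qed

end
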